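(* The Morse index of the pseudo $Y$-catenoid is two, and its nullity is five.
   Context: **The pseudo $Y$-catenoid.** It is the minimal triple junction surface $M=Y_{\pi/3}=(\Sigma_1,\Sigma_2,\Sigma_3;\Gamma)$ in $\mathbb{R}^3$ where $\Gamma\subset\{x_3=0\}$ is a circle centered at the origin, $\Sigma_2$ is the plane $\{x_3=0\}$ minus the open disk bounded by $\Gamma$, and $\Sigma_1,\Sigma_3$ are two pieces of catenoids with boundary $\Gamma$, symmetric to each other under reflection in $\{x_3=0\}$, both forming a constant contact angle of $60$ degrees with the horizontal plane along $\Gamma$. Explicitly, up to a homothety of $\mathbb{R}^3$, $\Gamma$ has radius $2/\sqrt3$, $\Sigma_2$ is the image of $X_2(t,\theta)=((t+\tfrac{2}{\sqrt3})\cos\theta,(t+\tfrac{2}{\sqrt3})\sin\theta,0)$, $t\in[0,\infty)$, and $\Sigma_1,\Sigma_3$ are the images of $(\cosh(t-\ln\sqrt3)\cos\theta,\cosh(t-\ln\sqrt3)\sin\theta,\pm t)$, $t\in[0,\infty)$ (sign $+$ for one, $-$ for the other), $\theta\in[0,2\pi)$. **Index form.** Let $\eta_i$ be the outward unit conormal of $\Sigma_i$ along $\Gamma=\partial\Sigma_i$; then $\eta_1+\eta_2+\eta_3=0$. Unit normals on the faces are chosen compatibly, so that they sum to $0$ along $\Gamma$; accordingly, an admissible (normal) variation is a triple $\phi=(\phi_1,\phi_2,\phi_3)$ of functions $\phi_i$ on $\Sigma_i$ with $\phi_1+\phi_2+\phi_3=0$ on $\Gamma$ (in the sense of traces). Let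 $A_i$ be the second fundamental form of $\Sigma_i$ and $\mathbf{H}_\Gamma$ the curvature vector of the curve $\Gamma$ in $\mathbb{R}^3$. The index form (second variation of area) is $$Q(\phi)=\sum_{i=1}^3\Big(\int_{\Sigma_i}|\nabla\phi_i|^2-|A_i|^2\phi_i^2-\int_\Gamma (\mathbf{H}_\Gamma\cdot\eta_i)\,\phi_i^2\Big),$$ with associated symmetric bilinear form $Q(\cdot,\cdot)$. **Morse index.** The maximal dimension of a subspace of compactly supported admissible $W^{1,2}$ triples (supports may meet $\Gamma$) on which $Q$ is negative definite. **Nullity.** Let $L^2_*$ be the completion of compactly supported smooth functions in the norm $\|f\|_{L^2_*}^2=\int f^2(1+|x|^2)^{-1}(\log(2+|x|))^{-2}$, where $|x|$ is the Euclidean norm of the position. Let $\mathcal D$ be the space of admissible triples $\phi$ with each $\phi_i\in L^2_*(\Sigma_i)$ and $|\nabla\phi_i|\in L^2(\Sigma_i)$. The nullity is the dimension of the null space $\{\phi\in\mathcal D: Q(\phi,\psi)=0\ \text{for all }\psi\in\mathcal D\}$. *)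

theory Defs
  imports "HOL-Analysis.Analysis" "HOL-Library.Extended_Nat"
begin

section \<open>Geometry of parametrized half-cylinders in space\<close>

text \<open>
  A face is given by an immersion \<open>X (t, \<theta>)\<close> that is \<open>2 * pi\<close>-periodic in \<open>\<theta>\<close>; the surface is
  the image of \<open>t \<ge> 0\<close>, its boundary the image of \<open>t = 0\<close>. The formula \<open>X\<close> also makes sense for
  \<open>t < 0\<close>, so derivatives at \<open>t = 0\<close> may be taken two-sidedly.
\<close>

definition pd :: "2 \<Rightarrow> (real \<times> real \<Rightarrow> 'a::real_normed_vector) \<Rightarrow> real \<times> real \<Rightarrow> 'a" where
  "pd j f p =
    (if j = 1 then vector_derivative (\<lambda>t. f (t, snd p)) (at (fst p))
     else vector_derivative (\<lambda>\<theta>. f (fst p, \<theta>)) (at (snd p)))"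

type_synonym face = "real \<times> real \<Rightarrow> real^3"

definition surface :: "face \<Rightarrow> (real^3) set" where
  "surface X = X ` ({0..} \<times> UNIV)"

definition first_form :: "face \<Rightarrow> real \<times> real \<Rightarrow> real^2^2" where
  "first_form X p = (\<chi> i j. pd i X p \<bullet> pd j X p)"

definition unit_normal :: "face \<Rightarrow> real \<times> real \<Rightarrow> real^3" where
  "unit_normal X p = sgn (cross3 (pd 1 X p) (pd 2 X p))"

definition second_form :: "face \<Rightarrow> real \<times> real \<Rightarrow> real^2^2" where
  "second_form X p = (\<chi> i j. pd i (pd j X) p \<bullet> unit_normal X p)"

definition second_form_norm_sq :: "face \<Rightarrow> real \<times> real \<Rightarrow> real" where
  "second_form_norm_sq X p =
    (let S = matrix_inv (first_form X p) ** second_form X p in trace (S ** S))"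

definition area_density :: "face \<Rightarrow> real \<times> real \<Rightarrow> real" where
  "area_density X p = sqrt (det (first_form X p))"

text \<open>
  The Riemannian inner product of the gradients of two functions whose coordinate differentials
  at \<open>p\<close> are \<open>v\<close> and \<open>w\<close>, that is \<open>g\<^sup>i\<^sup>j v\<^sub>i w\<^sub>j\<close>.
\<close>

definition grad_inner :: "face \<Rightarrow> real \<times> real \<Rightarrow> real^2 \<Rightarrow> real^2 \<Rightarrow> real" where
  "grad_inner X p v w = v \<bullet> (matrix_inv (first_form X p) *v w)"

text \<open>
  One period of the open half-cylinder. The boundary line is left out: it has measure zero, and
  a function on a face, taken up to null sets, has no meaningful values there.
\<close>

definition period_strip :: "(real \<times> real) set" where
  "period_strip = {0<..} \<times> {0..<2 * pi}"

definition face_integral :: "face \<Rightarrow> (real \<times> real \<Rightarrow> real) \<Rightarrow> real" where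
  "face_integral X f = (LINT p:period_strip|lborel. f p * area_density X p)"

definition face_integrable :: "face \<Rightarrow> (real \<times> real \<Rightarrow> real) \<Rightarrow> bool" where
  "face_integrable X f \<longleftrightarrow> set_integrable lborel period_strip (\<lambda>p. f p * area_density X p)"

definition boundary_velocity :: "face \<Rightarrow> real \<Rightarrow> real^3" where
  "boundary_velocity X \<theta> = vector_derivative (\<lambda>s. X (0, s)) (at \<theta>)"

definition boundary_curvature :: "face \<Rightarrow> real \<Rightarrow> real^3" where
  "boundary_curvature X \<theta> =
    vector_derivative (\<lambda>s. sgn (boundary_velocity X s)) (at \<theta>) /\<^sub>R norm (boundary_velocity X \<theta>)"

text \<open>
  The interior of the face lies on the side of increasing \<open>t\<close>, hence the minus sign in the
  outward conormal.
\<close>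

definition conormal :: "face \<Rightarrow> real \<Rightarrow> real^3" where
  "conormal X \<theta> =
    (let T = sgn (boundary_velocity X \<theta>); w = pd 1 X (0, \<theta>)
     in - sgn (w - (w \<bullet> T) *\<^sub>R T))"

definition boundary_integral :: "face \<Rightarrow> (real \<Rightarrow> real) \<Rightarrow> real" where
  "boundary_integral X f = (LINT \<theta>:{0..<2 * pi}|lborel. f \<theta> * norm (boundary_velocity X \<theta>))"


section \<open>Weak gradients and traces on the half-cylinder\<close>

definition C1_compact_support :: "(real \<times> real) set \<Rightarrow> (real \<times> real \<Rightarrow> real) \<Rightarrow> bool" where
  "C1_compact_support U \<psi> \<longleftrightarrow>
    (\<forall>p. \<psi> differentiable (at p)) \<and> (\<forall>j. continuous_on UNIV (pd j \<psi>)) \<and>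
    (\<exists>K. compact K \<and> K \<subseteq> U \<and> (\<forall>p. p \<notin> K \<longrightarrow> \<psi> p = 0))"

abbreviation open_half :: "(real \<times> real) set" where
  "open_half \<equiv> {0<..} \<times> UNIV"

definition locally_integrable :: "(real \<times> real \<Rightarrow> real) \<Rightarrow> bool" where
  "locally_integrable u \<longleftrightarrow> (\<forall>K. compact K \<and> K \<subseteq> open_half \<longrightarrow> set_integrable lborel K u)"

definition is_weak_grad :: "(real \<times> real \<Rightarrow> real) \<Rightarrow> (real \<times> real \<Rightarrow> real^2) \<Rightarrow> bool" where
  "is_weak_grad u G \<longleftrightarrow>
    locally_integrable u \<and> (\<forall>j. locally_integrable (\<lambda>p. G p $ j)) \<and>
    (\<forall>\<psi> j. C1_compact_support open_half \<psi> \<longrightarrow>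
      (LINT p:open_half|lborel. u p * pd j \<psi> p) = - (LINT p:open_half|lborel. G p $ j * \<psi> p))"

definition weakly_differentiable :: "(real \<times> real \<Rightarrow> real) \<Rightarrow> bool" where
  "weakly_differentiable u \<longleftrightarrow> (\<exists>G. is_weak_grad u G)"

text \<open>Weak gradients are unique up to null sets, so nothing below depends on the choice.\<close>

definition weak_grad :: "(real \<times> real \<Rightarrow> real) \<Rightarrow> real \<times> real \<Rightarrow> real^2" where
  "weak_grad u = (SOME G. is_weak_grad u G)"

text \<open>
  The Sobolev trace on \<open>t = 0\<close>, determined up to null sets by Green's formula against test
  functions whose support may meet the boundary.
\<close>

definition has_trace :: "(real \<times> real \<Rightarrow> real) \<Rightarrow> (real \<Rightarrow> real) \<Rightarrow> bool" where
  "has_trace u \<tau> \<longleftrightarrow>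
    \<tau> \<in> borel_measurable borel \<and>
    (\<forall>a b. set_integrable lborel {a..b} (\<lambda>\<theta>. (\<tau> \<theta>)\<^sup>2)) \<and>
    (\<forall>\<psi>. C1_compact_support UNIV \<psi> \<longrightarrow>
      (LINT p:open_half|lborel. u p * pd 1 \<psi> p + weak_grad u p $ 1 * \<psi> p)
        = - (LINT \<theta>|lborel. \<tau> \<theta> * \<psi> (0, \<theta>)))"

definition bd_trace :: "(real \<times> real \<Rightarrow> real) \<Rightarrow> real \<Rightarrow> real" where
  "bd_trace u = (SOME \<tau>. has_trace u \<tau>)"


section \<open>Index form, Morse index and nullity of a triple junction surface\<close>

text \<open>
  A triple junction surface is given by three faces with \<open>X 1 (0, \<theta>) = X 2 (0, \<theta>) = X 3 (0, \<theta>)\<close>.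
  (In the index type \<open>3\<close> the numeral \<open>3\<close> is \<open>0\<close>; the indices \<open>1\<close>, \<open>2\<close>, \<open>3\<close> are distinct and
  exhaust the type.) A function on a face is represented by a function on the ambient space of
  which only the restriction to the face matters; in coordinates it is \<open>\<phi> i \<circ> X i\<close>, which is
  automatically periodic in \<open>\<theta>\<close>.
\<close>

type_synonym junction = "3 \<Rightarrow> face"
type_synonym triple = "3 \<Rightarrow> real^3 \<Rightarrow> real"

definition admissible :: "junction \<Rightarrow> triple \<Rightarrow> bool" where
  "admissible X \<phi> \<longleftrightarrow>
    (\<forall>i. weakly_differentiable (\<phi> i \<circ> X i)) \<and>
    (\<exists>\<tau>. (\<forall>i. has_trace (\<phi> i \<circ> X i) (\<tau> i)) \<and> (AE \<theta> in lborel. (\<Sum>i\<in>UNIV. \<tau> i \<theta>) = 0))"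

definition index_form :: "junction \<Rightarrow> triple \<Rightarrow> triple \<Rightarrow> real" where
  "index_form X \<phi> \<psi> = (\<Sum>i\<in>UNIV.
     face_integral (X i) (\<lambda>p.
       grad_inner (X i) p (weak_grad (\<phi> i \<circ> X i) p) (weak_grad (\<psi> i \<circ> X i) p)
       - second_form_norm_sq (X i) p * \<phi> i (X i p) * \<psi> i (X i p))
     - boundary_integral (X i) (\<lambda>\<theta>.
         (boundary_curvature (X i) \<theta> \<bullet> conormal (X i) \<theta>)
         * bd_trace (\<phi> i \<circ> X i) \<theta> * bd_trace (\<psi> i \<circ> X i) \<theta>))"

definition grad_L2 :: "face \<Rightarrow> (real^3 \<Rightarrow> real) \<Rightarrow> bool" where
  "grad_L2 X f \<longleftrightarrow>
    face_integrable X (\<lambda>p. grad_inner X p (weak_grad (f \<circ> X) p) (weak_grad (f \<circ> X) p))"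

definition compactly_supported :: "face \<Rightarrow> (real^3 \<Rightarrow> real) \<Rightarrow> bool" where
  "compactly_supported X f \<longleftrightarrow>
    (\<exists>K. compact K \<and> K \<subseteq> surface X \<and>
      (AE p in lborel. p \<in> open_half \<longrightarrow> X p \<notin> K \<longrightarrow> f (X p) = 0))"

definition compact_W12_triples :: "junction \<Rightarrow> triple set" where
  "compact_W12_triples X = {\<phi>. admissible X \<phi> \<and>
    (\<forall>i. face_integrable (X i) (\<lambda>p. (\<phi> i (X i p))\<^sup>2) \<and> grad_L2 (X i) (\<phi> i)
      \<and> compactly_supported (X i) (\<phi> i))}"

text \<open>
  The completion of the compactly supported smooth functions in the norm of \<open>L\<^sup>2\<^sub>*\<close>, realized as
  the weighted \<open>L\<^sup>2\<close> space with the weight of that norm.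
\<close>

definition L2_star :: "face \<Rightarrow> (real^3 \<Rightarrow> real) \<Rightarrow> bool" where
  "L2_star X f \<longleftrightarrow>
    face_integrable X (\<lambda>p. (f (X p))\<^sup>2 / ((1 + (norm (X p))\<^sup>2) * (ln (2 + norm (X p)))\<^sup>2))"

definition energy_triples :: "junction \<Rightarrow> triple set" where
  "energy_triples X = {\<phi>. admissible X \<phi> \<and> (\<forall>i. L2_star (X i) (\<phi> i) \<and> grad_L2 (X i) (\<phi> i))}"

definition null_space :: "junction \<Rightarrow> triple set" where
  "null_space X = {\<phi> \<in> energy_triples X. \<forall>\<psi> \<in> energy_triples X. index_form X \<phi> \<psi> = 0}"

text \<open>
  Sobolev triples are classes modulo almost everywhere vanishing triples, so dimensions are
  dimensions of quotients: \<open>quotient_dim N V\<close> is the (possibly infinite) dimension of the image of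
  the linear space \<open>V\<close> modulo \<open>N\<close>.
\<close>

definition ae_zero :: "junction \<Rightarrow> triple set" where
  "ae_zero X = {\<phi>. \<forall>i. AE p in lborel. p \<in> open_half \<longrightarrow> \<phi> i (X i p) = 0}"

definition triple_subspace :: "triple set \<Rightarrow> bool" where
  "triple_subspace V \<longleftrightarrow>
    (\<lambda>i x. 0) \<in> V \<and>
    (\<forall>\<phi>\<in>V. \<forall>\<psi>\<in>V. (\<lambda>i x. \<phi> i x + \<psi> i x) \<in> V) \<and>
    (\<forall>a. \<forall>\<phi>\<in>V. (\<lambda>i x. a * \<phi> i x) \<in> V)"

definition independent_modulo :: "triple set \<Rightarrow> triple set \<Rightarrow> bool" where
  "independent_modulo N B \<longleftrightarrow>
    finite B \<and> (\<forall>a. (\<lambda>i x. \<Sum>b\<in>B. a b * b i x) \<in> N \<longrightarrow> (\<forall>b\<in>B. a b = 0))"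

definition quotient_dim :: "triple set \<Rightarrow> triple set \<Rightarrow> enat" where
  "quotient_dim N V = (SUP B \<in> {B. B \<subseteq> V \<and> independent_modulo N B}. enat (card B))"

definition negative_definite_on :: "junction \<Rightarrow> triple set \<Rightarrow> bool" where
  "negative_definite_on X V \<longleftrightarrow> (\<forall>\<phi>\<in>V. \<phi> \<notin> ae_zero X \<longrightarrow> index_form X \<phi> \<phi> < 0)"

definition morse_index :: "junction \<Rightarrow> enat" where
  "morse_index X =
    (SUP V \<in> {V. V \<subseteq> compact_W12_triples X \<and> triple_subspace V \<and> negative_definite_on X V}.
      quotient_dim (ae_zero X) V)"

definition nullity :: "junction \<Rightarrow> enat" where
  "nullity X = quotient_dim (ae_zero X) (null_space X)"


section \<open>The pseudo Y-catenoid\<close>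

definition planar_face :: face where
  "planar_face = (\<lambda>(t, \<theta>). vector [(t + 2 / sqrt 3) * cos \<theta>, (t + 2 / sqrt 3) * sin \<theta>, 0])"

definition catenoid_face :: "real \<Rightarrow> face" where
  "catenoid_face \<sigma> = (\<lambda>(t, \<theta>).
    vector [cosh (t - ln (sqrt 3)) * cos \<theta>, cosh (t - ln (sqrt 3)) * sin \<theta>, \<sigma> * t])"

text \<open>
  The parameter \<open>c > 0\<close> is the homothety factor: the junction circle has radius \<open>2 * c / sqrt 3\<close>.
\<close>

definition pseudo_Y_catenoid :: "real \<Rightarrow> junction" where
  "pseudo_Y_catenoid c i p =
    c *\<^sub>R (if i = 1 then catenoid_face 1 p else if i = 2 then planar_face p
        else catenoid_face (- 1) p)"


text \<open>
  The faces share their boundary curve, the outward conormals sum to zero, and so do the unit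
  normals \<open>X\<^sub>t \<times> X\<^sub>\<theta> / \<bar>X\<^sub>t \<times> X\<^sub>\<theta>\<bar>\<close>: this is the compatible choice of normals for which normal
  variations are the triples with \<open>\<phi>\<^sub>1 + \<phi>\<^sub>2 + \<phi>\<^sub>3 = 0\<close> on the junction.
\<close>

lemma has_vector_derivative_vector_3:
  fixes f g h :: "real \<Rightarrow> real"
  assumes "(f has_real_derivative f') (at x)" "(g has_real_derivative g') (at x)"
    "(h has_real_derivative h') (at x)"
  shows "((\<lambda>x. vector [f x, g x, h x] :: real^3) has_vector_derivative vector [f', g', h']) (at x)"
proof -
  have eq: "(vector [a, b, d] :: real^3) = a *\<^sub>R axis 1 1 + b *\<^sub>R axis 2 1 + d *\<^sub>R axis 3 1"
    for a b d :: real
    by (simp add: vec_eq_iff forall_3 axis_def)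
  show ?thesis
    unfolding eq using assms
    by (auto intro!: derivative_eq_intros simp: has_real_derivative_iff_has_vector_derivative)
qed

lemma ln_sqrt3: "cosh (ln (sqrt 3)) = 2 / sqrt 3" "sinh (ln (sqrt 3)) = 1 / sqrt 3"
  by (simp_all add: cosh_ln_real sinh_ln_real field_simps)

lemma pd_catenoid_face:
  "pd 1 (\<lambda>p. c *\<^sub>R catenoid_face \<sigma> p) (t, \<theta>) =
    c *\<^sub>R vector [sinh (t - ln (sqrt 3)) * cos \<theta>, sinh (t - ln (sqrt 3)) * sin \<theta>, \<sigma>]"
  "pd 2 (\<lambda>p. c *\<^sub>R catenoid_face \<sigma> p) (t, \<theta>) =
    c *\<^sub>R vector [- cosh (t - ln (sqrt 3)) * sin \<theta>, cosh (t - ln (sqrt 3)) * cos \<theta>, 0]"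
  unfolding pd_def catenoid_face_def
  by (auto intro!: vector_derivative_at has_vector_derivative_scaleR[THEN has_vector_derivative_eq_rhs]
      has_vector_derivative_vector_3 derivative_eq_intros
      simp: algebra_simps)

lemma pd_planar_face:
  "pd 1 (\<lambda>p. c *\<^sub>R planar_face p) (t, \<theta>) = c *\<^sub>R vector [cos \<theta>, sin \<theta>, 0]"
  "pd 2 (\<lambda>p. c *\<^sub>R planar_face p) (t, \<theta>) =
    c *\<^sub>R vector [- (sin \<theta> * (t + 2 / sqrt 3)), cos \<theta> * (t + 2 / sqrt 3), 0]"
  unfolding pd_def planar_face_def
  by (auto intro!: vector_derivative_at has_vector_derivative_vector_3 derivative_eq_intros)

lemma pseudo_Y_catenoid_faces:
  "pseudo_Y_catenoid c 1 = (\<lambda>p. c *\<^sub>R catenoid_face 1 p)"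
  "pseudo_Y_catenoid c 2 = (\<lambda>p. c *\<^sub>R planar_face p)"
  "pseudo_Y_catenoid c 3 = (\<lambda>p. c *\<^sub>R catenoid_face (- 1) p)"
  by (simp_all add: pseudo_Y_catenoid_def fun_eq_iff)


lemma boundary_velocity_conv_pd: "boundary_velocity X \<theta> = pd 2 X (0, \<theta>)"
  by (simp add: boundary_velocity_def pd_def)

lemma sgn_eqI:
  fixes w :: "'a::real_normed_vector"
  assumes "v = r *\<^sub>R w" "0 < r" "norm w = 1"
  shows "sgn v = w"
  using assms by (simp add: sgn_div_norm)

lemma norm_vector_3_eq_1:
  fixes x y z :: real
  assumes "x\<^sup>2 + y\<^sup>2 + z\<^sup>2 = 1"
  shows "norm (vector [x, y, z] :: real^3) = 1"
  using assms by (simp add: norm_eq_sqrt_inner inner_vec_def sum_3 power2_eq_square)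

lemma norm_vector_cylindrical: "norm (vector [a * cos \<theta>, a * sin \<theta>, b] :: real^3) = 1"
  if "a\<^sup>2 + b\<^sup>2 = (1::real)"
proof (rule norm_vector_3_eq_1)
  have "(a * cos \<theta>)\<^sup>2 + (a * sin \<theta>)\<^sup>2 + b\<^sup>2 = a\<^sup>2 * ((sin \<theta>)\<^sup>2 + (cos \<theta>)\<^sup>2) + b\<^sup>2"
    by (simp only: power_mult_distrib) algebra
  then show "(a * cos \<theta>)\<^sup>2 + (a * sin \<theta>)\<^sup>2 + b\<^sup>2 = 1"
    using that by simp
qed

lemma pseudo_Y_catenoid_junction:
  "pseudo_Y_catenoid c i (0, \<theta>) = (2 * c / sqrt 3) *\<^sub>R vector [cos \<theta>, sin \<theta>, 0]"
  by (simp add: pseudo_Y_catenoid_def catenoid_face_def planar_face_def ln_sqrt3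
      vec_eq_iff forall_3)

lemma boundary_pd_pseudo_Y_catenoid:
  "pd 2 (pseudo_Y_catenoid c i) (0, \<theta>) = (2 * c / sqrt 3) *\<^sub>R vector [- sin \<theta>, cos \<theta>, 0]"
  "pd 1 (pseudo_Y_catenoid c 1) (0, \<theta>) =
    c *\<^sub>R vector [- cos \<theta> / sqrt 3, - sin \<theta> / sqrt 3, 1]"
  "pd 1 (pseudo_Y_catenoid c 2) (0, \<theta>) = c *\<^sub>R vector [cos \<theta>, sin \<theta>, 0]"
  "pd 1 (pseudo_Y_catenoid c 3) (0, \<theta>) =
    c *\<^sub>R vector [- cos \<theta> / sqrt 3, - sin \<theta> / sqrt 3, - 1]"
proof -
  show "pd 2 (pseudo_Y_catenoid c i) (0, \<theta>) = (2 * c / sqrt 3) *\<^sub>R vector [- sin \<theta>, cos \<theta>, 0]"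
    using exhaust_3[of i]
    by (auto simp: pseudo_Y_catenoid_faces pd_catenoid_face pd_planar_face ln_sqrt3
        vec_eq_iff forall_3)
qed (simp_all add: pseudo_Y_catenoid_faces pd_catenoid_face pd_planar_face ln_sqrt3
        vec_eq_iff forall_3)

lemma conormal_pseudo_Y_catenoid:
  assumes "0 < c"
  shows "conormal (pseudo_Y_catenoid c 1) \<theta> = vector [cos \<theta> / 2, sin \<theta> / 2, - sqrt 3 / 2]"
    and "conormal (pseudo_Y_catenoid c 2) \<theta> = vector [- cos \<theta>, - sin \<theta>, 0]"
    and "conormal (pseudo_Y_catenoid c 3) \<theta> = vector [cos \<theta> / 2, sin \<theta> / 2, sqrt 3 / 2]"
proof -
  have T: "sgn (boundary_velocity (pseudo_Y_catenoid c i) \<theta>) = vector [- sin \<theta>, cos \<theta>, 0]" for i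
    unfolding boundary_velocity_conv_pd boundary_pd_pseudo_Y_catenoid
    by (rule sgn_eqI[OF refl]) (use assms in \<open>auto intro!: norm_vector_3_eq_1\<close>)
  note inner3 = inner_vec_def sum_3
  have "sgn (c *\<^sub>R vector [- cos \<theta> / sqrt 3, - sin \<theta> / sqrt 3, 1] :: real^3)
      = vector [- 1 / 2 * cos \<theta>, - 1 / 2 * sin \<theta>, sqrt 3 / 2]"
    by (rule sgn_eqI[where r = "2 * c / sqrt 3", OF _ _ norm_vector_cylindrical])
      (use assms in \<open>auto simp: vec_eq_iff forall_3 power2_eq_square field_simps\<close>)
  then show "conormal (pseudo_Y_catenoid c 1) \<theta> = vector [cos \<theta> / 2, sin \<theta> / 2, - sqrt 3 / 2]"
    unfolding conormal_def Let_def T boundary_pd_pseudo_Y_catenoid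
    by (simp add: inner3) (simp add: vec_eq_iff forall_3)
  have "sgn (c *\<^sub>R vector [cos \<theta>, sin \<theta>, 0] :: real^3) = vector [cos \<theta>, sin \<theta>, 0]"
    by (rule sgn_eqI[OF refl]) (use assms in \<open>auto intro!: norm_vector_3_eq_1\<close>)
  then show "conormal (pseudo_Y_catenoid c 2) \<theta> = vector [- cos \<theta>, - sin \<theta>, 0]"
    unfolding conormal_def Let_def T boundary_pd_pseudo_Y_catenoid
    by (simp add: inner3) (simp add: vec_eq_iff forall_3)
  have "sgn (c *\<^sub>R vector [- cos \<theta> / sqrt 3, - sin \<theta> / sqrt 3, - 1] :: real^3)
      = vector [- 1 / 2 * cos \<theta>, - 1 / 2 * sin \<theta>, - sqrt 3 / 2]"
    by (rule sgn_eqI[where r = "2 * c / sqrt 3", OF _ _ norm_vector_cylindrical])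
      (use assms in \<open>auto simp: vec_eq_iff forall_3 power2_eq_square field_simps\<close>)
  then show "conormal (pseudo_Y_catenoid c 3) \<theta> = vector [cos \<theta> / 2, sin \<theta> / 2, sqrt 3 / 2]"
    unfolding conormal_def Let_def T boundary_pd_pseudo_Y_catenoid
    by (simp add: inner3) (simp add: vec_eq_iff forall_3)
qed

lemma conormals_sum_zero:
  "0 < c \<Longrightarrow> (\<Sum>i\<in>UNIV. conormal (pseudo_Y_catenoid c i) \<theta>) = 0"
  by (simp add: sum_3 conormal_pseudo_Y_catenoid vec_eq_iff forall_3)

lemma unit_normals_sum_zero:
  assumes "0 < c"
  shows "(\<Sum>i\<in>UNIV. unit_normal (pseudo_Y_catenoid c i) (0, \<theta>)) = 0"
proof -
  have sc: "sin \<theta> * (sin \<theta> * x) = x - cos \<theta> * (cos \<theta> * x)" for x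
    using sin_cos_squared_add[of \<theta>] by algebra
  have q: "sqrt 3 * (sqrt 3 * x) = 3 * x" for x
    by (simp flip: mult.assoc)
  have "unit_normal (pseudo_Y_catenoid c 1) (0, \<theta>)
      = vector [- sqrt 3 / 2 * cos \<theta>, - sqrt 3 / 2 * sin \<theta>, - 1 / 2]"
    unfolding unit_normal_def boundary_pd_pseudo_Y_catenoid
  proof (rule sgn_eqI[where r = "4 * c\<^sup>2 / 3", OF _ _ norm_vector_cylindrical])
    show "cross3 (c *\<^sub>R vector [- cos \<theta> / sqrt 3, - sin \<theta> / sqrt 3, 1])
        ((2 * c / sqrt 3) *\<^sub>R vector [- sin \<theta>, cos \<theta>, 0])
      = (4 * c\<^sup>2 / 3) *\<^sub>R vector [- sqrt 3 / 2 * cos \<theta>, - sqrt 3 / 2 * sin \<theta>, - 1 / 2]"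
      by (simp add: cross3_def vec_eq_iff forall_3 field_simps)
        (simp add: sc q power2_eq_square algebra_simps)
  qed (use assms in \<open>simp_all add: power2_eq_square\<close>)
  moreover have "unit_normal (pseudo_Y_catenoid c 2) (0, \<theta>) = vector [0, 0, 1]"
    unfolding unit_normal_def boundary_pd_pseudo_Y_catenoid
  proof (rule sgn_eqI[where r = "2 * c\<^sup>2 / sqrt 3", OF _ _ norm_vector_3_eq_1])
    show "cross3 (c *\<^sub>R vector [cos \<theta>, sin \<theta>, 0])
        ((2 * c / sqrt 3) *\<^sub>R vector [- sin \<theta>, cos \<theta>, 0])
      = (2 * c\<^sup>2 / sqrt 3) *\<^sub>R vector [0, 0, 1]"
      by (simp add: cross3_def vec_eq_iff forall_3 field_simps)
        (simp add: sc q power2_eq_square algebra_simps)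
  qed (use assms in \<open>simp_all\<close>)
  moreover have "unit_normal (pseudo_Y_catenoid c 3) (0, \<theta>)
      = vector [sqrt 3 / 2 * cos \<theta>, sqrt 3 / 2 * sin \<theta>, - 1 / 2]"
    unfolding unit_normal_def boundary_pd_pseudo_Y_catenoid
  proof (rule sgn_eqI[where r = "4 * c\<^sup>2 / 3", OF _ _ norm_vector_cylindrical])
    show "cross3 (c *\<^sub>R vector [- cos \<theta> / sqrt 3, - sin \<theta> / sqrt 3, - 1])
        ((2 * c / sqrt 3) *\<^sub>R vector [- sin \<theta>, cos \<theta>, 0])
      = (4 * c\<^sup>2 / 3) *\<^sub>R vector [sqrt 3 / 2 * cos \<theta>, sqrt 3 / 2 * sin \<theta>, - 1 / 2]"
      by (simp add: cross3_def vec_eq_iff forall_3 field_simps)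
        (simp add: sc q power2_eq_square algebra_simps)
  qed (use assms in \<open>simp_all add: power2_eq_square\<close>)
  ultimately show ?thesis
    by (simp add: sum_3 vec_eq_iff forall_3)
qed

end

(*
  In the coordinates (t, theta) the Dirichlet energy of a face is the integral of rho v_t^2 + v_theta^2 / rho,
  and each face carries a positive solution y(t) cos theta of the Jacobi equation that satisfies the natural
  boundary condition of the index form. Completing the square with kappa = - rho y' / y turns the index form
  into an integral of squares plus (v_theta^2 - v^2) / rho, which is nonnegative by Wirtinger's inequality
  whenever the mean of v over the circles t = const vanishes. Hence only the rotational means matter. For
  these, the catenoid has no negative direction among functions vanishing at the waist, which leaves at most
  two negative directions; cut-off functions supported on one catenoid each provide two. In the same
  way a null triple is determined by its rotational part and by the first Fourier modes of its traces.
  Testing with the Green functions of the radial Jacobi operators shows that the rotational part is governed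
  by one parameter, and the traces of the first modes by four, since they sum to zero over the faces.
*)

theory Submission
 imports Defs "HOL-Real_Asymp.Real_Asymp"
begin

text \<open>On every face \<open>wq i = - wkap i 0\<close>: completing the square with
  \<open>\<kappa>\<close> leaves \<open>- \<kappa> 0\<close> times the squared trace at the
  junction, and this is exactly the curvature term of the index form. Hence the faces decouple
  outside the rotational mode, and the junction condition acts on finitely many Fourier coefficients
  of the traces only. The upper bound for the index has no slack: for the squared rotational
  boundary means the catenoids offer the constants 3/2 + 1/2 = 2 and the plane - 1, and the junction
  condition makes the resulting quadratic form degenerate.

  Two obstacles shape the rest. Null triples are merely Sobolev classes, and instead of a regularity
  theory the proof uses absolutely continuous representatives and tests with explicit triples. They
  also lack compact support. What controls infinity is parabolicity, the divergence of the integral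
  of \<open>1 / \<rho>\<close>: once the rotational mean vanishes it makes the square integral over
  suitable large circles small, while Fourier coefficients grow at most like that integral, which
  the decay of the radial Jacobi fields' derivatives outweighs.\<close>

abbreviation L1_on :: "'a::euclidean_space set \<Rightarrow> ('a \<Rightarrow> real) \<Rightarrow> bool" where
 "L1_on \<equiv> set_integrable lborel"

abbreviation borel_fun :: "('a::topological_space \<Rightarrow> 'b::topological_space) set" where
 "borel_fun \<equiv> borel_measurable borel"

abbreviation tensor :: "(real \<Rightarrow> real) \<Rightarrow> (real \<Rightarrow> real) \<Rightarrow> real \<times> real \<Rightarrow> real" where
 "tensor f g p \<equiv> f (fst p) * g (snd p)"

abbreviation "circ \<equiv> {0..2 * pi}"
abbreviation "strip \<equiv> {0::real..} \<times> circ"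
abbreviation "cyl T \<equiv> {0..T::real} \<times> circ"

section \<open>Absolutely continuous functions on intervals\<close>

text \<open>Absolute continuity with \<open>g\<close> as a version of the derivative. The integral
  identity is taken as the definition because a weak derivative can then be inserted for
  \<open>g\<close> directly, without differentiating almost everywhere.\<close>

definition primitive_on :: "real \<Rightarrow> real \<Rightarrow> (real \<Rightarrow> real) \<Rightarrow> (real \<Rightarrow> real) \<Rightarrow> bool" where
 "primitive_on p q f g \<longleftrightarrow> L1_on {p..q} g \<and>
  (\<forall>t\<in>{p..q}. f t = f p + (LBINT s:{p..t}. g s))"

lemma primitive_onI:
 assumes "L1_on {p..q} g"
  "\<And>t. p \<le> t \<Longrightarrow> t \<le> q \<Longrightarrow> f t = f p + (LBINT s:{p..t}. g s)"
 shows "primitive_on p q f g"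
 using assms unfolding primitive_on_def Ball_def atLeastAtMost_iff by blast

lemma primitive_on_integrable: "primitive_on p q f g \<Longrightarrow> L1_on {p..q} g"
 unfolding primitive_on_def by blast

lemma primitive_on_eq:
 "primitive_on p q f g \<Longrightarrow> p \<le> t \<Longrightarrow> t \<le> q \<Longrightarrow> f t = f p + (LBINT s:{p..t}. g s)"
 unfolding primitive_on_def Ball_def atLeastAtMost_iff by blast

lemma set_integral_split_Icc:
 fixes g :: "real \<Rightarrow> real"
 assumes "L1_on {p..q} g" "p \<le> m" "m \<le> q"
 shows "(LBINT s:{p..q}. g s) = (LBINT s:{p..m}. g s) + (LBINT s:{m..q}. g s)"
proof -
 have 1: "L1_on {p..m} g" "L1_on {m..q} g"
  using assms by (auto intro: set_integrable_subset)
 have eq: "{p..q} = {p..m} \<union> {m..q}" using assms by auto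
 show ?thesis unfolding eq
  by (rule set_integral_Un_AE)
   (use 1 AE_lborel_singleton[of m] in \<open>auto elim!: eventually_mono\<close>)
qed

lemma primitive_on_continuous:
 assumes "primitive_on p q f g" shows "continuous_on {p..q} f"
proof -
 have *: "L1_on {p..t} g" if "t \<le> q" for t
  using assms[THEN primitive_on_integrable] that by (auto intro: set_integrable_subset)
 have "g integrable_on {p..q}"
  using set_borel_integral_eq_integral(1)[OF *] by simp
 then have "continuous_on {p..q} (\<lambda>t. f p + integral {p..t} g)"
  by (intro continuous_intros indefinite_integral_continuous_1)
 then show ?thesis
 proof (rule continuous_on_eq)
  fix t assume "t \<in> {p..q}"
  then show "f p + integral {p..t} g = f t"
   using primitive_on_eq[OF assms, of t] set_borel_integral_eq_integral(2)[OF *[of t]] by auto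
 qed
qed

lemma continuous_set_integrable:
 fixes f :: "real \<Rightarrow> real"
 assumes "continuous_on {p..q} f" shows "L1_on {p..q} f"
 using borel_integrable_compact[of "{p..q}" f] assms
 by (simp add: set_integrable_def)

lemma set_integrable_continuous_mult:
 fixes f g :: "real \<Rightarrow> real"
 assumes "continuous_on {p..q} f" "L1_on {p..q} g"
 shows "L1_on {p..q} (\<lambda>s. f s * g s)"
proof -
 have "bounded (f ` {p..q})"
  using assms(1) compact_continuous_image compact_imp_bounded by blast
 then obtain M where M: "\<And>s. s \<in> {p..q} \<Longrightarrow> \<bar>f s\<bar> \<le> M"
  unfolding bounded_iff by (metis imageI real_norm_def)
 have fm: "set_borel_measurable lborel {p..q} f"
  using continuous_set_integrable[OF assms(1)]
  by (simp add: set_integrable_def set_borel_measurable_def)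
 have gm: "set_borel_measurable lborel {p..q} g"
  using assms(2) by (simp add: set_integrable_def set_borel_measurable_def)
 have "(\<lambda>s. (indicator {p..q} s *\<^sub>R f s) * (indicator {p..q} s *\<^sub>R g s)) \<in> borel_measurable lborel"
  using fm gm unfolding set_borel_measurable_def by (rule borel_measurable_times)
 also have "(\<lambda>s. (indicator {p..q} s *\<^sub>R f s) * (indicator {p..q} s *\<^sub>R g s))
   = (\<lambda>s. indicator {p..q} s *\<^sub>R (f s * g s))"
  by (auto simp: indicator_def fun_eq_iff)
 finally have meas: "set_borel_measurable lborel {p..q} (\<lambda>s. f s * g s)"
  by (simp add: set_borel_measurable_def)
 show ?thesis
 proof (rule set_integrable_bound[OF _ meas])
  show "L1_on {p..q} (\<lambda>s. M * g s)" using assms(2) by simp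
  show "AE x\<in>{p..q} in lborel. norm (f x * g x) \<le> norm (M * g x)"
  proof (intro AE_I2 impI)
   fix x assume "x \<in> {p..q}"
   with M[of x] have "\<bar>f x\<bar> \<le> \<bar>M\<bar>" by linarith
   then show "norm (f x * g x) \<le> norm (M * g x)"
    by (simp add: abs_mult mult_right_mono)
  qed
 qed
qed

lemma set_integrable_mult_continuous:
 fixes f g :: "real \<Rightarrow> real"
 assumes "continuous_on {p..q} f" "L1_on {p..q} g"
 shows "L1_on {p..q} (\<lambda>s. g s * f s)"
 using set_integrable_continuous_mult[OF assms] by (simp add: mult.commute)

lemma primitive_on_subinterval:
 assumes "primitive_on p q f g" "p \<le> p'" "p' \<le> q'" "q' \<le> q"
 shows "primitive_on p' q' f g"
proof -
 have int: "L1_on {p..t} g" if "t \<le> q" for t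
  using primitive_on_integrable[OF assms(1)] that by (auto intro: set_integrable_subset)
 have "f t = f p' + (LBINT s:{p'..t}. g s)" if "t \<in> {p'..q'}" for t
  using primitive_on_eq[OF assms(1), of t] primitive_on_eq[OF assms(1), of p']
   set_integral_split_Icc[OF int[of t], of p'] that assms by auto
 moreover have "L1_on {p'..q'} g"
  using int[of q'] assms by (auto intro: set_integrable_subset)
 ultimately show ?thesis unfolding primitive_on_def by blast
qed

lemma primitive_on_concat:
 assumes "primitive_on p m f g" "primitive_on m q f g" "p \<le> m" "m \<le> q"
 shows "primitive_on p q f g"
proof -
 have eq: "{p..q} = {p..m} \<union> {m..q}" using assms by auto
 have int: "L1_on {p..q} g"
  unfolding eq using assms(1,2)[THEN primitive_on_integrable] by (intro set_integrable_Un) auto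
 have "f t = f p + (LBINT s:{p..t}. g s)" if t: "t \<in> {p..q}" for t
 proof (cases "t \<le> m")
  case True then show ?thesis using primitive_on_eq[OF assms(1), of t] t by simp
 next
  case False
  have "L1_on {p..t} g" using int t by (auto intro: set_integrable_subset)
  from set_integral_split_Icc[OF this, of m] False show ?thesis
   using primitive_on_eq[OF assms(1), of m] primitive_on_eq[OF assms(2), of t] t assms(3,4) by auto
 qed
 with int show ?thesis unfolding primitive_on_def by blast
qed

text \<open>The two endpoints form a null set, so the derivatives may disagree there. This is what
  lets piecewise functions be glued: at a breakpoint the two branches prescribe different
  slopes.\<close>

lemma primitive_on_cong:
 assumes "primitive_on p q f g" "\<And>t. p \<le> t \<Longrightarrow> t \<le> q \<Longrightarrow> f' t = f t"
  "\<And>t. p < t \<Longrightarrow> t < q \<Longrightarrow> g' t = g t"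
 shows "primitive_on p q f' g'"
proof (cases "p \<le> q")
 case False then show ?thesis by (simp add: primitive_on_def set_integrable_def)
next
 case pq: True
 have X: "countable {p, q}" by simp
 have null: "emeasure lborel {x} = 0" for x :: real by simp
 have "L1_on {p..q} g' \<longleftrightarrow> L1_on {p..q} g"
  unfolding set_integrable_def
  by (rule integrable_discrete_difference[where X = "{p,q}"])
   (use assms in \<open>auto simp: indicator_def\<close>)
 moreover have "(LBINT s:{p..t}. g' s) = (LBINT s:{p..t}. g s)" if "t \<le> q" for t
  unfolding set_lebesgue_integral_def
  by (rule integral_discrete_difference[where X = "{p,q}"])
   (use assms that in \<open>auto simp: indicator_def\<close>)
 moreover have "f t = f p + (LBINT s:{p..t}. g s)" "f' t = f t" "f' p = f p"
  if "p \<le> t" "t \<le> q" for t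
  using primitive_on_eq[OF assms(1) that] assms(2) that pq by auto
 ultimately show ?thesis using primitive_on_integrable[OF assms(1)]
  by (intro primitive_onI) metis+
qed

lemma primitive_on_const: "primitive_on p q (\<lambda>_. k) (\<lambda>_. 0)"
 by (simp add: primitive_on_def set_integrable_def)

lemma primitive_on_add:
 assumes "primitive_on p q f g" "primitive_on p q f' g'"
 shows "primitive_on p q (\<lambda>t. f t + f' t) (\<lambda>t. g t + g' t)"
proof -
 have "L1_on {p..t} g" "L1_on {p..t} g'" if "t \<le> q" for t
  using assms[THEN primitive_on_integrable] that by (auto intro: set_integrable_subset)
 note int = this
 show ?thesis
 proof (rule primitive_onI)
  show "L1_on {p..q} (\<lambda>t. g t + g' t)" using int by auto
  fix t assume t: "p \<le> t" "t \<le> q"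
  show "f t + f' t = f p + f' p + (LBINT s:{p..t}. g s + g' s)"
   using primitive_on_eq[OF assms(1) t] primitive_on_eq[OF assms(2) t] int[OF t(2)]
   by (simp only: set_integral_add)
 qed
qed

lemma primitive_on_cmult:
 assumes "primitive_on p q f g"
 shows "primitive_on p q (\<lambda>t. k * f t) (\<lambda>t. k * g t)"
proof (rule primitive_onI)
 show "L1_on {p..q} (\<lambda>t. k * g t)"
  using primitive_on_integrable[OF assms] by simp
 fix t assume "p \<le> t" "t \<le> q"
 then have "f t = f p + (LBINT s:{p..t}. g s)"
  by (rule primitive_on_eq[OF assms])
 then show "k * f t = k * f p + (LBINT s:{p..t}. k * g s)"
  by (simp only: set_integral_mult_right distrib_left)
qed

lemma primitive_on_diff:
 assumes "primitive_on p q f g" "primitive_on p q f' g'"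
 shows "primitive_on p q (\<lambda>t. f t - f' t) (\<lambda>t. g t - g' t)"
 using primitive_on_add[OF assms(1) primitive_on_cmult[OF assms(2), of "-1"]] by simp

lemma primitive_on_deriv:
 assumes "\<And>t. p \<le> t \<Longrightarrow> t \<le> q \<Longrightarrow> (f has_real_derivative g t) (at t within {p..q})"
  "continuous_on {p..q} g"
 shows "primitive_on p q f g"
proof -
 have "(LBINT s:{p..t}. g s) = f t - f p" if "p \<le> t" "t \<le> q" for t
 proof -
  have "(LBINT s. indicator {p..t} s *\<^sub>R g s) = f t - f p"
  proof (rule integral_FTC_atLeastAtMost[OF that(1)])
   show "continuous_on {p..t} g" using assms(2) that by (auto intro: continuous_on_subset)
   fix x assume "p \<le> x" "x \<le> t"
   then show "(f has_vector_derivative g x) (at x within {p..t})"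
    using assms(1)[of x] that
    by (auto intro: DERIV_subset simp flip: has_real_derivative_iff_has_vector_derivative)
  qed
  then show ?thesis by (simp add: set_lebesgue_integral_def)
 qed
 then show ?thesis using continuous_set_integrable[OF assms(2)] by (intro primitive_onI) auto
qed

lemma primitive_on_at_deriv:
 assumes "\<And>t. p \<le> t \<Longrightarrow> t \<le> q \<Longrightarrow> (f has_real_derivative g t) (at t)"
  "continuous_on {p..q} g"
 shows "primitive_on p q f g"
 by (rule primitive_on_deriv) (use assms in \<open>auto intro: has_field_derivative_at_within\<close>)

text \<open>The product is a double integral over the plane, cut along the diagonal into the halves
  \<open>r \<le> s\<close> and \<open>s < r\<close>; Fubini evaluates each. It is integration by
  parts before any derivative is taken.\<close>

lemma integral_product_split:
 fixes G K :: "real \<Rightarrow> real"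
 assumes G: "integrable lborel G" and K: "integrable lborel K"
 shows "(LBINT s. G s) * (LBINT r. K r) =
  (LBINT s. G s * (LBINT r:{..s}. K r)) + (LBINT r. K r * (LBINT s:{..<r}. G s))"
proof -
 have [measurable]: "G \<in> borel_fun" "K \<in> borel_fun"
  using G K by auto
 have I: "integrable (lborel \<Otimes>\<^sub>M lborel) (\<lambda>(s, r). G s * K r)"
 proof (rule lborel_pair.Fubini_integrable)
  show "(\<lambda>(s, r). G s * K r) \<in> borel_measurable (lborel \<Otimes>\<^sub>M lborel)" by measurable
  show "integrable lborel (\<lambda>x. LBINT y. norm (case (x, y) of (s, r) \<Rightarrow> G s * K r))"
   using G K by (simp add: abs_mult)
  show "AE x in lborel. integrable lborel (\<lambda>y. case (x, y) of (s, r) \<Rightarrow> G s * K r)"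
   using K by simp
 qed
 have J: "integrable (lborel \<Otimes>\<^sub>M lborel) (\<lambda>(s, r). (if r \<le> s then G s * K r else 0))"
  by (rule Bochner_Integration.integrable_bound[OF I]) (auto split: prod.split)
 have L: "integrable (lborel \<Otimes>\<^sub>M lborel) (\<lambda>(s, r). (if s < r then G s * K r else 0))"
  by (rule Bochner_Integration.integrable_bound[OF I]) (auto split: prod.split)
 have 1: "(LBINT s. G s * (LBINT r:{..s}. K r)) =
   integral\<^sup>L (lborel \<Otimes>\<^sub>M lborel) (\<lambda>(s, r). (if r \<le> s then G s * K r else 0))"
 proof -
  have "(LBINT s. G s * (LBINT r:{..s}. K r)) =
   (LBINT s. (LBINT r. (if r \<le> s then G s * K r else 0)))"
   unfolding set_lebesgue_integral_def integral_mult_right_zero[symmetric]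
   by (intro Bochner_Integration.integral_cong refl) (auto simp: indicator_def)
  also have "\<dots> = integral\<^sup>L (lborel \<Otimes>\<^sub>M lborel) (\<lambda>(s, r). (if r \<le> s then G s * K r else 0))"
   using lborel_pair.integral_fst'[OF J] by simp
  finally show ?thesis .
 qed
 have 2: "(LBINT r. K r * (LBINT s:{..<r}. G s)) =
   integral\<^sup>L (lborel \<Otimes>\<^sub>M lborel) (\<lambda>(s, r). (if s < r then G s * K r else 0))"
 proof -
  have "(LBINT r. K r * (LBINT s:{..<r}. G s)) =
   (LBINT r. (LBINT s. (if s < r then G s * K r else 0)))"
   unfolding set_lebesgue_integral_def integral_mult_right_zero[symmetric]
   by (intro Bochner_Integration.integral_cong refl) (auto simp: indicator_def)
  also have "\<dots> = integral\<^sup>L (lborel \<Otimes>\<^sub>M lborel) (\<lambda>(s, r). (if s < r then G s * K r else 0))"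
   using lborel_pair.integral_snd[OF L] by simp
  finally show ?thesis .
 qed
 have "(LBINT s. G s) * (LBINT r. K r) = (LBINT s. (LBINT r. G s * K r))"
  by simp
 also have "\<dots> = integral\<^sup>L (lborel \<Otimes>\<^sub>M lborel) (\<lambda>(s, r). G s * K r)"
  using lborel_pair.integral_fst'[OF I] by simp
 also have "\<dots> = integral\<^sup>L (lborel \<Otimes>\<^sub>M lborel) (\<lambda>p. (case p of (s, r) \<Rightarrow> (if r \<le> s then G s * K r else 0))
   + (case p of (s, r) \<Rightarrow> (if s < r then G s * K r else 0)))"
  by (intro Bochner_Integration.integral_cong refl) auto
 finally show ?thesis unfolding 1 2 using J L by simp
qed

text \<open>With \<open>g\<close> and \<open>k\<close> restricted to \<open>{p..t}\<close>, the
  inner integrals of the split product are the increments of \<open>h\<close> and \<open>f\<close>.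
  Expanding the product of f t - f p and h t - h p then gives the product rule with no pointwise
  differentiability.\<close>

lemma primitive_on_mult:
 assumes f: "primitive_on p q f g" and h: "primitive_on p q h k"
 shows "primitive_on p q (\<lambda>t. f t * h t) (\<lambda>t. f t * k t + g t * h t)"
proof -
 note cf = primitive_on_continuous[OF f] and ch = primitive_on_continuous[OF h]
 note ig = primitive_on_integrable[OF f] and ik = primitive_on_integrable[OF h]
 have "f t * h t = f p * h p + (LBINT s:{p..t}. f s * k s + g s * h s)"
  if t: "t \<in> {p..q}" for t
 proof -
  define G where "G s = indicator {p..t} s * g s" for s
  define K where "K s = indicator {p..t} s * k s" for s
  have ig': "L1_on {p..t} g" and ik': "L1_on {p..t} k"
   using ig ik t by (auto intro: set_integrable_subset)
  have iG: "integrable lborel G" and iK: "integrable lborel K"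
   using ig' ik' by (auto simp: G_def[abs_def] K_def[abs_def] set_integrable_def)
  have GK: "(LBINT s. G s) = f t - f p" "(LBINT s. K s) = h t - h p"
   using primitive_on_eq[OF f, of t] primitive_on_eq[OF h, of t] t
   by (auto simp: G_def K_def set_lebesgue_integral_def)
  have 1: "G s * (LBINT r:{..s}. K r) = indicator {p..t} s * (g s * (h s - h p))" for s
  proof (cases "s \<in> {p..t}")
   case True
   have "(LBINT r:{..s}. K r) = (LBINT r:{p..s}. k r)"
    unfolding set_lebesgue_integral_def
    by (intro Bochner_Integration.integral_cong refl) (use True in \<open>auto simp: K_def indicator_def\<close>)
   then show ?thesis using primitive_on_eq[OF h, of s] True t by (simp add: G_def)
  qed (simp add: G_def)
  have 2: "K s * (LBINT r:{..<s}. G r) = indicator {p..t} s * (k s * (f s - f p))" for s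
  proof (cases "s \<in> {p..t}")
   case True
   have "(LBINT r:{..<s}. G r) = (LBINT r:{p..s}. g r)"
    unfolding set_lebesgue_integral_def
    by (rule integral_discrete_difference[where X = "{s}"])
     (use True in \<open>auto simp: G_def indicator_def\<close>)
   then show ?thesis using primitive_on_eq[OF f, of s] True t by (simp add: K_def)
  qed (simp add: K_def)
  have cf': "continuous_on {p..t} f" and ch': "continuous_on {p..t} h"
   using cf ch t by (auto intro: continuous_on_subset)
  have A: "L1_on {p..t} (\<lambda>s. g s * h s)" "L1_on {p..t} (\<lambda>s. f s * k s)"
   using set_integrable_mult_continuous[OF ch' ig'] set_integrable_continuous_mult[OF cf' ik'] by auto
  have "(f t - f p) * (h t - h p) =
   (LBINT s:{p..t}. g s * (h s - h p)) + (LBINT s:{p..t}. k s * (f s - f p))"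
   using integral_product_split[OF iG iK] unfolding GK 1 2 by (simp add: set_lebesgue_integral_def)
  also have "(LBINT s:{p..t}. g s * (h s - h p)) =
    (LBINT s:{p..t}. g s * h s) - h p * (f t - f p)"
   using A ig' primitive_on_eq[OF f, of t] t by (simp add: right_diff_distrib set_integral_diff mult.commute)
  also have "(LBINT s:{p..t}. k s * (f s - f p)) =
    (LBINT s:{p..t}. f s * k s) - f p * (h t - h p)"
   using A ik' primitive_on_eq[OF h, of t] t by (simp add: right_diff_distrib set_integral_diff mult.commute)
  finally show ?thesis using A by (simp add: algebra_simps)
 qed
 moreover have "L1_on {p..q} (\<lambda>t. f t * k t + g t * h t)"
  using set_integrable_mult_continuous[OF ch ig] set_integrable_continuous_mult[OF cf ik] by auto
 ultimately show ?thesis unfolding primitive_on_def by blast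
qed

section \<open>Riccati and Wirtinger inequalities\<close>

text \<open>The cross term of the expanded square completes to minus the derivative of k f^2, so
  only endpoint values remain. Applied with k' = - W - k^2, it bounds the energy with potential W
  below by boundary terms.\<close>

lemma riccati_identity:
 fixes f g k k' :: "real \<Rightarrow> real"
 assumes ac: "primitive_on p q f g" and pq: "p \<le> q"
  and g2: "L1_on {p..q} (\<lambda>s. (g s)^2)"
  and k: "\<And>t. p \<le> t \<Longrightarrow> t \<le> q \<Longrightarrow> (k has_real_derivative k' t) (at t)"
  and k': "continuous_on {p..q} k'"
 shows "L1_on {p..q} (\<lambda>s. (g s - k s * f s)^2)" (is ?I)
  and "(LBINT s:{p..q}. (g s - k s * f s)^2) =
   (LBINT s:{p..q}. (g s)^2 + (k' s + (k s)^2) * (f s)^2) - (k q * (f q)^2 - k p * (f p)^2)" (is ?E)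
proof -
 note cf = primitive_on_continuous[OF ac] and ig = primitive_on_integrable[OF ac]
 have pk: "primitive_on p q k k'" by (rule primitive_on_at_deriv) (use k k' in auto)
 note ck = primitive_on_continuous[OF pk]
 have P: "primitive_on p q (\<lambda>t. k t * (f t * f t)) (\<lambda>t. k t * (f t * g t + g t * f t) + k' t * (f t * f t))"
  by (intro primitive_on_mult pk ac)
 have 1: "L1_on {p..q} (\<lambda>s. (g s)^2 + (k' s + (k s)^2) * (f s)^2)"
  by (rule set_integral_add(1)[OF g2]) (intro continuous_set_integrable continuous_intros cf ck k')
 have eq: "(g s - k s * f s)^2 = ((g s)^2 + (k' s + (k s)^2) * (f s)^2)
   - (k s * (f s * g s + g s * f s) + k' s * (f s * f s))" for s
  by (simp add: power2_eq_square algebra_simps)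
 show ?I unfolding eq by (rule set_integral_diff(1)[OF 1 primitive_on_integrable[OF P]])
 have "(LBINT s:{p..q}. k s * (f s * g s + g s * f s) + k' s * (f s * f s))
   = k q * (f q)^2 - k p * (f p)^2"
  using primitive_on_eq[OF P, of q] pq by (simp add: power2_eq_square)
 then show ?E unfolding eq by (subst set_integral_diff(2)[OF 1 primitive_on_integrable[OF P]]) simp
qed

text \<open>The weight \<open>k\<close> is the logarithmic derivative of cos (l (x - m)), a solution
  of u'' = - l^2 u that stays positive on the interval; hence k' = - l^2 - k^2.\<close>

lemma tan_riccati_bound:
 fixes f g :: "real \<Rightarrow> real"
 assumes ac: "primitive_on p q f g" and pq: "p \<le> q"
  and g2: "L1_on {p..q} (\<lambda>s. (g s)^2)"
  and m: "\<And>x. p \<le> x \<Longrightarrow> x \<le> q \<Longrightarrow> \<bar>l * (x - m)\<bar> < pi / 2"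
 shows "l^2 * (LBINT s:{p..q}. (f s)^2) \<le> (LBINT s:{p..q}. (g s)^2)
  + l * tan (l * (q - m)) * (f q)^2 - l * tan (l * (p - m)) * (f p)^2"
proof -
 define k where "k x = - l * tan (l * (x - m))" for x
 have cos0: "cos (l * (x - m)) \<noteq> 0" if "p \<le> x" "x \<le> q" for x
 proof -
  have "cos (l * (x - m)) > 0" using m[OF that] by (intro cos_gt_zero_pi) auto
  then show ?thesis by simp
 qed
 have dk: "(k has_real_derivative (- (l^2) - (k x)^2)) (at x)" if "p \<le> x" "x \<le> q" for x
 proof -
  have "(k has_real_derivative - l * (inverse ((cos (l * (x - m)))^2) * l)) (at x)"
   unfolding k_def using cos0[OF that] by (auto intro!: derivative_eq_intros)
  moreover have "- l * (inverse ((cos (l * (x - m)))^2) * l) = - (l^2) - (k x)^2"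
  proof -
   have "inverse ((cos (l * (x - m)))^2) = 1 + (tan (l * (x - m)))^2"
    using tan_sec[OF cos0[OF that]] by (simp add: power_inverse)
   then show ?thesis by (simp only: k_def) (simp add: power2_eq_square algebra_simps)
  qed
  ultimately show ?thesis by simp
 qed
 have ck: "continuous_on {p..q} k"
  by (intro continuous_at_imp_continuous_on ballI DERIV_isCont[OF dk]) auto
 have ck': "continuous_on {p..q} (\<lambda>x. - (l^2) - (k x)^2)" by (intro continuous_intros ck)
 note R = riccati_identity[OF ac pq g2 dk ck']
 have "0 \<le> (LBINT s:{p..q}. (g s - k s * f s)^2)"
  by (simp add: set_lebesgue_integral_def)
 also have "\<dots> = (LBINT s:{p..q}. (g s)^2 + (- (l^2)) * (f s)^2) - (k q * (f q)^2 - k p * (f p)^2)"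
  using R(2) by simp
 also have "(LBINT s:{p..q}. (g s)^2 + (- (l^2)) * (f s)^2) =
   (LBINT s:{p..q}. (g s)^2) - l^2 * (LBINT s:{p..q}. (f s)^2)"
 proof -
  have "L1_on {p..q} (\<lambda>s. (f s)^2)"
   by (intro continuous_set_integrable continuous_intros primitive_on_continuous[OF ac])
  then have "L1_on {p..q} (\<lambda>s. - (l^2) * (f s)^2)" by (intro set_integrable_mult_right)
  from set_integral_add(2)[OF g2 this] show ?thesis unfolding set_integral_mult_right by simp
 qed
 finally show ?thesis by (simp add: k_def)
qed

text \<open>No Fourier series is used. b (x + pi) - b x changes sign on \<open>{0..pi}\<close>, so
  \<open>b\<close> takes some value c at two antipodal points. Then \<open>b - c\<close> vanishes at
  the ends of two arcs of length pi, where comparison with a cosine gives the constant 1; the mean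
  enters only when c is removed.\<close>

lemma wirtinger:
 fixes b g :: "real \<Rightarrow> real"
 assumes ac: "primitive_on 0 (2 * pi) b g" and per: "b (2 * pi) = b 0"
  and g2: "L1_on circ (\<lambda>s. (g s)^2)"
 shows "(LBINT s:circ. (b s)^2) \<le>
  (LBINT s:circ. (g s)^2) + (LBINT s:circ. b s)^2 / (2 * pi)"
proof -
 note cb = primitive_on_continuous[OF ac]
 obtain x where x: "0 \<le> x" "x \<le> pi" "b (x + pi) = b x"
 proof -
  define h where "h x = b (x + pi) - b x" for x
  have ch: "continuous_on {0..pi} h"
   unfolding h_def
   by (intro continuous_intros continuous_on_compose2[OF cb]) auto
  have "pi + pi = 2 * pi" by simp
  then have hpi: "h pi = - h 0" unfolding h_def using per by simp
  have "\<exists>x. 0 \<le> x \<and> x \<le> pi \<and> h x = 0"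
  proof (cases "h 0 \<le> 0")
   case True then show ?thesis by (intro IVT') (use ch hpi in auto)
  next
   case False then show ?thesis by (intro IVT2') (use ch hpi in auto)
  qed
  then show ?thesis using that by (auto simp: h_def)
 qed
 define c where "c = b x"
 define f where "f s = b s - c" for s
 have pf: "primitive_on 0 (2 * pi) f g"
  using primitive_on_diff[OF ac primitive_on_const[of _ _ c]] by (simp add: f_def[abs_def])
 have fx: "f x = 0" "f (x + pi) = 0" "f (2 * pi) = f 0"
  using x per by (simp_all add: f_def c_def)
 define FF where "FF = (LBINT s:circ. (f s)^2)"
 define GG where "GG = (LBINT s:circ. (g s)^2)"
 have if2: "L1_on circ (\<lambda>s. (f s)^2)"
  by (intro continuous_set_integrable continuous_intros primitive_on_continuous[OF pf])
 have split: "(LBINT s:circ. h s) = (LBINT s:{0..x}. h s)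
   + (LBINT s:{x..x + pi}. h s) + (LBINT s:{x + pi..2 * pi}. h s)"
  if "L1_on circ h" for h :: "real \<Rightarrow> real"
 proof -
  have "L1_on {x..2 * pi} h" using that x by (auto intro: set_integrable_subset)
  from set_integral_split_Icc[OF this, of "x + pi"] set_integral_split_Icc[OF that, of x] x
  show ?thesis by simp
 qed
 \<comment> \<open>On an arc of length pi the comparison cosine vanishes at both ends and its
   tangent blows up. The frequency is therefore kept below 1, and the limit is taken at the
   end.\<close>
 have z: "z * FF \<le> GG" if z: "0 < z" "z < 1" for z
 proof -
  define l where "l = sqrt z"
  have l: "0 < l" "l < 1" "l^2 = z" using z by (simp_all add: l_def)
  have lt: "\<bar>l * y\<bar> < pi / 2" if "- (pi / 2) \<le> y" "y \<le> pi / 2" for y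
  proof -
   have "\<bar>y\<bar> \<le> pi / 2" using that by linarith
   then
   have "l * \<bar>y\<bar> \<le> l * (pi / 2)" using l by (intro mult_left_mono) auto
   also have "\<dots> < 1 * (pi / 2)" using l pi_gt_zero by (intro mult_strict_right_mono) auto
   finally show ?thesis using l by (simp add: abs_mult)
  qed
  have g2': "L1_on {p..q} (\<lambda>s. (g s)^2)" if "0 \<le> p" "q \<le> 2 * pi" for p q
   using g2 that by (auto intro: set_integrable_subset)
  have 1: "l^2 * (LBINT s:{0..x}. (f s)^2) \<le> (LBINT s:{0..x}. (g s)^2)
   + l * tan (l * (x - (x - pi / 2))) * (f x)^2 - l * tan (l * (0 - (x - pi / 2))) * (f 0)^2"
   by (rule tan_riccati_bound[OF primitive_on_subinterval[OF pf]])
    ((rule lt; use x in linarith) | (rule g2'; use x in linarith) | (use x in linarith))+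
  have 2: "l^2 * (LBINT s:{x..x + pi}. (f s)^2) \<le> (LBINT s:{x..x + pi}. (g s)^2)
   + l * tan (l * (x + pi - (x + pi / 2))) * (f (x + pi))^2 - l * tan (l * (x - (x + pi / 2))) * (f x)^2"
   by (rule tan_riccati_bound[OF primitive_on_subinterval[OF pf]])
    ((rule lt; use x in linarith) | (rule g2'; use x in linarith) | (use x in linarith))+
  \<comment> \<open>The second arc runs through the end of the period and is cut there. The centres
    of its two pieces, x - pi / 2 and x + 3 pi / 2, differ by 2 pi, so the tangent terms at 0 and 2
    pi are equal and cancel.\<close>
  have 3: "l^2 * (LBINT s:{x + pi..2 * pi}. (f s)^2) \<le> (LBINT s:{x + pi..2 * pi}. (g s)^2)
   + l * tan (l * (2 * pi - (x + 3 * pi / 2))) * (f (2 * pi))^2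
   - l * tan (l * (x + pi - (x + 3 * pi / 2))) * (f (x + pi))^2"
   by (rule tan_riccati_bound[OF primitive_on_subinterval[OF pf]])
    ((rule lt; use x in linarith) | (rule g2'; use x in linarith) | (use x in linarith))+
  have e: "2 * pi - (x + 3 * pi / 2) = 0 - (x - pi / 2)" by simp
  show ?thesis
   using 1 2 3 unfolding e fx FF_def GG_def split[OF if2] split[OF g2] l(3)[symmetric]
   by (simp add: distrib_left)
 qed
 have FG: "FF \<le> GG" by (rule field_le_mult_one_interval) (use z in auto)
 define m where "m = (LBINT s:circ. b s)"
 have ib: "L1_on circ b" "L1_on circ (\<lambda>s. (b s)^2)"
  by (intro continuous_set_integrable continuous_intros cb)+
 have cst: "(LBINT s:circ. k) = 2 * pi * k" "L1_on circ (\<lambda>_. k)" for k :: real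
  by (simp_all add: set_integral_const set_integrable_def)
 have "FF = (LBINT s:circ. (b s)^2) - 2 * c * m + 2 * pi * c^2"
 proof -
  have "(f s)^2 = ((b s)^2 - 2 * c * b s) + c^2" for s
   by (simp add: f_def power2_eq_square algebra_simps)
  then show ?thesis unfolding FF_def m_def
   using ib cst by (simp add: set_integral_add set_integral_diff)
 qed
 \<comment> \<open>The shift is only known as some value of \<open>b\<close>, so it is estimated
   uniformly: for every c the correction is at most the contribution of the mean.\<close>
 moreover have "2 * c * m - 2 * pi * c^2 \<le> m^2 / (2 * pi)"
 proof -
  have "0 \<le> (2 * pi * c - m)^2" by simp
  then have "2 * pi * (2 * c * m - 2 * pi * c^2) \<le> m^2"
   by (simp add: power2_eq_square algebra_simps)
  then show ?thesis by (simp add: field_simps)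
 qed
 ultimately show ?thesis using FG by (simp add: GG_def m_def)
qed

text \<open>First variation at a minimum: for nonzero B the value r = - B / M with M above K lets
  the linear term win.\<close>

lemma nonneg_quadratic_imp_linear_zero:
 fixes B K :: real
 assumes "\<And>r. 0 \<le> 2 * r * B + r^2 * K"
 shows "B = 0"
proof (rule ccontr)
 assume B: "B \<noteq> 0"
 define M where "M = \<bar>K\<bar> + 1"
 have M: "0 < M" "K < M" by (auto simp: M_def)
 have "0 \<le> 2 * (- B / M) * B + (- B / M)^2 * K" by (rule assms)
 also have "\<dots> \<le> 2 * (- B / M) * B + (- B / M)^2 * M"
  using M by (intro add_left_mono mult_left_mono) auto
 also have "\<dots> = - (B^2 / M)" using M by (simp add: power2_eq_square field_simps)
 also have "\<dots> < 0" using B M by simp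
 finally show False by simp
qed

text \<open>
 The kernel \<open>(\<pi> - x) sin x\<close> with \<open>x = \<bar>\<theta> - s\<bar>\<close> is, up to multiples of \<open>cos (\<theta> - s)\<close>, a Green function
 of \<open>- d^2/d\<theta>^2 - 1\<close> on the circle; it turns the Euler equation of an extremal into a pointwise identity.
\<close>

lemma wirtinger_rigidity:
 fixes b g :: "real \<Rightarrow> real"
 assumes ac: "primitive_on 0 (2 * pi) b g" and per: "b (2 * pi) = b 0"
  and g2: "L1_on circ (\<lambda>s. (g s)^2)"
  and mean: "(LBINT s:circ. b s) = 0"
  and cos: "(LBINT s:circ. b s * cos s) = 0"
  and sin: "(LBINT s:circ. b s * sin s) = 0"
  and le: "(LBINT s:circ. (g s)^2) \<le> (LBINT s:circ. (b s)^2)"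
  and s: "0 \<le> s" "s \<le> 2 * pi"
 shows "b s = 0"
proof -
 note cb = primitive_on_continuous[OF ac] and ig = primitive_on_integrable[OF ac]
 define e1 where "e1 x = (pi - (s - x)) * sin (s - x)" for x
 define e2 where "e2 x = (pi - (x - s)) * sin (x - s)" for x
 define d1 where "d1 x = sin (s - x) - (pi - (s - x)) * cos (s - x)" for x
 define d2 where "d2 x = (pi - (x - s)) * cos (x - s) - sin (x - s)" for x
 define e where "e x = (if x \<le> s then e1 x else e2 x)" for x
 define d where "d x = (if x < s then d1 x else d2 x)" for x
 have De: "(e1 has_real_derivative d1 x) (at x)" "(e2 has_real_derivative d2 x) (at x)" for x
  unfolding e1_def e2_def d1_def d2_def by (auto intro!: derivative_eq_intros simp: algebra_simps)
 have Dd: "(d1 has_real_derivative - e1 x - 2 * cos (s - x)) (at x)"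
   "(d2 has_real_derivative - e2 x - 2 * cos (x - s)) (at x)" for x
  unfolding e1_def e2_def d1_def d2_def by (auto intro!: derivative_eq_intros simp: algebra_simps)
 have ce: "continuous_on A e1" "continuous_on A e2" "continuous_on A d1" "continuous_on A d2" for A
  unfolding e1_def e2_def d1_def d2_def by (intro continuous_intros)+
 have pe1: "primitive_on 0 s e1 d1" and pe2: "primitive_on s (2 * pi) e2 d2"
  by (rule primitive_on_at_deriv; use De ce in auto)+
 have "primitive_on 0 s e d"
  by (rule primitive_on_cong[OF pe1]) (auto simp: e_def d_def)
 moreover have "primitive_on s (2 * pi) e d"
  by (rule primitive_on_cong[OF pe2]) (auto simp: e_def d_def e1_def e2_def)
 ultimately have pe: "primitive_on 0 (2 * pi) e d"
  by (rule primitive_on_concat) (use s in auto)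
 note cee = primitive_on_continuous[OF pe]
 have null: "AE x in lborel. x \<noteq> s" by (rule AE_lborel_singleton)
 have eq: "circ = {0..s} \<union> {s..2 * pi}" using s by auto
 have glue: "L1_on circ h"
  if "L1_on {0..s} h1" "L1_on {s..2 * pi} h2"
   "\<And>x. x < s \<Longrightarrow> h x = h1 x" "\<And>x. x > s \<Longrightarrow> h x = h2 x" for h h1 h2 :: "real \<Rightarrow> real"
 proof -
  have "L1_on {0..s} h \<longleftrightarrow> L1_on {0..s} h1"
   unfolding set_integrable_def
   by (rule integrable_discrete_difference[where X = "{s}"])
    (use that in \<open>auto simp: indicator_def\<close>)
  moreover have "L1_on {s..2 * pi} h \<longleftrightarrow> L1_on {s..2 * pi} h2"
   unfolding set_integrable_def
   by (rule integrable_discrete_difference[where X = "{s}"])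
    (use that in \<open>auto simp: indicator_def\<close>)
  ultimately show ?thesis unfolding eq using that by (intro set_integrable_Un) auto
 qed
 have glueI: "(LBINT x:circ. h x) = (LBINT x:{0..s}. h1 x) + (LBINT x:{s..2 * pi}. h2 x)"
  if "L1_on {0..s} h1" "L1_on {s..2 * pi} h2"
   "\<And>x. x < s \<Longrightarrow> h x = h1 x" "\<And>x. x > s \<Longrightarrow> h x = h2 x" for h h1 h2 :: "real \<Rightarrow> real"
 proof -
  have "(LBINT x:{0..s}. h x) = (LBINT x:{0..s}. h1 x)"
   unfolding set_lebesgue_integral_def
   by (rule integral_discrete_difference[where X = "{s}"])
    (use that in \<open>auto simp: indicator_def\<close>)
  moreover have "(LBINT x:{s..2 * pi}. h x) = (LBINT x:{s..2 * pi}. h2 x)"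
   unfolding set_lebesgue_integral_def
   by (rule integral_discrete_difference[where X = "{s}"])
    (use that in \<open>auto simp: indicator_def\<close>)
  ultimately show ?thesis using set_integral_split_Icc[OF glue[OF that], of s] s by simp
 qed
 have ig1: "L1_on {0..s} g" and ig2: "L1_on {s..2 * pi} g"
  using ig s by (auto intro: set_integrable_subset)
 have gd: "L1_on circ (\<lambda>x. g x * d x)"
  by (rule glue[OF set_integrable_mult_continuous[OF ce(3) ig1] set_integrable_mult_continuous[OF ce(4) ig2]])
   (auto simp: d_def)
 have dd: "L1_on circ (\<lambda>x. (d x)^2)"
 proof (rule glue)
  show "L1_on {0..s} (\<lambda>x. (d1 x)^2)" "L1_on {s..2 * pi} (\<lambda>x. (d2 x)^2)"
   by (intro continuous_set_integrable continuous_intros ce)+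
 qed (auto simp: d_def)
 have be: "L1_on circ (\<lambda>x. b x * e x)"
  "L1_on circ (\<lambda>x. (e x)^2)" "L1_on circ (\<lambda>x. (b x)^2)"
  "L1_on circ b" "L1_on circ e"
  by (intro continuous_set_integrable continuous_intros cb cee)+
 define Bbe where "Bbe = (LBINT x:circ. g x * d x) - (LBINT x:circ. b x * e x)"
 define m where "m = (LBINT x:circ. e x)"
 define K where "K = (LBINT x:circ. (d x)^2) - (LBINT x:circ. (e x)^2) + m^2 / (2 * pi)"
 have per_e: "e (2 * pi) = e 0"
  using s by (auto simp: e_def e1_def e2_def sin_diff cos_diff algebra_simps)
 \<comment> \<open>By \<open>le\<close> and the zero mean, \<open>b\<close> attains equality in
   \<open>wirtinger\<close>, so the first variation in the direction \<open>e\<close> vanishes. The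
   mean of \<open>e\<close> contributes only at second order because that of \<open>b\<close> is
   zero.\<close>
 have "Bbe = 0"
 proof (rule nonneg_quadratic_imp_linear_zero[where K = K])
  fix r :: real
  have P: "primitive_on 0 (2 * pi) (\<lambda>x. b x + r * e x) (\<lambda>x. g x + r * d x)"
   by (intro primitive_on_add primitive_on_cmult ac pe)
  have sq: "(g x + r * d x)^2 = ((g x)^2 + 2 * r * (g x * d x)) + r^2 * (d x)^2"
   "(b x + r * e x)^2 = ((b x)^2 + 2 * r * (b x * e x)) + r^2 * (e x)^2" for x
   by (simp_all add: power2_eq_square algebra_simps)
  have I: "L1_on circ (\<lambda>x. (g x + r * d x)^2)"
   unfolding sq by (intro set_integral_add set_integrable_mult_right g2 gd dd impI)
  have W: "(LBINT x:circ. (b x + r * e x)^2) \<le>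
   (LBINT x:circ. (g x + r * d x)^2) + (LBINT x:circ. b x + r * e x)^2 / (2 * pi)"
   by (rule wirtinger[OF P _ I]) (simp add: per per_e)
  have "(LBINT x:circ. b x + r * e x) = r * m"
   using be mean by (simp add: m_def set_integral_add)
  moreover have "(LBINT x:circ. (b x + r * e x)^2) = (LBINT x:circ. (b x)^2)
    + 2 * r * (LBINT x:circ. b x * e x) + r^2 * (LBINT x:circ. (e x)^2)"
   unfolding sq using be by (simp add: set_integral_add)
  moreover have "(LBINT x:circ. (g x + r * d x)^2) = (LBINT x:circ. (g x)^2)
    + 2 * r * (LBINT x:circ. g x * d x) + r^2 * (LBINT x:circ. (d x)^2)"
   unfolding sq using g2 gd dd by (simp add: set_integral_add)
  ultimately show "0 \<le> 2 * r * Bbe + r^2 * K"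
   using W le by (simp add: Bbe_def K_def power_mult_distrib algebra_simps)
 qed
 have P1: "primitive_on 0 s (\<lambda>x. b x * d1 x) (\<lambda>x. b x * (- e1 x - 2 * cos (s - x)) + g x * d1 x)"
 proof (intro primitive_on_mult primitive_on_subinterval[OF ac])
  show "primitive_on 0 s d1 (\<lambda>x. - e1 x - 2 * cos (s - x))"
   by (rule primitive_on_at_deriv[OF Dd(1)]) (intro continuous_intros ce)
 qed (use s in auto)
 have P2: "primitive_on s (2 * pi) (\<lambda>x. b x * d2 x) (\<lambda>x. b x * (- e2 x - 2 * cos (x - s)) + g x * d2 x)"
 proof (intro primitive_on_mult primitive_on_subinterval[OF ac])
  show "primitive_on s (2 * pi) d2 (\<lambda>x. - e2 x - 2 * cos (x - s))"
   by (rule primitive_on_at_deriv[OF Dd(2)]) (intro continuous_intros ce)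
 qed (use s in auto)
 have "(LBINT x:circ. (g x * d x - b x * e x) - 2 * (b x * cos (x - s))) =
  (LBINT x:{0..s}. b x * (- e1 x - 2 * cos (s - x)) + g x * d1 x)
  + (LBINT x:{s..2 * pi}. b x * (- e2 x - 2 * cos (x - s)) + g x * d2 x)"
 proof (rule glueI[OF primitive_on_integrable[OF P1] primitive_on_integrable[OF P2]])
  fix x
  have "cos (s - x) = cos (x - s)" using cos_minus[of "x - s"] by simp
  then show "x < s \<Longrightarrow> g x * d x - b x * e x - 2 * (b x * cos (x - s)) =
   b x * (- e1 x - 2 * cos (s - x)) + g x * d1 x"
   by (simp add: d_def e_def algebra_simps)
  show "x > s \<Longrightarrow> g x * d x - b x * e x - 2 * (b x * cos (x - s)) =
   b x * (- e2 x - 2 * cos (x - s)) + g x * d2 x"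
   by (simp add: d_def e_def algebra_simps)
 qed
 also have "\<dots> = (b s * d1 s - b 0 * d1 0) + (b (2 * pi) * d2 (2 * pi) - b s * d2 s)"
  using primitive_on_eq[OF P1, of s] primitive_on_eq[OF P2, of "2 * pi"] s by simp
 \<comment> \<open>The derivative of the kernel jumps from - pi to pi at the pole, which is what
   isolates \<open>b s\<close>; the values at 0 and 2 pi cancel by periodicity.\<close>
 also have "\<dots> = - 2 * pi * b s"
  unfolding per by (simp add: d1_def d2_def cos_diff sin_diff algebra_simps)
 finally have 1: "(LBINT x:circ. (g x * d x - b x * e x) - 2 * (b x * cos (x - s))) = - 2 * pi * b s" .
 have ibc: "L1_on circ (\<lambda>x. b x * cos x)" "L1_on circ (\<lambda>x. b x * sin x)"
  by (intro continuous_set_integrable continuous_intros cb)+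
 \<comment> \<open>The kernel is a Green function only up to a multiple of cos (x - s), the resonant
   mode; orthogonality of \<open>b\<close> to cos and sin removes it.\<close>
 have c: "b x * cos (x - s) = cos s * (b x * cos x) + sin s * (b x * sin x)" for x
  by (simp add: cos_diff algebra_simps)
 have 2: "(LBINT x:circ. (g x * d x - b x * e x) - 2 * (b x * cos (x - s))) = Bbe"
  unfolding c using gd be ibc cos sin by (simp add: set_integral_diff set_integral_add Bbe_def)
 show ?thesis using 1 2 \<open>Bbe = 0\<close> by simp
qed

text \<open>Elimination with a pivot \<open>b0\<close> of the last functional. Both upper bounds use
  it: a family larger than the number of functionals contains a nontrivial combination annihilated
  by all of them, and the analysis then excludes such a combination.\<close>

lemma exists_nontrivial_combination:
 fixes m :: "nat \<Rightarrow> 'a \<Rightarrow> real"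
 assumes "finite B" "n < card B"
 shows "\<exists>a. (\<exists>b\<in>B. a b \<noteq> 0) \<and> (\<forall>j<n. (\<Sum>b\<in>B. a b * m j b) = 0)"
 using assms
proof (induction n arbitrary: B m)
 case 0
 then have "B \<noteq> {}" by auto
 then show ?case by (intro exI[of _ "\<lambda>_. 1"]) auto
next
 case (Suc n)
 show ?case
 proof (cases "\<forall>b\<in>B. m n b = 0")
  case True
  obtain a where "\<exists>b\<in>B. a b \<noteq> 0" "\<forall>j<n. (\<Sum>b\<in>B. a b * m j b) = 0"
   using Suc.IH[of B m] Suc.prems by auto
  moreover have "(\<Sum>b\<in>B. a b * m n b) = 0" using True by simp
  ultimately show ?thesis by (intro exI[of _ a]) (auto simp: less_Suc_eq)
 next
  case False
  then obtain b0 where b0: "b0 \<in> B" "m n b0 \<noteq> 0" by auto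
  define C where "C = B - {b0}"
  have C: "finite C" "n < card C" "B = insert b0 C" "b0 \<notin> C"
   using Suc.prems b0 by (auto simp: C_def)
  obtain a' where a': "\<exists>b\<in>C. a' b \<noteq> 0"
   "\<forall>j<n. (\<Sum>b\<in>C. a' b * (m j b - m n b / m n b0 * m j b0)) = 0"
   using Suc.IH[OF C(1,2), of "\<lambda>j b. m j b - m n b / m n b0 * m j b0"] by auto
  define S where "S = (\<Sum>b\<in>C. a' b * m n b)"
  \<comment> \<open>The pivot coefficient solves the last equation; the modified matrix given to the
    induction hypothesis makes the remaining equations survive this choice.\<close>
  define a where "a b = (if b = b0 then - S / m n b0 else a' b)" for b
  have sum: "(\<Sum>b\<in>B. a b * m j b) = - S / m n b0 * m j b0 + (\<Sum>b\<in>C. a' b * m j b)" for j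
  proof -
   have "(\<Sum>b\<in>C. a b * m j b) = (\<Sum>b\<in>C. a' b * m j b)"
    using C by (intro sum.cong) (auto simp: a_def)
   then show ?thesis using C by (simp add: a_def)
  qed
  have "(\<Sum>b\<in>B. a b * m n b) = 0" unfolding sum using b0 by (simp add: S_def)
  moreover have "(\<Sum>b\<in>B. a b * m j b) = 0" if "j < n" for j
  proof -
   have "0 = (\<Sum>b\<in>C. a' b * (m j b - m n b / m n b0 * m j b0))" using a' that by simp
   also have "\<dots> = (\<Sum>b\<in>C. a' b * m j b) - (\<Sum>b\<in>C. (a' b * m n b) * (m j b0 / m n b0))"
    unfolding sum_subtractf[symmetric] by (intro sum.cong) (auto simp: algebra_simps)
   also have "\<dots> = (\<Sum>b\<in>C. a' b * m j b) - S * (m j b0 / m n b0)"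
    unfolding S_def sum_distrib_right ..
   finally show ?thesis unfolding sum by simp
  qed
  moreover have "\<exists>b\<in>B. a b \<noteq> 0" using a'(1) C by (auto simp: a_def)
  ultimately show ?thesis by (intro exI[of _ a]) (auto simp: less_Suc_eq)
 qed
qed

section \<open>Functions of finite energy on the half-cylinder\<close>

lemma set_fubini:
 fixes f :: "real \<times> real \<Rightarrow> real"
 assumes f: "L1_on (A \<times> B) f"
 shows "AE t\<in>A in lborel. L1_on B (\<lambda>s. f (t, s))"
  and "L1_on A (\<lambda>t. LBINT s:B. f (t, s))"
  and "(LBINT p:A \<times> B. f p) = (LBINT t:A. LBINT s:B. f (t, s))"
  and "AE s\<in>B in lborel. L1_on A (\<lambda>t. f (t, s))"
  and "L1_on B (\<lambda>s. LBINT t:A. f (t, s))"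
  and "(LBINT p:A \<times> B. f p) = (LBINT s:B. LBINT t:A. f (t, s))"
proof -
 define g where "g p = indicator (A \<times> B) p *\<^sub>R f p" for p
 have g: "integrable (lborel \<Otimes>\<^sub>M lborel) g"
  using f unfolding set_integrable_def g_def lborel_prod .
 have geq: "g (t, s) = indicator A t *\<^sub>R (indicator B s *\<^sub>R f (t, s))"
  "g (t, s) = indicator B s *\<^sub>R (indicator A t *\<^sub>R f (t, s))" for t s
  by (simp_all add: g_def indicator_times)
 have g': "integrable (lborel \<Otimes>\<^sub>M lborel) (\<lambda>(t, s). g (t, s))"
  using g by simp
 have pull: "indicator A t *\<^sub>R (LBINT s. indicator B s *\<^sub>R f (t, s)) = (LBINT s. g (t, s))" for t
  unfolding geq by simp
 have pull': "indicator B s *\<^sub>R (LBINT t. indicator A t *\<^sub>R f (t, s)) = (LBINT t. g (t, s))" for s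
  unfolding geq(2) by simp
 show "AE t\<in>A in lborel. L1_on B (\<lambda>s. f (t, s))"
  using lborel_pair.AE_integrable_fst'[OF g]
  by eventually_elim (simp add: geq set_integrable_def, auto simp: indicator_def)
 show "L1_on A (\<lambda>t. LBINT s:B. f (t, s))"
  using lborel_pair.integrable_fst'[OF g]
  unfolding set_integrable_def set_lebesgue_integral_def pull .
 show "(LBINT p:A \<times> B. f p) = (LBINT t:A. LBINT s:B. f (t, s))"
  using lborel_pair.integral_fst'[OF g]
  unfolding set_lebesgue_integral_def pull by (simp add: g_def[abs_def] lborel_prod)
 show "AE s\<in>B in lborel. L1_on A (\<lambda>t. f (t, s))"
  using lborel_pair.AE_integrable_snd[OF g']
  by eventually_elim (simp add: geq(2) set_integrable_def, auto simp: indicator_def)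
 show "L1_on B (\<lambda>s. LBINT t:A. f (t, s))"
  using lborel_pair.integrable_snd[OF g']
  unfolding set_integrable_def set_lebesgue_integral_def pull' .
 show "(LBINT p:A \<times> B. f p) = (LBINT s:B. LBINT t:A. f (t, s))"
  using lborel_pair.integral_snd[OF g']
  unfolding set_lebesgue_integral_def pull' by (simp add: g_def[abs_def] lborel_prod case_prod_unfold)
qed

lemma borel_slice:
 fixes f :: "real \<times> real \<Rightarrow> real"
 assumes "f \<in> borel_fun"
 shows "(\<lambda>s. f (t, s)) \<in> borel_fun" "(\<lambda>s. f (s, t)) \<in> borel_fun"
proof -
 have "(\<lambda>s::real. (t, s)) \<in> borel_fun" "(\<lambda>s::real. (s, t)) \<in> borel_fun"
  by (intro borel_measurable_continuous_onI continuous_intros)+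
 then show "(\<lambda>s. f (t, s)) \<in> borel_fun" "(\<lambda>s. f (s, t)) \<in> borel_fun"
  by (auto intro: measurable_compose[OF _ assms])
qed

lemma borel_slice_integral:
 fixes f :: "real \<times> real \<Rightarrow> real"
 assumes f[measurable]: "f \<in> borel_fun" and A[measurable]: "A \<in> sets borel"
 shows "(\<lambda>s. LBINT t:A. f (t, s)) \<in> borel_fun"
  and "(\<lambda>s. LBINT t:A. f (s, t)) \<in> borel_fun"
proof -
 have 1: "f \<in> borel_measurable (borel \<Otimes>\<^sub>M borel)" by (simp add: borel_prod)
 have 2: "(\<lambda>p. f (snd p, fst p)) \<in> borel_measurable (borel \<Otimes>\<^sub>M borel)"
  by (rule measurable_compose[OF _ 1]) measurable
 have "(\<lambda>s. LBINT t. indicator A t *\<^sub>R f (t, s)) \<in> borel_fun"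
  by (rule lborel.borel_measurable_lebesgue_integral) (use 2 in \<open>simp add: split_beta\<close>)
 then show "(\<lambda>s. LBINT t:A. f (t, s)) \<in> borel_fun"
  by (simp add: set_lebesgue_integral_def)
 have "(\<lambda>s. LBINT t. indicator A t *\<^sub>R f (s, t)) \<in> borel_fun"
  by (rule lborel.borel_measurable_lebesgue_integral) (use 1 in \<open>simp add: split_beta\<close>)
 then show "(\<lambda>s. LBINT t:A. f (s, t)) \<in> borel_fun"
  by (simp add: set_lebesgue_integral_def)
qed

lemma set_integrable_bound_borel:
 fixes f g :: "'a::euclidean_space \<Rightarrow> real"
 assumes "L1_on A f" "g \<in> borel_fun" "A \<in> sets borel"
  "\<And>x. x \<in> A \<Longrightarrow> \<bar>g x\<bar> \<le> f x"
 shows "L1_on A g"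
proof (rule set_integrable_bound[OF assms(1)])
 show "set_borel_measurable lborel A g"
  using assms(2,3) by (simp add: set_borel_measurable_def)
 show "AE x\<in>A in lborel. norm (g x) \<le> norm (f x)"
  using assms(4) by (intro AE_I2) fastforce
qed

lemma set_integrable_mult_L2:
 fixes f g :: "'a::euclidean_space \<Rightarrow> real"
 assumes "L1_on A (\<lambda>x. (f x)^2)" "L1_on A (\<lambda>x. (g x)^2)"
  and [measurable]: "f \<in> borel_fun" "g \<in> borel_fun" "A \<in> sets borel"
 shows "L1_on A (\<lambda>x. f x * g x)"
proof (rule set_integrable_bound_borel)
 show "L1_on A (\<lambda>x. (f x)^2 + (g x)^2)" using assms(1,2) by auto
 fix x
 have "0 \<le> (\<bar>f x\<bar> - \<bar>g x\<bar>)^2" by simp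
 then have "2 * \<bar>f x * g x\<bar> \<le> (f x)^2 + (g x)^2"
  by (simp add: power2_diff abs_mult)
 then show "\<bar>f x * g x\<bar> \<le> (f x)^2 + (g x)^2" by linarith
qed simp_all

lemma set_integrable_bounded_mult:
 fixes f g :: "'a::euclidean_space \<Rightarrow> real"
 assumes "L1_on A f" "\<And>x. x \<in> A \<Longrightarrow> \<bar>g x\<bar> \<le> K"
  and [measurable]: "f \<in> borel_fun" "g \<in> borel_fun" "A \<in> sets borel"
 shows "L1_on A (\<lambda>x. f x * g x)"
proof (rule set_integrable_bound_borel)
 show "L1_on A (\<lambda>x. \<bar>f x\<bar> * K)" using assms(1) by (simp add: set_integrable_abs)
 fix x assume "x \<in> A"
 then show "\<bar>f x * g x\<bar> \<le> \<bar>f x\<bar> * K" using assms(2)[of x] by (simp add: abs_mult mult_left_mono)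
qed simp_all

lemma set_integrable_L1_L2:
 fixes f :: "'a::euclidean_space \<Rightarrow> real"
 assumes "L1_on A (\<lambda>x. (f x)^2)" "f \<in> borel_fun"
  and A: "A \<in> sets borel" "emeasure lborel A < \<infinity>"
 shows "L1_on A f"
proof -
 have "L1_on A (\<lambda>x. f x * 1)"
  by (rule set_integrable_mult_L2) (use assms in \<open>auto simp: set_integrable_def\<close>)
 then show ?thesis by simp
qed

text \<open>The variance of \<open>P\<close> about its average is nonnegative.\<close>

lemma Cauchy_Schwarz_circle:
 fixes P e :: "real \<Rightarrow> real"
 assumes "L1_on circ (\<lambda>s. (P s)^2)" and P[measurable]: "P \<in> borel_fun"
 shows "(LBINT s:circ. P s)^2 \<le> 2 * pi * (LBINT s:circ. (P s)^2)"
proof -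
 have iP: "L1_on circ P" by (rule set_integrable_L1_L2[OF assms]) auto
 define m where "m = (LBINT s:circ. P s)"
 define c where "c = m / (2 * pi)"
 have cst: "(LBINT s:circ. k) = 2 * pi * k" "L1_on circ (\<lambda>_. k)" for k :: real
  by (simp_all add: set_integral_const set_integrable_def)
 have "0 \<le> (LBINT s:circ. (P s - c)^2)"
  by (simp add: set_lebesgue_integral_def)
 also have "(\<lambda>s. (P s - c)^2) = (\<lambda>s. (P s)^2 - 2 * c * P s + c^2)"
  by (simp add: fun_eq_iff power2_diff)
 also have "(LBINT s:circ. (P s)^2 - 2 * c * P s + c^2)
   = (LBINT s:circ. (P s)^2) - 2 * c * m + 2 * pi * c^2"
  using assms(1) iP cst by (simp add: set_integral_add set_integral_diff m_def)
 also have "\<dots> = (LBINT s:circ. (P s)^2) - m^2 / (2 * pi)"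
  by (simp add: c_def power2_eq_square field_simps)
 finally show ?thesis unfolding m_def[symmetric] by (simp add: field_simps)
qed

text \<open>Fubini exchanges the running integral along rays with the integral over the circle.
  Absolute continuity on almost every ray thus yields slice integrability and the integrated
  identity for every t, not just almost every one.\<close>

lemma primitive_slices:
 fixes P R :: "real \<times> real \<Rightarrow> real"
 assumes [measurable]: "P \<in> borel_fun" "R \<in> borel_fun"
  and R: "L1_on (cyl T) R"
  and P0: "L1_on circ (\<lambda>s. P (0, s))"
  and ac: "AE s\<in>circ in lborel. primitive_on 0 T (\<lambda>t. P (t, s)) (\<lambda>t. R (t, s))"
 shows "primitive_on 0 T (\<lambda>t. LBINT s:circ. P (t, s)) (\<lambda>t. LBINT s:circ. R (t, s))"
  and "t \<in> {0..T} \<Longrightarrow> L1_on circ (\<lambda>s. P (t, s))"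
proof -
 note [measurable] = borel_slice borel_slice_integral
 have R': "L1_on ({0..t} \<times> circ) R" if "t \<le> T" for t
  by (rule set_integrable_subset[OF R]) (use that in \<open>auto intro!: borel_closed closed_Times\<close>)
 have ae: "AE s\<in>circ in lborel. P (t, s) = P (0, s) + (LBINT r:{0..t}. R (r, s))"
  if "t \<in> {0..T}" for t
  using ac by eventually_elim (use that in \<open>auto dest: primitive_on_eq\<close>)
 have m: "(\<lambda>s. P (0, s) + (LBINT r:{0..t}. R (r, s))) \<in> borel_measurable lborel"
   "(\<lambda>s. P (t, s)) \<in> borel_measurable lborel" for t
  by (simp_all add: borel_slice borel_slice_integral)
 have int: "L1_on circ (\<lambda>s. P (0, s) + (LBINT r:{0..t}. R (r, s)))"
  if "t \<in> {0..T}" for t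
  using set_fubini(5)[OF R'] P0 that by auto
 show "L1_on circ (\<lambda>s. P (t, s))" if "t \<in> {0..T}" for t
  using set_integrable_cong_AE[OF m(2) m(1) ae[OF that]] int[OF that] by simp
 show "primitive_on 0 T (\<lambda>t. LBINT s:circ. P (t, s)) (\<lambda>t. LBINT s:circ. R (t, s))"
 proof (rule primitive_onI)
  show "L1_on {0..T} (\<lambda>t. LBINT s:circ. R (t, s))"
   by (rule set_fubini(2)[OF R])
  fix t assume t: "0 \<le> t" "t \<le> T"
  have "(LBINT s:circ. P (t, s)) =
   (LBINT s:circ. P (0, s) + (LBINT r:{0..t}. R (r, s)))"
   by (rule set_lebesgue_integral_cong_AE[OF _ m(2) m(1)]) (use ae t in auto)
  also have "\<dots> = (LBINT s:circ. P (0, s)) + (LBINT s:circ. LBINT r:{0..t}. R (r, s))"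
   by (rule set_integral_add(2)[OF P0 set_fubini(5)[OF R'[OF t(2)]]])
  also have "(LBINT s:circ. LBINT r:{0..t}. R (r, s)) =
   (LBINT r:{0..t}. LBINT s:circ. R (r, s))"
   using set_fubini(3,6)[OF R'[OF t(2)]] by simp
  finally show "(LBINT s:circ. P (t, s)) =
   (LBINT s:circ. P (0, s)) + (LBINT r:{0..t}. LBINT s:circ. R (r, s))" .
 qed
qed

text \<open>
 The energy of a face is \<open>\<rho> v\<^sub>t^2 + v\<^sub>\<theta>^2 / \<rho> - V v^2\<close>; \<open>y\<close> is the radial factor of the positive Jacobi field of the
 first angular mode, and \<open>\<kappa> = - \<rho> y' / y\<close>.
\<close>

locale face_weights =
 fixes \<rho> V \<kappa> y :: "real \<Rightarrow> real"
 assumes rho_ge1: "0 \<le> t \<Longrightarrow> 1 \<le> \<rho> t"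
  and rho_cont: "continuous_on UNIV \<rho>" and V_cont: "continuous_on UNIV V"
  and kap_deriv: "0 \<le> t \<Longrightarrow> (\<kappa> has_real_derivative (\<kappa> t)^2 / \<rho> t - 1 / \<rho> t + V t) (at t)"
  and kap_cont: "continuous_on UNIV \<kappa>"
  and kap_le: "0 \<le> t \<Longrightarrow> \<bar>\<kappa> t\<bar> \<le> 1"
  and not_integrable: "\<not> L1_on {0..} (\<lambda>t. 1 / \<rho> t)"
  and y_pos: "0 \<le> t \<Longrightarrow> 0 < y t"
  and y_deriv: "0 \<le> t \<Longrightarrow> (y has_real_derivative - (\<kappa> t / \<rho> t) * y t) (at t)"
begin

text \<open>
 \<open>v\<close> is a representative that is absolutely continuous along almost every ray and equals an absolutely
 continuous periodic function on almost every circle, with partial derivatives \<open>G\<close> and \<open>H\<close> and trace \<open>\<tau>\<close>.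
\<close>

definition strip_data where
 "strip_data v G H \<tau> \<longleftrightarrow>
  v \<in> borel_fun \<and> G \<in> borel_fun \<and> H \<in> borel_fun \<and>
  \<tau> \<in> borel_fun \<and>
  L1_on strip (\<lambda>p. \<rho> (fst p) * (G p)^2) \<and>
  L1_on strip (\<lambda>p. (H p)^2 / \<rho> (fst p)) \<and>
  L1_on strip (\<lambda>p. V (fst p) * (v p)^2) \<and>
  (\<forall>T. L1_on (cyl T) (\<lambda>p. (v p)^2)) \<and>
  L1_on circ (\<lambda>s. (\<tau> s)^2) \<and>
  (AE s\<in>circ in lborel. v (0, s) = \<tau> s \<and> (\<forall>T\<ge>0. primitive_on 0 T (\<lambda>t. v (t, s)) (\<lambda>t. G (t, s)))) \<and>
  (AE t in lborel. 0 \<le> t \<longrightarrow> (\<exists>b. primitive_on 0 (2 * pi) b (\<lambda>s. H (t, s)) \<and> b (2 * pi) = b 0 \<and>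
   (AE s\<in>circ in lborel. v (t, s) = b s)))"

definition energy_density where
 "energy_density v G H p = \<rho> (fst p) * (G p)^2 + (H p)^2 / \<rho> (fst p) - V (fst p) * (v p)^2"

text \<open>By the Riccati equation \<open>kap_deriv\<close> this differs from
  \<open>energy_density\<close> by the t-derivative of \<open>\<kappa> v^2\<close>. The first square
  vanishes on multiples of \<open>y\<close>; the second term, integrated over a circle, has a sign
  by Wirtinger once the circle mean is zero.\<close>

definition square_density where
 "square_density v G H p = \<rho> (fst p) * (G p + \<kappa> (fst p) / \<rho> (fst p) * v p)^2 + ((H p)^2 - (v p)^2) / \<rho> (fst p)"

lemma rho_pos: "0 \<le> t \<Longrightarrow> 0 < \<rho> t" using rho_ge1[of t] by linarith

lemma weights_measurable:
 "\<rho> \<in> borel_fun" "V \<in> borel_fun" "\<kappa> \<in> borel_fun"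
 by (rule borel_measurable_continuous_onI, fact rho_cont V_cont kap_cont)+

lemma weights_fst_measurable:
 "(\<lambda>p::real \<times> real. \<rho> (fst p)) \<in> borel_fun"
 "(\<lambda>p::real \<times> real. V (fst p)) \<in> borel_fun"
 "(\<lambda>p::real \<times> real. \<kappa> (fst p)) \<in> borel_fun"
proof -
 have "(fst :: real \<times> real \<Rightarrow> real) \<in> borel_fun"
  by (intro borel_measurable_continuous_onI continuous_intros)
 then show "(\<lambda>p::real \<times> real. \<rho> (fst p)) \<in> borel_fun"
  "(\<lambda>p::real \<times> real. V (fst p)) \<in> borel_fun"
  "(\<lambda>p::real \<times> real. \<kappa> (fst p)) \<in> borel_fun"
  using weights_measurable by (auto intro: measurable_compose)
qed

end

text \<open>An unnormalised Fourier coefficient. With \<open>e = 1\<close> it is the integral over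
  the circle rather than the average, which is the source of the factors 2 pi in the estimates
  below.\<close>

definition cmean :: "(real \<times> real \<Rightarrow> real) \<Rightarrow> (real \<Rightarrow> real) \<Rightarrow> real \<Rightarrow> real" where
 "cmean w e t = (LBINT s:circ. w (t, s) * e s)"

abbreviation "mean w \<equiv> cmean w (\<lambda>_. 1)"

lemma set_integral_nonneg_real:
 fixes f :: "'a::euclidean_space \<Rightarrow> real"
 assumes "\<And>x. x \<in> A \<Longrightarrow> 0 \<le> f x"
 shows "0 \<le> (LBINT x:A. f x)"
 unfolding set_lebesgue_integral_def
 by (intro integral_nonneg_AE AE_I2) (use assms in \<open>auto simp: indicator_def\<close>)

lemma sets_cyl[measurable, simp]: "{0..T::real} \<times> circ \<in> sets borel" "strip \<in> sets borel"
 by (auto intro!: borel_closed closed_Times)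

lemma emeasure_cyl: "emeasure lborel ({0..T::real} \<times> circ) < \<infinity>"
proof -
 have "compact ({0..T::real} \<times> circ)" by (intro compact_Times) auto
 then show ?thesis using emeasure_compact_finite by blast
qed

section \<open>Representatives of finite energy on one face\<close>

locale face_function = face_weights +
 fixes v G H :: "real \<times> real \<Rightarrow> real" and \<tau> :: "real \<Rightarrow> real"
 assumes data: "strip_data v G H \<tau>"
begin

lemma meas[measurable]:
 "v \<in> borel_fun" "G \<in> borel_fun" "H \<in> borel_fun"
 "\<tau> \<in> borel_fun"
 using data unfolding strip_data_def by - (elim conjE, (assumption | erule spec))+

lemma v2: "L1_on (cyl T) (\<lambda>p. (v p)^2)"
 and tau2: "L1_on circ (\<lambda>s. (\<tau> s)^2)"
 and rG2: "L1_on strip (\<lambda>p. \<rho> (fst p) * (G p)^2)"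
 and rH2: "L1_on strip (\<lambda>p. (H p)^2 / \<rho> (fst p))"
 and Vv2: "L1_on strip (\<lambda>p. V (fst p) * (v p)^2)"
 using data unfolding strip_data_def by - (elim conjE, (assumption | erule spec))+

lemma v_primitive:
 "AE s\<in>circ in lborel. v (0, s) = \<tau> s \<and> (\<forall>T\<ge>0. primitive_on 0 T (\<lambda>t. v (t, s)) (\<lambda>t. G (t, s)))"
 and v_angular: "AE t in lborel. 0 \<le> t \<longrightarrow> (\<exists>b. primitive_on 0 (2 * pi) b (\<lambda>s. H (t, s)) \<and> b (2 * pi) = b 0 \<and>
   (AE s\<in>circ in lborel. v (t, s) = b s))"
 using data unfolding strip_data_def by - (elim conjE, assumption)+

lemma rho_fst_bound: "\<exists>K. \<forall>t\<in>{0..T}. \<bar>\<rho> t\<bar> \<le> K"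
 and kap_bound: "\<exists>K. \<forall>t\<in>{0..T}. \<bar>\<kappa> t\<bar> \<le> K"
proof -
 have "bounded (\<rho> ` {0..T})" "bounded (\<kappa> ` {0..T})"
  using rho_cont kap_cont by (intro compact_imp_bounded compact_continuous_image; auto intro: continuous_on_subset)+
 then show "\<exists>K. \<forall>t\<in>{0..T}. \<bar>\<rho> t\<bar> \<le> K" "\<exists>K. \<forall>t\<in>{0..T}. \<bar>\<kappa> t\<bar> \<le> K"
  by (auto simp: bounded_iff)
qed

lemma G2: "L1_on (cyl T) (\<lambda>p. (G p)^2)"
proof (rule set_integrable_bound_borel)
 show "L1_on (cyl T) (\<lambda>p. \<rho> (fst p) * (G p)^2)"
  by (rule set_integrable_subset[OF rG2]) auto
 fix x assume "x \<in> cyl T"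
 then show "\<bar>(G x)^2\<bar> \<le> \<rho> (fst x) * (G x)^2"
  using rho_ge1[of "fst x"] by (auto simp: mult_le_cancel_right1)
qed auto

lemma H2: "L1_on (cyl T) (\<lambda>p. (H p)^2)"
proof -
 obtain K where K: "\<forall>t\<in>{0..T}. \<bar>\<rho> t\<bar> \<le> K" using rho_fst_bound by blast
 show ?thesis
 proof (rule set_integrable_bound_borel)
  show "L1_on (cyl T) (\<lambda>p. K * ((H p)^2 / \<rho> (fst p)))"
   by (intro set_integrable_mult_right set_integrable_subset[OF rH2]) auto
  fix x assume x: "x \<in> cyl T"
  then have "\<rho> (fst x) > 0" "\<rho> (fst x) \<le> K" using rho_pos[of "fst x"] K by (auto simp: abs_le_iff)
  then have "\<rho> (fst x) * (H x)^2 \<le> K * (H x)^2" by (intro mult_right_mono) auto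
  then show "\<bar>(H x)^2\<bar> \<le> K * ((H x)^2 / \<rho> (fst x))"
   using \<open>\<rho> (fst x) > 0\<close> by (simp add: field_simps)
 qed auto
qed

lemma vG: "L1_on (cyl T) (\<lambda>p. v p * G p)"
 by (rule set_integrable_mult_L2[OF v2 G2]) auto

lemma G_L1: "L1_on (cyl T) G"
 using set_integrable_L1_L2[OF G2 _ _ emeasure_cyl] by simp

lemma tau_L1: "L1_on circ \<tau>"
 by (rule set_integrable_L1_L2[OF tau2]) auto

lemma continuous_circle_bounded:
 assumes "continuous_on UNIV (e :: real \<Rightarrow> real)"
 obtains K where "\<And>s. s \<in> circ \<Longrightarrow> \<bar>e s\<bar> \<le> K"
proof -
 have "bounded (e ` circ)"
  using assms by (intro compact_imp_bounded compact_continuous_image) (auto intro: continuous_on_subset)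
 then show ?thesis using that unfolding bounded_iff by (metis imageI real_norm_def)
qed

lemma cmean_primitive:
 assumes e: "continuous_on UNIV e" and T: "0 \<le> T"
 shows "primitive_on 0 T (cmean v e) (cmean G e)"
  and "L1_on circ (\<lambda>s. v (T, s) * e s)"
  and "cmean v e 0 = (LBINT s:circ. \<tau> s * e s)"
proof -
 have [measurable]: "e \<in> borel_fun" using e by (rule borel_measurable_continuous_onI)
 have [measurable]: "(\<lambda>p::real\<times>real. e (snd p)) \<in> borel_fun"
  using e by (intro borel_measurable_continuous_onI continuous_on_compose2[OF e] continuous_intros) auto
 obtain K where K: "\<And>s. s \<in> circ \<Longrightarrow> \<bar>e s\<bar> \<le> K" using continuous_circle_bounded[OF e] by blast
 have 1: "L1_on (cyl T) (\<lambda>p. G p * e (snd p))"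
  by (rule set_integrable_bounded_mult[OF G_L1, of _ "\<lambda>p. e (snd p)" K]) (use K in auto)
 have 2: "L1_on circ (\<lambda>s. \<tau> s * e s)"
  by (rule set_integrable_bounded_mult[OF tau_L1 K]) auto
 have ae: "AE s\<in>circ in lborel. v (0, s) * e s = \<tau> s * e s"
  using v_primitive by eventually_elim auto
 have m: "(\<lambda>s. v (0, s) * e s) \<in> borel_measurable lborel" "(\<lambda>s. \<tau> s * e s) \<in> borel_measurable lborel"
  using borel_slice(1)[OF meas(1)] by auto
 have 3: "L1_on circ (\<lambda>s. v (0, s) * e s)"
  using set_integrable_cong_AE[OF m ae] 2 by simp
 have 4: "AE s\<in>circ in lborel. primitive_on 0 T (\<lambda>t. v (t, s) * e s) (\<lambda>t. G (t, s) * e s)"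
  using v_primitive
 proof eventually_elim
  case (elim s)
  then show ?case using primitive_on_cmult[of 0 T "\<lambda>t. v (t, s)" "\<lambda>t. G (t, s)" "e s"] T
   by (auto simp: mult.commute)
 qed
 note P = primitive_slices[of "\<lambda>p. v p * e (snd p)" "\<lambda>p. G p * e (snd p)" T]
 show "primitive_on 0 T (cmean v e) (cmean G e)"
  using P(1)[OF _ _ 1] 3 4 unfolding cmean_def[abs_def] by simp
 show "L1_on circ (\<lambda>s. v (T, s) * e s)"
  using P(2)[OF _ _ 1, of T] 3 4 T by simp
 show "cmean v e 0 = (LBINT s:circ. \<tau> s * e s)"
  unfolding cmean_def by (rule set_lebesgue_integral_cong_AE[OF _ m]) (use ae in auto)
qed

definition sq_mean where "sq_mean t = (LBINT s:circ. (v (t, s))^2)"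

lemma sq_mean_primitive:
 assumes T: "0 \<le> T"
 shows "primitive_on 0 T sq_mean (\<lambda>t. LBINT s:circ. 2 * v (t, s) * G (t, s))"
  and "L1_on circ (\<lambda>s. (v (T, s))^2)"
  and "sq_mean 0 = (LBINT s:circ. (\<tau> s)^2)"
proof -
 have 1: "L1_on (cyl T) (\<lambda>p. 2 * v p * G p)"
  using vG[of T] by (simp add: mult.assoc)
 have ae: "AE s\<in>circ in lborel. (v (0, s))^2 = (\<tau> s)^2"
  using v_primitive by eventually_elim auto
 have m: "(\<lambda>s. (v (0, s))^2) \<in> borel_measurable lborel" "(\<lambda>s. (\<tau> s)^2) \<in> borel_measurable lborel"
  using borel_slice(1)[OF meas(1)] by auto
 have 3: "L1_on circ (\<lambda>s. (v (0, s))^2)"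
  using set_integrable_cong_AE[OF m ae] tau2 by simp
 have 4: "AE s\<in>circ in lborel. primitive_on 0 T (\<lambda>t. (v (t, s))^2) (\<lambda>t. 2 * v (t, s) * G (t, s))"
  using v_primitive
 proof eventually_elim
  case (elim s)
  then show ?case using primitive_on_mult[of 0 T "\<lambda>t. v (t, s)" "\<lambda>t. G (t, s)" "\<lambda>t. v (t, s)" "\<lambda>t. G (t, s)"] T
   by (auto simp: power2_eq_square algebra_simps)
 qed
 note P = primitive_slices[of "\<lambda>p. (v p)^2" "\<lambda>p. 2 * v p * G p" T]
 show "primitive_on 0 T sq_mean (\<lambda>t. LBINT s:circ. 2 * v (t, s) * G (t, s))"
  using P(1)[OF _ _ 1] 3 4 unfolding sq_mean_def[abs_def] by simp
 show "L1_on circ (\<lambda>s. (v (T, s))^2)"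
  using P(2)[OF _ _ 1, of T] 3 4 T by simp
 show "sq_mean 0 = (LBINT s:circ. (\<tau> s)^2)"
  unfolding sq_mean_def by (rule set_lebesgue_integral_cong_AE[OF _ m]) (use ae in auto)
qed

end

lemma set_integral_eq_AE:
 fixes f g :: "'a::euclidean_space \<Rightarrow> real"
 assumes f: "L1_on A f" and g: "g \<in> borel_fun" and A: "A \<in> sets borel"
  and ae: "AE x\<in>A in lborel. g x = f x"
 shows "L1_on A g" "(LBINT x:A. g x) = (LBINT x:A. f x)"
proof -
 have fm: "(\<lambda>x. indicator A x *\<^sub>R f x) \<in> borel_measurable lborel"
  using f by (auto simp: set_integrable_def)
 have gm: "(\<lambda>x. indicator A x *\<^sub>R g x) \<in> borel_measurable lborel" using g A by simp
 have ae': "AE x in lborel. indicator A x *\<^sub>R g x = indicator A x *\<^sub>R f x"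
  using ae by eventually_elim (auto simp: indicator_def)
 show "L1_on A g"
  using f integrable_cong_AE[OF gm fm ae'] by (simp add: set_integrable_def)
 show "(LBINT x:A. g x) = (LBINT x:A. f x)"
  using integral_cong_AE[OF gm fm ae'] by (simp add: set_lebesgue_integral_def)
qed

lemma AE_nonneg_from_nat:
 assumes "\<And>n::nat. AE t\<in>{0..real n} in lborel. P t"
 shows "AE t in lborel. 0 \<le> t \<longrightarrow> P t"
proof -
 have "AE t in lborel. \<forall>n::nat. t \<in> {0..real n} \<longrightarrow> P t"
  unfolding AE_all_countable using assms by blast
 then show ?thesis
  by eventually_elim (meson atLeastAtMost_iff real_arch_simple)
qed

lemma set_integral_nonneg_zero_AE:
 fixes f :: "'a::euclidean_space \<Rightarrow> real"
 assumes "L1_on A f" "AE x\<in>A in lborel. 0 \<le> f x" "(LBINT x:A. f x) = 0"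
 shows "AE x\<in>A in lborel. f x = 0"
proof -
 have "AE x in lborel. indicator A x *\<^sub>R f x = 0"
  using assms integral_nonneg_eq_0_iff_AE[of lborel "\<lambda>x. indicator A x *\<^sub>R f x"]
  by (auto simp: set_integrable_def set_lebesgue_integral_def indicator_def)
 then show ?thesis by eventually_elim (auto simp: indicator_def)
qed

section \<open>Angular inequalities and completion of the square\<close>

context face_function
begin

lemma H2_slice: "AE t in lborel. 0 \<le> t \<longrightarrow> L1_on circ (\<lambda>s. (H (t, s))^2)"
 by (rule AE_nonneg_from_nat) (rule set_fubini(1)[OF H2])

lemma G2_slice: "AE t in lborel. 0 \<le> t \<longrightarrow> L1_on circ (\<lambda>s. (G (t, s))^2)"
 by (rule AE_nonneg_from_nat) (rule set_fubini(1)[OF G2])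

lemmas slice_meas = borel_slice[OF meas(1)] borel_slice[OF meas(2)] borel_slice[OF meas(3)]

text \<open>The representative \<open>v\<close> is continuous along almost every ray, not along
  circles; on a circle it only agrees almost everywhere with the periodic function \<open>b\<close>,
  and the transfer happens under the integral.\<close>

lemma slice_transfer:
 assumes b: "primitive_on 0 (2 * pi) b h" and ae: "AE s\<in>circ in lborel. v (t, s) = b s"
  and F: "continuous_on UNIV (\<lambda>p. F (fst p) (snd p) :: real)"
 shows "(LBINT s:circ. F s (v (t, s))) = (LBINT s:circ. F s (b s))"
proof (rule set_integral_eq_AE(2))
 have "continuous_on circ (\<lambda>s. F (fst (s, b s)) (snd (s, b s)))"
  by (rule continuous_on_compose2[OF F]) (auto intro!: continuous_intros primitive_on_continuous[OF b])
 then show "L1_on circ (\<lambda>s. F s (b s))"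
  by (intro continuous_set_integrable) simp
 have "(\<lambda>p. F (fst p) (snd p)) \<in> borel_measurable (borel \<Otimes>\<^sub>M borel)"
  using borel_measurable_continuous_onI[OF F] by (simp add: borel_prod)
 moreover have "(\<lambda>s. (s, v (t, s))) \<in> borel \<rightarrow>\<^sub>M borel \<Otimes>\<^sub>M borel"
  using slice_meas by measurable
 ultimately have "(\<lambda>s. F (fst (s, v (t, s))) (snd (s, v (t, s)))) \<in> borel_fun"
  by (rule measurable_compose[rotated])
 then show "(\<lambda>s. F s (v (t, s))) \<in> borel_fun" by simp
 show "AE s\<in>circ in lborel. F s (v (t, s)) = F s (b s)"
  using ae by eventually_elim auto
qed simp

lemma angular_wirtinger:
 "AE t in lborel. 0 \<le> t \<longrightarrow> sq_mean t \<le> (LBINT s:circ. (H (t, s))^2)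
   + (mean v t)^2 / (2 * pi)"
 using H2_slice v_angular
proof (eventually_elim, intro impI)
 fix t :: real
 assume H: "0 \<le> t \<longrightarrow> L1_on circ (\<lambda>s. (H (t, s))^2)"
  and ex: "0 \<le> t \<longrightarrow> (\<exists>b. primitive_on 0 (2 * pi) b (\<lambda>s. H (t, s)) \<and> b (2 * pi) = b 0 \<and>
   (AE s\<in>circ in lborel. v (t, s) = b s))" and t: "0 \<le> t"
 from ex t obtain b where b: "primitive_on 0 (2 * pi) b (\<lambda>s. H (t, s))" "b (2 * pi) = b 0"
   "AE s\<in>circ in lborel. v (t, s) = b s" by blast
 have H': "L1_on circ (\<lambda>s. (H (t, s))^2)" using H t by simp
 have "sq_mean t = (LBINT s:circ. (b s)^2)"
  unfolding sq_mean_def by (rule slice_transfer[OF b(1,3)]) (intro continuous_intros)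
 moreover have "mean v t = (LBINT s:circ. b s)"
  using slice_transfer[OF b(1,3), of "\<lambda>s x. x"]
  by (simp add: cmean_def continuous_on_snd continuous_on_id)
 ultimately show "sq_mean t \<le> (LBINT s:circ. (H (t, s))^2)
   + (mean v t)^2 / (2 * pi)"
  using wirtinger[OF b(1,2) H'] by simp
qed

lemma angular_rigidity:
 "AE t in lborel. 0 \<le> t \<longrightarrow> mean v t = 0 \<longrightarrow> cmean v cos t = 0 \<longrightarrow>
  cmean v sin t = 0 \<longrightarrow> (LBINT s:circ. (H (t, s))^2) \<le> sq_mean t \<longrightarrow> sq_mean t = 0"
 using H2_slice v_angular
proof (eventually_elim, intro impI)
 fix t :: real
 assume H: "0 \<le> t \<longrightarrow> L1_on circ (\<lambda>s. (H (t, s))^2)"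
  and ex: "0 \<le> t \<longrightarrow> (\<exists>b. primitive_on 0 (2 * pi) b (\<lambda>s. H (t, s)) \<and> b (2 * pi) = b 0 \<and>
   (AE s\<in>circ in lborel. v (t, s) = b s))" and t: "0 \<le> t"
  and z: "mean v t = 0" "cmean v cos t = 0" "cmean v sin t = 0"
  and le: "(LBINT s:circ. (H (t, s))^2) \<le> sq_mean t"
 from ex t obtain b where b: "primitive_on 0 (2 * pi) b (\<lambda>s. H (t, s))" "b (2 * pi) = b 0"
   "AE s\<in>circ in lborel. v (t, s) = b s" by blast
 have H': "L1_on circ (\<lambda>s. (H (t, s))^2)" using H t by simp
 have 1: "sq_mean t = (LBINT s:circ. (b s)^2)"
  unfolding sq_mean_def by (rule slice_transfer[OF b(1,3)]) (intro continuous_intros)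
 have 2: "mean v t = (LBINT s:circ. b s)"
  using slice_transfer[OF b(1,3), of "\<lambda>s x. x"]
  by (simp add: cmean_def continuous_on_snd continuous_on_id)
 have 3: "cmean v cos t = (LBINT s:circ. b s * cos s)"
  unfolding cmean_def by (rule slice_transfer[OF b(1,3)]) (intro continuous_intros)
 have 4: "cmean v sin t = (LBINT s:circ. b s * sin s)"
  unfolding cmean_def by (rule slice_transfer[OF b(1,3)]) (intro continuous_intros)
 have b0: "b s = 0" if "0 \<le> s" "s \<le> 2 * pi" for s
  by (rule wirtinger_rigidity[OF b(1,2) H' _ _ _ _ that]) (use 1 2 3 4 z le in auto)
 have "(LBINT s:circ. (b s)^2) = (LBINT s:circ. 0)"
  by (rule set_lebesgue_integral_cong) (use b0 in auto)
 then show "sq_mean t = 0" using 1 by simp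
qed

text \<open>The circle has no boundary: both \<open>b\<close> and \<open>e\<close> are periodic, so
  the integral of the derivative of b e vanishes.\<close>

lemma angular_by_parts:
 assumes e: "\<And>s. (e has_real_derivative e' s) (at s)" "continuous_on UNIV e'" "e (2 * pi) = e 0"
 shows "AE t in lborel. 0 \<le> t \<longrightarrow> cmean H e t = - cmean v e' t"
 using v_angular
proof (eventually_elim, intro impI)
 fix t :: real
 assume ex: "0 \<le> t \<longrightarrow> (\<exists>b. primitive_on 0 (2 * pi) b (\<lambda>s. H (t, s)) \<and> b (2 * pi) = b 0 \<and>
   (AE s\<in>circ in lborel. v (t, s) = b s))" and t: "0 \<le> t"
 from ex t obtain b where b: "primitive_on 0 (2 * pi) b (\<lambda>s. H (t, s))" "b (2 * pi) = b 0"
   "AE s\<in>circ in lborel. v (t, s) = b s" by blast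
 have ce: "continuous_on UNIV e"
  by (intro continuous_at_imp_continuous_on ballI DERIV_isCont[OF e(1)])
 have pe: "primitive_on 0 (2 * pi) e e'"
  by (rule primitive_on_at_deriv) (use e in \<open>auto intro: continuous_on_subset\<close>)
 have P: "primitive_on 0 (2 * pi) (\<lambda>s. b s * e s) (\<lambda>s. b s * e' s + H (t, s) * e s)"
  by (rule primitive_on_mult[OF b(1) pe])
 have i: "L1_on circ (\<lambda>s. b s * e' s)" "L1_on circ (\<lambda>s. H (t, s) * e s)"
  by (intro continuous_set_integrable continuous_intros primitive_on_continuous[OF b(1)]
     continuous_on_subset[OF e(2)] subset_UNIV)
    (intro set_integrable_mult_continuous continuous_on_subset[OF ce] primitive_on_integrable[OF b(1)] subset_UNIV)
 have "0 = (LBINT s:circ. b s * e' s + H (t, s) * e s)"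
  using primitive_on_eq[OF P, of "2 * pi"] b(2) e(3) by simp
 also have "\<dots> = (LBINT s:circ. b s * e' s) + cmean H e t"
  using i by (simp add: set_integral_add cmean_def)
 also have "(LBINT s:circ. b s * e' s) = cmean v e' t"
  unfolding cmean_def
  by (rule slice_transfer[OF b(1,3), symmetric])
   (intro continuous_intros continuous_on_compose2[OF e(2)] subset_UNIV)
 finally show "cmean H e t = - cmean v e' t" by simp
qed

abbreviation "f1 \<equiv> mean v"
abbreviation "g1 \<equiv> mean G"

definition "kap' t = (\<kappa> t)^2 / \<rho> t - 1 / \<rho> t + V t"

lemma kap'_cont: "continuous_on {0..T} kap'"
 unfolding kap'_def[abs_def]
 by (intro continuous_intros continuous_on_subset[OF kap_cont] continuous_on_subset[OF rho_cont]
   continuous_on_subset[OF V_cont]) (use rho_pos in force)+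

lemma kap_primitive: "primitive_on 0 T \<kappa> kap'"
 by (rule primitive_on_at_deriv[OF _ kap'_cont]) (use kap_deriv in \<open>auto simp: kap'_def\<close>)

lemmas [measurable] = weights_measurable weights_fst_measurable

lemma energy_density_integrable:
 "L1_on strip (energy_density v G H)"
 "L1_on (cyl T) (energy_density v G H)"
proof -
 show 1: "L1_on strip (energy_density v G H)"
  unfolding energy_density_def[abs_def] using rG2 rH2 Vv2 by auto
 show "L1_on (cyl T) (energy_density v G H)"
  by (rule set_integrable_subset[OF 1]) auto
qed

lemma sum_of_squares:
 assumes T: "0 \<le> T"
 shows "L1_on (cyl T) (square_density v G H)"
  and "(LBINT p:cyl T. square_density v G H p) =
   (LBINT p:cyl T. energy_density v G H p) + \<kappa> T * sq_mean T - \<kappa> 0 * sq_mean 0"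
proof -
 let ?C = "cyl T"
 have kb: "\<exists>K. \<forall>t\<in>{0..T}. \<bar>kap' t\<bar> \<le> K"
 proof -
  have "bounded (kap' ` {0..T})"
   by (intro compact_imp_bounded compact_continuous_image kap'_cont) auto
  then show ?thesis by (auto simp: bounded_iff)
 qed
 then obtain K' where K': "\<forall>t\<in>{0..T}. \<bar>kap' t\<bar> \<le> K'" by blast
 obtain K where K: "\<forall>t\<in>{0..T}. \<bar>\<kappa> t\<bar> \<le> K" using kap_bound by blast
 have m: "(\<lambda>p::real \<times> real. kap' (fst p)) \<in> borel_fun"
  unfolding kap'_def by measurable
 have 1: "L1_on ?C (\<lambda>p. 2 * v p * G p * \<kappa> (fst p))"
  by (rule set_integrable_bounded_mult[of _ _ _ K]) (use K vG[of T] in \<open>auto simp: mult.assoc\<close>)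
 have 2: "L1_on ?C (\<lambda>p. (v p)^2 * kap' (fst p))"
  by (rule set_integrable_bounded_mult[OF v2, of _ _ K']) (use K' m in auto)
 have eq: "square_density v G H p = energy_density v G H p + (2 * v p * G p * \<kappa> (fst p) + (v p)^2 * kap' (fst p))"
  if "p \<in> ?C" for p
 proof -
  have "\<rho> (fst p) > 0" using that rho_pos by (auto simp: mem_Times_iff)
  then show ?thesis
   by (simp add: square_density_def energy_density_def kap'_def power2_eq_square field_simps)
 qed
 have 3: "L1_on ?C (\<lambda>p. energy_density v G H p + (2 * v p * G p * \<kappa> (fst p) + (v p)^2 * kap' (fst p)))"
  by (intro set_integral_add(1) energy_density_integrable 1 2)
 show "L1_on ?C (square_density v G H)"
  using 3 eq by (subst set_integrable_cong[OF refl refl]) auto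
 have "(LBINT p:?C. square_density v G H p) =
   (LBINT p:?C. energy_density v G H p + (2 * v p * G p * \<kappa> (fst p) + (v p)^2 * kap' (fst p)))"
  by (rule set_lebesgue_integral_cong) (use eq in auto)
 also have "\<dots> = (LBINT p:?C. energy_density v G H p) + ((LBINT p:?C. 2 * v p * G p * \<kappa> (fst p))
   + (LBINT p:?C. (v p)^2 * kap' (fst p)))"
  using energy_density_integrable(2) 1 2 by (simp add: set_integral_add)
 also have "(LBINT p:?C. 2 * v p * G p * \<kappa> (fst p)) + (LBINT p:?C. (v p)^2 * kap' (fst p)) =
  (LBINT t:{0..T}. \<kappa> t * (LBINT s:circ. 2 * v (t, s) * G (t, s)) + kap' t * sq_mean t)"
  using set_fubini(2)[OF 1] set_fubini(2)[OF 2]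
  unfolding set_fubini(3)[OF 1] set_fubini(3)[OF 2] sq_mean_def fst_conv set_integral_mult_left
  by (subst set_integral_add(2)) (simp_all add: mult.commute[of "\<kappa> _"] mult.commute[of "kap' _"])
 \<comment> \<open>The one-dimensional integrand is the derivative of \<open>\<kappa>\<close> times
   \<open>sq_mean\<close>.\<close>
 also have "\<dots> = \<kappa> T * sq_mean T - \<kappa> 0 * sq_mean 0"
  using primitive_on_eq[OF primitive_on_mult[OF kap_primitive sq_mean_primitive(1)[OF T]], of T] T by simp
 finally show "(LBINT p:?C. square_density v G H p) =
  (LBINT p:?C. energy_density v G H p) + \<kappa> T * sq_mean T - \<kappa> 0 * sq_mean 0"
  by simp
qed

lemma cmean_sq_bound:
 assumes e: "continuous_on UNIV e"
 shows "\<exists>K. AE t in lborel. 0 \<le> t \<longrightarrow> (cmean G e t)^2 \<le> K * (LBINT s:circ. (G (t, s))^2)"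
proof -
 obtain K where K: "\<And>s. s \<in> circ \<Longrightarrow> \<bar>e s\<bar> \<le> K" using continuous_circle_bounded[OF e] by blast
 have em: "e \<in> borel_fun" using e by (rule borel_measurable_continuous_onI)
 have "AE t in lborel. 0 \<le> t \<longrightarrow> (cmean G e t)^2 \<le> (2 * pi * K^2) * (LBINT s:circ. (G (t, s))^2)"
  using G2_slice
 proof (eventually_elim, intro impI)
  fix t :: real assume "0 \<le> t \<longrightarrow> L1_on circ (\<lambda>s. (G (t, s))^2)" "0 \<le> t"
  then have i: "L1_on circ (\<lambda>s. (G (t, s))^2)" by simp
  have b: "(G (t, s) * e s)^2 \<le> K^2 * (G (t, s))^2" if "s \<in> circ" for s
  proof -
   have "(e s)^2 \<le> K^2" using K[OF that] by (simp add: abs_le_square_iff[symmetric])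
   then show ?thesis by (simp add: power_mult_distrib mult.commute mult_right_mono)
  qed
  have i2: "L1_on circ (\<lambda>s. (G (t, s) * e s)^2)"
   by (rule set_integrable_bound_borel[of _ "\<lambda>s. K^2 * (G (t, s))^2"])
    (use i b slice_meas em in auto)
  have "(cmean G e t)^2 \<le> 2 * pi * (LBINT s:circ. (G (t, s) * e s)^2)"
   unfolding cmean_def by (rule Cauchy_Schwarz_circle[OF i2]) (use slice_meas em in auto)
  also have "(LBINT s:circ. (G (t, s) * e s)^2) \<le> (LBINT s:circ. K^2 * (G (t, s))^2)"
   by (rule set_integral_mono[OF i2]) (use i b in auto)
  finally show "(cmean G e t)^2 \<le> (2 * pi * K^2) * (LBINT s:circ. (G (t, s))^2)"
   by simp
 qed
 then show ?thesis by blast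
qed

lemma cmean_meas:
 "continuous_on UNIV e \<Longrightarrow> cmean v e \<in> borel_fun"
 "continuous_on UNIV e \<Longrightarrow> cmean G e \<in> borel_fun"
 "continuous_on UNIV e \<Longrightarrow> cmean H e \<in> borel_fun"
proof -
 assume e: "continuous_on UNIV e"
 have [measurable]: "(\<lambda>p::real\<times>real. e (snd p)) \<in> borel_fun"
  using e by (intro borel_measurable_continuous_onI continuous_on_compose2[OF e] continuous_intros) auto
 have "(\<lambda>p. v p * e (snd p)) \<in> borel_fun" "(\<lambda>p. G p * e (snd p)) \<in> borel_fun"
  "(\<lambda>p. H p * e (snd p)) \<in> borel_fun" by measurable
 then show "cmean v e \<in> borel_fun" "cmean G e \<in> borel_fun"
  "cmean H e \<in> borel_fun"
  unfolding cmean_def[abs_def]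
  using borel_slice_integral(2)[of "\<lambda>p. v p * e (snd p)" "circ"]
   borel_slice_integral(2)[of "\<lambda>p. G p * e (snd p)" "circ"]
   borel_slice_integral(2)[of "\<lambda>p. H p * e (snd p)" "circ"] by simp_all
qed

lemma rho_mean_sq_integrable:
 assumes e: "continuous_on UNIV e"
 shows "L1_on {0..} (\<lambda>t. \<rho> t * (cmean G e t)^2)"
proof -
 obtain K where K: "AE t in lborel. 0 \<le> t \<longrightarrow> (cmean G e t)^2 \<le> K * (LBINT s:circ. (G (t, s))^2)"
  using cmean_sq_bound[OF e] by blast
 note [measurable] = cmean_meas[OF e]
 show ?thesis
 proof (rule set_integrable_bound)
  show "L1_on {0..} (\<lambda>t. K * (LBINT s:circ. \<rho> t * (G (t, s))^2))"
   using set_fubini(2)[OF rG2] by (intro set_integrable_mult_right) simp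
  show "set_borel_measurable lborel {0..} (\<lambda>t. \<rho> t * (cmean G e t)^2)"
   unfolding set_borel_measurable_def by measurable
  show "AE t\<in>{0..} in lborel. norm (\<rho> t * (cmean G e t)^2) \<le>
   norm (K * (LBINT s:circ. \<rho> t * (G (t, s))^2))"
   using K
  proof (eventually_elim, intro impI)
   fix t :: real assume a: "0 \<le> t \<longrightarrow> (cmean G e t)^2 \<le> K * (LBINT s:circ. (G (t, s))^2)"
    and "t \<in> {0..}"
   then have "\<rho> t * (cmean G e t)^2 \<le> \<rho> t * (K * (LBINT s:circ. (G (t, s))^2))" "0 < \<rho> t"
    using rho_pos[of t] by (auto intro: mult_left_mono)
   moreover have "\<rho> t * (K * (LBINT s:circ. (G (t, s))^2)) = K * (LBINT s:circ. \<rho> t * (G (t, s))^2)"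
    by simp
   ultimately have "\<rho> t * (cmean G e t)^2 \<le> K * (LBINT s:circ. \<rho> t * (G (t, s))^2)"
    "0 \<le> \<rho> t * (cmean G e t)^2" by simp_all
   then show "norm (\<rho> t * (cmean G e t)^2) \<le> norm (K * (LBINT s:circ. \<rho> t * (G (t, s))^2))"
    unfolding real_norm_def by linarith
  qed
 qed
qed

text \<open>The same completion for the rotational mean alone. It has no angular derivative to
  compensate the term - f1^2 / \<rho>, so this term stays.\<close>

lemma radial_sum_of_squares:
 assumes T: "0 \<le> T"
 shows "L1_on {0..T} (\<lambda>t. \<rho> t * (g1 t + \<kappa> t / \<rho> t * f1 t)^2 - (f1 t)^2 / \<rho> t)"
  and "(LBINT t:{0..T}. \<rho> t * (g1 t + \<kappa> t / \<rho> t * f1 t)^2 - (f1 t)^2 / \<rho> t) =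
   (LBINT t:{0..T}. \<rho> t * (g1 t)^2 - V t * (f1 t)^2) + \<kappa> T * (f1 T)^2 - \<kappa> 0 * (f1 0)^2"
proof -
 have f: "primitive_on 0 T f1 g1" by (rule cmean_primitive(1)) (use T in auto)
 have P: "primitive_on 0 T (\<lambda>t. \<kappa> t * (f1 t * f1 t)) (\<lambda>t. \<kappa> t * (f1 t * g1 t + g1 t * f1 t) + kap' t * (f1 t * f1 t))"
  by (intro primitive_on_mult kap_primitive f)
 have 0: "L1_on {0..T} (\<lambda>t. \<rho> t * (g1 t)^2)"
  by (rule set_integrable_subset[OF rho_mean_sq_integrable]) auto
 have 1: "L1_on {0..T} (\<lambda>t. \<rho> t * (g1 t)^2 - V t * (f1 t)^2)"
  by (rule set_integral_diff(1)[OF 0])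
   (intro continuous_set_integrable continuous_intros primitive_on_continuous[OF f] continuous_on_subset[OF V_cont] subset_UNIV)
 have eq: "\<rho> t * (g1 t + \<kappa> t / \<rho> t * f1 t)^2 - (f1 t)^2 / \<rho> t = (\<rho> t * (g1 t)^2 - V t * (f1 t)^2)
  + (\<kappa> t * (f1 t * g1 t + g1 t * f1 t) + kap' t * (f1 t * f1 t))" if "t \<in> {0..T}" for t
  using rho_pos[of t] that by (simp add: kap'_def power2_eq_square field_simps)
 have 2: "L1_on {0..T} (\<lambda>t. (\<rho> t * (g1 t)^2 - V t * (f1 t)^2)
  + (\<kappa> t * (f1 t * g1 t + g1 t * f1 t) + kap' t * (f1 t * f1 t)))"
  by (rule set_integral_add(1)[OF 1 primitive_on_integrable[OF P]])
 show "L1_on {0..T} (\<lambda>t. \<rho> t * (g1 t + \<kappa> t / \<rho> t * f1 t)^2 - (f1 t)^2 / \<rho> t)"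
  by (subst set_integrable_cong[OF refl refl eq]) (use 2 in auto)
 have "(LBINT t:{0..T}. \<rho> t * (g1 t + \<kappa> t / \<rho> t * f1 t)^2 - (f1 t)^2 / \<rho> t) =
  (LBINT t:{0..T}. (\<rho> t * (g1 t)^2 - V t * (f1 t)^2)
  + (\<kappa> t * (f1 t * g1 t + g1 t * f1 t) + kap' t * (f1 t * f1 t)))"
  by (rule set_lebesgue_integral_cong) (use eq in auto)
 also have "\<dots> = (LBINT t:{0..T}. \<rho> t * (g1 t)^2 - V t * (f1 t)^2)
   + (LBINT t:{0..T}. \<kappa> t * (f1 t * g1 t + g1 t * f1 t) + kap' t * (f1 t * f1 t))"
  by (rule set_integral_add(2)[OF 1 primitive_on_integrable[OF P]])
 also have "(LBINT t:{0..T}. \<kappa> t * (f1 t * g1 t + g1 t * f1 t) + kap' t * (f1 t * f1 t)) = \<kappa> T * (f1 T)^2 - \<kappa> 0 * (f1 0)^2"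
  using primitive_on_eq[OF P, of T] T by (simp add: power2_eq_square)
 finally show "(LBINT t:{0..T}. \<rho> t * (g1 t + \<kappa> t / \<rho> t * f1 t)^2 - (f1 t)^2 / \<rho> t) =
   (LBINT t:{0..T}. \<rho> t * (g1 t)^2 - V t * (f1 t)^2) + \<kappa> T * (f1 T)^2 - \<kappa> 0 * (f1 0)^2" by simp
qed

lemma square_slice:
 "AE t in lborel. 0 \<le> t \<longrightarrow>
  (LBINT s:circ. square_density v G H (t, s)) =
   \<rho> t * (LBINT s:circ. (G (t, s) + \<kappa> t / \<rho> t * v (t, s))^2)
   + ((LBINT s:circ. (H (t, s))^2) - sq_mean t) / \<rho> t \<and>
  L1_on circ (\<lambda>s. (G (t, s) + \<kappa> t / \<rho> t * v (t, s))^2)"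
 using G2_slice H2_slice
proof (eventually_elim, intro impI)
 fix t :: real assume a: "0 \<le> t \<longrightarrow> L1_on circ (\<lambda>s. (G (t, s))^2)"
  "0 \<le> t \<longrightarrow> L1_on circ (\<lambda>s. (H (t, s))^2)" and t: "0 \<le> t"
 define k where "k = \<kappa> t / \<rho> t"
 note sm = slice_meas
 have G: "L1_on circ (\<lambda>s. (G (t, s))^2)" and H: "L1_on circ (\<lambda>s. (H (t, s))^2)"
  using a t by auto
 note v = sq_mean_primitive(2)[OF t]
 have Gv: "L1_on circ (\<lambda>s. G (t, s) * v (t, s))"
  by (rule set_integrable_mult_L2[OF G v]) (use sm in auto)
 have 1: "L1_on circ (\<lambda>s. (G (t, s) + k * v (t, s))^2)"
 proof -
  have "(G (t, s) + k * v (t, s))^2 = (G (t, s))^2 + (2 * k) * (G (t, s) * v (t, s)) + k^2 * (v (t, s))^2" for s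
   by (simp add: power2_eq_square algebra_simps)
  then show ?thesis using G v Gv by auto
 qed
 have 2: "square_density v G H (t, s) = \<rho> t * (G (t, s) + k * v (t, s))^2 + ((H (t, s))^2 - (v (t, s))^2) / \<rho> t" for s
  by (simp add: square_density_def k_def)
 have "(LBINT s:circ. square_density v G H (t, s)) =
   \<rho> t * (LBINT s:circ. (G (t, s) + k * v (t, s))^2)
   + ((LBINT s:circ. (H (t, s))^2) - sq_mean t) / \<rho> t"
  unfolding 2 sq_mean_def using 1 H v
  by (simp add: set_integral_add set_integral_diff)
 then show "(LBINT s:circ. square_density v G H (t, s)) =
   \<rho> t * (LBINT s:circ. (G (t, s) + \<kappa> t / \<rho> t * v (t, s))^2)
   + ((LBINT s:circ. (H (t, s))^2) - sq_mean t) / \<rho> t \<and>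
  L1_on circ (\<lambda>s. (G (t, s) + \<kappa> t / \<rho> t * v (t, s))^2)"
  using 1 by (simp add: k_def)
qed

text \<open>The energy is bounded below by that of the rotational mean: the remaining angular modes contribute
 a nonnegative amount by Wirtinger's inequality.\<close>

lemma energy_ge_radial:
 assumes T: "0 \<le> T"
 shows "(LBINT p:cyl T. energy_density v G H p) + \<kappa> T * sq_mean T - \<kappa> 0 * sq_mean 0
  \<ge> ((LBINT t:{0..T}. \<rho> t * (g1 t)^2 - V t * (f1 t)^2) + \<kappa> T * (f1 T)^2 - \<kappa> 0 * (f1 0)^2) / (2 * pi)"
proof -
 have "((LBINT t:{0..T}. \<rho> t * (g1 t)^2 - V t * (f1 t)^2) + \<kappa> T * (f1 T)^2 - \<kappa> 0 * (f1 0)^2) / (2 * pi)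
  = (LBINT t:{0..T}. (\<rho> t * (g1 t + \<kappa> t / \<rho> t * f1 t)^2 - (f1 t)^2 / \<rho> t) / (2 * pi))"
  unfolding set_integral_divide_zero radial_sum_of_squares(2)[OF T] ..
 also have "\<dots> \<le> (LBINT t:{0..T}. LBINT s:circ. square_density v G H (t, s))"
 proof (rule set_integral_mono_AE)
  show "L1_on {0..T} (\<lambda>t. (\<rho> t * (g1 t + \<kappa> t / \<rho> t * f1 t)^2 - (f1 t)^2 / \<rho> t) / (2 * pi))"
   using radial_sum_of_squares(1)[OF T] by (intro set_integrable_divide) auto
  show "L1_on {0..T} (\<lambda>t. LBINT s:circ. square_density v G H (t, s))"
   by (rule set_fubini(2)[OF sum_of_squares(1)[OF T]])
  show "AE t \<in> {0..T} in lborel. (\<rho> t * (g1 t + \<kappa> t / \<rho> t * f1 t)^2 - (f1 t)^2 / \<rho> t) / (2 * pi)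
   \<le> (LBINT s:circ. square_density v G H (t, s))"
   using angular_wirtinger square_slice G2_slice
  proof (eventually_elim, intro impI)
   fix t assume a: "0 \<le> t \<longrightarrow> sq_mean t \<le> (LBINT s:circ. (H (t, s))^2) + (f1 t)^2 / (2 * pi)"
    "0 \<le> t \<longrightarrow> (LBINT s:circ. square_density v G H (t, s)) =
    \<rho> t * (LBINT s:circ. (G (t, s) + \<kappa> t / \<rho> t * v (t, s))^2)
    + ((LBINT s:circ. (H (t, s))^2) - sq_mean t) / \<rho> t \<and>
    L1_on circ (\<lambda>s. (G (t, s) + \<kappa> t / \<rho> t * v (t, s))^2)"
    "0 \<le> t \<longrightarrow> L1_on circ (\<lambda>s. (G (t, s))^2)"
    and t: "t \<in> {0..T}"
   then have t0: "0 \<le> t" by simp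
   define k where "k = \<kappa> t / \<rho> t"
   have r: "0 < \<rho> t" using rho_pos[OF t0] .
   have iG: "L1_on circ (\<lambda>s. G (t, s))"
    by (rule set_integrable_L1_L2) (use a(3) t0 slice_meas in auto)
   have iv: "L1_on circ (\<lambda>s. v (t, s))"
    by (rule set_integrable_L1_L2) (use sq_mean_primitive(2)[OF t0] slice_meas in auto)
   have "g1 t + k * f1 t = (LBINT s:circ. G (t, s) + k * v (t, s))"
    using iG iv by (simp add: cmean_def set_integral_add)
   \<comment> \<open>The rotational part splits off: Cauchy-Schwarz handles the t-derivative, and
     Wirtinger with its mean term handles the angular one.\<close>
   then have "(g1 t + k * f1 t)^2 \<le> 2 * pi * (LBINT s:circ. (G (t, s) + k * v (t, s))^2)"
    using Cauchy_Schwarz_circle[of "\<lambda>s. G (t, s) + k * v (t, s)"] a(2) t0 slice_meas by (simp add: k_def)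
   then have 1: "\<rho> t * (g1 t + k * f1 t)^2 / (2 * pi) \<le> \<rho> t * (LBINT s:circ. (G (t, s) + k * v (t, s))^2)"
    using r by (simp add: field_simps)
   have 2: "- ((f1 t)^2 / \<rho> t / (2 * pi)) \<le> ((LBINT s:circ. (H (t, s))^2) - sq_mean t) / \<rho> t"
   proof -
    have "- ((f1 t)^2 / (2 * pi)) / \<rho> t \<le> ((LBINT s:circ. (H (t, s))^2) - sq_mean t) / \<rho> t"
     using a(1) t0 r by (intro divide_right_mono) auto
    then show ?thesis by (simp add: mult.commute)
   qed
   show "(\<rho> t * (g1 t + \<kappa> t / \<rho> t * f1 t)^2 - (f1 t)^2 / \<rho> t) / (2 * pi)
    \<le> (LBINT s:circ. square_density v G H (t, s))"
    using 1 2 a(2) t0 unfolding k_def[symmetric] diff_divide_distrib by linarith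
  qed
 qed
 also have "\<dots> = (LBINT p:cyl T. square_density v G H p)"
  by (rule set_fubini(3)[OF sum_of_squares(1)[OF T], symmetric])
 finally show ?thesis using sum_of_squares(2)[OF T] by simp
qed

end

section \<open>Behaviour at infinity, rigidity, and pairing with separated functions\<close>

context face_function
begin

lemma inverse_rho_integrable: "L1_on {0..T} (\<lambda>t. 1 / \<rho> t)"
 by (intro continuous_set_integrable continuous_intros continuous_on_subset[OF rho_cont])
   (use rho_pos in force)+

lemma sq_mean_meas[measurable]: "sq_mean \<in> borel_fun"
 using borel_slice_integral(2)[of "\<lambda>p. (v p)^2" "circ"] unfolding sq_mean_def[abs_def] by simp

text \<open>Parabolicity at work. With zero mean, Wirtinger bounds
  \<open>sq_mean t / \<rho> t\<close> by the integrable angular energy; a positive lower bound for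
  \<open>sq_mean\<close> near infinity would make \<open>1 / \<rho>\<close> integrable.\<close>

lemma sq_mean_small:
 assumes zero: "\<And>t. 0 \<le> t \<Longrightarrow> f1 t = 0" and \<delta>: "0 < \<delta>"
 shows "\<exists>T\<ge>T1. sq_mean T < \<delta>"
proof (rule ccontr)
 assume "\<not> ?thesis"
 then have big: "\<delta> \<le> sq_mean T" if "T1 \<le> T" for T using that by force
 define T2 where "T2 = max 0 T1"
 have i1: "L1_on {0..} (\<lambda>t. sq_mean t / \<rho> t)"
 proof (rule set_integrable_bound)
  show "L1_on {0..} (\<lambda>t. LBINT s:circ. (H (t, s))^2 / \<rho> t)"
   using set_fubini(2)[OF rH2] by simp
  show "set_borel_measurable lborel {0..} (\<lambda>t. sq_mean t / \<rho> t)"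
   unfolding set_borel_measurable_def by measurable
  show "AE t\<in>{0..} in lborel. norm (sq_mean t / \<rho> t) \<le> norm (LBINT s:circ. (H (t, s))^2 / \<rho> t)"
   using angular_wirtinger
  proof (eventually_elim, intro impI)
   fix t assume a: "0 \<le> t \<longrightarrow> sq_mean t \<le> (LBINT s:circ. (H (t, s))^2) + (f1 t)^2 / (2 * pi)"
    and "t \<in> {0..}"
   then have t: "0 \<le> t" by simp
   have "0 \<le> sq_mean t" unfolding sq_mean_def by (rule set_integral_nonneg_real) simp
   moreover have "sq_mean t \<le> (LBINT s:circ. (H (t, s))^2)" using a t zero by simp
   ultimately show "norm (sq_mean t / \<rho> t) \<le> norm (LBINT s:circ. (H (t, s))^2 / \<rho> t)"
    using rho_pos[OF t] by (simp add: divide_right_mono)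
  qed
 qed
 have "L1_on {T2..} (\<lambda>t. 1 / \<rho> t)"
 proof (rule set_integrable_bound_borel)
  show "L1_on {T2..} (\<lambda>t. (1 / \<delta>) * (sq_mean t / \<rho> t))"
   by (intro set_integrable_mult_right set_integrable_subset[OF i1]) (auto simp: T2_def)
  fix t assume "t \<in> {T2..}"
  then have "0 < \<rho> t" "\<delta> \<le> sq_mean t" using rho_pos[of t] big[of t] by (auto simp: T2_def)
  then show "\<bar>1 / \<rho> t\<bar> \<le> (1 / \<delta>) * (sq_mean t / \<rho> t)" using \<delta> by (simp add: field_simps)
 qed auto
 moreover have "{0..} = {0..T2} \<union> {T2..}" by (auto simp: T2_def)
 ultimately have "L1_on {0..} (\<lambda>t. 1 / \<rho> t)"
  using set_integrable_Un[OF inverse_rho_integrable[of T2]] by simp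
 then show False using not_integrable by simp
qed

lemma energy_limit:
 "((\<lambda>T. LBINT p:cyl T. energy_density v G H p) \<longlongrightarrow>
  (LBINT p:strip. energy_density v G H p)) at_top"
 using tendsto_set_lebesgue_integral_at_top[OF _ set_fubini(2)[OF energy_density_integrable(1)]]
 unfolding set_fubini(3)[OF energy_density_integrable(1)] set_fubini(3)[OF energy_density_integrable(2)]
 by simp

lemma square_slice_nonneg:
 assumes zero: "\<And>t. 0 \<le> t \<Longrightarrow> f1 t = 0"
 shows "AE t in lborel. 0 \<le> t \<longrightarrow> 0 \<le> (LBINT s:circ. square_density v G H (t, s))"
 using angular_wirtinger square_slice
proof (eventually_elim, intro impI)
 fix t assume a: "0 \<le> t \<longrightarrow> sq_mean t \<le> (LBINT s:circ. (H (t, s))^2) + (f1 t)^2 / (2 * pi)"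
   "0 \<le> t \<longrightarrow> (LBINT s:circ. square_density v G H (t, s)) =
    \<rho> t * (LBINT s:circ. (G (t, s) + \<kappa> t / \<rho> t * v (t, s))^2)
    + ((LBINT s:circ. (H (t, s))^2) - sq_mean t) / \<rho> t \<and>
    L1_on circ (\<lambda>s. (G (t, s) + \<kappa> t / \<rho> t * v (t, s))^2)" and t: "0 \<le> t"
 have "0 \<le> (LBINT s:circ. (G (t, s) + \<kappa> t / \<rho> t * v (t, s))^2)"
  by (rule set_integral_nonneg_real) simp
 then show "0 \<le> (LBINT s:circ. square_density v G H (t, s))"
  using a t zero[OF t] rho_pos[OF t] by simp
qed

lemma square_mono:
 assumes zero: "\<And>t. 0 \<le> t \<Longrightarrow> f1 t = 0" and T: "0 \<le> T0" "T0 \<le> T"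
 shows "(LBINT p:cyl T0. square_density v G H p)
  \<le> (LBINT p:cyl T. square_density v G H p)"
  and "0 \<le> (LBINT p:cyl T0. square_density v G H p)"
proof -
 define S where "S t = (LBINT s:circ. square_density v G H (t, s))" for t
 have nn: "AE t in lborel. 0 \<le> t \<longrightarrow> 0 \<le> S t" unfolding S_def by (rule square_slice_nonneg[OF zero])
 have pos: "0 \<le> (LBINT t:{a..b}. S t)" if "0 \<le> a" for a b
  unfolding set_lebesgue_integral_def
  by (rule integral_nonneg_AE) (use nn that in \<open>auto simp: indicator_def elim!: eventually_mono\<close>)
 have T0: "0 \<le> T" using T by simp
 have iS: "L1_on {0..T} S"
  unfolding S_def[abs_def] by (rule set_fubini(2)[OF sum_of_squares(1)[OF T0]])
 show "(LBINT p:cyl T0. square_density v G H p)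
  \<le> (LBINT p:cyl T. square_density v G H p)"
  unfolding set_fubini(3)[OF sum_of_squares(1)[OF T0]] set_fubini(3)[OF sum_of_squares(1)[OF T(1)]]
  unfolding S_def[symmetric]
  using set_integral_split_Icc[OF iS T] pos[OF T(1), of T] by simp
 show "0 \<le> (LBINT p:cyl T0. square_density v G H p)"
  unfolding set_fubini(3)[OF sum_of_squares(1)[OF T(1)]] unfolding S_def[symmetric]
  by (rule pos) simp
qed

text \<open>The outer boundary term is at most \<open>sq_mean T\<close> since
  \<open>\<bar>\<kappa> T\<bar> \<le> 1\<close>, and the radii from \<open>sq_mean_small\<close>
  make it negligible. Only some large radii are available, but monotonicity in T carries the bound
  back to \<open>T0\<close>.\<close>

lemma square_le_energy:
 assumes zero: "\<And>t. 0 \<le> t \<Longrightarrow> f1 t = 0" and T0: "0 \<le> T0"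
 shows "(LBINT p:cyl T0. square_density v G H p)
  \<le> (LBINT p:strip. energy_density v G H p) - \<kappa> 0 * sq_mean 0" (is "?P \<le> ?E - _")
proof (rule field_le_epsilon)
 fix \<epsilon> :: real assume \<epsilon>: "0 < \<epsilon>"
 have "\<forall>\<^sub>F T in at_top. dist (LBINT p:cyl T. energy_density v G H p) ?E < \<epsilon> / 2"
  using energy_limit by (rule tendstoD) (use \<epsilon> in simp)
 then obtain T1 where T1: "\<And>T. T1 \<le> T \<Longrightarrow> dist (LBINT p:cyl T. energy_density v G H p) ?E < \<epsilon> / 2"
  by (auto simp: eventually_at_top_linorder)
 obtain T where T: "max T0 T1 \<le> T" "sq_mean T < \<epsilon> / 2"
  using sq_mean_small[OF zero, of "\<epsilon> / 2" "max T0 T1"] \<epsilon> by auto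
 then have T': "0 \<le> T" "T0 \<le> T" "T1 \<le> T" using T0 by auto
 have "0 \<le> sq_mean T" unfolding sq_mean_def by (rule set_integral_nonneg_real) simp
 then have "\<kappa> T * sq_mean T \<le> 1 * sq_mean T"
  using kap_le[OF T'(1)] by (intro mult_right_mono) auto
 moreover have "?P \<le> (LBINT p:cyl T. square_density v G H p)"
  by (rule square_mono(1)[OF zero T0 T'(2)])
 moreover note sum_of_squares(2)[OF T'(1)]
 moreover have "(LBINT p:cyl T. energy_density v G H p) < ?E + \<epsilon> / 2"
  using T1[OF T'(3)] unfolding dist_real_def by linarith
 ultimately show "?P \<le> ?E - \<kappa> 0 * sq_mean 0 + \<epsilon>" using T(2) by linarith
qed

text \<open>Zero squares mean \<open>G = - (\<kappa> / \<rho>) v\<close> and equality in Wirtinger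
  on almost every circle. The first makes the cos and sin coefficients multiples of
  \<open>y\<close>, hence zero with their initial values; the second then forces
  \<open>v = 0\<close> by \<open>wirtinger_rigidity\<close>.\<close>

lemma vanishing:
 assumes zero: "\<And>t. 0 \<le> t \<Longrightarrow> f1 t = 0"
  and sq: "\<And>T. 0 \<le> T \<Longrightarrow> (LBINT p:cyl T. square_density v G H p) = 0"
  and c0: "cmean v cos 0 = 0" and s0: "cmean v sin 0 = 0"
 shows "AE p\<in>strip in lborel. v p = 0"
proof -
 define S where "S t = (LBINT s:circ. square_density v G H (t, s))" for t
 have nn: "AE t in lborel. 0 \<le> t \<longrightarrow> 0 \<le> S t" unfolding S_def by (rule square_slice_nonneg[OF zero])
 have S0: "AE t in lborel. 0 \<le> t \<longrightarrow> S t = 0"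
 proof (rule AE_nonneg_from_nat, rule set_integral_nonneg_zero_AE)
  fix n :: nat
  show "L1_on {0..real n} S"
   unfolding S_def[abs_def] by (rule set_fubini(2)[OF sum_of_squares(1)]) simp
  show "AE t\<in>{0..real n} in lborel. 0 \<le> S t" using nn by eventually_elim auto
  show "(LBINT t:{0..real n}. S t) = 0"
   using sq[of "real n"] unfolding set_fubini(3)[OF sum_of_squares(1)[OF of_nat_0_le_iff]] S_def by simp
 qed
 have both: "AE t in lborel. 0 \<le> t \<longrightarrow>
  (AE s\<in>circ in lborel. G (t, s) = - (\<kappa> t / \<rho> t) * v (t, s)) \<and>
  (LBINT s:circ. (H (t, s))^2) \<le> sq_mean t"
  using S0 square_slice angular_wirtinger
 proof (eventually_elim, intro impI)
  fix t assume a: "0 \<le> t \<longrightarrow> S t = 0"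
   "0 \<le> t \<longrightarrow> (LBINT s:circ. square_density v G H (t, s)) =
    \<rho> t * (LBINT s:circ. (G (t, s) + \<kappa> t / \<rho> t * v (t, s))^2)
    + ((LBINT s:circ. (H (t, s))^2) - sq_mean t) / \<rho> t \<and>
    L1_on circ (\<lambda>s. (G (t, s) + \<kappa> t / \<rho> t * v (t, s))^2)"
   "0 \<le> t \<longrightarrow> sq_mean t \<le> (LBINT s:circ. (H (t, s))^2) + (f1 t)^2 / (2 * pi)" and t: "0 \<le> t"
  define X where "X = (LBINT s:circ. (G (t, s) + \<kappa> t / \<rho> t * v (t, s))^2)"
  define Y where "Y = (LBINT s:circ. (H (t, s))^2) - sq_mean t"
  have r: "0 < \<rho> t" by (rule rho_pos[OF t])
  have X: "0 \<le> X" unfolding X_def by (rule set_integral_nonneg_real) simp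
  have Y: "0 \<le> Y" unfolding Y_def using a(3) t zero[OF t] by simp
  have "\<rho> t * X + Y / \<rho> t = 0" using a(1,2) t by (simp add: S_def X_def Y_def)
  moreover have "0 \<le> \<rho> t * X" "0 \<le> Y / \<rho> t" using r X Y by auto
  ultimately have "\<rho> t * X = 0" "Y / \<rho> t = 0" by linarith+
  then have XY: "X = 0" "Y = 0" using r by auto
  have "AE s\<in>circ in lborel. (G (t, s) + \<kappa> t / \<rho> t * v (t, s))^2 = 0"
   by (rule set_integral_nonneg_zero_AE) (use a(2) t XY(1) in \<open>auto simp: X_def\<close>)
  then have "AE s\<in>circ in lborel. G (t, s) = - (\<kappa> t / \<rho> t) * v (t, s)"
   by eventually_elim (auto simp: add_eq_0_iff2)
  then show "(AE s\<in>circ in lborel. G (t, s) = - (\<kappa> t / \<rho> t) * v (t, s)) \<and>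
   (LBINT s:circ. (H (t, s))^2) \<le> sq_mean t" using XY(2) by (simp add: Y_def)
 qed
 have mode0: "cmean v e T = 0" if e: "continuous_on UNIV e" and e0: "cmean v e 0 = 0" and T: "0 \<le> T" for e T
 proof -
  have gm: "AE t in lborel. 0 \<le> t \<longrightarrow> cmean G e t = - (\<kappa> t / \<rho> t) * cmean v e t"
   using both
  proof (eventually_elim, intro impI)
   fix t assume a: "0 \<le> t \<longrightarrow> (AE s\<in>circ in lborel. G (t, s) = - (\<kappa> t / \<rho> t) * v (t, s)) \<and>
     (LBINT s:circ. (H (t, s))^2) \<le> sq_mean t" and t: "0 \<le> t"
   have [measurable]: "e \<in> borel_fun" using e by (rule borel_measurable_continuous_onI)
   note [measurable] = slice_meas
   have "cmean G e t = (LBINT s:circ. (- (\<kappa> t / \<rho> t)) * (v (t, s) * e s))"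
    unfolding cmean_def
   proof (rule set_integral_eq_AE(2))
    show "L1_on circ (\<lambda>s. (- (\<kappa> t / \<rho> t)) * (v (t, s) * e s))"
     by (intro set_integrable_mult_right cmean_primitive(2)[OF e t])
    show "AE s\<in>circ in lborel. G (t, s) * e s = (- (\<kappa> t / \<rho> t)) * (v (t, s) * e s)"
     using a t by (auto elim!: eventually_mono)
   qed auto
   then show "cmean G e t = - (\<kappa> t / \<rho> t) * cmean v e t"
    unfolding cmean_def set_integral_mult_right .
  qed
  \<comment> \<open>The integrating factor: a coefficient divided by \<open>y\<close> has derivative
    zero.\<close>
  define z where "z t = 1 / y t" for t
  have dz: "(z has_real_derivative \<kappa> t / \<rho> t * z t) (at t)" if "0 \<le> t" for t
   unfolding z_def using y_pos[OF that] y_deriv[OF that]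
   by (auto intro!: derivative_eq_intros simp: field_simps)
  have cz: "continuous_on {0..T} z"
   by (intro continuous_at_imp_continuous_on ballI DERIV_isCont[OF dz]) auto
  have pz: "primitive_on 0 T z (\<lambda>t. \<kappa> t / \<rho> t * z t)"
   by (rule primitive_on_at_deriv[OF dz])
    (auto intro!: continuous_intros cz continuous_on_subset[OF kap_cont] continuous_on_subset[OF rho_cont],
     use rho_pos in force)
  note P = primitive_on_mult[OF cmean_primitive(1)[OF e T] pz]
  have "(LBINT t:{0..T}. cmean v e t * (\<kappa> t / \<rho> t * z t) + cmean G e t * z t) = 0"
   unfolding set_lebesgue_integral_def
   by (rule integral_eq_zero_AE) (use gm in \<open>auto simp: indicator_def elim!: eventually_mono\<close>)
  then have "cmean v e T * z T = 0" using primitive_on_eq[OF P, of T] T e0 by simp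
  then show ?thesis using y_pos[OF T] by (simp add: z_def)
 qed
 have z: "AE t in lborel. 0 \<le> t \<longrightarrow> sq_mean t = 0"
  using angular_rigidity both
 proof (eventually_elim, intro impI)
  fix t assume a: "0 \<le> t \<longrightarrow> f1 t = 0 \<longrightarrow> cmean v cos t = 0 \<longrightarrow> cmean v sin t = 0 \<longrightarrow>
    (LBINT s:circ. (H (t, s))^2) \<le> sq_mean t \<longrightarrow> sq_mean t = 0"
   "0 \<le> t \<longrightarrow> (AE s\<in>circ in lborel. G (t, s) = - (\<kappa> t / \<rho> t) * v (t, s)) \<and>
    (LBINT s:circ. (H (t, s))^2) \<le> sq_mean t" and t: "0 \<le> t"
  have "cmean v cos t = 0" by (rule mode0[OF continuous_on_cos[OF continuous_on_id] c0 t])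
  moreover have "cmean v sin t = 0" by (rule mode0[OF continuous_on_sin[OF continuous_on_id] s0 t])
  ultimately show "sq_mean t = 0" using a t zero[OF t] by blast
 qed
 have "AE p in lborel. \<forall>n::nat. p \<in> {0..real n} \<times> circ \<longrightarrow> (v p)^2 = 0"
  unfolding AE_all_countable
 proof (intro allI set_integral_nonneg_zero_AE[OF v2])
  fix n :: nat
  have "(LBINT t:{0..real n}. sq_mean t) = 0"
   unfolding set_lebesgue_integral_def
   by (rule integral_eq_zero_AE) (use z in \<open>auto simp: indicator_def elim!: eventually_mono\<close>)
  then show "(LBINT p:{0..real n} \<times> circ. (v p)^2) = 0"
   unfolding set_fubini(3)[OF v2] sq_mean_def .
 qed simp
 then show ?thesis
  by eventually_elim (auto, meson real_arch_simple)
qed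

text \<open>Integrating over circles first, the angular derivative is moved from \<open>v\<close> to
  the mode, where \<open>e'' = - k e\<close> returns the coefficient itself. What remains is the
  radial Jacobi form of the Fourier coefficient.\<close>

lemma mode_form:
 assumes e: "\<And>s. (e has_real_derivative e' s) (at s)" "\<And>s. (e' has_real_derivative - k * e s) (at s)"
   "e' (2 * pi) = e' 0"
  and [measurable]: "F \<in> borel_fun" "F' \<in> borel_fun"
  and int: "L1_on strip (\<lambda>p. \<rho> (fst p) * G p * (tensor F' e p)
   + H p * (tensor F e' p) / \<rho> (fst p) - V (fst p) * v p * (tensor F e p))"
 shows "L1_on {0..} (\<lambda>t. \<rho> t * F' t * cmean G e t + (k / \<rho> t - V t) * F t * cmean v e t)"
  and "(LBINT p:strip. \<rho> (fst p) * G p * (tensor F' e p)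
   + H p * (tensor F e' p) / \<rho> (fst p) - V (fst p) * v p * (tensor F e p))
   = (LBINT t:{0..}. \<rho> t * F' t * cmean G e t + (k / \<rho> t - V t) * F t * cmean v e t)"
proof -
 have ce: "continuous_on UNIV e" "continuous_on UNIV e'"
  by (intro continuous_at_imp_continuous_on ballI DERIV_isCont[OF e(1)] DERIV_isCont[OF e(2)])+
 have [measurable]: "e \<in> borel_fun" "e' \<in> borel_fun"
  using ce by (auto intro: borel_measurable_continuous_onI)
 note [measurable] = slice_meas cmean_meas[OF ce(1)]
 have parts: "AE t in lborel. 0 \<le> t \<longrightarrow> cmean H e' t = - cmean v (\<lambda>s. - k * e s) t"
  by (rule angular_by_parts[OF e(2) _ e(3)]) (intro continuous_intros ce)
 have ae: "AE t\<in>{0..} in lborel. \<rho> t * F' t * cmean G e t + (k / \<rho> t - V t) * F t * cmean v e t =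
   (LBINT s:circ. \<rho> (fst (t, s)) * G (t, s) * (tensor F' e (t, s))
   + H (t, s) * (tensor F e' (t, s)) / \<rho> (fst (t, s))
   - V (fst (t, s)) * v (t, s) * (tensor F e (t, s)))"
  using parts G2_slice H2_slice
 proof (eventually_elim, intro impI)
  fix t assume a: "0 \<le> t \<longrightarrow> cmean H e' t = - cmean v (\<lambda>s. - k * e s) t"
   "0 \<le> t \<longrightarrow> L1_on circ (\<lambda>s. (G (t, s))^2)"
   "0 \<le> t \<longrightarrow> L1_on circ (\<lambda>s. (H (t, s))^2)" and "t \<in> {0..}"
  then have t: "0 \<le> t" by simp
  have iG: "L1_on circ (\<lambda>s. G (t, s))"
   by (rule set_integrable_L1_L2) (use a(2) t slice_meas in auto)
  have iH: "L1_on circ (\<lambda>s. H (t, s))"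
   by (rule set_integrable_L1_L2) (use a(3) t slice_meas in auto)
  have 1: "L1_on circ (\<lambda>s. G (t, s) * e s)" "L1_on circ (\<lambda>s. H (t, s) * e' s)"
   by (intro set_integrable_mult_continuous iG iH continuous_on_subset[OF ce(1)] continuous_on_subset[OF ce(2)] subset_UNIV)+
  have 2: "L1_on circ (\<lambda>s. v (t, s) * e s)"
   by (rule cmean_primitive(2)[OF ce(1) t])
  have 3: "cmean H e' t = k * cmean v e t"
  proof -
   have "cmean v (\<lambda>s. - k * e s) t = (LBINT s:circ. (- k) * (v (t, s) * e s))"
    unfolding cmean_def by (simp add: mult.left_commute)
   also have "\<dots> = - k * cmean v e t" unfolding cmean_def set_integral_mult_right ..
   finally show ?thesis using a(1) t by simp
  qed
  have "(LBINT s:circ. \<rho> (fst (t, s)) * G (t, s) * (tensor F' e (t, s))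
   + H (t, s) * (tensor F e' (t, s)) / \<rho> (fst (t, s))
   - V (fst (t, s)) * v (t, s) * (tensor F e (t, s))) =
   (LBINT s:circ. (\<rho> t * F' t) * (G (t, s) * e s) + (F t / \<rho> t) * (H (t, s) * e' s)
    - (V t * F t) * (v (t, s) * e s))"
   by (rule set_lebesgue_integral_cong) auto
  also have "\<dots> = (\<rho> t * F' t) * cmean G e t + (F t / \<rho> t) * cmean H e' t - (V t * F t) * cmean v e t"
   using 1 2 by (simp add: set_integral_add set_integral_diff cmean_def)
  finally show "\<rho> t * F' t * cmean G e t + (k / \<rho> t - V t) * F t * cmean v e t =
   (LBINT s:circ. \<rho> (fst (t, s)) * G (t, s) * (tensor F' e (t, s))
   + H (t, s) * (tensor F e' (t, s)) / \<rho> (fst (t, s))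
   - V (fst (t, s)) * v (t, s) * (tensor F e (t, s)))"
   unfolding 3 by (simp add: algebra_simps)
 qed
 have m: "(\<lambda>t. \<rho> t * F' t * cmean G e t + (k / \<rho> t - V t) * F t * cmean v e t) \<in> borel_fun"
  by measurable
 note R = set_integral_eq_AE[OF set_fubini(2)[OF int] m _ ae]
 show "L1_on {0..} (\<lambda>t. \<rho> t * F' t * cmean G e t + (k / \<rho> t - V t) * F t * cmean v e t)"
  by (rule R(1)) simp
 show "(LBINT p:strip. \<rho> (fst p) * G p * (tensor F' e p)
   + H p * (tensor F e' p) / \<rho> (fst p) - V (fst p) * v p * (tensor F e p))
   = (LBINT t:{0..}. \<rho> t * F' t * cmean G e t + (k / \<rho> t - V t) * F t * cmean v e t)"
  unfolding set_fubini(3)[OF int] by (rule R(2)[symmetric]) simp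
qed

text \<open>The bound x <= \<rho> x^2 + 1 / \<rho> under the integral replaces Cauchy-Schwarz and
  costs only a constant. The resulting growth is logarithmic on the plane and linear on a
  catenoid.\<close>

lemma cmean_growth:
 assumes e: "continuous_on UNIV e"
 shows "\<exists>A. \<forall>T\<ge>0. \<bar>cmean v e T\<bar> \<le> A * (1 + (LBINT t:{0..T}. 1 / \<rho> t))"
proof -
 define B where "B = (LBINT t:{0..}. \<rho> t * (cmean G e t)^2)"
 note iB = rho_mean_sq_integrable[OF e]
 have B: "0 \<le> B" unfolding B_def
  by (intro set_integral_nonneg_real mult_nonneg_nonneg less_imp_le[OF rho_pos]) auto
 have "\<bar>cmean v e T\<bar> \<le> (\<bar>cmean v e 0\<bar> + B + 1) * (1 + (LBINT t:{0..T}. 1 / \<rho> t))" if T: "0 \<le> T" for T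
 proof -
  define L where "L = (LBINT t:{0..T}. 1 / \<rho> t)"
  have L: "0 \<le> L" unfolding L_def using rho_pos by (intro set_integral_nonneg_real) (auto intro: less_imp_le)
  note P = cmean_primitive(1)[OF e T]
  have iT: "L1_on {0..T} (\<lambda>t. \<rho> t * (cmean G e t)^2)"
   by (rule set_integrable_subset[OF iB]) auto
  have "\<bar>LBINT t:{0..T}. cmean G e t\<bar> \<le> (LBINT t:{0..T}. \<bar>cmean G e t\<bar>)"
   unfolding set_lebesgue_integral_def
   by (rule order_trans[OF integral_abs_bound]) (simp add: abs_mult)
  also have "\<dots> \<le> (LBINT t:{0..T}. \<rho> t * (cmean G e t)^2 + 1 / \<rho> t)"
  proof (rule set_integral_mono)
   show "L1_on {0..T} (\<lambda>t. \<bar>cmean G e t\<bar>)"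
    by (rule set_integrable_abs[OF primitive_on_integrable[OF P]])
   show "L1_on {0..T} (\<lambda>t. \<rho> t * (cmean G e t)^2 + 1 / \<rho> t)"
    by (rule set_integral_add(1)[OF iT inverse_rho_integrable])
   fix t assume "t \<in> {0..T}"
   then have r: "0 < \<rho> t" using rho_pos[of t] by simp
   define x where "x = \<bar>cmean G e t\<bar>"
   have "0 \<le> (\<rho> t * x - 1)^2" by simp
   then have "2 * \<rho> t * x \<le> \<rho> t * (\<rho> t * x^2) + 1" by (simp add: power2_eq_square algebra_simps)
   moreover have "0 \<le> \<rho> t * x" using r by (simp add: x_def)
   ultimately have "\<rho> t * x \<le> \<rho> t * (\<rho> t * x^2) + 1" by linarith
   then have "x \<le> \<rho> t * x^2 + 1 / \<rho> t" using r by (simp add: field_simps)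
   then show "\<bar>cmean G e t\<bar> \<le> \<rho> t * (cmean G e t)^2 + 1 / \<rho> t" by (simp add: x_def)
  qed
  also have "\<dots> = (LBINT t:{0..T}. \<rho> t * (cmean G e t)^2) + L"
   unfolding L_def by (rule set_integral_add(2)[OF iT inverse_rho_integrable])
  also have "(LBINT t:{0..T}. \<rho> t * (cmean G e t)^2) \<le> B"
   unfolding B_def set_lebesgue_integral_def
  proof (rule integral_mono)
   show "integrable lborel (\<lambda>t. indicator {0..T} t *\<^sub>R (\<rho> t * (cmean G e t)^2))"
    using iT by (simp add: set_integrable_def)
   show "integrable lborel (\<lambda>t. indicator {0..} t *\<^sub>R (\<rho> t * (cmean G e t)^2))"
    using iB by (simp add: set_integrable_def)
   fix t show "indicator {0..T} t *\<^sub>R (\<rho> t * (cmean G e t)^2) \<le> indicator {0..} t *\<^sub>R (\<rho> t * (cmean G e t)^2)"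
    using rho_pos[of t] by (auto simp: indicator_def intro: less_imp_le)
  qed
  finally have "\<bar>cmean v e T\<bar> \<le> \<bar>cmean v e 0\<bar> + B + L"
   using primitive_on_eq[OF P, of T] T by simp
  also have "\<dots> \<le> (\<bar>cmean v e 0\<bar> + B + 1) * (1 + L)"
  proof -
   have "0 \<le> (\<bar>cmean v e 0\<bar> + B) * L" using B L by simp
   then show ?thesis by (simp add: algebra_simps)
  qed
  finally show ?thesis by (simp add: L_def)
 qed
 then show ?thesis by blast
qed

text \<open>Since \<open>F\<close> solves the radial Jacobi equation, the integrand is the
  derivative of \<open>\<rho> F'\<close> times the coefficient. The outer boundary term vanishes
  because \<open>decay\<close> beats the growth allowed by \<open>cmean_growth\<close>.\<close>

lemma null_mode_form:
 assumes e: "continuous_on UNIV e"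
  and int: "L1_on {0..} (\<lambda>t. \<rho> t * F' t * cmean G e t + (k / \<rho> t - V t) * F t * cmean v e t)"
  and ode: "\<And>t. 0 \<le> t \<Longrightarrow> ((\<lambda>t. \<rho> t * F' t) has_real_derivative (k / \<rho> t - V t) * F t) (at t)"
  and F: "continuous_on {0..} F"
  and decay: "((\<lambda>T. \<rho> T * F' T * (1 + (LBINT t:{0..T}. 1 / \<rho> t))) \<longlongrightarrow> 0) at_top"
 shows "(LBINT t:{0..}. \<rho> t * F' t * cmean G e t + (k / \<rho> t - V t) * F t * cmean v e t)
  = - (\<rho> 0 * F' 0 * cmean v e 0)" (is "?I = ?R")
proof -
 have eq: "(LBINT t:{0..T}. \<rho> t * F' t * cmean G e t + (k / \<rho> t - V t) * F t * cmean v e t)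
   = \<rho> T * F' T * cmean v e T + ?R" if T: "0 \<le> T" for T
 proof -
  have "primitive_on 0 T (\<lambda>t. \<rho> t * F' t) (\<lambda>t. (k / \<rho> t - V t) * F t)"
   by (rule primitive_on_at_deriv[OF ode])
    (auto intro!: continuous_intros continuous_on_subset[OF F] continuous_on_subset[OF V_cont]
      continuous_on_subset[OF rho_cont], use rho_pos in force)
  note P = primitive_on_mult[OF this cmean_primitive(1)[OF e T]]
  show ?thesis using primitive_on_eq[OF P, of T] T by simp
 qed
 have lim: "((\<lambda>T. \<rho> T * F' T * cmean v e T) \<longlongrightarrow> 0) at_top"
 proof -
  obtain A where A: "\<And>T. 0 \<le> T \<Longrightarrow> \<bar>cmean v e T\<bar> \<le> A * (1 + (LBINT t:{0..T}. 1 / \<rho> t))"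
   using cmean_growth[OF e] by blast
  have "((\<lambda>T. A * \<bar>\<rho> T * F' T * (1 + (LBINT t:{0..T}. 1 / \<rho> t))\<bar>) \<longlongrightarrow> A * \<bar>0\<bar>) at_top"
   by (intro tendsto_intros decay)
  then have "((\<lambda>T. A * \<bar>\<rho> T * F' T * (1 + (LBINT t:{0..T}. 1 / \<rho> t))\<bar>) \<longlongrightarrow> 0) at_top" by simp
  then show ?thesis
  proof (rule Lim_null_comparison[rotated])
   show "\<forall>\<^sub>F T in at_top. norm (\<rho> T * F' T * cmean v e T) \<le> A * \<bar>\<rho> T * F' T * (1 + (LBINT t:{0..T}. 1 / \<rho> t))\<bar>"
    using eventually_ge_at_top[of 0]
   proof eventually_elim
    fix T :: real assume T: "0 \<le> T"
    define L where "L = (LBINT t:{0..T}. 1 / \<rho> t)"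
    have L: "0 \<le> L" unfolding L_def using rho_pos by (intro set_integral_nonneg_real) (auto intro: less_imp_le)
    have "\<bar>\<rho> T * F' T\<bar> * \<bar>cmean v e T\<bar> \<le> \<bar>\<rho> T * F' T\<bar> * (A * (1 + L))"
     using A[OF T] by (intro mult_left_mono) (auto simp: L_def)
    then show "norm (\<rho> T * F' T * cmean v e T) \<le> A * \<bar>\<rho> T * F' T * (1 + (LBINT t:{0..T}. 1 / \<rho> t))\<bar>"
     unfolding L_def[symmetric] real_norm_def abs_mult[of _ "cmean v e T"] abs_mult[of _ "1 + L"]
     using L by (simp add: mult_ac)
   qed
  qed
 qed
 have "((\<lambda>T. \<rho> T * F' T * cmean v e T + ?R) \<longlongrightarrow> 0 + ?R) at_top"
  by (intro tendsto_intros lim)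
 moreover have "((\<lambda>T. LBINT t:{0..T}. \<rho> t * F' t * cmean G e t + (k / \<rho> t - V t) * F t * cmean v e t) \<longlongrightarrow> ?I) at_top"
  by (rule tendsto_set_lebesgue_integral_at_top[OF _ int]) simp
 then have "((\<lambda>T. \<rho> T * F' T * cmean v e T + ?R) \<longlongrightarrow> ?I) at_top"
  by (rule Lim_transform_eventually) (use eq in \<open>auto intro!: eventually_mono[OF eventually_ge_at_top[of 0]]\<close>)
 ultimately show ?thesis using tendsto_unique[OF trivial_limit_at_top_linorder] by fastforce
qed

end

text \<open>The building block of the test functions: one continuous derivative is all that
  \<open>C1_compact_support\<close> asks, so polynomial pieces replace smooth bump
  functions.\<close>

lemma pos_part_sq_deriv: "((\<lambda>x::real. (max 0 x)^2) has_real_derivative 2 * max 0 x) (at x)"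
proof -
 consider "x > 0" | "x < 0" | "x = 0" by linarith
 then show ?thesis
 proof cases
  case 1
  have "((\<lambda>x::real. x^2) has_real_derivative 2 * x) (at x)" by (auto intro!: derivative_eq_intros)
  then have "((\<lambda>x::real. (max 0 x)^2) has_real_derivative 2 * x) (at x)"
   by (rule has_field_derivative_transform_within_open[where S = "{0<..}"]) (use 1 in auto)
  then show ?thesis using 1 by simp
 next
  case 2
  have "((\<lambda>x::real. 0) has_real_derivative 0) (at x)" by (auto intro!: derivative_eq_intros)
  then have "((\<lambda>x::real. (max 0 x)^2) has_real_derivative 0) (at x)"
   by (rule has_field_derivative_transform_within_open[where S = "{..<0}"]) (use 2 in auto)
  then show ?thesis using 2 by simp
 next
  case 3
  have "((\<lambda>h::real. (max 0 h)^2 / h) \<longlongrightarrow> 0) (at 0)"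
  proof (rule Lim_null_comparison)
   show "\<forall>\<^sub>F h in at 0. norm ((max 0 h)^2 / h) \<le> \<bar>h\<bar>"
    by (intro always_eventually) (auto simp: max_def power2_eq_square)
   show "((\<lambda>h::real. \<bar>h\<bar>) \<longlongrightarrow> 0) (at 0)" by (rule tendsto_eq_intros refl | simp)+
  qed
  then show ?thesis using 3 by (simp add: DERIV_def)
 qed
qed

section \<open>Test functions, weak gradients and traces\<close>

definition bump :: "real \<Rightarrow> real \<Rightarrow> real \<Rightarrow> real" where
 "bump p q x = (max 0 (x - p))^2 * (max 0 (q - x))^2"

text \<open>For growing n these profiles tend to the indicator of \<open>{p<..<q}\<close> and stay
  between 0 and 1, while remaining C1. Dominated convergence thus turns tests against their products
  into integrals over open rectangles.\<close>

definition plateau :: "nat \<Rightarrow> real \<Rightarrow> real \<Rightarrow> real \<Rightarrow> real" where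
 "plateau n p q x = real n * bump p q x / (1 + real n * bump p q x)"

definition bump_deriv :: "real \<Rightarrow> real \<Rightarrow> real \<Rightarrow> real" where
 "bump_deriv p q x = 2 * max 0 (x - p) * (max 0 (q - x))^2 - (max 0 (x - p))^2 * (2 * max 0 (q - x))"

lemma bump_nonneg: "0 \<le> bump p q x" by (simp add: bump_def)

lemma bump_zero: "x \<notin> {p<..<q} \<Longrightarrow> bump p q x = 0" by (auto simp: bump_def max_def)

lemma bump_pos: "x \<in> {p<..<q} \<Longrightarrow> 0 < bump p q x" by (auto simp: bump_def)

lemma bump_has_deriv: "(bump p q has_real_derivative bump_deriv p q x) (at x)"
proof -
 have 1: "((\<lambda>x. (max 0 (x - p))^2) has_real_derivative 2 * max 0 (x - p) * 1) (at x)"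
  by (rule DERIV_chain2[OF pos_part_sq_deriv]) (auto intro!: derivative_eq_intros)
 have 2: "((\<lambda>x. (max 0 (q - x))^2) has_real_derivative 2 * max 0 (q - x) * (- 1)) (at x)"
  by (rule DERIV_chain2[OF pos_part_sq_deriv]) (auto intro!: derivative_eq_intros)
 show ?thesis using DERIV_mult[OF 1 2]
  by (simp add: bump_def[abs_def] bump_deriv_def algebra_simps)
qed

lemma bump_cont: "continuous_on A (bump p q)" "continuous_on A (bump_deriv p q)"
 unfolding bump_def[abs_def] bump_deriv_def[abs_def] by (intro continuous_intros)+

definition plateau_deriv :: "nat \<Rightarrow> real \<Rightarrow> real \<Rightarrow> real \<Rightarrow> real" where
 "plateau_deriv n p q x = real n * bump_deriv p q x / (1 + real n * bump p q x)^2"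

lemma plateau_denominator: "0 < 1 + real n * bump p q x"
 using bump_nonneg[of p q x] by (simp add: add_pos_nonneg)

lemma plateau_has_deriv: "(plateau n p q has_real_derivative plateau_deriv n p q x) (at x)"
 unfolding plateau_def[abs_def] plateau_deriv_def
 using plateau_denominator[of n p q x]
 by (auto intro!: derivative_eq_intros bump_has_deriv simp: field_simps power2_eq_square)

lemma plateau_cont: "continuous_on A (plateau n p q)" "continuous_on A (plateau_deriv n p q)"
proof -
 have "1 + real n * bump p q x \<noteq> 0" for x
  using plateau_denominator[of n p q x] by linarith
 then show "continuous_on A (plateau n p q)" "continuous_on A (plateau_deriv n p q)"
  unfolding plateau_def[abs_def] plateau_deriv_def[abs_def]
  by (auto intro!: continuous_intros bump_cont)
qed

lemma plateau_range: "0 \<le> plateau n p q x" "plateau n p q x \<le> 1"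
 using bump_nonneg[of p q x]
 by (simp_all add: plateau_def divide_le_eq_1_pos[OF plateau_denominator])

lemma plateau_zero: "x \<notin> {p<..<q} \<Longrightarrow> plateau n p q x = 0"
 by (simp add: plateau_def bump_zero)

lemma plateau_lim: "(\<lambda>n. plateau n p q x) \<longlonglongrightarrow> indicator {p<..<q} x"
proof (cases "x \<in> {p<..<q}")
 case True
 define b where "b = bump p q x"
 have "0 < b" using bump_pos[OF True] by (simp add: b_def)
 then have "(\<lambda>n. real n * b / (1 + real n * b)) \<longlonglongrightarrow> 1" by real_asymp
 then show ?thesis using True by (simp add: plateau_def b_def)
qed (simp add: plateau_zero)

lemma plateau_meas[measurable]: "plateau n p q \<in> borel_fun"
 by (rule borel_measurable_continuous_onI[OF plateau_cont(1)])

section \<open>Functions that vanish against all product tests\<close>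

lemma set_integral_restrict:
 fixes f :: "'a::euclidean_space \<Rightarrow> real"
 assumes "A \<subseteq> B" "\<And>x. x \<in> B - A \<Longrightarrow> f x = 0"
 shows "(LBINT x:B. f x) = (LBINT x:A. f x)"
 unfolding set_lebesgue_integral_def
 by (intro Bochner_Integration.integral_cong refl) (use assms in \<open>auto simp: indicator_def\<close>)

lemma set_integrable_restrict:
 fixes f :: "'a::euclidean_space \<Rightarrow> real"
 assumes "A \<subseteq> B" "\<And>x. x \<in> B - A \<Longrightarrow> f x = 0"
 shows "L1_on B f = L1_on A f"
 unfolding set_integrable_def
 by (intro Bochner_Integration.integrable_cong refl) (use assms in \<open>auto simp: indicator_def\<close>)

text \<open>Open boxes form an intersection-stable generator of the Borel sets, so by Dynkin
  induction the integral of \<open>f\<close> vanishes over every Borel set, in particular over the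
  sets where it is positive or negative.\<close>

lemma AE_zero_of_rectangles:
 fixes W :: "real \<times> real \<Rightarrow> real"
 assumes int: "L1_on ({a1<..<b1} \<times> {a2<..<b2}) W"
  and ab: "a1 < b1" "a2 < b2"
  and zero: "\<And>c1 d1 c2 d2. a1 \<le> c1 \<Longrightarrow> c1 < d1 \<Longrightarrow> d1 \<le> b1 \<Longrightarrow> a2 \<le> c2 \<Longrightarrow> c2 < d2 \<Longrightarrow> d2 \<le> b2 \<Longrightarrow>
   (LBINT p:{c1<..<d1} \<times> {c2<..<d2}. W p) = 0"
 shows "AE p\<in>{a1<..<b1} \<times> {a2<..<b2} in lborel. W p = 0"
proof -
 let ?R = "{a1<..<b1} \<times> {a2<..<b2}"
 define f where "f p = indicator ?R p *\<^sub>R W p" for p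
 have f: "integrable lborel f" using int by (simp add: f_def[abs_def] set_integrable_def)
 have [measurable]: "f \<in> borel_fun" using f by auto
 have sf: "L1_on A f" if "A \<in> sets borel" for A
  using f that unfolding set_integrable_def by (intro integrable_mult_indicator) auto
 have "(LBINT p:A. f p) = 0" if A: "A \<in> sets (borel :: (real \<times> real) measure)" for A
 proof -
  have stable: "Int_stable (range (\<lambda>(a, b). box a b :: (real \<times> real) set))"
   by (auto simp: Int_stable_def box_Int_box)
  have Pow_UNIV_sub: "range (\<lambda>(a, b). box a b :: (real \<times> real) set) \<subseteq> Pow UNIV" by simp
  have A': "A \<in> sigma_sets UNIV (range (\<lambda>(a, b). box a b))"
   using A by (simp add: borel_eq_box)
  show ?thesis
   using stable Pow_UNIV_sub A'
  proof (induction rule: sigma_sets_induct_disjoint)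
   case (basic A)
   then obtain c d where A: "A = box c d" by auto
   define l1 where "l1 = max a1 (fst c)" define r1 where "r1 = min b1 (fst d)"
   define l2 where "l2 = max a2 (snd c)" define r2 where "r2 = min b2 (snd d)"
   have "(LBINT p:A. f p) = (LBINT p:{l1<..<r1} \<times> {l2<..<r2}. W p)"
    unfolding set_lebesgue_integral_def f_def A
    by (intro Bochner_Integration.integral_cong refl)
     (auto simp: indicator_def l1_def l2_def r1_def r2_def mem_box Basis_prod_def inner_prod_def)
   also have "\<dots> = 0"
   proof (cases "l1 < r1 \<and> l2 < r2")
    case True
    then show ?thesis by (intro zero) (auto simp: l1_def l2_def r1_def r2_def)
   next
    case False
    then have "{l1<..<r1} \<times> {l2<..<r2} = {}" by auto
    then show ?thesis by (simp only:) (simp add: set_lebesgue_integral_def)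
   qed
   finally show ?case .
  next
   case empty then show ?case by (simp add: set_lebesgue_integral_def)
  next
   \<comment> \<open>Complements need the integral over the whole rectangle, which is itself one of
     the rectangles in the hypothesis.\<close>
   case (compl A)
   then have A: "A \<in> sets borel" by (simp add: borel_eq_box)
   have "(LBINT p:UNIV. f p) = (LBINT p:A. f p) + (LBINT p:UNIV - A. f p)"
    using set_integral_Un[of A "UNIV - A" lborel f] sf[OF A] sf[of "UNIV - A"] A by auto
   moreover have "(LBINT p:UNIV. f p) = (LBINT p:?R. W p)"
    by (simp add: f_def[abs_def] set_lebesgue_integral_def)
   moreover have "\<dots> = 0" by (rule zero) (use ab in auto)
   ultimately show ?case using compl by simp
  next
   case (union A)
   then have A: "A i \<in> sets borel" for i by (auto simp: borel_eq_box)
   have "(LBINT p:(\<Union>i. A i). f p) = (\<Sum>i. LBINT p:A i. f p)"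
    by (rule lebesgue_integral_countable_add)
     (use A union sf[of "\<Union>i. A i"] in \<open>auto simp: disjoint_family_on_def\<close>)
   then show ?case using union by simp
  qed
 qed
 then have Z: "(LBINT p:A. f p) = 0" if "A \<in> sets borel" for A using that by simp
 have "AE p\<in>{p. 0 < f p} in lborel. f p = 0"
  by (rule set_integral_nonneg_zero_AE[OF sf _ Z]) auto
 moreover have "AE p\<in>{p. f p < 0} in lborel. - f p = 0"
 proof (rule set_integral_nonneg_zero_AE)
  show "L1_on {p. f p < 0} (\<lambda>p. - f p)"
   using set_integrable_mult_right[of "-1" lborel "{p. f p < 0}" f] sf[of "{p. f p < 0}"] by simp
  show "(LBINT p:{p. f p < 0}. - f p) = 0"
   using Z[of "{p. f p < 0}"] set_integral_mult_right[of lborel "{p. f p < 0}" "-1" f] by simp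
 qed auto
 ultimately show ?thesis
  by eventually_elim (auto simp: f_def indicator_def split: if_splits)
qed

text \<open>Dominated convergence along the plateaus, with the absolute value of \<open>W\<close> as
  majorant.\<close>

lemma AE_zero_of_tests:
 fixes W :: "real \<times> real \<Rightarrow> real"
 assumes int: "L1_on ({a1<..<b1} \<times> {a2<..<b2}) W"
  and ab: "a1 < b1" "a2 < b2"
  and zero: "\<And>n c1 d1 c2 d2. a1 \<le> c1 \<Longrightarrow> c1 < d1 \<Longrightarrow> d1 \<le> b1 \<Longrightarrow> a2 \<le> c2 \<Longrightarrow> c2 < d2 \<Longrightarrow> d2 \<le> b2 \<Longrightarrow>
   (LBINT p:{a1<..<b1} \<times> {a2<..<b2}. W p * (tensor (plateau n c1 d1) (plateau n c2 d2) p)) = 0"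
 shows "AE p\<in>{a1<..<b1} \<times> {a2<..<b2} in lborel. W p = 0"
proof (rule AE_zero_of_rectangles[OF int ab])
 fix c1 d1 c2 d2 assume cd: "a1 \<le> c1" "c1 < d1" "d1 \<le> b1" "a2 \<le> c2" "c2 < d2" "d2 \<le> b2"
 let ?R = "{a1<..<b1} \<times> {a2<..<b2}" and ?S = "{c1<..<d1} \<times> {c2<..<d2}"
 define f where "f p = indicator ?R p *\<^sub>R W p" for p
 have f: "integrable lborel f" using int by (simp add: f_def[abs_def] set_integrable_def)
 have [measurable]: "f \<in> borel_fun" using f by auto
 have pm[measurable]: "(\<lambda>p::real\<times>real. plateau n c1 d1 (fst p) * plateau n c2 d2 (snd p)) \<in> borel_fun" for n
  by (intro borel_measurable_continuous_onI continuous_intros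
    continuous_on_compose2[OF plateau_cont(1)[of UNIV]]) auto
 have Sm[measurable]: "?S \<in> sets borel" by (auto intro!: borel_open open_Times)
 have lim: "(\<lambda>n. LBINT p. f p * (tensor (plateau n c1 d1) (plateau n c2 d2) p)) \<longlonglongrightarrow>
  (LBINT p. f p * indicator ?S p)"
 proof (rule integral_dominated_convergence[where w = "\<lambda>p. norm (f p)"])
  show "AE p in lborel. (\<lambda>n. f p * (tensor (plateau n c1 d1) (plateau n c2 d2) p)) \<longlonglongrightarrow> f p * indicator ?S p"
   unfolding indicator_times by (intro AE_I2 tendsto_intros plateau_lim)
  fix n
  show "AE p in lborel. norm (f p * (tensor (plateau n c1 d1) (plateau n c2 d2) p)) \<le> norm (f p)"
  proof (intro AE_I2)
   fix p :: "real \<times> real"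
   have "0 \<le> plateau n c1 d1 (fst p) * plateau n c2 d2 (snd p)"
    "plateau n c1 d1 (fst p) * plateau n c2 d2 (snd p) \<le> 1"
    using plateau_range by (auto intro: mult_le_one)
   then show "norm (f p * (tensor (plateau n c1 d1) (plateau n c2 d2) p)) \<le> norm (f p)"
    by (simp add: abs_mult mult_left_le)
  qed
 qed (use f in auto)
 have "(LBINT p. f p * (tensor (plateau n c1 d1) (plateau n c2 d2) p)) = 0" for n
  using zero[OF cd, of n] by (simp add: set_lebesgue_integral_def f_def mult.assoc)
 with lim have "(LBINT p. f p * indicator ?S p) = 0"
  by (simp add: LIMSEQ_const_iff)
 moreover have "(LBINT p. f p * indicator ?S p) = (LBINT p:?S. W p)"
  unfolding set_lebesgue_integral_def
  by (intro Bochner_Integration.integral_cong refl) (use cd in \<open>auto simp: f_def indicator_def\<close>)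
 ultimately show "(LBINT p:?S. W p) = 0" by simp
qed

section \<open>Product test functions and representatives along rays and circles\<close>

definition test_function :: "(real \<Rightarrow> real) \<Rightarrow> (real \<Rightarrow> real) \<Rightarrow> real \<Rightarrow> real \<Rightarrow> bool" where
 "test_function A A' p q \<longleftrightarrow> (\<forall>x. (A has_real_derivative A' x) (at x)) \<and> continuous_on UNIV A' \<and>
  (\<forall>x. x \<notin> {p..q} \<longrightarrow> A x = 0)"

lemma test_functionD:
 assumes "test_function A A' p q"
 shows "(A has_real_derivative A' x) (at x)" "continuous_on S A'" "continuous_on S A" "x \<notin> {p..q} \<Longrightarrow> A x = 0"
  "x \<notin> {p..q} \<Longrightarrow> A' x = 0" "primitive_on l r A A'"
proof -
 have d: "(A has_real_derivative A' x) (at x)" for x using assms by (simp add: test_function_def)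
 have z: "A x = 0" if "x \<notin> {p..q}" for x using assms that by (simp add: test_function_def)
 have c: "continuous_on S A'" for S using assms continuous_on_subset[of UNIV A' S] by (simp add: test_function_def)
 show "(A has_real_derivative A' x) (at x)" "x \<notin> {p..q} \<Longrightarrow> A x = 0" "continuous_on S A'"
  using d z c by auto
 show "continuous_on S A" by (intro continuous_at_imp_continuous_on ballI DERIV_isCont[OF d])
 show "primitive_on l r A A'" by (rule primitive_on_at_deriv[OF d c])
 assume x: "x \<notin> {p..q}"
 have "((\<lambda>_. 0) has_real_derivative 0) (at x)" by (auto intro!: derivative_eq_intros)
 then have "(A has_real_derivative 0) (at x)"
  by (rule has_field_derivative_transform_within_open[where S = "- {p..q}"]) (use x z in auto)
 then show "A' x = 0" using DERIV_unique[OF d] by blast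
qed

lemma plateau_test: "test_function (plateau n p q) (plateau_deriv n p q) p q"
 by (auto simp: test_function_def plateau_has_deriv plateau_cont plateau_zero)

lemma bump_test: "test_function (bump p q) (bump_deriv p q) p q"
 by (auto simp: test_function_def bump_has_deriv bump_cont bump_zero)

text \<open>A zero integral is what makes the antiderivative vanish beyond \<open>q\<close>. It
  starts at p - 1 so that \<open>p\<close> is interior to the range of integration and the two-sided
  derivative there follows from the same formula.\<close>

lemma antiderivative_test:
 assumes c: "continuous_on UNIV h" and z: "\<And>x. x \<notin> {p..q} \<Longrightarrow> h x = 0" and pq: "p \<le> q"
  and i: "integral {p..q} h = 0"
 shows "test_function (\<lambda>x. integral {p - 1..x} h) h p q"
proof -
 have io: "h integrable_on {a..b}" for a b
  by (rule integrable_continuous_real) (use c in \<open>auto intro: continuous_on_subset\<close>)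
 have left: "integral {p - 1..x} h = 0" if "x \<le> p" for x
 proof -
  have "h y = 0" if "y \<in> {p - 1..x}" "y \<noteq> p" for y using z[of y] that \<open>x \<le> p\<close> by auto
  then have "integral {p - 1..x} h = integral {p - 1..x} (\<lambda>_. 0)"
   by (intro integral_spike[of "{p}"]) auto
  then show ?thesis by simp
 qed
 have right: "integral {p - 1..x} h = 0" if "q \<le> x" for x
 proof -
  have "integral {p - 1..x} h = integral {p - 1..p} h + integral {p..x} h"
   using that pq by (intro Henstock_Kurzweil_Integration.integral_combine[symmetric] io) auto
  also have "integral {p..x} h = integral {p..q} h + integral {q..x} h"
   using that pq by (intro Henstock_Kurzweil_Integration.integral_combine[symmetric] io) auto
  also have "integral {q..x} h = integral {q..x} (\<lambda>_. 0)"
   by (intro integral_spike[of "{q}"]) (use z in auto)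
  finally show ?thesis using left[of p] i by simp
 qed
 have d: "((\<lambda>x. integral {p - 1..x} h) has_real_derivative h x) (at x)" for x
 proof (cases "x < p")
  case True
  have "((\<lambda>_. 0) has_real_derivative 0) (at x)" by (auto intro!: derivative_eq_intros)
  then have "((\<lambda>x. integral {p - 1..x} h) has_real_derivative 0) (at x)"
   by (rule has_field_derivative_transform_within_open[where S = "{..<p}"]) (use True left in auto)
  then show ?thesis using z[of x] True by simp
 next
  case False
  have "((\<lambda>x. integral {p - 1..x} h) has_real_derivative h x) (at x within {p - 1..x + 1})"
   by (rule integral_has_real_derivative) (use c False in \<open>auto intro: continuous_on_subset\<close>)
  moreover have "at x within {p - 1..x + 1} = at x"
   by (rule at_within_interior) (use False in auto)
  ultimately show ?thesis by simp
 qed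
 show ?thesis unfolding test_function_def using d c left right by (auto simp: not_le)
qed

lemma C1_compact_support_product:
 assumes A: "test_function A A' p q" and B: "test_function B B' r s" and U: "{p..q} \<times> {r..s} \<subseteq> U"
 shows "C1_compact_support U (\<lambda>x. A (fst x) * B (snd x))"
  and "pd 1 (\<lambda>x. A (fst x) * B (snd x)) x = A' (fst x) * B (snd x)"
  and "pd 2 (\<lambda>x. A (fst x) * B (snd x)) x = A (fst x) * B' (snd x)"
proof -
 have 1: "pd 1 (\<lambda>x. A (fst x) * B (snd x)) = (\<lambda>x. A' (fst x) * B (snd x))"
  unfolding pd_def fun_eq_iff
  by (auto intro!: vector_derivative_at derivative_eq_intros test_functionD(1)[OF A]
    simp flip: has_real_derivative_iff_has_vector_derivative)
 have two: "(2::2) \<noteq> 1" by simp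
 have 2: "pd 2 (\<lambda>x. A (fst x) * B (snd x)) = (\<lambda>x. A (fst x) * B' (snd x))"
  unfolding pd_def fun_eq_iff
  by (auto intro!: vector_derivative_at derivative_eq_intros test_functionD(1)[OF B]
    simp flip: has_real_derivative_iff_has_vector_derivative)
 show "pd 1 (\<lambda>x. A (fst x) * B (snd x)) x = A' (fst x) * B (snd x)"
  "pd 2 (\<lambda>x. A (fst x) * B (snd x)) x = A (fst x) * B' (snd x)" using 1 2 by simp_all
 have cA: "continuous_on UNIV (\<lambda>x::real\<times>real. A (fst x))" "continuous_on UNIV (\<lambda>x::real\<times>real. A' (fst x))"
  "continuous_on UNIV (\<lambda>x::real\<times>real. B (snd x))" "continuous_on UNIV (\<lambda>x::real\<times>real. B' (snd x))"
  by (rule continuous_on_compose2[OF test_functionD(3)[OF A, of UNIV]] continuous_on_compose2[OF test_functionD(2)[OF A, of UNIV]]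
     continuous_on_compose2[OF test_functionD(3)[OF B, of UNIV]] continuous_on_compose2[OF test_functionD(2)[OF B, of UNIV]];
     auto intro!: continuous_intros)+
 have "continuous_on UNIV (pd j (\<lambda>x. A (fst x) * B (snd x)))" for j :: 2
  using exhaust_2[of j] 1 2 cA by (auto intro!: continuous_intros)
 moreover have "(\<lambda>x. A (fst x) * B (snd x)) differentiable (at x)" for x
 proof -
  have dA: "((\<lambda>x. A (fst x)) has_derivative (\<lambda>h. fst h * A' (fst x))) (at x)"
   by (rule DERIV_compose_FDERIV[OF test_functionD(1)[OF A]]) (auto intro!: derivative_eq_intros)
  have dB: "((\<lambda>x. B (snd x)) has_derivative (\<lambda>h. snd h * B' (snd x))) (at x)"
   by (rule DERIV_compose_FDERIV[OF test_functionD(1)[OF B]]) (auto intro!: derivative_eq_intros)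
  show ?thesis unfolding differentiable_def using has_derivative_mult[OF dA dB] by blast
 qed
 moreover have "compact ({p..q} \<times> {r..s})" by (intro compact_Times) auto
 moreover have "A (fst x) * B (snd x) = 0" if "x \<notin> {p..q} \<times> {r..s}" for x
  using that test_functionD(4)[OF A, of "fst x"] test_functionD(4)[OF B, of "snd x"] by (auto simp: mem_Times_iff)
 ultimately show "C1_compact_support U (\<lambda>x. A (fst x) * B (snd x))"
  unfolding C1_compact_support_def using U by blast
qed

text \<open>Local integrability says nothing outside the open half-plane, hence the indicator;
  inside, the compact rectangles \<open>K n\<close> exhaust it and measurability passes to the
  limit.\<close>

lemma locally_integrable_measurable:
 assumes "locally_integrable f"
 shows "(\<lambda>p. indicator open_half p * f p) \<in> borel_fun"
proof (rule borel_measurable_LIMSEQ_real)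
 define K where "K n = {1 / real (Suc n)..real n} \<times> {- real n..real n}" for n
 have cK: "compact (K n)" "K n \<subseteq> open_half" for n
  by (auto simp: K_def intro!: compact_Times intro: less_le_trans[of 0 "1 / (1 + real n)"])
 show "(\<lambda>p. indicator (K n) p * f p) \<in> borel_fun" for n
  using assms cK[of n] by (auto simp: locally_integrable_def set_integrable_def)
 fix p :: "real \<times> real"
 show "(\<lambda>n. indicator (K n) p * f p) \<longlonglongrightarrow> indicator open_half p * f p"
 proof (cases "p \<in> open_half")
  case True
  have "\<forall>\<^sub>F n in sequentially. 1 / real (Suc n) \<le> fst p"
  proof -
   have "\<forall>\<^sub>F n in sequentially. inverse (real (Suc n)) < fst p"
    using order_tendstoD(2)[OF LIMSEQ_inverse_real_of_nat, of "fst p"] True by (auto simp: mem_Times_iff)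
   then show ?thesis by eventually_elim (simp add: inverse_eq_divide)
  qed
  moreover have "\<forall>\<^sub>F n in sequentially. max (fst p) \<bar>snd p\<bar> \<le> real n"
   using filterlim_real_sequentially unfolding filterlim_at_top by blast
  ultimately have "\<forall>\<^sub>F n in sequentially. indicator (K n) p * f p = indicator open_half p * f p"
   by eventually_elim (use True in \<open>auto simp: K_def indicator_def mem_Times_iff abs_le_iff\<close>)
  then show ?thesis by (rule tendsto_eventually)
 next
  case False
  then have "indicator (K n) p = (0::real)" for n using cK(2)[of n] by (auto simp: indicator_def)
  then show ?thesis using False by simp
 qed
qed

lemma set_integrable_prod:
 fixes f g :: "real \<Rightarrow> real"
 assumes f: "L1_on A f" and g: "L1_on B g"
 shows "L1_on (A \<times> B) (\<lambda>p. f (fst p) * g (snd p))"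
proof -
 define F where "F x = indicator A x *\<^sub>R f x" for x
 define K where "K x = indicator B x *\<^sub>R g x" for x
 have F: "integrable lborel F" and K: "integrable lborel K"
  using f g by (auto simp: F_def[abs_def] K_def[abs_def] set_integrable_def)
 have [measurable]: "F \<in> borel_fun" "K \<in> borel_fun" using F K by auto
 have "integrable (lborel \<Otimes>\<^sub>M lborel) (\<lambda>(s, r). F s * K r)"
 proof (rule lborel_pair.Fubini_integrable)
  show "(\<lambda>(s, r). F s * K r) \<in> borel_measurable (lborel \<Otimes>\<^sub>M lborel)" by measurable
  show "integrable lborel (\<lambda>x. LBINT y. norm (case (x, y) of (s, r) \<Rightarrow> F s * K r))"
   using F K by (simp add: abs_mult)
  show "AE x in lborel. integrable lborel (\<lambda>y. case (x, y) of (s, r) \<Rightarrow> F s * K r)"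
   using K by simp
 qed
 then have "integrable lborel (\<lambda>p. F (fst p) * K (snd p))"
  by (simp add: lborel_prod case_prod_unfold)
 moreover have "(\<lambda>p. F (fst p) * K (snd p)) = (\<lambda>p. indicator (A \<times> B) p *\<^sub>R (tensor f g p))"
  by (auto simp: F_def K_def fun_eq_iff indicator_def)
 ultimately show ?thesis by (simp add: set_integrable_def)
qed

lemma plateau_nonzero: "plateau n p q x \<noteq> 0 \<Longrightarrow> p < x \<and> x < q"
 using plateau_zero[of x p q n] by auto

lemma AE_coordinate:
 assumes "AE s in lborel. P (s :: real)"
 shows "AE p in (lborel :: (real \<times> real) measure). P (snd p)" "AE p in (lborel :: (real \<times> real) measure). P (fst p)"
proof -
 obtain N where N: "N \<in> null_sets lborel" "{s. \<not> P s} \<subseteq> N"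
  using assms by (auto simp: eventually_ae_filter)
 have "UNIV \<times> N \<in> null_sets (lborel \<Otimes>\<^sub>M lborel)" "N \<times> UNIV \<in> null_sets (lborel \<Otimes>\<^sub>M lborel)"
  using N(1) by (auto simp: null_sets_def lborel.emeasure_pair_measure_Times)
 then have null: "(UNIV \<times> N :: (real \<times> real) set) \<in> null_sets lborel" "(N \<times> UNIV :: (real \<times> real) set) \<in> null_sets lborel"
  by (simp_all add: lborel_prod)
 show "AE p in (lborel :: (real \<times> real) measure). P (snd p)"
  by (rule AE_I'[OF null(1)]) (use N(2) in auto)
 show "AE p in (lborel :: (real \<times> real) measure). P (fst p)"
  by (rule AE_I'[OF null(2)]) (use N(2) in auto)
qed

lemma test_function_endpoints:
 assumes A: "test_function A A' p q"
 shows "x \<le> p \<Longrightarrow> A x = 0" "q \<le> x \<Longrightarrow> A x = 0"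
proof -
 have c: "continuous_on UNIV A" by (rule test_functionD(3)[OF A])
 have iso: "isCont A y" for y using test_functionD(1)[OF A] DERIV_isCont by blast
 have z: "A y = 0" if "\<forall>\<^sub>F x in F. A x = 0" "F \<le> at y" "F \<noteq> bot" for y and F :: "real filter"
 proof -
  have "(A \<longlongrightarrow> A y) F" using iso[of y] that(2) by (auto simp: isCont_def intro: tendsto_mono)
  moreover have "(A \<longlongrightarrow> 0) F" using that(1) by (rule tendsto_eventually)
  ultimately show ?thesis using that(3) tendsto_unique by blast
 qed
 have "A p = 0"
  by (rule z[of "at_left p"])
   (use test_functionD(4)[OF A] in \<open>auto simp: eventually_at_filter at_within_le_at\<close>)
 then show "x \<le> p \<Longrightarrow> A x = 0" using test_functionD(4)[OF A, of x] by (cases "x = p") auto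
 have "A q = 0"
  by (rule z[of "at_right q"])
   (use test_functionD(4)[OF A] in \<open>auto simp: eventually_at_filter at_within_le_at\<close>)
 then show "q \<le> x \<Longrightarrow> A x = 0" using test_functionD(4)[OF A, of x] by (cases "x = q") auto
qed

lemma bump_integral_pos:
 assumes "a \<le> p" "p < q" "q \<le> b"
 shows "0 < integral {a..b} (bump p q)"
proof -
 have i: "bump p q integrable_on {a..b}" by (rule integrable_continuous_real) (rule bump_cont)
 have "0 \<le> integral {a..b} (bump p q)" by (rule integral_nonneg[OF i]) (simp add: bump_nonneg)
 moreover have "integral {a..b} (bump p q) \<noteq> 0"
 proof
  assume "integral {a..b} (bump p q) = 0"
  then have "(bump p q has_integral 0) (cbox a b)" using i by (metis has_integral_integral box_real(2))
  moreover have "(p + q) / 2 \<in> cbox a b" using assms by (auto simp: field_simps)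
  ultimately have "bump p q ((p + q) / 2) = 0"
   by (intro has_integral_0_cbox_imp_0[of a b "bump p q"]) (use bump_cont bump_nonneg assms in \<open>auto simp: box_real\<close>)
  then show False using bump_pos[of "(p + q) / 2" p q] assms by (auto simp: field_simps)
 qed
 ultimately show ?thesis by linarith
qed

lemma compose_fst_snd_meas:
 fixes h :: "real \<Rightarrow> real"
 assumes "h \<in> borel_fun"
 shows "(\<lambda>p::real\<times>real. h (fst p)) \<in> borel_fun" "(\<lambda>p::real\<times>real. h (snd p)) \<in> borel_fun"
proof -
 have "(fst :: real \<times> real \<Rightarrow> real) \<in> borel_fun" "(snd :: real \<times> real \<Rightarrow> real) \<in> borel_fun"
  by (intro borel_measurable_continuous_onI continuous_intros)+
 then show "(\<lambda>p::real\<times>real. h (fst p)) \<in> borel_fun" "(\<lambda>p::real\<times>real. h (snd p)) \<in> borel_fun"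
  using assms by (auto intro: measurable_compose)
qed

lemma continuous_bounded_interval:
 assumes "continuous_on {a..b} (h :: real \<Rightarrow> real)"
 obtains K where "\<And>s. s \<in> {a..b} \<Longrightarrow> \<bar>h s\<bar> \<le> K"
proof -
 have "bounded (h ` {a..b})" using assms by (intro compact_imp_bounded compact_continuous_image) auto
 then show ?thesis using that unfolding bounded_iff by (metis imageI real_norm_def)
qed

lemma set_integrable_mult_coords:
 fixes W :: "real \<times> real \<Rightarrow> real"
 assumes W: "L1_on ({a..b} \<times> {c..d}) W" "W \<in> borel_fun"
  and h: "continuous_on UNIV (h :: real \<Rightarrow> real)" "continuous_on UNIV (k :: real \<Rightarrow> real)"
 shows "L1_on ({a..b} \<times> {c..d}) (\<lambda>p. W p * (tensor h k p))"
proof -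
 obtain K where K: "\<And>s. s \<in> {a..b} \<Longrightarrow> \<bar>h s\<bar> \<le> K"
  using continuous_bounded_interval[OF continuous_on_subset[OF h(1)], of a b] by auto
 obtain L where L: "\<And>s. s \<in> {c..d} \<Longrightarrow> \<bar>k s\<bar> \<le> L"
  using continuous_bounded_interval[OF continuous_on_subset[OF h(2)], of c d] by auto
 note m = compose_fst_snd_meas[OF borel_measurable_continuous_onI[OF h(1)]]
   compose_fst_snd_meas[OF borel_measurable_continuous_onI[OF h(2)]]
 show ?thesis
 proof (rule set_integrable_bounded_mult[OF W(1), of _ "K * L"])
  fix x assume "x \<in> {a..b} \<times> {c..d}"
  then have "\<bar>h (fst x)\<bar> \<le> K" "\<bar>k (snd x)\<bar> \<le> L" using K L by auto
  then show "\<bar>h (fst x) * k (snd x)\<bar> \<le> K * L" unfolding abs_mult by (intro mult_mono) auto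
 qed (use W m in \<open>auto intro!: borel_closed closed_Times\<close>)
qed

lemma running_integral_meas:
 fixes G :: "real \<times> real \<Rightarrow> real"
 assumes [measurable]: "G \<in> borel_fun"
 shows "(\<lambda>p. LBINT s:{0..fst p}. G (s, snd p)) \<in> borel_fun"
  and "(\<lambda>p. LBINT s:{0..snd p}. G (fst p, s)) \<in> borel_fun"
proof -
 have G: "G \<in> borel_measurable (borel \<Otimes>\<^sub>M borel)" by (simp add: borel_prod)
 have 1: "(\<lambda>(p, s). indicator {0..fst p} s *\<^sub>R G (s, snd p)) \<in> borel_measurable ((borel \<Otimes>\<^sub>M borel) \<Otimes>\<^sub>M lborel)"
 proof -
  have "(\<lambda>x::(real \<times> real) \<times> real. (snd x, snd (fst x))) \<in> (borel \<Otimes>\<^sub>M borel) \<Otimes>\<^sub>M lborel \<rightarrow>\<^sub>M borel \<Otimes>\<^sub>M borel"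
   by measurable
  from measurable_compose[OF this G]
  have [measurable]: "(\<lambda>x::(real \<times> real) \<times> real. G (snd x, snd (fst x))) \<in> borel_measurable ((borel \<Otimes>\<^sub>M borel) \<Otimes>\<^sub>M lborel)" .
  have "(\<lambda>x::(real \<times> real) \<times> real. if 0 \<le> snd x \<and> snd x \<le> fst (fst x) then G (snd x, snd (fst x)) else 0) \<in> borel_measurable ((borel \<Otimes>\<^sub>M borel) \<Otimes>\<^sub>M lborel)"
   by measurable
  then show ?thesis by (simp add: case_prod_unfold indicator_def if_distrib cong: if_cong)
 qed
 have 2: "(\<lambda>(p, s). indicator {0..snd p} s *\<^sub>R G (fst p, s)) \<in> borel_measurable ((borel \<Otimes>\<^sub>M borel) \<Otimes>\<^sub>M lborel)"
 proof -
  have "(\<lambda>x::(real \<times> real) \<times> real. (fst (fst x), snd x)) \<in> (borel \<Otimes>\<^sub>M borel) \<Otimes>\<^sub>M lborel \<rightarrow>\<^sub>M borel \<Otimes>\<^sub>M borel"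
   by measurable
  from measurable_compose[OF this G]
  have [measurable]: "(\<lambda>x::(real \<times> real) \<times> real. G (fst (fst x), snd x)) \<in> borel_measurable ((borel \<Otimes>\<^sub>M borel) \<Otimes>\<^sub>M lborel)" .
  have "(\<lambda>x::(real \<times> real) \<times> real. if 0 \<le> snd x \<and> snd x \<le> snd (fst x) then G (fst (fst x), snd x) else 0) \<in> borel_measurable ((borel \<Otimes>\<^sub>M borel) \<Otimes>\<^sub>M lborel)"
   by measurable
  then show ?thesis by (simp add: case_prod_unfold indicator_def if_distrib cong: if_cong)
 qed
 show "(\<lambda>p. LBINT s:{0..fst p}. G (s, snd p)) \<in> borel_fun"
  "(\<lambda>p. LBINT s:{0..snd p}. G (fst p, s)) \<in> borel_fun"
  using lborel.borel_measurable_lebesgue_integral[OF 1] lborel.borel_measurable_lebesgue_integral[OF 2]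
  by (simp_all add: set_lebesgue_integral_def borel_prod)
qed

lemma rectangle_const_integrable:
 "L1_on {a..b::real} (\<lambda>_. k :: real)"
 by (rule continuous_set_integrable) (rule continuous_on_const)

lemma set_integral_AE_rectangle:
 fixes f g :: "real \<times> real \<Rightarrow> real"
 assumes f: "L1_on ({a..b} \<times> {c..d}) f" and g: "g \<in> borel_fun"
  and ae: "AE s\<in>{c..d} in lborel. (LBINT t:{a..b}. f (t, s)) = h s" and h: "h \<in> borel_fun"
 shows "(LBINT p:{a..b} \<times> {c..d}. f p) = (LBINT s:{c..d}. h s)"
 unfolding set_fubini(6)[OF f]
 by (rule set_integral_eq_AE(2)[OF set_fubini(5)[OF f] h, symmetric]) (use ae in \<open>auto elim!: eventually_mono\<close>)

text \<open>
 Testing Green's formula with products \<open>A t * \<beta> \<theta>\<close>, where \<open>A' = \<alpha>\<close> on the half-cylinder, shows that a function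
 with a trace is the sum of the trace and the integral of its weak derivative along almost every ray.
\<close>

lemma trace_representation:
 fixes U G1 :: "real \<times> real \<Rightarrow> real" and \<tau> :: "real \<Rightarrow> real"
 assumes m[measurable]: "U \<in> borel_fun" "G1 \<in> borel_fun" "\<tau> \<in> borel_fun"
  and zero: "\<And>p. fst p \<le> 0 \<Longrightarrow> U p = 0" "\<And>p. fst p \<le> 0 \<Longrightarrow> G1 p = 0"
  and iU: "\<And>T. L1_on (cyl T) U"
  and iG: "\<And>T. L1_on (cyl T) G1"
  and itau: "L1_on circ \<tau>"
  and weak: "\<And>\<psi>. C1_compact_support UNIV \<psi> \<Longrightarrow>
   (LBINT p:open_half. U p * pd 1 \<psi> p + G1 p * \<psi> p) = - (LBINT s. \<tau> s * \<psi> (0, s))"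
  and v: "\<And>p. v p = \<tau> (snd p) + (LBINT s:{0..fst p}. G1 (s, snd p))"
 shows "v \<in> borel_fun"
  and "AE s\<in>circ in lborel. v (0, s) = \<tau> s \<and> (\<forall>T\<ge>0. primitive_on 0 T (\<lambda>t. v (t, s)) (\<lambda>t. G1 (t, s)))"
  and "AE p\<in>{0<..} \<times> {0<..<2 * pi} in lborel. U p = v p"
proof -
 show vm[measurable]: "v \<in> borel_fun"
  unfolding v[abs_def] using running_integral_meas(1)[OF m(2)] compose_fst_snd_meas(2)[OF m(3)] by simp
 have v0: "v (0, s) = \<tau> s" for s
 proof -
  have "(LBINT r:{0..0}. G1 (r, s)) = (LBINT r:{0..0::real}. 0)"
   by (rule set_lebesgue_integral_cong) (use zero(2) in auto)
  then show ?thesis by (simp add: v)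
 qed
 have "AE s in lborel. \<forall>n::nat. s \<in> circ \<longrightarrow> L1_on {0..real n} (\<lambda>t. G1 (t, s))"
  unfolding AE_all_countable using set_fubini(4)[OF iG] by blast
 then have Gs: "AE s\<in>circ in lborel. (\<forall>T\<ge>0. primitive_on 0 T (\<lambda>t. v (t, s)) (\<lambda>t. G1 (t, s)))"
 proof (eventually_elim, intro impI allI)
  fix s T :: real assume a: "\<forall>n::nat. s \<in> circ \<longrightarrow> L1_on {0..real n} (\<lambda>t. G1 (t, s))"
   "s \<in> circ" "0 \<le> T"
  obtain n :: nat where "T \<le> real n" using real_arch_simple by blast
  then have "L1_on {0..T} (\<lambda>t. G1 (t, s))"
   using a by (auto intro: set_integrable_subset[of _ "{0..real n}"])
  then show "primitive_on 0 T (\<lambda>t. v (t, s)) (\<lambda>t. G1 (t, s))"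
  proof (rule primitive_onI)
   fix t show "v (t, s) = v (0, s) + (LBINT r:{0..t}. G1 (r, s))" using v[of "(t, s)"] v0[of s] by simp
  qed
 qed
 then show "AE s\<in>circ in lborel. v (0, s) = \<tau> s \<and> (\<forall>T\<ge>0. primitive_on 0 T (\<lambda>t. v (t, s)) (\<lambda>t. G1 (t, s)))"
  using v0 by (auto elim!: eventually_mono)
 have iv: "L1_on (cyl T) v" for T
 proof -
  define M where "M s = \<bar>\<tau> s\<bar> + (LBINT t:{0..T}. \<bar>G1 (t, s)\<bar>)" for s
  have iM: "L1_on circ M"
   unfolding M_def[abs_def]
   by (intro set_integral_add(1) set_integrable_abs itau set_fubini(5)) (rule iG)
  have iM2: "L1_on (cyl T) (\<lambda>p. M (snd p))"
   using set_integrable_prod[OF rectangle_const_integrable[of 0 T 1] iM] by simp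
  show ?thesis
  proof (rule set_integrable_bound[OF iM2])
   show "set_borel_measurable lborel (cyl T) v"
    unfolding set_borel_measurable_def by measurable
   have "AE s\<in>circ in lborel. L1_on {0..T} (\<lambda>t. G1 (t, s))"
    by (rule set_fubini(4)[OF iG])
   have bound: "\<bar>v (t, s)\<bar> \<le> \<bar>M s\<bar>" if "t \<in> {0..T}" "L1_on {0..T} (\<lambda>t. G1 (t, s))" for t s
   proof -
    have i: "L1_on {0..t} (\<lambda>t. G1 (t, s))"
     using that by (auto intro: set_integrable_subset)
    have "\<bar>LBINT r:{0..t}. G1 (r, s)\<bar> \<le> (LBINT r:{0..t}. \<bar>G1 (r, s)\<bar>)"
     unfolding set_lebesgue_integral_def
     by (rule order_trans[OF integral_abs_bound]) (simp add: abs_mult)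
    also have "\<dots> \<le> (LBINT r:{0..T}. \<bar>G1 (r, s)\<bar>)"
     unfolding set_lebesgue_integral_def
     by (rule integral_mono)
      (use set_integrable_abs[OF i] set_integrable_abs[OF that(2)] that(1) in \<open>auto simp: set_integrable_def indicator_def\<close>)
    finally show ?thesis unfolding v M_def by simp
   qed
   have "AE p in (lborel :: (real \<times> real) measure). snd p \<in> circ \<longrightarrow> L1_on {0..T} (\<lambda>t. G1 (t, snd p))"
    using AE_coordinate(1)[OF set_fubini(4)[OF iG[of T]]] .
   then show "AE p\<in>cyl T in lborel. norm (v p) \<le> norm (M (snd p))"
    by eventually_elim (use bound in auto)
  qed
 qed
 have main: "AE p\<in>{0<..<T} \<times> {0<..<2 * pi} in lborel. U p - v p = 0" if T: "0 < T" for T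
 proof (rule AE_zero_of_tests)
  have "L1_on (cyl T) (\<lambda>p. U p - v p)"
   by (rule set_integral_diff(1)[OF iU iv])
  then show "L1_on ({0<..<T} \<times> {0<..<2 * pi}) (\<lambda>p. U p - v p)"
   by (rule set_integrable_subset) (auto intro!: borel_open open_Times)
  fix n c1 d1 c2 d2 assume cd: "0 \<le> c1" "c1 < d1" "d1 \<le> T" "0 \<le> c2" "c2 < d2" "d2 \<le> 2 * pi"
  let ?C = "cyl T"
  define \<alpha> where "\<alpha> = plateau n c1 d1"
  define \<beta> where "\<beta> = plateau n c2 d2"
  \<comment> \<open>The plateau \<open>\<alpha>\<close> is corrected on t < 0, where the half-plane
    does not see it. The corrected \<open>h\<close> has integral zero, so its antiderivative
    \<open>A\<close> is a test function with derivative \<open>\<alpha>\<close> on t >= 0;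
    \<open>A\<close> may be nonzero at t = 0, which brings in the trace.\<close>
  define I where "I = integral {- 1..d1} (bump (- 1) 0)"
  have I: "0 < I" unfolding I_def by (rule bump_integral_pos) (use cd in auto)
  define K where "K = integral {- 1..d1} \<alpha> / I"
  define h where "h x = \<alpha> x - K * bump (- 1) 0 x" for x
  have ch: "continuous_on S h" for S
   unfolding h_def[abs_def] \<alpha>_def by (intro continuous_intros plateau_cont bump_cont)
  have hz: "h x = 0" if "x \<notin> {- 1..d1}" for x
   using that cd by (auto simp: h_def \<alpha>_def plateau_zero bump_zero)
  have hi: "integral {- 1..d1} h = 0"
  proof -
   have "integral {- 1..d1} h = integral {- 1..d1} \<alpha> - integral {- 1..d1} (\<lambda>x. K * bump (- 1) 0 x)"
    unfolding h_def[abs_def] \<alpha>_def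
    by (intro integral_diff integrable_continuous_real continuous_intros plateau_cont bump_cont)
   then show ?thesis using I by (simp add: K_def I_def)
  qed
  define A where "A x = integral {- 1 - 1..x} h" for x
  have tA: "test_function A h (- 1) d1"
   unfolding A_def[abs_def] by (rule antiderivative_test[OF ch hz]) (use cd hi in auto)
  have tB: "test_function \<beta> (plateau_deriv n c2 d2) c2 d2" unfolding \<beta>_def by (rule plateau_test)
  note P = C1_compact_support_product[OF tA tB, of UNIV]
  have h\<alpha>: "h t = \<alpha> t" if "0 \<le> t" for t using that by (simp add: h_def bump_zero)
  have "(LBINT p:open_half. U p * (tensor h \<beta> p) + G1 p * (tensor A \<beta> p))
   = - (LBINT s. \<tau> s * (A 0 * \<beta> s))"
   using weak[OF P(1)] P(2) by simp
  also have "(LBINT p:open_half. U p * (tensor h \<beta> p) + G1 p * (tensor A \<beta> p)) =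
   (LBINT p:?C. U p * (tensor \<alpha> \<beta> p) + G1 p * (tensor A \<beta> p))"
   unfolding set_lebesgue_integral_def
  proof (intro Bochner_Integration.integral_cong refl)
   fix p :: "real \<times> real"
   consider "fst p \<le> 0" | "0 < fst p" "fst p \<le> T" "snd p \<in> circ" | "0 < fst p" "fst p > T" | "snd p \<notin> circ"
    by linarith
   then show "indicator open_half p *\<^sub>R (U p * (tensor h \<beta> p) + G1 p * (tensor A \<beta> p)) =
    indicator ?C p *\<^sub>R (U p * (tensor \<alpha> \<beta> p) + G1 p * (tensor A \<beta> p))"
   proof cases
    case 1 then show ?thesis using zero by simp
   next
    case 2 then show ?thesis using h\<alpha>[of "fst p"] by (auto simp: indicator_def mem_Times_iff)
   next
    case 3 then show ?thesis using test_functionD(4,5)[OF tA, of "fst p"] cd by (auto simp: indicator_def mem_Times_iff)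
   next
    case 4 then have "\<beta> (snd p) = 0" using cd by (auto simp: \<beta>_def plateau_zero)
    then show ?thesis by simp
   qed
  qed
  also have "(LBINT s. \<tau> s * (A 0 * \<beta> s)) = (LBINT s:circ. A 0 * (\<tau> s * \<beta> s))"
   unfolding set_lebesgue_integral_def
   by (intro Bochner_Integration.integral_cong refl) (use cd in \<open>auto simp: indicator_def \<beta>_def dest!: plateau_nonzero\<close>)
  finally have 1: "(LBINT p:?C. U p * (tensor \<alpha> \<beta> p) + G1 p * (tensor A \<beta> p))
    = - (LBINT s:circ. A 0 * (\<tau> s * \<beta> s))" .
  have cA: "continuous_on UNIV A" by (rule test_functionD(3)[OF tA])
  have c\<alpha>: "continuous_on UNIV \<alpha>" "continuous_on UNIV \<beta>" by (simp_all add: \<alpha>_def \<beta>_def plateau_cont)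
  have \<beta>m: "\<beta> \<in> borel_fun" by (simp add: \<beta>_def)
  have iv\<alpha>: "L1_on ?C (\<lambda>p. v p * (tensor \<alpha> \<beta> p))"
    and iU\<alpha>: "L1_on ?C (\<lambda>p. U p * (tensor \<alpha> \<beta> p))"
    and iGA: "L1_on ?C (\<lambda>p. G1 p * (tensor A \<beta> p))"
   by (intro set_integrable_mult_coords iv iU iG c\<alpha> cA m vm)+
  \<comment> \<open>The representative \<open>v\<close> satisfies the same identity, by the product
    rule along almost every ray; the two identities are then subtracted.\<close>
  have 2: "(LBINT p:?C. v p * (tensor \<alpha> \<beta> p) + G1 p * (tensor A \<beta> p))
    = (LBINT s:circ. - A 0 * (\<tau> s * \<beta> s))"
  proof (rule set_integral_AE_rectangle[OF set_integral_add(1)[OF iv\<alpha> iGA] m(1)])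
   show "AE s\<in>circ in lborel. (LBINT t:{0..T}. v (t, s) * (tensor \<alpha> \<beta> (t, s)) + G1 (t, s) * (tensor A \<beta> (t, s)))
     = - A 0 * (\<tau> s * \<beta> s)"
    using Gs
   proof (eventually_elim, intro impI)
    fix s assume "s \<in> circ \<longrightarrow> (\<forall>T\<ge>0. primitive_on 0 T (\<lambda>t. v (t, s)) (\<lambda>t. G1 (t, s)))" "s \<in> circ"
    then have "primitive_on 0 T (\<lambda>t. v (t, s)) (\<lambda>t. G1 (t, s))" using T by simp
    from primitive_on_mult[OF this test_functionD(6)[OF tA]]
    have Q: "primitive_on 0 T (\<lambda>t. v (t, s) * A t) (\<lambda>t. v (t, s) * h t + G1 (t, s) * A t)" .
    have "A T = 0" by (rule test_function_endpoints(2)[OF tA cd(3)])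
    then have "(LBINT t:{0..T}. v (t, s) * h t + G1 (t, s) * A t) = - (\<tau> s * A 0)"
     using primitive_on_eq[OF Q, of T] T v0[of s] by simp
    moreover have "(LBINT t:{0..T}. v (t, s) * (tensor \<alpha> \<beta> (t, s)) + G1 (t, s) * (tensor A \<beta> (t, s))) =
     (LBINT t:{0..T}. (v (t, s) * h t + G1 (t, s) * A t) * \<beta> s)"
     by (rule set_lebesgue_integral_cong) (auto simp: h\<alpha> algebra_simps)
    ultimately show "(LBINT t:{0..T}. v (t, s) * (tensor \<alpha> \<beta> (t, s)) + G1 (t, s) * (tensor A \<beta> (t, s)))
      = - A 0 * (\<tau> s * \<beta> s)" by simp
   qed
   show "(\<lambda>s. - A 0 * (\<tau> s * \<beta> s)) \<in> borel_fun" using \<beta>m by measurable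
  qed
  have 2: "(LBINT p:?C. v p * (tensor \<alpha> \<beta> p) + G1 p * (tensor A \<beta> p))
    = - (LBINT s:circ. A 0 * (\<tau> s * \<beta> s))"
   using 2 unfolding set_integral_mult_right by simp
  have "(LBINT p:?C. (U p - v p) * (tensor \<alpha> \<beta> p)) = 0"
  proof -
   have "(LBINT p:?C. U p * (tensor \<alpha> \<beta> p)) = (LBINT p:?C. v p * (tensor \<alpha> \<beta> p))"
    using 1 2 iU\<alpha> iv\<alpha> iGA by (simp add: set_integral_add)
   then show ?thesis using iU\<alpha> iv\<alpha> by (simp add: left_diff_distrib set_integral_diff)
  qed
  moreover have "(LBINT p:?C. (U p - v p) * (tensor \<alpha> \<beta> p)) =
   (LBINT p:{0<..<T} \<times> {0<..<2 * pi}. (U p - v p) * (tensor \<alpha> \<beta> p))"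
   by (rule set_integral_restrict) (use cd in \<open>auto simp: \<alpha>_def \<beta>_def dest!: plateau_nonzero\<close>)
  ultimately show "(LBINT p:{0<..<T} \<times> {0<..<2 * pi}. (U p - v p) * (tensor (plateau n c1 d1) (plateau n c2 d2) p)) = 0"
   by (simp add: \<alpha>_def \<beta>_def)
 qed (use T in auto)
 have "AE p in lborel. \<forall>n::nat. p \<in> {0<..<real (Suc n)} \<times> {0<..<2 * pi} \<longrightarrow> U p - v p = 0"
  unfolding AE_all_countable by (intro allI main) simp
 then show "AE p\<in>{0<..} \<times> {0<..<2 * pi} in lborel. U p = v p"
 proof (eventually_elim, intro impI)
  fix p assume a: "\<forall>n::nat. p \<in> {0<..<real (Suc n)} \<times> {0<..<2 * pi} \<longrightarrow> U p - v p = 0" "p \<in> {0<..} \<times> {0<..<2 * pi}"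
  obtain n :: nat where "fst p < real n" using reals_Archimedean2 by blast
  then have "p \<in> {0<..<real (Suc n)} \<times> {0<..<2 * pi}" using a(2) by (auto simp: mem_Times_iff)
  then show "U p = v p" using a(1) by auto
 qed
qed

lemma AE_zero_imp_zero_interval:
 fixes h :: "real \<Rightarrow> real"
 assumes "continuous_on {p..q} h" "p < q" "AE x\<in>{p..q} in lborel. h x = 0" "x \<in> {p..q}"
 shows "h x = 0"
proof -
 have c: "continuous_on {p..q} (\<lambda>x. (h x)^2)" by (intro continuous_intros assms)
 have "(LBINT x:{p..q}. (h x)^2) = 0"
  unfolding set_lebesgue_integral_def
  by (rule integral_eq_zero_AE) (use assms(3) in \<open>auto simp: indicator_def elim!: eventually_mono\<close>)
 then have "((\<lambda>x. (h x)^2) has_integral 0) {p..q}"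
  using has_integral_set_lebesgue[of "{p..q}" "\<lambda>x. (h x)^2"] set_borel_integral_eq_integral[OF continuous_set_integrable[OF c]]
  by (metis has_integral_integral)
 then have "(h x)^2 = 0"
  using has_integral_0_cbox_imp_0[of p q "\<lambda>x. (h x)^2" x] c assms by (simp add: box_real)
 then show ?thesis by simp
qed

lemma AE_translate:
 fixes c :: "'a::euclidean_space"
 assumes "AE s in lborel. P s"
 shows "AE s in lborel. P (s + c)"
proof -
 have "AE s in distr lborel borel ((+) c). P s" using assms unfolding lborel_distr_plus .
 from AE_distrD[OF _ this] have "AE s in lborel. P (c + s)" by simp
 then show ?thesis by (simp add: add.commute)
qed

lemma AE_slices:
 assumes "AE p in (lborel :: (real \<times> real) measure). P p"
 shows "AE t in lborel. AE s in lborel. P (t, s)"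
 by (rule lborel_pair.AE_pair) (use assms in \<open>simp only: lborel_prod\<close>)

text \<open>Testing with angular derivatives shows that \<open>U\<close> minus the running integral
  of \<open>H\<close> does not depend on the angle (the du Bois-Reymond argument). The window of two
  periods makes it possible to compare a circle with its translate by 2 pi.\<close>

lemma angular_representation:
 fixes U H :: "real \<times> real \<Rightarrow> real"
 assumes m[measurable]: "U \<in> borel_fun" "H \<in> borel_fun"
  and iU: "\<And>c d. 0 < c \<Longrightarrow> L1_on ({c..d} \<times> {0..4 * pi}) U"
  and iH: "\<And>c d. 0 < c \<Longrightarrow> L1_on ({c..d} \<times> {0..4 * pi}) H"
  and weak: "\<And>\<psi>. C1_compact_support open_half \<psi> \<Longrightarrow>
   (LBINT p:open_half. U p * pd 2 \<psi> p) = - (LBINT p:open_half. H p * \<psi> p)"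
  and per: "\<And>t s. U (t, s + 2 * pi) = U (t, s)"
 shows "AE t in lborel. 0 < t \<longrightarrow> (\<exists>b. primitive_on 0 (2 * pi) b (\<lambda>s. H (t, s)) \<and> b (2 * pi) = b 0 \<and>
   (AE s\<in>circ in lborel. U (t, s) = b s))"
proof -
 define v where "v p = (LBINT s:{0..snd p}. H (fst p, s))" for p
 have vm[measurable]: "v \<in> borel_fun"
  unfolding v_def[abs_def] by (rule running_integral_meas(2)[OF m(2)])
 define I where "I = integral {0..4 * pi} (bump 0 (4 * pi))"
 have I: "0 < I" unfolding I_def by (rule bump_integral_pos) auto
 \<comment> \<open>The constant of integration on each circle, recovered as a weighted average with
   the bump; this involves no choice of a point and is measurable in t.\<close>
 define C where "C t = (LBINT s:{0..4 * pi}. (U (t, s) - v (t, s)) * bump 0 (4 * pi) s) / I" for t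
 have main: "AE p\<in>{c<..<d} \<times> {0<..<4 * pi} in lborel. U p - v p - C (fst p) = 0" and
  prim: "AE t\<in>{c..d} in lborel. primitive_on 0 (4 * pi) (\<lambda>s. v (t, s)) (\<lambda>s. H (t, s))"
  if cd: "0 < c" "c < d" for c d
 proof -
  let ?Q = "{c..d} \<times> {0..4 * pi}"
  have Qm: "?Q \<in> sets borel" by (auto intro!: borel_closed closed_Times)
  have v0: "v (t, 0) = 0" for t
  proof -
   have "(LBINT s:{0..0}. H (t, s)) = (LBINT s:{0..0::real}. 0)"
    unfolding set_lebesgue_integral_def
    by (rule integral_discrete_difference[where X = "{0}"]) (auto simp: indicator_def)
   then show ?thesis by (simp add: v_def)
  qed
  have Ha: "AE t\<in>{c..d} in lborel. L1_on {0..4 * pi} (\<lambda>s. H (t, s))"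
   by (rule set_fubini(1)[OF iH[OF cd(1)]])
  show prim: "AE t\<in>{c..d} in lborel. primitive_on 0 (4 * pi) (\<lambda>s. v (t, s)) (\<lambda>s. H (t, s))"
   using Ha
  proof (eventually_elim, intro impI)
   fix t assume "t \<in> {c..d} \<longrightarrow> L1_on {0..4 * pi} (\<lambda>s. H (t, s))" "t \<in> {c..d}"
   then show "primitive_on 0 (4 * pi) (\<lambda>s. v (t, s)) (\<lambda>s. H (t, s))"
    by (intro primitive_onI) (auto simp: v0, simp add: v_def)
  qed
  have iv: "L1_on ?Q v"
  proof -
   define M where "M t = (LBINT s:{0..4 * pi}. \<bar>H (t, s)\<bar>)" for t
   have iM: "L1_on {c..d} M"
    unfolding M_def[abs_def] by (intro set_integrable_abs set_fubini(2)) (rule iH[OF cd(1)])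
   have iM2: "L1_on ?Q (\<lambda>p. M (fst p))"
    using set_integrable_prod[OF iM rectangle_const_integrable[of 0 "4 * pi" 1]] by simp
   show ?thesis
   proof (rule set_integrable_bound[OF iM2])
    show "set_borel_measurable lborel ?Q v"
     unfolding set_borel_measurable_def using Qm by simp
    have bound: "\<bar>v (t, s)\<bar> \<le> \<bar>M t\<bar>" if "s \<in> {0..4 * pi}" "L1_on {0..4 * pi} (\<lambda>s. H (t, s))" for t s
    proof -
     have i: "L1_on {0..s} (\<lambda>s. H (t, s))"
      using that by (auto intro: set_integrable_subset)
     have "\<bar>LBINT r:{0..s}. H (t, r)\<bar> \<le> (LBINT r:{0..s}. \<bar>H (t, r)\<bar>)"
      unfolding set_lebesgue_integral_def
      by (rule order_trans[OF integral_abs_bound]) (simp add: abs_mult)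
     also have "\<dots> \<le> M t"
      unfolding set_lebesgue_integral_def M_def
      by (rule integral_mono)
       (use set_integrable_abs[OF i] set_integrable_abs[OF that(2)] that(1) in \<open>auto simp: set_integrable_def indicator_def\<close>)
     finally show ?thesis unfolding v_def by simp
    qed
    show "AE p\<in>?Q in lborel. norm (v p) \<le> norm (M (fst p))"
     using AE_coordinate(2)[OF Ha] by eventually_elim (use bound in auto)
   qed
  qed
  define W where "W p = U p - v p" for p
  have Wm[measurable]: "W \<in> borel_fun" unfolding W_def[abs_def] by measurable
  have iW: "L1_on ?Q W"
   unfolding W_def[abs_def] by (rule set_integral_diff(1)[OF iU[OF cd(1)] iv])
  have cb: "continuous_on UNIV (bump 0 (4 * pi))" by (rule bump_cont)
  have Cm: "C \<in> borel_fun"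
  proof -
   have "(\<lambda>p. (U p - v p) * bump 0 (4 * pi) (snd p)) \<in> borel_fun"
    using compose_fst_snd_meas(2)[OF borel_measurable_continuous_onI[OF cb]] by measurable
   from borel_slice_integral(2)[OF this, of "{0..4 * pi}"] show ?thesis
    unfolding C_def[abs_def] by simp
  qed
  have iWb: "L1_on ?Q (\<lambda>p. W p * (1 * bump 0 (4 * pi) (snd p)))"
   by (rule set_integrable_mult_coords[OF iW Wm continuous_on_const cb])
  have iC: "L1_on {c..d} C"
   using set_integrable_divide[of I, OF set_fubini(2)[OF iWb]]
   unfolding C_def[abs_def] W_def by simp
  have iC2: "L1_on ?Q (\<lambda>p. C (fst p))"
   using set_integrable_prod[OF iC rectangle_const_integrable[of 0 "4 * pi" 1]] by simp
  show "AE p\<in>{c<..<d} \<times> {0<..<4 * pi} in lborel. U p - v p - C (fst p) = 0"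
  proof (rule AE_zero_of_tests)
   have "L1_on ?Q (\<lambda>p. W p - C (fst p))"
    by (rule set_integral_diff(1)[OF iW iC2])
   then show "L1_on ({c<..<d} \<times> {0<..<4 * pi}) (\<lambda>p. U p - v p - C (fst p))"
    unfolding W_def by (rule set_integrable_subset) (auto intro!: borel_open open_Times)
   fix n c1 d1 c2 d2 assume cd': "c \<le> c1" "c1 < d1" "d1 \<le> d" "0 \<le> c2" "c2 < d2" "d2 \<le> 4 * pi"
   define \<alpha> where "\<alpha> = plateau n c1 d1"
   define \<beta> where "\<beta> = plateau n c2 d2"
   \<comment> \<open>Subtracting a multiple of the bump makes the integral zero, so that
     \<open>h\<close> is the derivative of a test function supported in the window.\<close>
   define K where "K = integral {0..4 * pi} \<beta> / I"
   define h where "h x = \<beta> x - K * bump 0 (4 * pi) x" for x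
   have c\<alpha>: "continuous_on UNIV \<alpha>" "continuous_on UNIV \<beta>" by (simp_all add: \<alpha>_def \<beta>_def plateau_cont)
   have ch: "continuous_on S h" for S
    unfolding h_def[abs_def] \<beta>_def by (intro continuous_intros plateau_cont bump_cont)
   have hz: "h x = 0" if "x \<notin> {0..4 * pi}" for x
    using that cd' by (auto simp: h_def \<beta>_def plateau_zero bump_zero)
   have hi: "integral {0..4 * pi} h = 0"
   proof -
    have "integral {0..4 * pi} h = integral {0..4 * pi} \<beta> - integral {0..4 * pi} (\<lambda>x. K * bump 0 (4 * pi) x)"
     unfolding h_def[abs_def] \<beta>_def
     by (intro integral_diff integrable_continuous_real continuous_intros plateau_cont bump_cont)
    then show ?thesis using I by (simp add: K_def I_def)
   qed
   define B where "B x = integral {0 - 1..x} h" for x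
   have tB: "test_function B h 0 (4 * pi)"
    unfolding B_def[abs_def] by (rule antiderivative_test[OF ch hz]) (use hi in auto)
   have tA: "test_function \<alpha> (plateau_deriv n c1 d1) c1 d1" unfolding \<alpha>_def by (rule plateau_test)
   have sub: "{c1..d1} \<times> {0..4 * pi} \<subseteq> open_half" using cd cd' by auto
   note P = C1_compact_support_product[OF tA tB sub]
   have cB: "continuous_on UNIV B" by (rule test_functionD(3)[OF tB])
   have ind: "(LBINT p:open_half. X p * (tensor \<alpha> Y p)) = (LBINT p:?Q. X p * (tensor \<alpha> Y p))"
    if "\<And>x. x \<notin> {0..4 * pi} \<Longrightarrow> Y x = 0" for X Y
   proof (rule set_integral_restrict)
    show "?Q \<subseteq> open_half" using cd by auto
    fix p :: "real \<times> real" assume "p \<in> open_half - ?Q"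
    then have "fst p \<notin> {c1<..<d1} \<or> snd p \<notin> {0..4 * pi}" using cd' by (auto simp: mem_Times_iff)
    then show "X p * (tensor \<alpha> Y p) = 0" using that by (auto simp: \<alpha>_def plateau_zero)
   qed
   have 1: "(LBINT p:?Q. U p * (tensor \<alpha> h p)) = - (LBINT p:?Q. H p * (tensor \<alpha> B p))"
    using weak[OF P(1)] P(3) ind[of h U] ind[of B H] hz test_functionD(4)[OF tB] by simp
   have ivh: "L1_on ?Q (\<lambda>p. v p * (tensor \<alpha> h p))"
    and iUh: "L1_on ?Q (\<lambda>p. U p * (tensor \<alpha> h p))"
    and iHB: "L1_on ?Q (\<lambda>p. H p * (tensor \<alpha> B p))"
    by (intro set_integrable_mult_coords iv iU iH cd c\<alpha> cB ch m vm)+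
   have 2: "(LBINT p:?Q. v p * (tensor \<alpha> h p) + H p * (tensor \<alpha> B p)) = 0"
    unfolding set_fubini(3)[OF set_integral_add(1)[OF ivh iHB]]
    unfolding set_lebesgue_integral_def[of lborel "{c..d}"]
   proof (rule integral_eq_zero_AE)
    show "AE t in lborel. indicator {c..d} t *\<^sub>R (LBINT s:{0..4 * pi}. v (t, s) * (tensor \<alpha> h (t, s))
      + H (t, s) * (tensor \<alpha> B (t, s))) = 0"
     using prim
    proof eventually_elim
     fix t assume a: "t \<in> {c..d} \<longrightarrow> primitive_on 0 (4 * pi) (\<lambda>s. v (t, s)) (\<lambda>s. H (t, s))"
     have "(LBINT s:{0..4 * pi}. v (t, s) * (\<alpha> t * h s) + H (t, s) * (\<alpha> t * B s)) = 0" if "t \<in> {c..d}"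
     proof -
      from a that have "primitive_on 0 (4 * pi) (\<lambda>s. v (t, s)) (\<lambda>s. H (t, s))" by blast
      from primitive_on_mult[OF this test_functionD(6)[OF tB]]
      have Q: "primitive_on 0 (4 * pi) (\<lambda>s. v (t, s) * B s) (\<lambda>s. v (t, s) * h s + H (t, s) * B s)" .
      have "(LBINT s:{0..4 * pi}. v (t, s) * h s + H (t, s) * B s) = 0"
       using primitive_on_eq[OF Q, of "4 * pi"] v0[of t] test_function_endpoints[OF tB] by simp
      moreover have "(LBINT s:{0..4 * pi}. v (t, s) * (\<alpha> t * h s) + H (t, s) * (\<alpha> t * B s)) =
       (LBINT s:{0..4 * pi}. \<alpha> t * (v (t, s) * h s + H (t, s) * B s))"
       by (rule set_lebesgue_integral_cong) (auto simp: algebra_simps)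
      ultimately show ?thesis by simp
     qed
     then show "indicator {c..d} t *\<^sub>R (LBINT s:{0..4 * pi}. v (t, s) * (tensor \<alpha> h (t, s))
      + H (t, s) * (tensor \<alpha> B (t, s))) = 0" by (simp add: indicator_def)
    qed
   qed
   have 3: "(LBINT p:?Q. W p * (tensor \<alpha> h p)) = 0"
   proof -
    have "(LBINT p:?Q. U p * (tensor \<alpha> h p)) = (LBINT p:?Q. v p * (tensor \<alpha> h p))"
     using 1 2 iUh ivh iHB by (simp add: set_integral_add)
    then show ?thesis using iUh ivh by (simp add: W_def left_diff_distrib set_integral_diff)
   qed
   have iWbeta: "L1_on ?Q (\<lambda>p. W p * (tensor \<alpha> \<beta> p))"
    and iWbump: "L1_on ?Q (\<lambda>p. W p * (tensor \<alpha> (bump 0 (4 * pi)) p))"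
    and iCbeta: "L1_on ?Q (\<lambda>p. C (fst p) * (tensor \<alpha> \<beta> p))"
    by (intro set_integrable_mult_coords iW iC2 c\<alpha> cb Wm compose_fst_snd_meas(1)[OF Cm])+
   have "(LBINT p:?Q. W p * (tensor \<alpha> h p)) =
    (LBINT p:?Q. W p * (tensor \<alpha> \<beta> p) - K * (W p * (tensor \<alpha> (bump 0 (4 * pi)) p)))"
    by (rule set_lebesgue_integral_cong) (use Qm in \<open>auto simp: h_def algebra_simps\<close>)
   also have "\<dots> = (LBINT p:?Q. W p * (tensor \<alpha> \<beta> p)) - K * (LBINT p:?Q. W p * (tensor \<alpha> (bump 0 (4 * pi)) p))"
    using iWbeta iWbump by (simp add: set_integral_diff)
   also have "K * (LBINT p:?Q. W p * (tensor \<alpha> (bump 0 (4 * pi)) p)) =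
    (LBINT p:?Q. C (fst p) * (tensor \<alpha> \<beta> p))"
   proof -
    have "(LBINT p:?Q. W p * (tensor \<alpha> (bump 0 (4 * pi)) p)) = (LBINT t:{c..d}. \<alpha> t * (I * C t))"
     unfolding set_fubini(3)[OF iWbump]
    proof (rule set_lebesgue_integral_cong)
     show "\<forall>t. t \<in> {c..d} \<longrightarrow> (LBINT s:{0..4 * pi}. W (t, s) * (tensor \<alpha> (bump 0 (4 * pi)) (t, s))) = \<alpha> t * (I * C t)"
     proof (intro allI impI)
      fix t
      have "(LBINT s:{0..4 * pi}. W (t, s) * (tensor \<alpha> (bump 0 (4 * pi)) (t, s))) =
       (LBINT s:{0..4 * pi}. \<alpha> t * (W (t, s) * bump 0 (4 * pi) s))"
       by (rule set_lebesgue_integral_cong) auto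
      then show "(LBINT s:{0..4 * pi}. W (t, s) * (tensor \<alpha> (bump 0 (4 * pi)) (t, s))) = \<alpha> t * (I * C t)"
       using I by (simp add: C_def W_def)
     qed
    qed simp
    moreover have "(LBINT p:?Q. C (fst p) * (tensor \<alpha> \<beta> p)) = (LBINT t:{c..d}. (integral {0..4 * pi} \<beta>) * (\<alpha> t * C t))"
     unfolding set_fubini(3)[OF iCbeta]
    proof (rule set_lebesgue_integral_cong)
     have ib: "(LBINT s:{0..4 * pi}. \<beta> s) = integral {0..4 * pi} \<beta>"
      by (rule set_borel_integral_eq_integral(2)) (intro continuous_set_integrable continuous_on_subset[OF c\<alpha>(2)] subset_UNIV)
     show "\<forall>t. t \<in> {c..d} \<longrightarrow> (LBINT s:{0..4 * pi}. C (fst (t, s)) * (tensor \<alpha> \<beta> (t, s))) =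
       (integral {0..4 * pi} \<beta>) * (\<alpha> t * C t)"
     proof (intro allI impI)
      fix t
      have "(LBINT s:{0..4 * pi}. C (fst (t, s)) * (tensor \<alpha> \<beta> (t, s))) =
       (LBINT s:{0..4 * pi}. (\<alpha> t * C t) * \<beta> s)"
       by (rule set_lebesgue_integral_cong) auto
      then show "(LBINT s:{0..4 * pi}. C (fst (t, s)) * (tensor \<alpha> \<beta> (t, s))) =
       (integral {0..4 * pi} \<beta>) * (\<alpha> t * C t)" using ib by simp
     qed
    qed simp
    moreover have "(LBINT t:{c..d}. \<alpha> t * (I * C t)) = I * (LBINT t:{c..d}. \<alpha> t * C t)"
     unfolding set_integral_mult_right[symmetric] by (simp add: mult.left_commute)
    ultimately show ?thesis using I by (simp add: K_def)
   qed
   finally have "(LBINT p:?Q. (W p - C (fst p)) * (tensor \<alpha> \<beta> p)) = 0"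
    using 3 iWbeta iCbeta by (simp add: left_diff_distrib set_integral_diff)
   moreover have "(LBINT p:?Q. (W p - C (fst p)) * (tensor \<alpha> \<beta> p)) =
    (LBINT p:{c<..<d} \<times> {0<..<4 * pi}. (W p - C (fst p)) * (tensor \<alpha> \<beta> p))"
    by (rule set_integral_restrict) (use cd' in \<open>auto simp: \<alpha>_def \<beta>_def dest!: plateau_nonzero\<close>)
   ultimately show "(LBINT p:{c<..<d} \<times> {0<..<4 * pi}. (U p - v p - C (fst p)) * (tensor (plateau n c1 d1) (plateau n c2 d2) p)) = 0"
    by (simp add: \<alpha>_def \<beta>_def W_def)
  qed (use cd in auto)
 qed
 \<comment> \<open>With n + 2 the rectangle is nonempty for every n, since 1 / (n + 2) < n +
   2.\<close>
 have A1: "AE t in lborel. \<forall>n::nat. AE s in lborel. (t, s) \<in> {1 / real (n + 2)<..<real (n + 2)} \<times> {0<..<4 * pi} \<longrightarrow>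
   U (t, s) - v (t, s) - C (fst (t, s)) = 0"
  unfolding AE_all_countable
  by (intro allI AE_slices main) (auto simp: field_simps intro!: add_pos_nonneg)
 have A2: "AE t in lborel. \<forall>n::nat. t \<in> {1 / real (n + 2)..real (n + 2)} \<longrightarrow> primitive_on 0 (4 * pi) (\<lambda>s. v (t, s)) (\<lambda>s. H (t, s))"
  unfolding AE_all_countable
  by (intro allI prim) (auto simp: field_simps intro!: add_pos_nonneg)
 show ?thesis
  using A1 A2
 proof (eventually_elim, intro impI)
  fix t :: real assume a1: "\<forall>n::nat. AE s in lborel. (t, s) \<in> {1 / real (n + 2)<..<real (n + 2)} \<times> {0<..<4 * pi} \<longrightarrow>
    U (t, s) - v (t, s) - C (fst (t, s)) = 0"
   and a2: "\<forall>n::nat. t \<in> {1 / real (n + 2)..real (n + 2)} \<longrightarrow> primitive_on 0 (4 * pi) (\<lambda>s. v (t, s)) (\<lambda>s. H (t, s))"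
   and t: "0 < t"
  obtain n :: nat where n: "max t (1 / t) < real n" using reals_Archimedean2 by blast
  then have n': "1 / real (n + 2) < t" "t < real (n + 2)" using t by (auto simp: field_simps)
  define b where "b s = C t + v (t, s)" for s
  have pv: "primitive_on 0 (4 * pi) (\<lambda>s. v (t, s)) (\<lambda>s. H (t, s))"
  proof -
   have "t \<in> {1 / real (n + 2)..real (n + 2)}" using n' by simp
   then show ?thesis using a2 by blast
  qed
  have pb: "primitive_on 0 (4 * pi) b (\<lambda>s. H (t, s))"
   using primitive_on_add[OF primitive_on_const[of _ _ "C t"] pv] by (simp add: b_def[abs_def])
  have ub: "AE s\<in>{0<..<4 * pi} in lborel. U (t, s) = b s"
   using spec[OF a1, of n] by eventually_elim (use n' in \<open>auto simp: b_def\<close>)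
  have nn: "AE s in lborel. s \<noteq> 0 \<and> s \<noteq> 2 * pi" using AE_lborel_singleton[of 0] AE_lborel_singleton[of "2 * pi"] by eventually_elim simp
  \<comment> \<open>Periodicity of \<open>U\<close> gives b (s + 2 pi) = b s almost everywhere on
    the first period; continuity extends it to s = 0.\<close>
  have "b (0 + 2 * pi) - b 0 = 0"
  proof (rule AE_zero_imp_zero_interval[of 0 "2 * pi" "\<lambda>s. b (s + 2 * pi) - b s"])
   note cbb = primitive_on_continuous[OF pb]
   show "continuous_on circ (\<lambda>s. b (s + 2 * pi) - b s)"
    by (intro continuous_intros continuous_on_compose2[OF cbb] continuous_on_subset[OF cbb]) auto
   show "AE s\<in>circ in lborel. b (s + 2 * pi) - b s = 0"
    using ub AE_translate[OF ub, of "2 * pi"] nn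
   proof (eventually_elim, intro impI)
    fix s assume "s \<in> {0<..<4 * pi} \<longrightarrow> U (t, s) = b s" "s + 2 * pi \<in> {0<..<4 * pi} \<longrightarrow> U (t, s + 2 * pi) = b (s + 2 * pi)"
     "s \<noteq> 0 \<and> s \<noteq> 2 * pi" "s \<in> circ"
    then show "b (s + 2 * pi) - b s = 0" using per[of t s] by auto
   qed
  qed auto
  moreover have "primitive_on 0 (2 * pi) b (\<lambda>s. H (t, s))"
   by (rule primitive_on_subinterval[OF pb]) auto
  moreover have "AE s\<in>circ in lborel. U (t, s) = b s"
   using ub nn by eventually_elim auto
  ultimately show "\<exists>b. primitive_on 0 (2 * pi) b (\<lambda>s. H (t, s)) \<and> b (2 * pi) = b 0 \<and>
   (AE s\<in>circ in lborel. U (t, s) = b s)" by auto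
 qed
qed

section \<open>Uniqueness of weak gradients and traces\<close>

lemma set_integrable_open_closed:
 fixes f :: "real \<times> real \<Rightarrow> real"
 assumes "locally_integrable f" "0 < a"
 shows "L1_on ({a..b} \<times> {c..d}) f"
proof -
 have "compact ({a..b} \<times> {c..d})" "{a..b} \<times> {c..d} \<subseteq> open_half"
  using assms(2) by (auto intro!: compact_Times)
 then show ?thesis using assms(1) unfolding locally_integrable_def by blast
qed

lemma set_integrable_indicator_open_half:
 fixes f :: "real \<times> real \<Rightarrow> real"
 assumes "A \<subseteq> open_half"
 shows "L1_on A (\<lambda>p. indicator open_half p * f p) = L1_on A f"
 unfolding set_integrable_def
 by (intro Bochner_Integration.integrable_cong refl) (use assms in \<open>auto simp: indicator_def\<close>)

text \<open>\<open>weak_grad\<close> is an arbitrary choice; this is what allows it to be replaced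
  by an explicit gradient. Products of plateaus on exhausting rectangles separate two
  candidates.\<close>

lemma weak_grad_unique:
 assumes G: "is_weak_grad u G" and G': "is_weak_grad u G'"
 shows "AE p\<in>open_half in lborel. G p = G' p"
proof -
 have comp: "AE p\<in>open_half in lborel. G p $ j = G' p $ j" for j
 proof -
  define A where "A p = indicator open_half p * G p $ j" for p
  define B where "B p = indicator open_half p * G' p $ j" for p
  have l: "locally_integrable (\<lambda>p. G p $ j)" "locally_integrable (\<lambda>p. G' p $ j)"
   using G G' by (auto simp: is_weak_grad_def)
  have m: "A \<in> borel_fun" "B \<in> borel_fun"
   unfolding A_def[abs_def] B_def[abs_def] by (intro locally_integrable_measurable l)+
  have box: "AE p\<in>{1 / real (n + 2)<..<real (n + 2)} \<times> {- real (n + 2)<..<real (n + 2)} in lborel. A p - B p = 0" for n :: nat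
  proof (rule AE_zero_of_tests)
   let ?R = "{1 / real (n + 2)<..<real (n + 2)} \<times> {- real (n + 2)<..<real (n + 2)}"
   let ?Q = "{1 / real (n + 2)..real (n + 2)} \<times> {- real (n + 2)..real (n + 2)}"
   have sub: "?Q \<subseteq> open_half"
   proof
    fix p assume "p \<in> ?Q"
    then have "1 / real (n + 2) \<le> fst p" by auto
    moreover have "0 < 1 / real (n + 2)" by simp
    ultimately have "0 < fst p" by linarith
    then show "p \<in> open_half" by (simp add: mem_Times_iff)
   qed
   have i: "L1_on ?Q A" "L1_on ?Q B"
    unfolding A_def[abs_def] B_def[abs_def] set_integrable_indicator_open_half[OF sub]
    by (intro set_integrable_open_closed l; simp)+
   show "L1_on ?R (\<lambda>p. A p - B p)"
    by (rule set_integrable_subset[OF set_integral_diff(1)[OF i]]) (auto intro!: borel_open open_Times)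
   fix k c1 d1 c2 d2 assume cd: "1 / real (n + 2) \<le> c1" "c1 < d1" "d1 \<le> real (n + 2)"
    "- real (n + 2) \<le> c2" "c2 < d2" "d2 \<le> real (n + 2)"
   have "0 < 1 / real (n + 2)" by simp
   then have c1: "0 < c1" using cd(1) by linarith
   have U: "{c1..d1} \<times> {c2..d2} \<subseteq> open_half" using c1 by auto
   note P = C1_compact_support_product(1)[OF plateau_test[of k c1 d1] plateau_test[of k c2 d2] U]
   have "(LBINT p:open_half. G p $ j * (tensor (plateau k c1 d1) (plateau k c2 d2) p)) =
    (LBINT p:open_half. G' p $ j * (tensor (plateau k c1 d1) (plateau k c2 d2) p))"
   proof -
    have "(LBINT p:open_half. u p * pd j (\<lambda>x. plateau k c1 d1 (fst x) * plateau k c2 d2 (snd x)) p) =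
      - (LBINT p:open_half. G p $ j * (tensor (plateau k c1 d1) (plateau k c2 d2) p))"
     using G P unfolding is_weak_grad_def by blast
    moreover have "(LBINT p:open_half. u p * pd j (\<lambda>x. plateau k c1 d1 (fst x) * plateau k c2 d2 (snd x)) p) =
      - (LBINT p:open_half. G' p $ j * (tensor (plateau k c1 d1) (plateau k c2 d2) p))"
     using G' P unfolding is_weak_grad_def by blast
    ultimately show ?thesis by linarith
   qed
   moreover have r: "(LBINT p:open_half. Z p $ j * (tensor (plateau k c1 d1) (plateau k c2 d2) p)) =
    (LBINT p:?Q. (indicator open_half p * Z p $ j) * (tensor (plateau k c1 d1) (plateau k c2 d2) p))" for Z :: "real \<times> real \<Rightarrow> real^2"
    unfolding set_lebesgue_integral_def
    by (intro Bochner_Integration.integral_cong refl)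
     (use cd c1 sub in \<open>auto simp: indicator_def dest!: plateau_nonzero\<close>)
   moreover have "L1_on ?Q (\<lambda>p. A p * (tensor (plateau k c1 d1) (plateau k c2 d2) p))"
     "L1_on ?Q (\<lambda>p. B p * (tensor (plateau k c1 d1) (plateau k c2 d2) p))"
    by (intro set_integrable_mult_coords i m plateau_cont)+
   ultimately have "(LBINT p:?Q. (A p - B p) * (tensor (plateau k c1 d1) (plateau k c2 d2) p)) = 0"
    by (simp add: A_def B_def left_diff_distrib set_integral_diff)
   moreover have "(LBINT p:?Q. (A p - B p) * (tensor (plateau k c1 d1) (plateau k c2 d2) p)) =
    (LBINT p:?R. (A p - B p) * (tensor (plateau k c1 d1) (plateau k c2 d2) p))"
    by (rule set_integral_restrict) (use cd in \<open>auto dest!: plateau_nonzero\<close>)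
   ultimately show "(LBINT p:?R. (A p - B p) * (tensor (plateau k c1 d1) (plateau k c2 d2) p)) = 0" by simp
  qed (auto simp: field_simps intro!: add_pos_nonneg)
  have "AE p in lborel. \<forall>n::nat. p \<in> {1 / real (n + 2)<..<real (n + 2)} \<times> {- real (n + 2)<..<real (n + 2)} \<longrightarrow> A p - B p = 0"
   unfolding AE_all_countable using box by blast
  then show ?thesis
  proof (eventually_elim, intro impI)
   fix p :: "real \<times> real" assume a: "\<forall>n::nat. p \<in> {1 / real (n + 2)<..<real (n + 2)} \<times> {- real (n + 2)<..<real (n + 2)} \<longrightarrow> A p - B p = 0"
    and p: "p \<in> open_half"
   have p0: "0 < fst p" using p by (auto simp: mem_Times_iff)
   obtain n :: nat where n: "max (max (fst p) (1 / fst p)) \<bar>snd p\<bar> < real n" using reals_Archimedean2 by blast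
   have "1 / real (n + 2) < fst p" using n p0 by (auto simp: field_simps)
   then have "A p - B p = 0" using a n by (auto simp: mem_Times_iff abs_less_iff)
   then show "G p $ j = G' p $ j" using p by (simp add: A_def B_def)
  qed
 qed
 show ?thesis
  using comp[of 1] comp[of 2] by eventually_elim (auto simp: vec_eq_iff forall_2)
qed

text \<open>The planar vanishing criterion is reused for functions on the line by extending them
  constantly in t over (0, 1).\<close>

lemma trace_unique:
 assumes t: "has_trace u \<tau>" and t': "has_trace u \<tau>'"
 shows "AE s in lborel. \<tau> s = \<tau>' s"
proof -
 have m[measurable]: "\<tau> \<in> borel_fun" "\<tau>' \<in> borel_fun"
  using t t' by (auto simp: has_trace_def)
 have i: "L1_on {a..b} \<tau>" "L1_on {a..b} \<tau>'" for a b
  by (rule set_integrable_L1_L2; use t t' in \<open>simp add: has_trace_def emeasure_lborel_Icc_eq\<close>)+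
 have box: "AE p\<in>{0<..<1::real} \<times> {- real (n + 1)<..<real (n + 1)} in lborel. \<tau> (snd p) - \<tau>' (snd p) = 0" for n :: nat
 proof (rule AE_zero_of_tests[where W = "\<lambda>p. \<tau> (snd p) - \<tau>' (snd p)"])
  let ?R = "{0<..<1} \<times> {- real (n + 1)<..<real (n + 1)} :: (real \<times> real) set"
  let ?J = "{- real (n + 1)..real (n + 1)}"
  let ?Q = "{0..1::real} \<times> ?J"
  have d: "L1_on ?J (\<lambda>s. \<tau> s - \<tau>' s)" by (rule set_integral_diff(1)[OF i])
  have iQ: "L1_on ?Q (\<lambda>p. \<tau> (snd p) - \<tau>' (snd p))"
   using set_integrable_prod[OF rectangle_const_integrable[of 0 1 1] d] by simp
  then show "L1_on ?R (\<lambda>p. \<tau> (snd p) - \<tau>' (snd p))"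
   by (rule set_integrable_subset) (auto intro!: borel_open open_Times)
  fix k and c1 d1 c2 d2 :: real assume cd: "0 \<le> c1" "c1 < d1" "d1 \<le> 1" "- real (n + 1) \<le> c2" "c2 < d2" "d2 \<le> real (n + 1)"
  define \<beta> where "\<beta> = plateau k c2 d2"
  have c\<beta>: "continuous_on UNIV \<beta>" by (simp add: \<beta>_def plateau_cont)
  note P = C1_compact_support_product(1)[OF bump_test[of "- 1" 1] plateau_test[of k c2 d2] subset_UNIV]
  \<comment> \<open>The value 1 at t = 0 makes the test function restrict to \<open>\<beta>\<close>
    on the boundary line.\<close>
  have b1: "bump (- 1) 1 0 = 1" by (simp add: bump_def)
  have "(LBINT s. \<tau> s * \<beta> s) = (LBINT s. \<tau>' s * \<beta> s)"
  proof -
   let ?\<psi> = "\<lambda>x. bump (- 1) 1 (fst x) * plateau k c2 d2 (snd x)"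
   have "(LBINT p:open_half. u p * pd 1 ?\<psi> p + weak_grad u p $ 1 * ?\<psi> p) = - (LBINT s. \<tau> s * ?\<psi> (0, s))"
    using t P unfolding has_trace_def by blast
   moreover have "(LBINT p:open_half. u p * pd 1 ?\<psi> p + weak_grad u p $ 1 * ?\<psi> p) = - (LBINT s. \<tau>' s * ?\<psi> (0, s))"
    using t' P unfolding has_trace_def by blast
   ultimately show ?thesis by (simp add: b1 \<beta>_def)
  qed
  moreover have r: "(LBINT s. f s * \<beta> s) = (LBINT s:?J. f s * \<beta> s)" for f
   unfolding set_lebesgue_integral_def
   by (intro Bochner_Integration.integral_cong refl)
    (use cd in \<open>auto simp: indicator_def \<beta>_def dest!: plateau_nonzero\<close>)
  moreover have "L1_on ?J (\<lambda>s. \<tau> s * \<beta> s)" "L1_on ?J (\<lambda>s. \<tau>' s * \<beta> s)"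
   by (intro set_integrable_mult_continuous i continuous_on_subset[OF c\<beta>] subset_UNIV)+
  ultimately have z: "(LBINT s:?J. (\<tau> s - \<tau>' s) * \<beta> s) = 0"
   by (simp add: left_diff_distrib set_integral_diff)
  have iQ2: "L1_on ?Q (\<lambda>p. (\<tau> (snd p) - \<tau>' (snd p)) * (tensor (plateau k c1 d1) \<beta> p))"
   by (rule set_integrable_mult_coords[OF iQ]) (use compose_fst_snd_meas(2)[OF m(1)] compose_fst_snd_meas(2)[OF m(2)] c\<beta> plateau_cont in auto)
  have "(LBINT p:?Q. (\<tau> (snd p) - \<tau>' (snd p)) * (tensor (plateau k c1 d1) \<beta> p)) = (LBINT t:{0..1}. plateau k c1 d1 t * 0)"
   unfolding set_fubini(3)[OF iQ2]
  proof (rule set_lebesgue_integral_cong)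
   show "\<forall>t. t \<in> {0..1} \<longrightarrow> (LBINT s:?J. (\<tau> (snd (t, s)) - \<tau>' (snd (t, s))) * (tensor (plateau k c1 d1) \<beta> (t, s))) = plateau k c1 d1 t * 0"
   proof (intro allI impI)
    fix t :: real
    have "(LBINT s:?J. (\<tau> (snd (t, s)) - \<tau>' (snd (t, s))) * (tensor (plateau k c1 d1) \<beta> (t, s))) =
     (LBINT s:?J. plateau k c1 d1 t * ((\<tau> s - \<tau>' s) * \<beta> s))"
     by (rule set_lebesgue_integral_cong) auto
    then show "(LBINT s:?J. (\<tau> (snd (t, s)) - \<tau>' (snd (t, s))) * (tensor (plateau k c1 d1) \<beta> (t, s))) = plateau k c1 d1 t * 0"
     using z by simp
   qed
  qed simp
  moreover have "(LBINT p:?Q. (\<tau> (snd p) - \<tau>' (snd p)) * (tensor (plateau k c1 d1) \<beta> p)) =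
   (LBINT p:?R. (\<tau> (snd p) - \<tau>' (snd p)) * (tensor (plateau k c1 d1) \<beta> p))"
   by (rule set_integral_restrict) (use cd in \<open>auto simp: \<beta>_def dest!: plateau_nonzero\<close>)
  ultimately show "(LBINT p:?R. (\<tau> (snd p) - \<tau>' (snd p)) * (tensor (plateau k c1 d1) (plateau k c2 d2) p)) = 0"
   by (simp add: \<beta>_def)
 qed auto
 have "AE s\<in>{- real (n + 1)<..<real (n + 1)} in lborel. \<tau> s - \<tau>' s = 0" for n :: nat
 proof -
  have ae: "AE t in lborel. AE s in lborel. (t, s) \<in> {0<..<1::real} \<times> {- real (n + 1)<..<real (n + 1)} \<longrightarrow> \<tau> (snd (t, s)) - \<tau>' (snd (t, s)) = 0"
   by (rule AE_slices[OF box])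
  have "\<exists>t\<in>{0<..<1::real}. AE s in lborel. (t, s) \<in> {0<..<1::real} \<times> {- real (n + 1)<..<real (n + 1)} \<longrightarrow> \<tau> (snd (t, s)) - \<tau>' (snd (t, s)) = 0"
  proof (rule ccontr)
   assume "\<not> ?thesis"
   then have "AE t in lborel. t \<notin> {0<..<1::real}" using ae by (auto elim!: eventually_mono)
   then have "emeasure lborel {0<..<1::real} = 0" by (subst AE_iff_measurable[symmetric, of _ lborel "\<lambda>t. t \<notin> {0<..<1}"]) auto
   then show False by simp
  qed
  then show ?thesis by (auto elim!: eventually_mono)
 qed
 then have "AE s in lborel. \<forall>n::nat. s \<in> {- real (n + 1)<..<real (n + 1)} \<longrightarrow> \<tau> s - \<tau>' s = 0"
  unfolding AE_all_countable by blast
 then show ?thesis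
 proof eventually_elim
  fix s assume a: "\<forall>n::nat. s \<in> {- real (n + 1)<..<real (n + 1)} \<longrightarrow> \<tau> s - \<tau>' s = 0"
  obtain n :: nat where "\<bar>s\<bar> < real n" using reals_Archimedean2 by blast
  then have "s \<in> {- real (n + 1)<..<real (n + 1)}" by (auto simp: abs_less_iff)
  then show "\<tau> s = \<tau>' s" using spec[OF a, of n] by simp
 qed
qed

section \<open>Weak gradients and traces of separated functions\<close>

lemma C1_compact_supportD:
 assumes "C1_compact_support U \<psi>"
 obtains M where "0 < M" "\<And>t s. M \<le> \<bar>t\<bar> \<or> M \<le> \<bar>s\<bar> \<Longrightarrow> \<psi> (t, s) = 0 \<and> pd 1 \<psi> (t, s) = 0 \<and> pd 2 \<psi> (t, s) = 0"
  "\<And>t s. ((\<lambda>t. \<psi> (t, s)) has_real_derivative pd 1 \<psi> (t, s)) (at t)"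
  "\<And>t s. ((\<lambda>s. \<psi> (t, s)) has_real_derivative pd 2 \<psi> (t, s)) (at s)"
  "continuous_on UNIV \<psi>" "continuous_on UNIV (pd 1 \<psi>)" "continuous_on UNIV (pd 2 \<psi>)"
  "\<And>t s. (t, s) \<notin> U \<Longrightarrow> \<psi> (t, s) = 0"
proof -
 obtain K where K: "compact K" "K \<subseteq> U" "\<And>p. p \<notin> K \<Longrightarrow> \<psi> p = 0"
  and d: "\<And>p. \<psi> differentiable (at p)" and c: "\<And>j. continuous_on UNIV (pd j \<psi>)"
  using assms by (auto simp: C1_compact_support_def)
 obtain B where B: "\<And>p. p \<in> K \<Longrightarrow> norm p \<le> B" using compact_imp_bounded[OF K(1)] by (auto simp: bounded_iff)
 \<comment> \<open>The margin 1 makes the function vanish near every point with a coordinate of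
   absolute value at least \<open>M\<close>, so that its partial derivatives vanish there as
   well.\<close>
 define M where "M = \<bar>B\<bar> + 1"
 have z: "\<psi> (t, s) = 0" if "M - 1 < \<bar>t\<bar> \<or> M - 1 < \<bar>s\<bar>" for t s
 proof (rule K(3), rule notI)
  assume "(t, s) \<in> K"
  then have "norm (t, s) \<le> B" by (rule B)
  then show False using that norm_fst_le[of t s] norm_snd_le[of s t] by (auto simp: M_def)
 qed
 have two: "(2::2) \<noteq> 1" by simp
 have d1: "((\<lambda>t. \<psi> (t, s)) has_real_derivative pd 1 \<psi> (t, s)) (at t)" for t s
 proof -
  have "(\<lambda>t. \<psi> (t, s)) differentiable (at t)"
   by (rule differentiable_compose[where f = \<psi> and g = "\<lambda>t. (t, s)", OF d]) (auto intro!: derivative_intros simp: differentiable_def)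
  then show ?thesis
   by (simp add: pd_def has_real_derivative_iff_has_vector_derivative vector_derivative_works[symmetric])
 qed
 have d2: "((\<lambda>s. \<psi> (t, s)) has_real_derivative pd 2 \<psi> (t, s)) (at s)" for t s
 proof -
  have "(\<lambda>s. \<psi> (t, s)) differentiable (at s)"
   by (rule differentiable_compose[where f = \<psi> and g = "\<lambda>s. (t, s)", OF d]) (auto intro!: derivative_intros simp: differentiable_def)
  then show ?thesis
   by (simp add: pd_def has_real_derivative_iff_has_vector_derivative vector_derivative_works[symmetric])
 qed
 have zd: "pd 1 \<psi> (t, s) = 0 \<and> pd 2 \<psi> (t, s) = 0" if "M \<le> \<bar>t\<bar> \<or> M \<le> \<bar>s\<bar>" for t s
 proof -
  have op: "open {x::real. M - 1 < \<bar>x\<bar>}" by (intro open_Collect_less continuous_intros)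
  have "((\<lambda>t. \<psi> (t, s)) has_real_derivative 0) (at t)"
  proof (cases "M \<le> \<bar>s\<bar>")
   case True then show ?thesis using z by simp
  next
   case False
   have "((\<lambda>_. 0) has_real_derivative 0) (at t)" by simp
   then show ?thesis
    by (rule has_field_derivative_transform_within_open[OF _ op]) (use that False z in auto)
  qed
  moreover have "((\<lambda>s. \<psi> (t, s)) has_real_derivative 0) (at s)"
  proof (cases "M \<le> \<bar>t\<bar>")
   case True then show ?thesis using z by simp
  next
   case False
   have "((\<lambda>_. 0) has_real_derivative 0) (at s)" by simp
   then show ?thesis
    by (rule has_field_derivative_transform_within_open[OF _ op]) (use that False z in auto)
  qed
  ultimately show ?thesis using DERIV_unique d1 d2 by blast
 qed
 have cp: "continuous_on UNIV \<psi>"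
  using d by (intro continuous_at_imp_continuous_on ballI differentiable_imp_continuous_within)
 show ?thesis
 proof (rule that)
  show "0 < M" by (simp add: M_def)
  show "\<psi> (t, s) = 0 \<and> pd 1 \<psi> (t, s) = 0 \<and> pd 2 \<psi> (t, s) = 0" if "M \<le> \<bar>t\<bar> \<or> M \<le> \<bar>s\<bar>" for t s
   using z[of t s] zd[OF that] that by auto
  show "\<psi> (t, s) = 0" if "(t, s) \<notin> U" for t s using K that by blast
 qed (use d1 d2 cp c in auto)
qed

lemma half_plane_integral:
 fixes Y :: "real \<times> real \<Rightarrow> real"
 assumes Y: "Y \<in> borel_fun" "L1_on ({0..M} \<times> {- M..M}) Y"
  and zero: "\<And>t s. M \<le> \<bar>t\<bar> \<or> M \<le> \<bar>s\<bar> \<Longrightarrow> Y (t, s) = 0"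
 shows "L1_on open_half Y"
  and "(LBINT p:open_half. Y p) = (LBINT p:{0..M} \<times> {- M..M}. Y p)"
proof -
 have m: "open_half \<in> sets (borel :: (real \<times> real) measure)"
  by (intro borel_open open_Times) auto
 have m': "{0..M} \<times> {- M..M} \<in> sets (borel :: (real \<times> real) measure)"
  by (intro borel_closed closed_Times) auto
 have mm: "(\<lambda>p. indicator open_half p *\<^sub>R Y p) \<in> borel_measurable lborel"
  "(\<lambda>p. indicator ({0..M} \<times> {- M..M}) p *\<^sub>R Y p) \<in> borel_measurable lborel"
  using Y m m' by simp_all
 have ae: "AE p in lborel. indicator open_half p *\<^sub>R Y p = indicator ({0..M} \<times> {- M..M}) p *\<^sub>R Y p"
  using AE_coordinate(2)[OF AE_lborel_singleton[of 0]]
 proof eventually_elim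
  fix p :: "real \<times> real" assume p: "fst p \<noteq> 0"
  show "indicator open_half p *\<^sub>R Y p = indicator ({0..M} \<times> {- M..M}) p *\<^sub>R Y p"
  proof (cases "M \<le> \<bar>fst p\<bar> \<or> M \<le> \<bar>snd p\<bar>")
   case True then show ?thesis using zero[of "fst p" "snd p"] by simp
  next
   case False then show ?thesis using p by (auto simp: indicator_def mem_Times_iff)
  qed
 qed
 show "L1_on open_half Y"
  using integrable_cong_AE[OF mm ae] Y(2) by (simp add: set_integrable_def)
 show "(LBINT p:open_half. Y p) = (LBINT p:{0..M} \<times> {- M..M}. Y p)"
  using integral_cong_AE[OF mm ae] by (simp add: set_lebesgue_integral_def)
qed

lemma set_integrable_mult_continuous_plane:
 fixes W k :: "real \<times> real \<Rightarrow> real"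
 assumes W: "L1_on ({a..b} \<times> {c..d}) W" "W \<in> borel_fun" and k: "continuous_on UNIV k"
 shows "L1_on ({a..b} \<times> {c..d}) (\<lambda>p. W p * k p)"
proof -
 have "bounded (k ` ({a..b} \<times> {c..d}))"
  by (intro compact_imp_bounded compact_continuous_image compact_Times continuous_on_subset[OF k]) auto
 then obtain K where K: "\<And>p. p \<in> {a..b} \<times> {c..d} \<Longrightarrow> \<bar>k p\<bar> \<le> K"
  unfolding bounded_iff by (metis imageI real_norm_def)
 show ?thesis
  by (rule set_integrable_bounded_mult[OF W(1) K W(2) borel_measurable_continuous_onI[OF k]])
   (auto intro!: borel_closed closed_Times)
qed

text \<open>For separated functions the defining identities follow from the product rule along rays
  and along lines of constant t. \<open>F\<close> is only absolutely continuous, so that cut-offs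
  and Green functions with a kink are covered.\<close>

lemma explicit_function:
 fixes F F' e e' :: "real \<Rightarrow> real" and u :: "real \<times> real \<Rightarrow> real"
 assumes F: "\<And>T. 0 \<le> T \<Longrightarrow> primitive_on 0 T F F'" and m: "F \<in> borel_fun" "F' \<in> borel_fun"
  and e: "\<And>s. (e has_real_derivative e' s) (at s)" "continuous_on UNIV e'"
  and u: "\<And>t s. 0 < t \<Longrightarrow> u (t, s) = F t * e s"
 shows "is_weak_grad u (\<lambda>p. vector [F' (fst p) * e (snd p), F (fst p) * e' (snd p)])"
  and "has_trace u (\<lambda>s. F 0 * e s)"
proof -
 let ?G = "\<lambda>p. vector [F' (fst p) * e (snd p), F (fst p) * e' (snd p)] :: real^2"
 have ce: "continuous_on UNIV e"
  by (intro continuous_at_imp_continuous_on ballI DERIV_isCont[OF e(1)])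
 have em: "e \<in> borel_fun" "e' \<in> borel_fun"
  using ce e(2) by (auto intro: borel_measurable_continuous_onI)
 note [measurable] = compose_fst_snd_meas[OF m(1)] compose_fst_snd_meas[OF m(2)]
  compose_fst_snd_meas[OF em(1)] compose_fst_snd_meas[OF em(2)]
 have iF: "L1_on {0..M} F" "L1_on {0..M} F'" for M
 proof -
  show "L1_on {0..M} F"
  proof (cases "0 \<le> M")
   case True
   show ?thesis by (rule continuous_set_integrable[OF primitive_on_continuous[OF F[OF True]]])
  qed (simp add: set_integrable_def)
  show "L1_on {0..M} F'"
  proof (cases "0 \<le> M")
   case True
   show ?thesis by (rule primitive_on_integrable[OF F[OF True]])
  qed (simp add: set_integrable_def)
 qed
 have ie: "L1_on {a..b} e" "L1_on {a..b} e'" for a b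
  by (intro continuous_set_integrable continuous_on_subset[OF ce] continuous_on_subset[OF e(2)] subset_UNIV)+
 have I: "L1_on ({0..M} \<times> {a..b}) (\<lambda>p. F (fst p) * e (snd p))"
   "L1_on ({0..M} \<times> {a..b}) (\<lambda>p. F' (fst p) * e (snd p))"
   "L1_on ({0..M} \<times> {a..b}) (\<lambda>p. F (fst p) * e' (snd p))" for M a b
  by (intro set_integrable_prod iF ie)+
 have loc: "locally_integrable f" if f: "\<And>M a b. L1_on ({0..M} \<times> {a..b}) f" for f
  unfolding locally_integrable_def
 proof (intro allI impI)
  fix K :: "(real \<times> real) set" assume K: "compact K \<and> K \<subseteq> open_half"
  then obtain B where B: "\<And>p. p \<in> K \<Longrightarrow> norm p \<le> B" using compact_imp_bounded by (metis bounded_iff)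
  have "K \<subseteq> {0..B} \<times> {- B..B}"
  proof
   fix p assume p: "p \<in> K"
   have "\<bar>fst p\<bar> \<le> B" "\<bar>snd p\<bar> \<le> B"
    using B[OF p] norm_fst_le[of "fst p" "snd p"] norm_snd_le[of "snd p" "fst p"] by auto
   then show "p \<in> {0..B} \<times> {- B..B}" using K p by (auto simp: mem_Times_iff abs_le_iff)
  qed
  then show "L1_on K f" using K by (intro set_integrable_subset[OF f]) (auto intro: borel_compact)
 qed
 have locu: "locally_integrable u"
  unfolding locally_integrable_def
 proof (intro allI impI)
  fix K :: "(real \<times> real) set" assume K: "compact K \<and> K \<subseteq> open_half"
  have "L1_on K (\<lambda>p. F (fst p) * e (snd p))"
   using loc[OF I(1)] K unfolding locally_integrable_def by blast
  moreover have "L1_on K u = L1_on K (\<lambda>p. F (fst p) * e (snd p))"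
   by (rule set_integrable_cong) (use K u in auto)
  ultimately show "L1_on K u" by simp
 qed
 have core1: "(LBINT p:open_half. u p * pd 1 \<psi> p + (tensor F' e p) * \<psi> p) = - (LBINT s. F 0 * e s * \<psi> (0, s))"
   "L1_on open_half (\<lambda>p. u p * pd 1 \<psi> p)" "L1_on open_half (\<lambda>p. (tensor F' e p) * \<psi> p)"
   "(LBINT p:open_half. u p * pd 2 \<psi> p + (tensor F e' p) * \<psi> p) = 0"
   "L1_on open_half (\<lambda>p. u p * pd 2 \<psi> p)" "L1_on open_half (\<lambda>p. (tensor F e' p) * \<psi> p)"
  if \<psi>: "C1_compact_support U \<psi>" for \<psi> U
 proof -
  obtain M where M: "0 < M" "\<And>t s. M \<le> \<bar>t\<bar> \<or> M \<le> \<bar>s\<bar> \<Longrightarrow> \<psi> (t, s) = 0 \<and> pd 1 \<psi> (t, s) = 0 \<and> pd 2 \<psi> (t, s) = 0"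
   and d1: "\<And>t s. ((\<lambda>t. \<psi> (t, s)) has_real_derivative pd 1 \<psi> (t, s)) (at t)"
   and d2: "\<And>t s. ((\<lambda>s. \<psi> (t, s)) has_real_derivative pd 2 \<psi> (t, s)) (at s)"
   and c: "continuous_on UNIV \<psi>" "continuous_on UNIV (pd 1 \<psi>)" "continuous_on UNIV (pd 2 \<psi>)"
   by (rule C1_compact_supportD[OF \<psi>]) blast
  note [measurable] = c[THEN borel_measurable_continuous_onI]
  let ?Q = "{0..M} \<times> {- M..M}"
  have J1: "L1_on ?Q (\<lambda>p. (tensor F e p) * pd 1 \<psi> p)"
   and J2: "L1_on ?Q (\<lambda>p. (tensor F' e p) * \<psi> p)"
   and J3: "L1_on ?Q (\<lambda>p. (tensor F e p) * pd 2 \<psi> p)"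
   and J4: "L1_on ?Q (\<lambda>p. (tensor F e' p) * \<psi> p)"
   by (rule set_integrable_mult_continuous_plane[OF I(1) _ c(2)] set_integrable_mult_continuous_plane[OF I(2) _ c(1)]
    set_integrable_mult_continuous_plane[OF I(1) _ c(3)] set_integrable_mult_continuous_plane[OF I(3) _ c(1)], measurable)+
  have uu: "L1_on open_half (\<lambda>p. u p * k p) = L1_on open_half (\<lambda>p. (tensor F e p) * k p)" for k
   by (rule set_integrable_cong) (use u in auto)
  have om: "open_half \<in> sets lborel" by (auto intro!: borel_open open_Times)
  show "L1_on open_half (\<lambda>p. u p * pd 1 \<psi> p)"
   unfolding uu by (rule half_plane_integral(1)[OF _ J1]) (use M(2) in \<open>auto, measurable\<close>)
  show "L1_on open_half (\<lambda>p. (tensor F' e p) * \<psi> p)"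
   by (rule half_plane_integral(1)[OF _ J2]) (use M(2) in \<open>auto, measurable\<close>)
  show "L1_on open_half (\<lambda>p. u p * pd 2 \<psi> p)"
   unfolding uu by (rule half_plane_integral(1)[OF _ J3]) (use M(2) in \<open>auto, measurable\<close>)
  show "L1_on open_half (\<lambda>p. (tensor F e' p) * \<psi> p)"
   by (rule half_plane_integral(1)[OF _ J4]) (use M(2) in \<open>auto, measurable\<close>)
  have "(LBINT p:open_half. u p * pd 1 \<psi> p + (tensor F' e p) * \<psi> p) =
   (LBINT p:open_half. (tensor F e p) * pd 1 \<psi> p + (tensor F' e p) * \<psi> p)"
   by (rule set_lebesgue_integral_cong[OF om]) (use u in auto)
  also have "\<dots> = (LBINT p:?Q. (tensor F e p) * pd 1 \<psi> p + (tensor F' e p) * \<psi> p)"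
   by (rule half_plane_integral(2)[OF _ set_integral_add(1)[OF J1 J2]]) (use M(2) in \<open>auto, measurable\<close>)
  also have "\<dots> = (LBINT s:{- M..M}. - (F 0 * e s * \<psi> (0, s)))"
   unfolding set_fubini(6)[OF set_integral_add(1)[OF J1 J2]]
  proof (rule set_lebesgue_integral_cong)
   show "\<forall>s. s \<in> {- M..M} \<longrightarrow> (LBINT t:{0..M}. (tensor F e (t, s)) * pd 1 \<psi> (t, s) + (tensor F' e (t, s)) * \<psi> (t, s))
    = - (F 0 * e s * \<psi> (0, s))"
   proof (intro allI impI)
    fix s :: real
    have c1: "continuous_on {0..M} (\<lambda>t. pd 1 \<psi> (t, s))"
     by (rule continuous_on_compose2[OF c(2)]) (auto intro!: continuous_intros)
    have "primitive_on 0 M (\<lambda>t. \<psi> (t, s)) (\<lambda>t. pd 1 \<psi> (t, s))"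
     by (rule primitive_on_at_deriv[OF d1 c1])
    from primitive_on_mult[OF F this] M(1)
    have Q: "primitive_on 0 M (\<lambda>t. F t * \<psi> (t, s)) (\<lambda>t. F t * pd 1 \<psi> (t, s) + F' t * \<psi> (t, s))" by simp
    have "(LBINT t:{0..M}. (tensor F e (t, s)) * pd 1 \<psi> (t, s) + (tensor F' e (t, s)) * \<psi> (t, s)) =
     (LBINT t:{0..M}. e s * (F t * pd 1 \<psi> (t, s) + F' t * \<psi> (t, s)))"
     by (rule set_lebesgue_integral_cong) (auto simp: algebra_simps)
    also have "\<dots> = e s * (F M * \<psi> (M, s) - F 0 * \<psi> (0, s))"
     using primitive_on_eq[OF Q, of M] M(1) by simp
    finally show "(LBINT t:{0..M}. (tensor F e (t, s)) * pd 1 \<psi> (t, s) + (tensor F' e (t, s)) * \<psi> (t, s))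
     = - (F 0 * e s * \<psi> (0, s))" using M(2)[of M s] M(1) by (simp add: mult_ac)
   qed
  qed simp
  also have "\<dots> = (LBINT s. - (F 0 * e s * \<psi> (0, s)))"
   unfolding set_lebesgue_integral_def
  proof (intro Bochner_Integration.integral_cong refl)
   fix s :: real
   have "\<psi> (0, s) = 0" if "s \<notin> {- M..M}"
   proof -
    have "M \<le> \<bar>s\<bar>" using that by auto
    then show ?thesis using M(2)[of 0 s] by simp
   qed
   then show "indicator {- M..M} s *\<^sub>R - (F 0 * e s * \<psi> (0, s)) = - (F 0 * e s * \<psi> (0, s))"
    by (cases "s \<in> {- M..M}") simp_all
  qed
  finally show "(LBINT p:open_half. u p * pd 1 \<psi> p + (tensor F' e p) * \<psi> p) = - (LBINT s. F 0 * e s * \<psi> (0, s))" by simp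
  have "(LBINT p:open_half. u p * pd 2 \<psi> p + (tensor F e' p) * \<psi> p) =
   (LBINT p:open_half. (tensor F e p) * pd 2 \<psi> p + (tensor F e' p) * \<psi> p)"
   by (rule set_lebesgue_integral_cong[OF om]) (use u in auto)
  also have "\<dots> = (LBINT p:?Q. (tensor F e p) * pd 2 \<psi> p + (tensor F e' p) * \<psi> p)"
   by (rule half_plane_integral(2)[OF _ set_integral_add(1)[OF J3 J4]]) (use M(2) in \<open>auto, measurable\<close>)
  also have "\<dots> = (LBINT t:{0..M}. 0)"
   unfolding set_fubini(3)[OF set_integral_add(1)[OF J3 J4]]
  proof (rule set_lebesgue_integral_cong)
   show "\<forall>t. t \<in> {0..M} \<longrightarrow> (LBINT s:{- M..M}. (tensor F e (t, s)) * pd 2 \<psi> (t, s) + (tensor F e' (t, s)) * \<psi> (t, s)) = 0"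
   proof (intro allI impI)
    fix t :: real
    have c2: "continuous_on {- M..M} (\<lambda>s. pd 2 \<psi> (t, s))"
     by (rule continuous_on_compose2[OF c(3)]) (auto intro!: continuous_intros)
    have p1: "primitive_on (- M) M (\<lambda>s. \<psi> (t, s)) (\<lambda>s. pd 2 \<psi> (t, s))"
     by (rule primitive_on_at_deriv[OF d2 c2])
    have p2: "primitive_on (- M) M e e'"
     by (rule primitive_on_at_deriv[OF e(1)]) (rule continuous_on_subset[OF e(2) subset_UNIV])
    note Q = primitive_on_mult[OF p2 p1]
    have "(LBINT s:{- M..M}. (tensor F e (t, s)) * pd 2 \<psi> (t, s) + (tensor F e' (t, s)) * \<psi> (t, s)) =
     (LBINT s:{- M..M}. F t * (e s * pd 2 \<psi> (t, s) + e' s * \<psi> (t, s)))"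
     by (rule set_lebesgue_integral_cong) (auto simp: algebra_simps)
    also have "\<dots> = F t * (e M * \<psi> (t, M) - e (- M) * \<psi> (t, - M))"
     using primitive_on_eq[OF Q, of M] M(1) by simp
    finally show "(LBINT s:{- M..M}. (tensor F e (t, s)) * pd 2 \<psi> (t, s) + (tensor F e' (t, s)) * \<psi> (t, s)) = 0"
     using M(2)[of t M] M(2)[of t "- M"] M(1) by simp
   qed
  qed simp
  finally show "(LBINT p:open_half. u p * pd 2 \<psi> p + (tensor F e' p) * \<psi> p) = 0" by simp
 qed
 show wg: "is_weak_grad u ?G"
  unfolding is_weak_grad_def
 proof (intro conjI allI impI)
  show "locally_integrable u" by (rule locu)
  show "locally_integrable (\<lambda>p. ?G p $ j)" for j
   using exhaust_2[of j] loc[OF I(2)] loc[OF I(3)] by (auto simp: vector_2)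
  fix \<psi> and j :: 2 assume \<psi>: "C1_compact_support open_half \<psi>"
  \<comment> \<open>Test functions for the weak gradient are supported in the open half-plane, so no
    trace term appears.\<close>
  have z: "\<psi> (0, s) = 0" for s
   using C1_compact_supportD[OF \<psi>] by (metis SigmaD1 greaterThan_iff less_irrefl)
  consider "j = 1" | "j = 2" using exhaust_2[of j] by blast
  then show "(LBINT p:open_half. u p * pd j \<psi> p) = - (LBINT p:open_half. ?G p $ j * \<psi> p)"
  proof cases
   case 1
   then show ?thesis using core1(1-3)[OF \<psi>] z by (simp add: set_integral_add vector_2)
  next
   case 2
   then show ?thesis using core1(4-6)[OF \<psi>] by (simp add: set_integral_add vector_2)
  qed
 qed
 have wu: "is_weak_grad u (weak_grad u)"
 proof -
  have "\<exists>G. is_weak_grad u G" using wg by blast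
  then show ?thesis unfolding weak_grad_def by (rule someI_ex)
 qed
 have ae: "AE p\<in>open_half in lborel. weak_grad u p = ?G p" by (rule weak_grad_unique[OF wu wg])
 show "has_trace u (\<lambda>s. F 0 * e s)"
  unfolding has_trace_def
 proof (intro conjI allI impI)
  show "(\<lambda>s. F 0 * e s) \<in> borel_fun" using em(1) by measurable
  show "L1_on {a..b} (\<lambda>\<theta>. (F 0 * e \<theta>)^2)" for a b
   by (intro continuous_set_integrable continuous_intros continuous_on_subset[OF ce] subset_UNIV)
  fix \<psi> assume \<psi>: "C1_compact_support UNIV \<psi>"
  have c: "continuous_on UNIV \<psi>" "continuous_on UNIV (pd 1 \<psi>)"
   by (rule C1_compact_supportD[OF \<psi>], assumption)+
  note cm[measurable] = c[THEN borel_measurable_continuous_onI]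
  have [measurable]: "(\<lambda>p. indicator open_half p * u p) \<in> borel_fun"
   "(\<lambda>p. indicator open_half p * weak_grad u p $ 1) \<in> borel_fun"
   using wu by (auto simp: is_weak_grad_def intro: locally_integrable_measurable)
  have om[measurable]: "open_half \<in> sets (borel :: (real \<times> real) measure)" by (auto intro!: borel_open open_Times)
  have m1: "(\<lambda>p. (indicator open_half p * u p) * pd 1 \<psi> p + (indicator open_half p * weak_grad u p $ 1) * \<psi> p) \<in> borel_measurable lborel"
   by measurable
  have m2: "(\<lambda>p. (indicator open_half p * u p) * pd 1 \<psi> p + indicator open_half p * ((tensor F' e p) * \<psi> p)) \<in> borel_measurable lborel"
   by measurable
  have "(LBINT p:open_half. u p * pd 1 \<psi> p + weak_grad u p $ 1 * \<psi> p) =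
    (LBINT p. (indicator open_half p * u p) * pd 1 \<psi> p + (indicator open_half p * weak_grad u p $ 1) * \<psi> p)"
   by (simp add: set_lebesgue_integral_def algebra_simps)
  also have "\<dots> = (LBINT p. (indicator open_half p * u p) * pd 1 \<psi> p + indicator open_half p * ((tensor F' e p) * \<psi> p))"
   by (rule integral_cong_AE[OF m1 m2]) (use ae in \<open>auto simp: indicator_def vector_2 elim!: eventually_mono\<close>)
  also have "\<dots> = (LBINT p:open_half. u p * pd 1 \<psi> p + (tensor F' e p) * \<psi> p)"
   by (simp add: set_lebesgue_integral_def algebra_simps)
  also have "\<dots> = - (LBINT s. F 0 * e s * \<psi> (0, s))" by (rule core1(1)[OF \<psi>])
  finally show "(LBINT p:open_half. u p * pd 1 \<psi> p + weak_grad u p $ 1 * \<psi> p) = - (LBINT \<theta>. F 0 * e \<theta> * \<psi> (0, \<theta>))" .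
 qed
qed

text \<open>The two strips differ by parts of the null lines t = 0 and theta = 2 pi; the closed one
  is the form in which slices over \<open>circ\<close> are taken.\<close>

lemma period_strip_convert:
 fixes f f' :: "real \<times> real \<Rightarrow> real"
 assumes f': "f' \<in> borel_fun" and eq: "\<And>p. p \<in> period_strip \<Longrightarrow> f p = f' p"
 shows "L1_on period_strip f = L1_on strip f'"
  and "(LBINT p:period_strip. f p) = (LBINT p:strip. f' p)"
proof -
 have sm: "period_strip \<in> sets borel"
  unfolding period_strip_def borel_prod[symmetric] by (intro pair_measureI) auto
 have feq: "(\<lambda>p. indicator period_strip p *\<^sub>R f p) = (\<lambda>p. indicator period_strip p *\<^sub>R f' p)"
  using eq by (auto simp: fun_eq_iff indicator_def)
 have mm: "(\<lambda>p. indicator period_strip p *\<^sub>R f' p) \<in> borel_measurable lborel"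
  "(\<lambda>p. indicator strip p *\<^sub>R f' p) \<in> borel_measurable lborel"
  using f' sm by simp_all
 have ae: "AE p in lborel. indicator period_strip p *\<^sub>R f' p = indicator strip p *\<^sub>R f' p"
  using AE_coordinate(2)[OF AE_lborel_singleton[of 0]] AE_coordinate(1)[OF AE_lborel_singleton[of "2 * pi"]]
  by eventually_elim (auto simp: indicator_def period_strip_def mem_Times_iff)
 show "L1_on period_strip f = L1_on strip f'"
  unfolding set_integrable_def feq by (rule integrable_cong_AE[OF mm ae])
 show "(LBINT p:period_strip. f p) = (LBINT p:strip. f' p)"
  unfolding set_lebesgue_integral_def feq by (rule integral_cong_AE[OF mm ae])
qed

section \<open>From Sobolev functions to absolutely continuous representatives\<close>

context face_weights
begin

text \<open>\<open>trace_representation\<close> supplies continuity along rays and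
  \<open>angular_representation\<close> along circles. The two constructions need not agree
  pointwise, which is why \<open>strip_data\<close> asks for equality with a periodic function only
  almost everywhere on a circle.\<close>

lemma strip_data_of_weak:
 fixes u :: "real \<times> real \<Rightarrow> real"
 assumes wd: "weakly_differentiable u" and tr: "has_trace u \<tau>" and per: "\<And>t s. u (t, s + 2 * pi) = u (t, s)"
  and U: "\<And>p. U p = indicator open_half p * u p"
  and G: "\<And>p. G p = indicator open_half p * weak_grad u p $ 1"
  and H: "\<And>p. H p = indicator open_half p * weak_grad u p $ 2"
  and rG2: "L1_on strip (\<lambda>p. \<rho> (fst p) * (G p)^2)"
  and rH2: "L1_on strip (\<lambda>p. (H p)^2 / \<rho> (fst p))"
  and VU2: "L1_on strip (\<lambda>p. V (fst p) * (U p)^2)"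
  and U2: "\<And>T. L1_on (cyl T) (\<lambda>p. (U p)^2)"
  and v: "\<And>p. v p = \<tau> (snd p) + (LBINT s:{0..fst p}. G (s, snd p))"
 shows "strip_data v G H \<tau>" and "AE p\<in>strip in lborel. v p = U p"
  and "U \<in> borel_fun" "G \<in> borel_fun" "H \<in> borel_fun"
proof -
 have wg: "is_weak_grad u (weak_grad u)"
  using wd unfolding weakly_differentiable_def weak_grad_def by (rule someI_ex)
 have l: "locally_integrable u" "locally_integrable (\<lambda>p. weak_grad u p $ j)" for j
  using wg by (auto simp: is_weak_grad_def)
 show m[measurable]: "U \<in> borel_fun" "G \<in> borel_fun" "H \<in> borel_fun"
  unfolding U[abs_def] G[abs_def] H[abs_def] by (intro locally_integrable_measurable l)+
 have tm[measurable]: "\<tau> \<in> borel_fun" and tau2: "L1_on circ (\<lambda>s. (\<tau> s)^2)"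
  using tr unfolding has_trace_def by blast+
 have G2: "L1_on (cyl T) (\<lambda>p. (G p)^2)" for T
 proof (rule set_integrable_bound_borel)
  show "L1_on (cyl T) (\<lambda>p. \<rho> (fst p) * (G p)^2)"
   by (rule set_integrable_subset[OF rG2]) auto
  fix x assume "x \<in> cyl T"
  then show "\<bar>(G x)^2\<bar> \<le> \<rho> (fst x) * (G x)^2"
   using rho_ge1[of "fst x"] by (auto simp: mult_le_cancel_right1)
 qed auto
 have iU: "L1_on (cyl T) U" and iG: "L1_on (cyl T) G" for T
  using set_integrable_L1_L2[OF U2 _ _ emeasure_cyl] set_integrable_L1_L2[OF G2 _ _ emeasure_cyl] by simp_all
 have itau: "L1_on circ \<tau>"
  by (rule set_integrable_L1_L2[OF tau2]) auto
 have zU: "U p = 0" "G p = 0" if "fst p \<le> 0" for p using that by (auto simp: U G mem_Times_iff indicator_def)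
 have weak1: "(LBINT p:open_half. U p * pd 1 \<psi> p + G p * \<psi> p) = - (LBINT s. \<tau> s * \<psi> (0, s))"
  if "C1_compact_support UNIV \<psi>" for \<psi>
 proof -
  have "(LBINT p:open_half. U p * pd 1 \<psi> p + G p * \<psi> p) = (LBINT p:open_half. u p * pd 1 \<psi> p + weak_grad u p $ 1 * \<psi> p)"
   by (rule set_lebesgue_integral_cong) (auto simp: U G intro!: borel_open open_Times)
  then show ?thesis using tr that by (simp add: has_trace_def)
 qed
 note R = trace_representation[OF m(1,2) tm zU iU iG itau weak1 v]
 have vm[measurable]: "v \<in> borel_fun" by (rule R(1))
 have prim: "AE s\<in>circ in lborel. v (0, s) = \<tau> s \<and> (\<forall>T\<ge>0. primitive_on 0 T (\<lambda>t. v (t, s)) (\<lambda>t. G (t, s)))"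
  by (rule R(2))
 have vU: "AE p\<in>{0<..} \<times> {0<..<2 * pi} in lborel. U p = v p" by (rule R(3))
 have nn: "AE s in lborel. s \<noteq> 0 \<and> s \<noteq> 2 * pi"
  using AE_lborel_singleton[of 0] AE_lborel_singleton[of "2 * pi"] by eventually_elim simp
 show vU': "AE p\<in>strip in lborel. v p = U p"
  using vU AE_coordinate(1)[OF nn] AE_coordinate(2)[OF nn]
  by eventually_elim (auto simp: mem_Times_iff)
 have weak2: "(LBINT p:open_half. U p * pd 2 \<psi> p) = - (LBINT p:open_half. H p * \<psi> p)"
  if "C1_compact_support open_half \<psi>" for \<psi>
 proof -
  have om: "open_half \<in> sets (lborel :: (real \<times> real) measure)" by (auto intro!: borel_open open_Times)
  have "(LBINT p:open_half. U p * pd 2 \<psi> p) = (LBINT p:open_half. u p * pd 2 \<psi> p)"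
   "(LBINT p:open_half. H p * \<psi> p) = (LBINT p:open_half. weak_grad u p $ 2 * \<psi> p)"
   by (rule set_lebesgue_integral_cong[OF om]; auto simp: U H)+
  then show ?thesis using wg that by (simp add: is_weak_grad_def)
 qed
 have sub: "{c..d} \<times> {0..4 * pi} \<subseteq> open_half" if "0 < c" for c d :: real using that by auto
 have iU4: "L1_on ({c..d} \<times> {0..4 * pi}) U" "L1_on ({c..d} \<times> {0..4 * pi}) H"
  if "0 < c" for c d
  unfolding U[abs_def] H[abs_def] set_integrable_indicator_open_half[OF sub[OF that]]
  by (intro set_integrable_open_closed l that)+
 have perU: "U (t, s + 2 * pi) = U (t, s)" for t s by (simp add: U per indicator_def)
 have ang: "AE t in lborel. 0 < t \<longrightarrow> (\<exists>b. primitive_on 0 (2 * pi) b (\<lambda>s. H (t, s)) \<and> b (2 * pi) = b 0 \<and>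
   (AE s\<in>circ in lborel. U (t, s) = b s))"
  by (rule angular_representation[OF m(1,3) iU4 weak2 perU])
 have ang': "AE t in lborel. 0 \<le> t \<longrightarrow> (\<exists>b. primitive_on 0 (2 * pi) b (\<lambda>s. H (t, s)) \<and> b (2 * pi) = b 0 \<and>
   (AE s\<in>circ in lborel. v (t, s) = b s))"
  using ang AE_slices[OF vU'] nn
 proof (eventually_elim, intro impI)
  fix t :: real assume a: "0 < t \<longrightarrow> (\<exists>b. primitive_on 0 (2 * pi) b (\<lambda>s. H (t, s)) \<and> b (2 * pi) = b 0 \<and>
   (AE s\<in>circ in lborel. U (t, s) = b s))"
   "AE s in lborel. (t, s) \<in> strip \<longrightarrow> v (t, s) = U (t, s)" "t \<noteq> 0 \<and> t \<noteq> 2 * pi" "0 \<le> t"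
  then obtain b where b: "primitive_on 0 (2 * pi) b (\<lambda>s. H (t, s))" "b (2 * pi) = b 0"
   "AE s\<in>circ in lborel. U (t, s) = b s" by auto
  have "AE s\<in>circ in lborel. v (t, s) = b s"
   using a(2) b(3) by eventually_elim (use a(4) in auto)
  then show "\<exists>b. primitive_on 0 (2 * pi) b (\<lambda>s. H (t, s)) \<and> b (2 * pi) = b 0 \<and>
   (AE s\<in>circ in lborel. v (t, s) = b s)" using b by blast
 qed
 have v2: "L1_on (cyl T) (\<lambda>p. (v p)^2)" for T
  by (rule set_integral_eq_AE(1)[OF U2]) (use vU' in \<open>auto elim!: eventually_mono\<close>)
 have Vv2: "L1_on strip (\<lambda>p. V (fst p) * (v p)^2)"
  by (rule set_integral_eq_AE(1)[OF VU2]) (use vU' weights_fst_measurable in \<open>auto elim!: eventually_mono\<close>)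
 show "strip_data v G H \<tau>"
  unfolding strip_data_def
  using m(2,3) vm tm rG2 rH2 Vv2 v2 tau2 prim ang' by blast
qed

end

section \<open>Green's identity for the rotational mean\<close>

context face_function
begin

text \<open>The test function is Green's function of the radial operator with pole \<open>s\<close>, vanishing at the boundary.\<close>

lemma green_value:
 assumes s: "0 \<le> s"
  and d0: "\<And>t. 0 \<le> t \<Longrightarrow> ((\<lambda>t. \<rho> t * y0' t) has_real_derivative (0 / \<rho> t - V t) * y0 t) (at t)"
  and dz: "\<And>t. 0 \<le> t \<Longrightarrow> ((\<lambda>t. \<rho> t * z' t) has_real_derivative (0 / \<rho> t - V t) * z t) (at t)"
  and cont: "continuous_on {0..} y0" "continuous_on {0..} z"
  and z0: "z 0 = 0"
  and W: "\<And>t. 0 \<le> t \<Longrightarrow> \<rho> t * (y0 t * z' t - z t * y0' t) = w" "w \<noteq> 0"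
  and decay: "((\<lambda>T. \<rho> T * y0' T * (1 + (LBINT t:{0..T}. 1 / \<rho> t))) \<longlongrightarrow> 0) at_top"
  and int0: "L1_on {0..} (\<lambda>t. \<rho> t * y0' t * g1 t + (0 / \<rho> t - V t) * y0 t * f1 t)"
  and F: "\<And>t. F t = (if t \<le> s then y0 s * z t else z s * y0 t)"
   "\<And>t. F' t = (if t \<le> s then y0 s * z' t else z s * y0' t)"
  and int: "L1_on {0..} (\<lambda>t. \<rho> t * F' t * g1 t + (0 / \<rho> t - V t) * F t * f1 t)"
  and null: "(LBINT t:{0..}. \<rho> t * F' t * g1 t + (0 / \<rho> t - V t) * F t * f1 t) = 0"
 shows "f1 s * y0 0 = f1 0 * y0 s"
proof -
 define B where "B h h' t = \<rho> t * h' t * g1 t + (0 / \<rho> t - V t) * h t * f1 t" for h h' :: "real \<Rightarrow> real" and t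
 have P: "L1_on {0..s} (B h h') \<and> (LBINT t:{0..s}. B h h' t) = \<rho> s * h' s * f1 s - \<rho> 0 * h' 0 * f1 0"
  if h: "\<And>t. 0 \<le> t \<Longrightarrow> ((\<lambda>t. \<rho> t * h' t) has_real_derivative (0 / \<rho> t - V t) * h t) (at t)"
   and ch: "continuous_on {0..} h" for h h'
 proof -
  have "primitive_on 0 s (\<lambda>t. \<rho> t * h' t) (\<lambda>t. (0 / \<rho> t - V t) * h t)"
   by (rule primitive_on_at_deriv[OF h])
    (auto intro!: continuous_intros continuous_on_subset[OF ch] continuous_on_subset[OF V_cont]
      continuous_on_subset[OF rho_cont])
  from primitive_on_mult[OF this cmean_primitive(1)[OF continuous_on_const s, of 1]]
  have Q: "primitive_on 0 s (\<lambda>t. \<rho> t * h' t * f1 t) (B h h')"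
   unfolding B_def[abs_def] by simp
  show ?thesis using primitive_on_eq[OF Q, of s] primitive_on_integrable[OF Q] s by simp
 qed
 have split: "(LBINT t:{0..}. f t) = (LBINT t:{0..s}. f t) + (LBINT t:{s..}. f t)"
  if "L1_on {0..} f" for f :: "real \<Rightarrow> real"
 proof -
  have eq: "{0..} = {0..s} \<union> {s..}" using s by auto
  have "L1_on {0..s} f" "L1_on {s..} f"
   using that s by (auto intro: set_integrable_subset)
  then show ?thesis unfolding eq
   by (intro set_integral_Un_AE) (use AE_lborel_singleton[of s] in \<open>auto elim!: eventually_mono\<close>)
 qed
 have 1: "(LBINT t:{0..s}. B F F' t) = y0 s * (\<rho> s * z' s * f1 s - \<rho> 0 * z' 0 * f1 0)"
 proof -
  have "(LBINT t:{0..s}. B F F' t) = (LBINT t:{0..s}. y0 s * B z z' t)"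
   by (rule set_lebesgue_integral_cong) (auto simp: B_def F algebra_simps)
  then show ?thesis using P[OF dz cont(2)] by simp
 qed
 \<comment> \<open>The tail is the full integral, known from \<open>null_mode_form\<close>, minus
   the part up to the pole.\<close>
 have 2: "(LBINT t:{s..}. B y0 y0' t) = - (\<rho> s * y0' s * f1 s)"
 proof -
  have "(LBINT t:{0..}. B y0 y0' t) = - (\<rho> 0 * y0' 0 * f1 0)"
   unfolding B_def by (rule null_mode_form[OF continuous_on_const int0 d0 cont(1) decay])
  moreover have "L1_on {0..} (B y0 y0')" using int0 by (simp add: B_def[abs_def])
  ultimately show ?thesis using split[of "B y0 y0'"] P[OF d0 cont(1)] by simp
 qed
 have 3: "(LBINT t:{s..}. B F F' t) = z s * - (\<rho> s * y0' s * f1 s)"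
 proof -
  have "(LBINT t:{s..}. B F F' t) = (LBINT t:{s..}. z s * B y0 y0' t)"
   unfolding set_lebesgue_integral_def
   by (rule integral_discrete_difference[where X = "{s}"]) (auto simp: B_def F indicator_def algebra_simps)
  then show ?thesis using 2 by simp
 qed
 have "0 = (LBINT t:{0..}. B F F' t)" using null by (simp add: B_def[abs_def])
 also have "\<dots> = y0 s * (\<rho> s * z' s * f1 s - \<rho> 0 * z' 0 * f1 0) + z s * - (\<rho> s * y0' s * f1 s)"
  using split[of "B F F'"] int 1 3 by (simp add: B_def[abs_def])
 also have "\<dots> = f1 s * (\<rho> s * (y0 s * z' s - z s * y0' s)) - y0 s * (\<rho> 0 * z' 0) * f1 0"
  by (simp add: algebra_simps)
 \<comment> \<open>The values at the pole combine into the Wronskian, whose constancy makes the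
   coefficient of \<open>f1 s\<close> independent of \<open>s\<close>.\<close>
 finally have 4: "f1 s * w = y0 s * (\<rho> 0 * z' 0) * f1 0" using W(1)[OF s] by simp
 have "w = y0 0 * (\<rho> 0 * z' 0)" using W(1)[of 0] z0 by (auto simp: mult.left_commute)
 then have "w * (f1 s * y0 0) = w * (f1 0 * y0 s)"
 proof -
  have "w * (f1 s * y0 0) = (f1 s * w) * y0 0" by simp
  also have "\<dots> = (y0 0 * (\<rho> 0 * z' 0)) * (f1 0 * y0 s)" unfolding 4 by simp
  finally show ?thesis unfolding \<open>w = y0 0 * (\<rho> 0 * z' 0)\<close>[symmetric] .
 qed
 then show ?thesis using W(2) by simp
qed

end

section \<open>Coordinate weights and radial comparison on the catenoid\<close>

text \<open>The coordinate weights of the faces: \<open>i = 2\<close> is the plane, the other two indices are the catenoids.\<close>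

definition waist :: real where "waist = ln (sqrt 3)"

definition "wrho i t = (if i = (2::3) then t + 2 / sqrt 3 else 1 :: real)"
definition "wV i t = (if i = (2::3) then 0 else 2 / (cosh (t - waist))^2 :: real)"
definition "wkap i t = (if i = (2::3) then 1 else tanh (t - waist) :: real)"
definition "wy i t = (if i = (2::3) then 1 / (t + 2 / sqrt 3) else 1 / cosh (t - waist) :: real)"

text \<open>The waist is half of ln 3, and e between 2 and 3 settles all bounds. Positivity puts the
  neck circle in the interior of the catenoid faces; \<open>1 \<le> 2 * waist\<close> says that no t
  in [0, 1] is farther from the neck than the junction is.\<close>

lemma waist_bounds: "0 < waist" "waist < 1" "1 \<le> 2 * waist"
proof -
 have *: "2 * waist = ln 3" by (simp add: waist_def ln_sqrt)
 have "exp 1 \<le> (3::real)" using exp_le by simp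
 then have "1 \<le> ln (3::real)" by (simp add: ln_ge_iff)
 then show "0 < waist" "1 \<le> 2 * waist" using * by auto
 have e1: "2 \<le> exp (1::real)" using exp_ge_add_one_self[of 1] by simp
 have "exp 2 = exp 1 * exp (1::real)" by (simp flip: exp_add)
 moreover have "2 * 2 \<le> exp 1 * exp (1::real)" using e1 by (intro mult_mono) auto
 ultimately have "(3::real) < exp 2" by linarith
 then have "ln 3 < ln (exp (2::real))" by (subst ln_less_cancel_iff) auto
 then have "ln 3 < (2::real)" by simp
 then show "waist < 1" using * by simp
qed

lemma waist_values:
 "tanh waist = 1 / 2" "cosh waist = 2 / sqrt 3" "1 / (cosh waist)^2 = 3 / 4"
 using ln_sqrt3 by (simp_all add: waist_def tanh_def power_divide)

lemma cosh_sq_identity: "1 / (cosh x)^2 = 1 - (tanh x)^2" for x :: real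
proof -
 have "cosh x \<noteq> 0" using cosh_real_pos[of x] by simp
 then have "1 - (tanh x)^2 = ((cosh x)^2 - (sinh x)^2) / (cosh x)^2"
  by (simp add: tanh_def power_divide diff_divide_distrib)
 then show ?thesis using hyperbolic_pythagoras[of x] by simp
qed

lemma tanh_deriv: "((\<lambda>t. tanh (t - waist)) has_real_derivative 1 / (cosh (t - waist))^2) (at t)"
 unfolding cosh_sq_identity using cosh_real_pos[of "t - waist"]
 by (auto intro!: derivative_eq_intros)

lemma wrho_integral:
 "0 \<le> T \<Longrightarrow> (LBINT t:{0..T}. 1 / wrho i t) = (if i = 2 then ln ((T + 2 / sqrt 3) / (2 / sqrt 3)) else T)"
proof -
 assume T: "0 \<le> T"
 show ?thesis
 proof (cases "i = 2")
  case True
  have P: "primitive_on 0 T (\<lambda>t. ln (t + 2 / sqrt 3)) (\<lambda>t. 1 / (t + 2 / sqrt 3))"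
  proof (rule primitive_on_at_deriv)
   have p: "0 < t + 2 / sqrt 3" if "0 \<le> t" for t using that by (simp add: add_nonneg_pos)
   show "((\<lambda>t. ln (t + 2 / sqrt 3)) has_real_derivative 1 / (t + 2 / sqrt 3)) (at t)" if "0 \<le> t" for t
    using p[OF that] by (auto intro!: derivative_eq_intros simp: divide_simps)
   show "continuous_on {0..T} (\<lambda>t. 1 / (t + 2 / sqrt 3))"
    using p by (intro continuous_intros) force
  qed
  have "(LBINT t:{0..T}. 1 / (t + 2 / sqrt 3)) = ln (T + 2 / sqrt 3) - ln (2 / sqrt 3)"
   using primitive_on_eq[OF P, of T] T by simp
  also have "\<dots> = ln ((T + 2 / sqrt 3) / (2 / sqrt 3))"
   using add_nonneg_pos[OF T, of "2 / sqrt 3"] by (subst ln_div) auto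
  finally show ?thesis by (simp only: wrho_def True if_True simp_thms)
 next
  case False
  then show ?thesis using T by (simp add: wrho_def set_integral_const)
 qed
qed

lemma not_integrable_if_unbounded:
 fixes f \<Phi> :: "real \<Rightarrow> real"
 assumes "\<And>T. 0 \<le> T \<Longrightarrow> (LBINT t:{0..T}. f t) = \<Phi> T" "filterlim \<Phi> at_top at_top"
 shows "\<not> L1_on {0..} f"
proof
 assume "L1_on {0..} f"
 then have "((\<lambda>T. LBINT t:{0..T}. f t) \<longlongrightarrow> (LBINT t:{0..}. f t)) at_top"
  by (intro tendsto_set_lebesgue_integral_at_top) auto
 then have "(\<Phi> \<longlongrightarrow> (LBINT t:{0..}. f t)) at_top"
  by (rule Lim_transform_eventually) (use assms(1) in \<open>auto intro!: eventually_mono[OF eventually_ge_at_top[of 0]]\<close>)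
 then show False using assms(2) not_tendsto_and_filterlim_at_infinity[of at_top \<Phi>]
   filterlim_at_top_imp_at_infinity trivial_limit_at_top_linorder by blast
qed

lemma weights: "face_weights (wrho i) (wV i) (wkap i) (wy i)"
proof (cases "i = 2")
 case True
 have r0: "1 < 2 / sqrt (3::real)" using real_sqrt_less_mono[of 3 4] by (simp add: field_simps)
 have p: "0 < t + 2 / sqrt 3" if "0 \<le> t" for t using that by (simp add: add_nonneg_pos)
 have w: "wrho i = (\<lambda>t. t + 2 / sqrt 3)" "wV i = (\<lambda>t. 0)" "wkap i = (\<lambda>t. 1)" "wy i = (\<lambda>t. 1 / (t + 2 / sqrt 3))"
  using True by (auto simp: wrho_def wV_def wkap_def wy_def)
 have ni: "\<not> L1_on {0..} (\<lambda>t. 1 / wrho i t)"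
 proof (rule not_integrable_if_unbounded[OF wrho_integral])
  have "filterlim (\<lambda>T::real. ln ((T + 2 / sqrt 3) / (2 / sqrt 3))) at_top at_top" by real_asymp
  then show "filterlim (\<lambda>T. if i = 2 then ln ((T + 2 / sqrt 3) / (2 / sqrt 3)) else T) at_top at_top"
   using True by simp
 qed
 show ?thesis
 proof
  show "\<not> L1_on {0..} (\<lambda>t. 1 / wrho i t)" by (rule ni)
  fix t :: real assume t: "0 \<le> t"
  show "1 \<le> wrho i t" unfolding w using r0 t by linarith
  show "(wkap i has_real_derivative (wkap i t)^2 / wrho i t - 1 / wrho i t + wV i t) (at t)"
   by (auto simp: w intro!: derivative_eq_intros)
  show "\<bar>wkap i t\<bar> \<le> 1" by (simp add: w)
  show "0 < wy i t" using p[OF t] by (simp add: w)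
  show "(wy i has_real_derivative - (wkap i t / wrho i t) * wy i t) (at t)"
   unfolding w using p[OF t] by (auto intro!: derivative_eq_intros simp: power2_eq_square)
 qed (simp_all add: w continuous_intros)
next
 case False
 have w: "wrho i = (\<lambda>t. 1)" "wV i = (\<lambda>t. 2 / (cosh (t - waist))^2)" "wkap i = (\<lambda>t. tanh (t - waist))"
   "wy i = (\<lambda>t. 1 / cosh (t - waist))"
  using False by (auto simp: wrho_def wV_def wkap_def wy_def)
 have ni: "\<not> L1_on {0..} (\<lambda>t. 1 / wrho i t)"
  by (rule not_integrable_if_unbounded[OF wrho_integral]) (use False filterlim_ident in auto)
 have c: "cosh x \<noteq> 0" for x :: real using cosh_real_pos[of x] by simp
 show ?thesis
 proof
  show "\<not> L1_on {0..} (\<lambda>t. 1 / wrho i t)" by (rule ni)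
  fix t :: real assume t: "0 \<le> t"
  show "1 \<le> wrho i t" by (simp add: w)
  have "1 / (cosh (t - waist))^2 = (tanh (t - waist))^2 / 1 - 1 / 1 + 2 / (cosh (t - waist))^2"
   using cosh_sq_identity[of "t - waist"] by (simp add: field_simps)
  then show "(wkap i has_real_derivative (wkap i t)^2 / wrho i t - 1 / wrho i t + wV i t) (at t)"
   using tanh_deriv[of t] by (simp add: w)
  show "\<bar>wkap i t\<bar> \<le> 1" using tanh_real_bounds[of "t - waist"] by (auto simp: w)
  show "0 < wy i t" by (simp add: w)
  show "(wy i has_real_derivative - (wkap i t / wrho i t) * wy i t) (at t)"
   unfolding w using c by (auto intro!: derivative_eq_intros simp: power2_eq_square tanh_def)
 qed (auto simp: w c intro!: continuous_intros)
qed

interpretation W: face_weights "wrho i" "wV i" "wkap i" "wy i" for i by (rule weights)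

text \<open>\<open>h\<close> combines the two rotational Jacobi fields, tanh from vertical
  translation and 1 - x tanh x from homothety. Where it is positive, its logarithmic derivative
  solves the Riccati equation for the potential, and \<open>riccati_identity\<close>
  applies.\<close>

lemma catenoid_jacobi:
 fixes f g :: "real \<Rightarrow> real"
 assumes ac: "primitive_on p q f g" and pq: "p \<le> q" and g2: "L1_on {p..q} (\<lambda>s. (g s)^2)"
  and h: "\<And>t. h t = \<sigma> * tanh (t - waist) + \<epsilon> * (1 - (t - waist) * tanh (t - waist))"
  and h': "\<And>t. h' t = \<sigma> * (1 / (cosh (t - waist))^2) - \<epsilon> * (tanh (t - waist) + (t - waist) * (1 / (cosh (t - waist))^2))"
  and pos: "\<And>t. p \<le> t \<Longrightarrow> t \<le> q \<Longrightarrow> 0 < h t"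
 shows "h' q / h q * (f q)^2 - h' p / h p * (f p)^2 \<le> (LBINT s:{p..q}. (g s)^2 - 2 / (cosh (s - waist))^2 * (f s)^2)"
proof -
 define k where "k t = h' t / h t" for t
 define th where "th t = tanh (t - waist)" for t
 have dth: "(th has_real_derivative 1 - (th t)^2) (at t)" for t
  unfolding th_def using tanh_deriv[of t] unfolding cosh_sq_identity .
 have dh: "(h has_real_derivative h' t) (at t)" for t
  unfolding h[abs_def] h' cosh_sq_identity th_def[symmetric]
  by (auto intro!: derivative_eq_intros dth simp: algebra_simps)
 have dh': "(h' has_real_derivative - (2 / (cosh (t - waist))^2) * h t) (at t)" for t
 proof -
  have "2 / (cosh (t - waist))^2 = 2 * (1 - (th t)^2)"
   using cosh_sq_identity[of "t - waist"] by (simp add: th_def)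
  moreover have "(h' has_real_derivative - (2 * (1 - (th t)^2)) * h t) (at t)"
   unfolding h'[abs_def] h cosh_sq_identity th_def[symmetric]
   by (auto intro!: derivative_eq_intros dth simp: algebra_simps power2_eq_square)
  ultimately show ?thesis by simp
 qed
 have dk: "(k has_real_derivative - (2 / (cosh (t - waist))^2) - (k t)^2) (at t)" if "p \<le> t" "t \<le> q" for t
  unfolding k_def using pos[OF that] dh[of t] dh'[of t]
  by (auto intro!: derivative_eq_intros simp: power2_eq_square field_simps)
 have ck: "continuous_on {p..q} k"
  by (intro continuous_at_imp_continuous_on ballI DERIV_isCont[OF dk]) auto
 have cosh0: "cosh x \<noteq> 0" for x :: real using cosh_real_pos[of x] by simp
 have ck': "continuous_on {p..q} (\<lambda>t. - (2 / (cosh (t - waist))^2) - (k t)^2)"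
  by (intro continuous_intros ck) (use cosh0 in auto)
 have "0 \<le> (LBINT s:{p..q}. (g s - k s * f s)^2)"
  by (rule set_integral_nonneg_real) simp
 also have "\<dots> = (LBINT s:{p..q}. (g s)^2 + (- (2 / (cosh (s - waist))^2) - (k s)^2 + (k s)^2) * (f s)^2) - (k q * (f q)^2 - k p * (f p)^2)"
  by (rule riccati_identity(2)[OF ac pq g2 dk ck'])
 also have "(\<lambda>s. (g s)^2 + (- (2 / (cosh (s - waist))^2) - (k s)^2 + (k s)^2) * (f s)^2) = (\<lambda>s. (g s)^2 - 2 / (cosh (s - waist))^2 * (f s)^2)"
  by (simp add: fun_eq_iff)
 finally show ?thesis by (simp add: k_def)
qed

text \<open>The waist cuts the face into two pieces on which the Jacobi field tanh has constant
  sign, but it vanishes at the waist itself. A small multiple of the homothety field makes the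
  comparison function positive up to there; letting it tend to zero gives the logarithmic derivative
  of tanh at the junction.\<close>

lemma catenoid_radial_bound:
 fixes f g :: "real \<Rightarrow> real"
 assumes ac: "primitive_on 0 T f g" and T: "1 \<le> T" and g2: "L1_on {0..T} (\<lambda>s. (g s)^2)"
  and f: "f waist = 0" "f T = 0"
 shows "3 / 2 * (f 0)^2 \<le> (LBINT s:{0..T}. (g s)^2 - 2 / (cosh (s - waist))^2 * (f s)^2)"
proof -
 have cosh0: "cosh x \<noteq> 0" for x :: real using cosh_real_pos[of x] by simp
 have w: "0 < waist" "waist < T" "waist < 1" using waist_bounds T by auto
 have int: "L1_on {0..T} (\<lambda>s. (g s)^2 - 2 / (cosh (s - waist))^2 * (f s)^2)"
  by (rule set_integral_diff(1)[OF g2])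
   (intro continuous_set_integrable continuous_intros primitive_on_continuous[OF ac], use cosh0 in auto)
 define I where "I = (LBINT s:{0..waist}. (g s)^2 - 2 / (cosh (s - waist))^2 * (f s)^2)"
 define J where "J = (LBINT s:{waist..T}. (g s)^2 - 2 / (cosh (s - waist))^2 * (f s)^2)"
 have split: "(LBINT s:{0..T}. (g s)^2 - 2 / (cosh (s - waist))^2 * (f s)^2) = I + J"
  unfolding I_def J_def by (rule set_integral_split_Icc[OF int]) (use w in auto)
 have g2': "L1_on {p..q} (\<lambda>s. (g s)^2)" if "0 \<le> p" "q \<le> T" for p q
  by (rule set_integrable_subset[OF g2]) (use that in auto)
 have J: "0 \<le> J"
 proof -
  \<comment> \<open>With this weight the homothety field cannot outweigh tanh before t = T, so
    \<open>h\<close> stays positive on the whole outer piece. Both endpoint values of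
    \<open>f\<close> are zero there, so no limit is taken.\<close>
  define \<epsilon> where "\<epsilon> = 1 / T"
  have \<epsilon>: "0 < \<epsilon>" using T by (simp add: \<epsilon>_def)
  define h where "h t = 1 * tanh (t - waist) + \<epsilon> * (1 - (t - waist) * tanh (t - waist))" for t
  define h' where "h' t = 1 * (1 / (cosh (t - waist))^2) - \<epsilon> * (tanh (t - waist) + (t - waist) * (1 / (cosh (t - waist))^2))" for t
  have pos: "0 < h t" if "waist \<le> t" "t \<le> T" for t
  proof -
   have "0 \<le> tanh (t - waist)" using that by (simp add: tanh_real_nonneg_iff)
   moreover have "\<epsilon> * (t - waist) \<le> 1" using that w T by (simp add: \<epsilon>_def field_simps)
   ultimately have "0 \<le> tanh (t - waist) * (1 - \<epsilon> * (t - waist))" by (intro mult_nonneg_nonneg) auto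
   then show ?thesis using \<epsilon> by (simp add: h_def algebra_simps)
  qed
  have "h' T / h T * (f T)^2 - h' waist / h waist * (f waist)^2 \<le> J"
   unfolding J_def
   by (rule catenoid_jacobi[OF primitive_on_subinterval[OF ac] _ g2' h_def h'_def pos]) (use w in auto)
  then show ?thesis using f by simp
 qed
 have I: "(3 / 4 - \<epsilon> * (1 / 2 + waist * (3 / 4))) / (1 / 2 + \<epsilon> * (1 - waist * (1 / 2))) * (f 0)^2 \<le> I" if \<epsilon>: "0 < \<epsilon>" for \<epsilon>
 proof -
  define h where "h t = (- 1) * tanh (t - waist) + \<epsilon> * (1 - (t - waist) * tanh (t - waist))" for t
  define h' where "h' t = (- 1) * (1 / (cosh (t - waist))^2) - \<epsilon> * (tanh (t - waist) + (t - waist) * (1 / (cosh (t - waist))^2))" for t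
  have pos: "0 < h t" if t: "0 \<le> t" "t \<le> waist" for t
  proof -
   have a: "0 \<le> tanh (waist - t)" "tanh (waist - t) \<le> 1"
    using t tanh_real_bounds[of "waist - t"] by (auto simp: tanh_real_nonneg_iff)
   have "(waist - t) * tanh (waist - t) \<le> (waist - t) * 1" using a t by (intro mult_left_mono) auto
   also have "\<dots> < 1" using t w by simp
   finally have "(waist - t) * tanh (waist - t) < 1" .
   then have "0 < \<epsilon> * (1 - (waist - t) * tanh (waist - t))" using \<epsilon> by simp
   moreover have "tanh (t - waist) = - tanh (waist - t)" using tanh_minus[of "waist - t"] by simp
   moreover from this have "h t = tanh (waist - t) + \<epsilon> * (1 - (waist - t) * tanh (waist - t))"
    unfolding h_def by (simp add: algebra_simps)
   ultimately show ?thesis using a(1) by linarith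
  qed
  have J: "h' waist / h waist * (f waist)^2 - h' 0 / h 0 * (f 0)^2 \<le> I"
   unfolding I_def
   by (rule catenoid_jacobi[OF primitive_on_subinterval[OF ac] _ g2' h_def h'_def pos]) (use w in auto)
  have eq: "- (h' 0 / h 0) = (3 / 4 - \<epsilon> * (1 / 2 + waist * (3 / 4))) / (1 / 2 + \<epsilon> * (1 - waist * (1 / 2)))"
  proof -
   have "h 0 = 1 / 2 + \<epsilon> * (1 - waist * (1 / 2))"
    unfolding h_def by (simp add: waist_values(1))
   moreover have "h' 0 = - (3 / 4 - \<epsilon> * (1 / 2 + waist * (3 / 4)))"
    unfolding h'_def by (simp add: waist_values(1,3)) (simp add: algebra_simps)
   ultimately show ?thesis by (simp only: minus_divide_left minus_minus)
  qed
  have "- (h' 0 / h 0) * (f 0)^2 \<le> I" using J f by simp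
  then show ?thesis unfolding eq .
 qed
 \<comment> \<open>In the limit the quotient is (3 / 4) / (1 / 2) = 3 / 2.\<close>
 have "((\<lambda>\<epsilon>. (3 / 4 - \<epsilon> * (1 / 2 + waist * (3 / 4))) / (1 / 2 + \<epsilon> * (1 - waist * (1 / 2))) * (f 0)^2) \<longlongrightarrow>
   (3 / 4 - 0 * (1 / 2 + waist * (3 / 4))) / (1 / 2 + 0 * (1 - waist * (1 / 2))) * (f 0)^2) (at_right 0)"
  by (intro tendsto_intros) auto
 then have "(3 / 4 - 0 * (1 / 2 + waist * (3 / 4))) / (1 / 2 + 0 * (1 - waist * (1 / 2))) * (f 0)^2 \<le> I"
  by (rule tendsto_upperbound) (use I in \<open>auto simp: eventually_at_right_less intro!: eventually_mono[OF eventually_at_right_less[of 0]]\<close>)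
 then show ?thesis using J split by simp
qed

section \<open>Geometry of the faces\<close>

definition diag2 :: "real \<Rightarrow> real \<Rightarrow> real^2^2" where
 "diag2 a b = vector [vector [a, 0], vector [0, b]]"

lemma diag2_nth: "diag2 a b $ 1 $ 1 = a" "diag2 a b $ 1 $ 2 = 0" "diag2 a b $ 2 $ 1 = 0" "diag2 a b $ 2 $ 2 = b"
 by (simp_all add: diag2_def vector_2)

lemma diag2_mult: "diag2 a b ** diag2 c d = diag2 (a * c) (b * d)"
 by (simp add: vec_eq_iff forall_2 matrix_matrix_mult_def sum_2 diag2_nth)

lemma diag2_inv:
 assumes "a \<noteq> 0" "b \<noteq> 0" shows "matrix_inv (diag2 a b) = diag2 (1 / a) (1 / b)"
proof -
 have 1: "diag2 1 1 = mat 1" by (simp add: vec_eq_iff forall_2 diag2_nth mat_def)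
 have "diag2 a b ** diag2 (1 / a) (1 / b) = mat 1" "diag2 (1 / a) (1 / b) ** diag2 a b = mat 1"
  using assms by (simp_all add: diag2_mult 1)
 note AB = this
 show ?thesis unfolding matrix_inv_def
 proof (rule some_equality)
  fix A' assume A': "diag2 a b ** A' = mat 1 \<and> A' ** diag2 a b = mat 1"
  have "A' = A' ** (diag2 a b ** diag2 (1 / a) (1 / b))" using AB by simp
  also have "\<dots> = diag2 (1 / a) (1 / b)" unfolding matrix_mul_assoc using A' by simp
  finally show "A' = diag2 (1 / a) (1 / b)" .
 qed (use AB in blast)
qed

lemma first_form_diag:
 assumes "pd 1 X p \<bullet> pd 1 X p = a" "pd 1 X p \<bullet> pd 2 X p = 0" "pd 2 X p \<bullet> pd 2 X p = b"
 shows "first_form X p = diag2 a b"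
 using assms by (simp add: first_form_def vec_eq_iff forall_2 diag2_nth inner_commute)

lemma area_density_diag: "first_form X p = diag2 a b \<Longrightarrow> area_density X p = sqrt (a * b)"
 by (simp add: area_density_def det_2 diag2_nth)

lemma grad_inner_diag:
 "first_form X p = diag2 a b \<Longrightarrow> a \<noteq> 0 \<Longrightarrow> b \<noteq> 0 \<Longrightarrow> grad_inner X p v w = v $ 1 * w $ 1 / a + v $ 2 * w $ 2 / b"
 by (simp add: grad_inner_def diag2_inv inner_vec_def sum_2 matrix_vector_mult_def diag2_nth)

lemma second_form_norm_diag:
 assumes "first_form X p = diag2 a b" "a \<noteq> 0" "b \<noteq> 0" "second_form X p = diag2 k l"
 shows "second_form_norm_sq X p = (k / a)^2 + (l / b)^2"
 using assms by (simp add: second_form_norm_sq_def Let_def diag2_inv diag2_mult trace_def sum_2 diag2_nth power2_eq_square)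

lemma inner_vector_3: "(vector [a, b, d] :: real^3) \<bullet> vector [a', b', d'] = a * a' + b * b' + d * d'"
 by (simp add: inner_vec_def sum_3)

lemma scaleR_vector_3: "k *\<^sub>R (vector [a, b, d] :: real^3) = vector [k * a, k * b, k * d]"
 by (simp add: vec_eq_iff forall_3)

text \<open>The parametrization is conformal, and the second fundamental form has the constant
  diagonal entries - c \<sigma> and c \<sigma>; their opposite signs are minimality.\<close>

lemma catenoid_geometry:
 assumes c: "0 < c" and \<sigma>: "\<sigma>^2 = (1::real)"
 defines "X \<equiv> (\<lambda>p. c *\<^sub>R catenoid_face \<sigma> p)"
 shows "first_form X (t, \<theta>) = diag2 (c^2 * (cosh (t - waist))^2) (c^2 * (cosh (t - waist))^2)"
  and "area_density X (t, \<theta>) = c^2 * (cosh (t - waist))^2"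
  and "second_form_norm_sq X (t, \<theta>) = 2 / (c^2 * (cosh (t - waist)) ^ 4)"
  and "grad_inner X (t, \<theta>) v w = (v $ 1 * w $ 1 + v $ 2 * w $ 2) / (c^2 * (cosh (t - waist))^2)"
proof -
 define C where "C = cosh (t - waist)"
 define S where "S = sinh (t - waist)"
 have CS: "C^2 = S^2 + 1" using cosh_square_eq[of "t - waist"] by (simp add: C_def S_def)
 have C: "0 < C" by (simp add: C_def)
 have sc: "cos \<theta> * cos \<theta> = 1 - sin \<theta> * sin \<theta>"
  using sin_cos_squared_add[of \<theta>] by (simp add: power2_eq_square)
 have p1: "pd 1 X (t, \<theta>) = vector [c * (S * cos \<theta>), c * (S * sin \<theta>), c * \<sigma>]"
  and p2: "pd 2 X (t, \<theta>) = vector [c * (- C * sin \<theta>), c * (C * cos \<theta>), 0]"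
  unfolding X_def pd_catenoid_face waist_def[symmetric] C_def S_def scaleR_vector_3 by simp_all
 have ss: "\<sigma> * \<sigma> = 1" using \<sigma> by (simp add: power2_eq_square)
 show ff: "first_form X (t, \<theta>) = diag2 (c^2 * (cosh (t - waist))^2) (c^2 * (cosh (t - waist))^2)"
 proof (rule first_form_diag)
  have "pd 1 X (t, \<theta>) \<bullet> pd 1 X (t, \<theta>) = c^2 * (S^2 * (cos \<theta> * cos \<theta> + sin \<theta> * sin \<theta>) + \<sigma> * \<sigma>)"
   unfolding p1 inner_vector_3 by algebra
  then show "pd 1 X (t, \<theta>) \<bullet> pd 1 X (t, \<theta>) = c^2 * (cosh (t - waist))^2"
   using CS ss sc unfolding C_def[symmetric] by simp
  show "pd 1 X (t, \<theta>) \<bullet> pd 2 X (t, \<theta>) = 0" unfolding p1 p2 inner_vector_3 by (simp add: algebra_simps)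
  have "pd 2 X (t, \<theta>) \<bullet> pd 2 X (t, \<theta>) = c^2 * (C^2 * (cos \<theta> * cos \<theta> + sin \<theta> * sin \<theta>))"
   unfolding p2 inner_vector_3 by algebra
  then show "pd 2 X (t, \<theta>) \<bullet> pd 2 X (t, \<theta>) = c^2 * (cosh (t - waist))^2"
   using sc unfolding C_def[symmetric] by simp
 qed
 have nz: "c^2 * (cosh (t - waist))^2 \<noteq> 0" using c C by (simp add: C_def)
 show "area_density X (t, \<theta>) = c^2 * (cosh (t - waist))^2"
  using area_density_diag[OF ff] by (simp add: real_sqrt_mult)
 show "grad_inner X (t, \<theta>) v w = (v $ 1 * w $ 1 + v $ 2 * w $ 2) / (c^2 * (cosh (t - waist))^2)"
  using grad_inner_diag[OF ff nz nz] by (simp add: add_divide_distrib)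
 have N: "unit_normal X (t, \<theta>) = vector [- \<sigma> * cos \<theta> / C, - \<sigma> * sin \<theta> / C, S / C]"
  unfolding unit_normal_def p1 p2
 proof (rule sgn_eqI[where r = "c^2 * C^2"])
  show "cross3 (vector [c * (S * cos \<theta>), c * (S * sin \<theta>), c * \<sigma>]) (vector [c * (- C * sin \<theta>), c * (C * cos \<theta>), 0]) =
   (c^2 * C^2) *\<^sub>R vector [- \<sigma> * cos \<theta> / C, - \<sigma> * sin \<theta> / C, S / C]"
  proof -
   have "c * (S * cos \<theta>) * (c * (C * cos \<theta>)) - c * (S * sin \<theta>) * (c * (- C * sin \<theta>)) =
    c^2 * (S * C) * (cos \<theta> * cos \<theta> + sin \<theta> * sin \<theta>)"
    by algebra
   then have e3: "c * (S * cos \<theta>) * (c * (C * cos \<theta>)) - c * (S * sin \<theta>) * (c * (- C * sin \<theta>)) = c^2 * (S * C)"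
    unfolding sc by simp
   have "cross3 (vector [c * (S * cos \<theta>), c * (S * sin \<theta>), c * \<sigma>]) (vector [c * (- C * sin \<theta>), c * (C * cos \<theta>), 0]) =
    vector [- (c * \<sigma> * (c * (C * cos \<theta>))), c * \<sigma> * (c * (- C * sin \<theta>)), c^2 * (S * C)]"
    using e3 by (simp add: cross3_def)
   then show ?thesis
    unfolding scaleR_vector_3 using C by (simp add: power2_eq_square mult_ac)
  qed
  show "0 < c^2 * C^2" using c C by simp
  have "(- \<sigma> * cos \<theta> / C)^2 + (- \<sigma> * sin \<theta> / C)^2 + (S / C)^2 = (\<sigma>^2 * ((cos \<theta>)^2 + (sin \<theta>)^2) + S^2) / C^2"
   by (simp only: power_divide power_mult_distrib add_divide_distrib distrib_left power2_minus)
  also have "\<dots> = C^2 / C^2" using CS \<sigma> by simp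
  also have "\<dots> = 1" using C by simp
  finally show "norm (vector [- \<sigma> * cos \<theta> / C, - \<sigma> * sin \<theta> / C, S / C] :: real^3) = 1"
   by (rule norm_vector_3_eq_1)
 qed
 have P1: "pd 1 X = (\<lambda>(t, \<theta>). c *\<^sub>R vector [sinh (t - waist) * cos \<theta>, sinh (t - waist) * sin \<theta>, \<sigma>])"
  unfolding X_def by (auto simp: fun_eq_iff pd_catenoid_face waist_def)
 have P2: "pd 2 X = (\<lambda>(t, \<theta>). c *\<^sub>R vector [- cosh (t - waist) * sin \<theta>, cosh (t - waist) * cos \<theta>, 0])"
  unfolding X_def by (auto simp: fun_eq_iff pd_catenoid_face waist_def)
 have D: "pd 1 (pd 1 X) (t, \<theta>) = c *\<^sub>R vector [C * cos \<theta>, C * sin \<theta>, 0]"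
  "pd 2 (pd 1 X) (t, \<theta>) = c *\<^sub>R vector [- S * sin \<theta>, S * cos \<theta>, 0]"
  "pd 1 (pd 2 X) (t, \<theta>) = c *\<^sub>R vector [- S * sin \<theta>, S * cos \<theta>, 0]"
  "pd 2 (pd 2 X) (t, \<theta>) = c *\<^sub>R vector [- C * cos \<theta>, - C * sin \<theta>, 0]"
  unfolding P1 P2 unfolding pd_def C_def S_def
  by (auto intro!: vector_derivative_at has_vector_derivative_scaleR[THEN has_vector_derivative_eq_rhs]
   has_vector_derivative_vector_3 derivative_eq_intros simp: mult.commute)
 have sf: "second_form X (t, \<theta>) = diag2 (- c * \<sigma>) (c * \<sigma>)"
 proof -
  have a: "c *\<^sub>R vector [C * cos \<theta>, C * sin \<theta>, 0] \<bullet> unit_normal X (t, \<theta>) = - c * \<sigma>"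
   unfolding N scaleR_vector_3 inner_vector_3 using C by (simp add: field_simps sc)
  moreover have "c *\<^sub>R vector [- C * cos \<theta>, - C * sin \<theta>, 0] \<bullet> unit_normal X (t, \<theta>) = c * \<sigma>"
   unfolding N scaleR_vector_3 inner_vector_3 using C by (simp add: field_simps sc)
  moreover have "c *\<^sub>R vector [- S * sin \<theta>, S * cos \<theta>, 0] \<bullet> unit_normal X (t, \<theta>) = 0"
   unfolding N scaleR_vector_3 inner_vector_3 using C by (simp add: field_simps)
  ultimately show ?thesis
   by (simp add: second_form_def vec_eq_iff forall_2 diag2_nth D)
 qed
 have "(- c * \<sigma> / (c^2 * C^2))^2 + (c * \<sigma> / (c^2 * C^2))^2 = 2 / (c^2 * C ^ 4)"
  using c C ss by (simp add: power2_eq_square field_simps power4_eq_xxxx)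
 then show "second_form_norm_sq X (t, \<theta>) = 2 / (c^2 * (cosh (t - waist)) ^ 4)"
  unfolding second_form_norm_diag[OF ff nz nz sf] C_def .
qed

lemma plane_geometry:
 assumes c: "0 < c" and t: "0 \<le> t"
 defines "X \<equiv> (\<lambda>p. c *\<^sub>R planar_face p)"
 shows "first_form X (t, \<theta>) = diag2 (c^2) (c^2 * (t + 2 / sqrt 3)^2)"
  and "area_density X (t, \<theta>) = c^2 * (t + 2 / sqrt 3)"
  and "second_form_norm_sq X (t, \<theta>) = 0"
  and "grad_inner X (t, \<theta>) v w = v $ 1 * w $ 1 / c^2 + v $ 2 * w $ 2 / (c^2 * (t + 2 / sqrt 3)^2)"
proof -
 define r where "r = t + 2 / sqrt 3"
 have r: "0 < r" using t by (simp add: r_def add_nonneg_pos)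
 have sc: "cos \<theta> * cos \<theta> = 1 - sin \<theta> * sin \<theta>"
  using sin_cos_squared_add[of \<theta>] by (simp add: power2_eq_square)
 have p1: "pd 1 X (t, \<theta>) = vector [c * cos \<theta>, c * sin \<theta>, 0]"
  and p2: "pd 2 X (t, \<theta>) = vector [- c * (sin \<theta> * r), c * (cos \<theta> * r), 0]"
  unfolding X_def pd_planar_face r_def scaleR_vector_3 by simp_all
 show ff: "first_form X (t, \<theta>) = diag2 (c^2) (c^2 * (t + 2 / sqrt 3)^2)"
 proof (rule first_form_diag)
  have "pd 1 X (t, \<theta>) \<bullet> pd 1 X (t, \<theta>) = c^2 * (cos \<theta> * cos \<theta> + sin \<theta> * sin \<theta>)"
   unfolding p1 inner_vector_3 by algebra
  then show "pd 1 X (t, \<theta>) \<bullet> pd 1 X (t, \<theta>) = c^2" using sc by simp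
  show "pd 1 X (t, \<theta>) \<bullet> pd 2 X (t, \<theta>) = 0" unfolding p1 p2 inner_vector_3 by (simp add: algebra_simps)
  have "pd 2 X (t, \<theta>) \<bullet> pd 2 X (t, \<theta>) = c^2 * r^2 * (cos \<theta> * cos \<theta> + sin \<theta> * sin \<theta>)"
   unfolding p2 inner_vector_3 by algebra
  then show "pd 2 X (t, \<theta>) \<bullet> pd 2 X (t, \<theta>) = c^2 * (t + 2 / sqrt 3)^2" using sc by (simp add: r_def)
 qed
 have nz: "c^2 \<noteq> 0" "c^2 * (t + 2 / sqrt 3)^2 \<noteq> 0" using c r by (simp_all add: r_def)
 show "area_density X (t, \<theta>) = c^2 * (t + 2 / sqrt 3)"
 proof -
  have "c^2 * (c^2 * r^2) = (c^2 * r)^2" by (simp add: power2_eq_square algebra_simps)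
  moreover have "0 \<le> c^2 * r" using r by simp
  ultimately show ?thesis using area_density_diag[OF ff] unfolding r_def[symmetric] by (simp add: real_sqrt_abs)
 qed
 show "grad_inner X (t, \<theta>) v w = v $ 1 * w $ 1 / c^2 + v $ 2 * w $ 2 / (c^2 * (t + 2 / sqrt 3)^2)"
  by (rule grad_inner_diag[OF ff nz])
 have N: "unit_normal X (t, \<theta>) = vector [0, 0, 1]"
  unfolding unit_normal_def p1 p2
 proof (rule sgn_eqI[where r = "c^2 * r"])
  show "cross3 (vector [c * cos \<theta>, c * sin \<theta>, 0]) (vector [- c * (sin \<theta> * r), c * (cos \<theta> * r), 0]) =
   (c^2 * r) *\<^sub>R vector [0, 0, 1]"
  proof -
   have "c * cos \<theta> * (c * (cos \<theta> * r)) - c * sin \<theta> * (- c * (sin \<theta> * r)) = c^2 * r * (cos \<theta> * cos \<theta> + sin \<theta> * sin \<theta>)"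
    by algebra
   then show ?thesis using sc by (simp add: cross3_def scaleR_vector_3)
  qed
  show "0 < c^2 * r" using c r by simp
  show "norm (vector [0, 0, 1] :: real^3) = 1" by (rule norm_vector_3_eq_1) simp
 qed
 have P1: "pd 1 X = (\<lambda>(t, \<theta>). c *\<^sub>R vector [cos \<theta>, sin \<theta>, 0])"
  unfolding X_def by (auto simp: fun_eq_iff pd_planar_face)
 have P2: "pd 2 X = (\<lambda>(t, \<theta>). c *\<^sub>R vector [- (sin \<theta> * (t + 2 / sqrt 3)), cos \<theta> * (t + 2 / sqrt 3), 0])"
  unfolding X_def by (auto simp: fun_eq_iff pd_planar_face)
 have zero3: "(vector [0, 0, 0] :: real^3) = 0" by (simp add: vec_eq_iff forall_3)
 have D: "pd 1 (pd 1 X) (t, \<theta>) = c *\<^sub>R vector [0, 0, 0]"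
  "pd 2 (pd 1 X) (t, \<theta>) = c *\<^sub>R vector [- sin \<theta>, cos \<theta>, 0]"
  "pd 1 (pd 2 X) (t, \<theta>) = c *\<^sub>R vector [- sin \<theta>, cos \<theta>, 0]"
  "pd 2 (pd 2 X) (t, \<theta>) = c *\<^sub>R vector [- (cos \<theta> * r), - (sin \<theta> * r), 0]"
  unfolding P1 P2 unfolding pd_def r_def
  by (auto intro!: vector_derivative_at has_vector_derivative_scaleR[THEN has_vector_derivative_eq_rhs]
   has_vector_derivative_vector_3 derivative_eq_intros simp: zero3)
 have sf: "second_form X (t, \<theta>) = diag2 0 0"
  by (simp add: second_form_def vec_eq_iff forall_2 diag2_nth D N scaleR_vector_3 inner_vector_3)
 show "second_form_norm_sq X (t, \<theta>) = 0"
  unfolding second_form_norm_diag[OF ff nz sf] by simp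
qed

section \<open>Densities, boundary terms and norms of the three faces\<close>

abbreviation "Ycat \<equiv> pseudo_Y_catenoid"

text \<open>The geodesic curvature term of the index form: \<open>- H\<^sub>\<Gamma> \<bullet> \<eta>\<^sub>i\<close> times the length element.\<close>

definition "wq i = (if i = (2::3) then - 1 else 1 / 2 :: real)"

lemma three_cases: "i = 1 \<or> i = 2 \<or> i = (3::3)" using exhaust_3 by blast

text \<open>Dirichlet integrals and |A|^2 times area are invariant under homotheties in dimension
  two, so \<open>c\<close> disappears from the weights. On the catenoids conformality moreover gives
  both derivatives the weight 1.\<close>

lemma Ycat_density:
 assumes c: "0 < c" and t: "0 \<le> t"
 shows "(grad_inner (Ycat c i) (t, \<theta>) v w - second_form_norm_sq (Ycat c i) (t, \<theta>) * x * y) * area_density (Ycat c i) (t, \<theta>)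
  = wrho i t * v $ 1 * w $ 1 + v $ 2 * w $ 2 / wrho i t - wV i t * x * y" (is ?A)
  and "grad_inner (Ycat c i) (t, \<theta>) v w * area_density (Ycat c i) (t, \<theta>)
  = wrho i t * v $ 1 * w $ 1 + v $ 2 * w $ 2 / wrho i t" (is ?B)
proof -
 have cat: "(grad_inner X (t, \<theta>) v w - second_form_norm_sq X (t, \<theta>) * x * y) * area_density X (t, \<theta>)
  = v $ 1 * w $ 1 + v $ 2 * w $ 2 - 2 / (cosh (t - waist))^2 * x * y \<and>
  grad_inner X (t, \<theta>) v w * area_density X (t, \<theta>) = v $ 1 * w $ 1 + v $ 2 * w $ 2"
  if X: "X = (\<lambda>p. c *\<^sub>R catenoid_face \<sigma> p)" and \<sigma>: "\<sigma>^2 = 1" for X \<sigma>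
 proof -
  define C where "C = cosh (t - waist)"
  have "0 < C" by (simp add: C_def)
  then have e: "(w1 / (c^2 * C^2) - 2 / (c^2 * C ^ 4) * x * y) * (c^2 * C^2) = w1 - 2 / C^2 * x * y" "w1 / (c^2 * C^2) * (c^2 * C^2) = w1" for w1
   using c by (simp_all add: field_simps power2_eq_square power4_eq_xxxx)
  show ?thesis
   unfolding X catenoid_geometry[OF c \<sigma>] using e unfolding C_def by blast
 qed
 have "?A \<and> ?B"
 proof (cases "i = 2")
  case True
  define r where "r = t + 2 / sqrt 3"
  have r: "0 < r" using t by (simp add: r_def add_nonneg_pos)
  have e: "(a / c^2 + b / (c^2 * r^2)) * (c^2 * r) = r * a + b / r" for a b
   using c r by (simp add: field_simps power2_eq_square)
  show ?thesis unfolding True pseudo_Y_catenoid_faces plane_geometry[OF c t] wrho_def wV_def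
   using e[of "v $ 1 * w $ 1" "v $ 2 * w $ 2"] by (simp add: r_def mult.assoc)
 next
  case False
  then consider "i = 1" | "i = 3" using three_cases by blast
  then have "\<exists>\<sigma>. Ycat c i = (\<lambda>p. c *\<^sub>R catenoid_face \<sigma> p) \<and> \<sigma>^2 = 1"
  proof cases
   case 1 then show ?thesis by (intro exI[of _ 1]) (simp add: pseudo_Y_catenoid_faces)
  next
   case 2 then show ?thesis by (intro exI[of _ "-1"]) (simp add: pseudo_Y_catenoid_faces)
  qed
  then show ?thesis using cat False by (auto simp: wrho_def wV_def)
 qed
 then show ?A ?B by auto
qed

text \<open>The curvature vector points to the axis with length one over the radius, and the length
  element contributes the radius, so the radius cancels together with \<open>c\<close>. What is left
  is the radial component of the conormal, fixed by the contact angle.\<close>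

lemma Ycat_boundary:
 assumes c: "0 < c"
 shows "boundary_integral (Ycat c i) (\<lambda>\<theta>. (boundary_curvature (Ycat c i) \<theta> \<bullet> conormal (Ycat c i) \<theta>) * a \<theta> * b \<theta>)
  = - wq i * (LBINT \<theta>:{0..<2 * pi}. a \<theta> * b \<theta>)"
proof -
 have bv: "boundary_velocity (Ycat c i) \<theta> = (2 * c / sqrt 3) *\<^sub>R vector [- sin \<theta>, cos \<theta>, 0]" for \<theta>
  unfolding boundary_velocity_conv_pd boundary_pd_pseudo_Y_catenoid ..
 have n1: "norm (vector [- sin \<theta>, cos \<theta>, 0] :: real^3) = 1" for \<theta>
  by (rule norm_vector_3_eq_1) simp
 have nbv: "norm (boundary_velocity (Ycat c i) \<theta>) = 2 * c / sqrt 3" for \<theta>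
  unfolding bv norm_scaleR n1 using c by simp
 have sg: "sgn (boundary_velocity (Ycat c i) \<theta>) = vector [- sin \<theta>, cos \<theta>, 0]" for \<theta>
  unfolding bv by (rule sgn_eqI[OF refl _ n1]) (use c in simp)
 have vd: "vector_derivative (\<lambda>s. vector [- sin s, cos s, 0] :: real^3) (at \<theta>) = vector [- cos \<theta>, - sin \<theta>, 0]" for \<theta>
  by (rule vector_derivative_at, rule has_vector_derivative_vector_3) (auto intro!: derivative_eq_intros)
 have bc: "boundary_curvature (Ycat c i) \<theta> = vector [- cos \<theta>, - sin \<theta>, 0] /\<^sub>R (2 * c / sqrt 3)" for \<theta>
  unfolding boundary_curvature_def sg nbv vd ..
 have sc: "cos \<theta> * cos \<theta> = 1 - sin \<theta> * sin \<theta>" for \<theta> :: real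
  using sin_cos_squared_add[of \<theta>] by (simp add: power2_eq_square)
 have k: "(vector [- cos \<theta>, - sin \<theta>, 0] :: real^3) \<bullet> conormal (Ycat c i) \<theta> = - wq i" for \<theta>
  using three_cases[of i]
 proof (elim disjE)
  assume i: "i = 1"
  show ?thesis unfolding i conormal_pseudo_Y_catenoid(1)[OF c] inner_vector_3 using sc[of \<theta>] by (simp add: wq_def field_simps)
 next
  assume i: "i = 2"
  show ?thesis unfolding i conormal_pseudo_Y_catenoid(2)[OF c] inner_vector_3 using sc[of \<theta>] by (simp add: wq_def field_simps)
 next
  assume i: "i = 3"
  show ?thesis unfolding i conormal_pseudo_Y_catenoid(3)[OF c] inner_vector_3 using sc[of \<theta>] by (simp add: wq_def field_simps)
 qed
 have "(boundary_curvature (Ycat c i) \<theta> \<bullet> conormal (Ycat c i) \<theta>) * a \<theta> * b \<theta> * norm (boundary_velocity (Ycat c i) \<theta>) = - wq i * (a \<theta> * b \<theta>)" for \<theta>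
  unfolding bc nbv inner_scaleR_left k using c by (simp add: field_simps)
 then show ?thesis unfolding boundary_integral_def by (simp only: set_integral_mult_right)
qed

definition "wnorm c i t = (if i = (2::3) then c * (t + 2 / sqrt 3) else c * sqrt ((cosh (t - waist))^2 + t^2) :: real)"
definition "warea c i t = (if i = (2::3) then c^2 * (t + 2 / sqrt 3) else c^2 * (cosh (t - waist))^2 :: real)"
definition "wstar c i t = warea c i t / ((1 + (wnorm c i t)^2) * (ln (2 + wnorm c i t))^2)"

lemma norm_vector_3: "norm (vector [a, b, d] :: real^3) = sqrt (a^2 + b^2 + d^2)"
 by (simp add: norm_eq_sqrt_inner inner_vector_3 power2_eq_square)

lemma Ycat_norm_area:
 assumes c: "0 < c" and t: "0 \<le> t"
 shows "norm (Ycat c i (t, \<theta>)) = wnorm c i t" and "area_density (Ycat c i) (t, \<theta>) = warea c i t"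
proof -
 have cat: "norm (catenoid_face \<sigma> (t, \<theta>)) = sqrt ((cosh (t - waist))^2 + t^2)" if "\<sigma>^2 = 1" for \<sigma>
 proof -
  have "(cosh (t - waist) * cos \<theta>)^2 + (cosh (t - waist) * sin \<theta>)^2 + (\<sigma> * t)^2 =
   (cosh (t - waist))^2 * ((sin \<theta>)^2 + (cos \<theta>)^2) + \<sigma>^2 * t^2"
   by (simp only: power_mult_distrib) algebra
  then show ?thesis using that by (simp add: catenoid_face_def norm_vector_3 waist_def)
 qed
 have pl: "norm (planar_face (t, \<theta>)) = t + 2 / sqrt 3"
 proof -
  have "((t + 2 / sqrt 3) * cos \<theta>)^2 + ((t + 2 / sqrt 3) * sin \<theta>)^2 + 0^2 = (t + 2 / sqrt 3)^2 * ((sin \<theta>)^2 + (cos \<theta>)^2)"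
   by (simp only: power_mult_distrib zero_power2) algebra
  then show ?thesis using t by (simp add: planar_face_def norm_vector_3)
 qed
 show "norm (Ycat c i (t, \<theta>)) = wnorm c i t"
  using three_cases[of i] cat[of 1] cat[of "-1"] pl c by (auto simp: pseudo_Y_catenoid_faces wnorm_def)
 show "area_density (Ycat c i) (t, \<theta>) = warea c i t"
  using three_cases[of i] catenoid_geometry(2)[OF c, of 1 t \<theta>] catenoid_geometry(2)[OF c, of "-1" t \<theta>] plane_geometry(2)[OF c t, of \<theta>]
  by (auto simp: pseudo_Y_catenoid_faces warea_def)
qed

lemma Ycat_periodic: "Ycat c i (t, \<theta> + 2 * pi) = Ycat c i (t, \<theta>)"
 by (simp add: pseudo_Y_catenoid_def catenoid_face_def planar_face_def)

section \<open>The weighted space in coordinates\<close>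

lemma pos_integrable_FTC:
 fixes f \<Phi> :: "real \<Rightarrow> real"
 assumes d: "\<And>t. 0 \<le> t \<Longrightarrow> (\<Phi> has_real_derivative f t) (at t)" and c: "continuous_on {0..} f"
  and nn: "\<And>t. 0 \<le> t \<Longrightarrow> 0 \<le> f t" and lim: "(\<Phi> \<longlongrightarrow> l) at_top"
 shows "L1_on {0..} f"
proof -
 have P: "primitive_on 0 T \<Phi> f" for T
  by (rule primitive_on_at_deriv[OF d continuous_on_subset[OF c]]) auto
 have eq: "(\<Union>n::nat. {0..real n}) = {0::real..}"
  by (auto simp: real_arch_simple)
 have "L1_on (\<Union>n::nat. {0..real n}) f"
 proof (rule pos_integrable_to_top[where l = "l - \<Phi> 0"])
  show "L1_on {0..real n} f" for n by (rule primitive_on_integrable[OF P])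
  have "(LBINT t:{0..real n}. f t) = \<Phi> (real n) - \<Phi> 0" for n
   using primitive_on_eq[OF P[of "real n"], of "real n"] by simp
  moreover have "(\<lambda>n. \<Phi> (real n) - \<Phi> 0) \<longlonglongrightarrow> l - \<Phi> 0"
   by (intro tendsto_intros filterlim_compose[OF lim filterlim_real_sequentially])
  ultimately show "(\<lambda>n. LBINT t:{0..real n}. f t) \<longlonglongrightarrow> l - \<Phi> 0" by simp
 qed (use nn in \<open>auto simp: mono_def\<close>)
 then show ?thesis unfolding eq .
qed

lemma wnorm_nonneg: "0 < c \<Longrightarrow> 0 \<le> t \<Longrightarrow> 0 \<le> wnorm c i t"
 by (simp add: wnorm_def add_nonneg_nonneg)

lemma warea_pos: "0 < c \<Longrightarrow> 0 \<le> t \<Longrightarrow> 0 < warea c i t"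
 by (simp add: warea_def add_nonneg_pos)

lemma ln_wnorm_pos: "0 < c \<Longrightarrow> 0 \<le> t \<Longrightarrow> ln 2 \<le> ln (2 + wnorm c i t)"
 using wnorm_nonneg[of c t i] by (subst ln_le_cancel_iff) auto

lemma ln2_half: "1 / 2 \<le> ln (2::real)"
proof -
 have "exp (1 / 2 :: real) \<le> 2"
 proof -
  have "(exp (1 / 2 :: real))^2 = exp 1" by (simp add: power2_eq_square flip: exp_add)
  also have "\<dots> \<le> 2^2" using exp_le by simp
  finally show ?thesis by (rule power2_le_imp_le) simp
 qed
 then show ?thesis by (subst ln_ge_iff) simp_all
qed

lemma wstar_pos: "0 < c \<Longrightarrow> 0 \<le> t \<Longrightarrow> 0 < wstar c i t"
 using ln_wnorm_pos[of c t i] ln2_half warea_pos[of c t i] unfolding wstar_def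
 by (intro divide_pos_pos mult_pos_pos zero_less_power) (auto intro: add_pos_nonneg)

lemma wstar_cont:
 assumes c: "0 < c" shows "continuous_on {0..} (wstar c i)"
proof -
 have "ln (2 + wnorm c i t) \<noteq> 0" "2 + wnorm c i t \<noteq> 0" "1 + (wnorm c i t)^2 \<noteq> 0" if "t \<in> {0..}" for t
  using ln_wnorm_pos[OF c, of t i] ln2_half wnorm_nonneg[OF c, of t i] that
  by (auto simp: add_nonneg_eq_0_iff)
 moreover have "continuous_on {0..} (wnorm c i)" "continuous_on {0..} (warea c i)"
  unfolding wnorm_def[abs_def] warea_def[abs_def]
  by (cases "i = 2"; auto intro!: continuous_intros)+
 ultimately show ?thesis
  unfolding wstar_def[abs_def] by (intro continuous_intros) auto
qed

lemma wstar_lower: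
 assumes c: "0 < c" and T: "0 \<le> T"
 shows "\<exists>\<delta>>0. \<forall>t\<in>{0..T}. \<delta> \<le> wstar c i t"
proof -
 have "continuous_on {0..T} (wstar c i)" using wstar_cont[OF c] by (rule continuous_on_subset) auto
 then obtain x where "x \<in> {0..T}" "\<forall>t\<in>{0..T}. wstar c i x \<le> wstar c i t"
  using continuous_attains_inf[of "{0..T}" "wstar c i"] T by auto
 then show ?thesis using wstar_pos[OF c, of x i] by (intro exI[of _ "wstar c i x"]) auto
qed

lemma bounded_of_limit:
 fixes h :: "real \<Rightarrow> real"
 assumes c: "continuous_on {0..} h" and lim: "(h \<longlongrightarrow> l) at_top"
 shows "\<exists>K. \<forall>t\<ge>0. h t \<le> K"
proof -
 obtain T where T: "\<And>t. T \<le> t \<Longrightarrow> h t < l + 1"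
  using order_tendstoD(2)[OF lim, of "l + 1"] by (auto simp: eventually_at_top_linorder)
 have "bounded (h ` {0..T})"
  by (intro compact_imp_bounded compact_continuous_image continuous_on_subset[OF c]) auto
 then obtain M where "\<forall>t\<in>{0..T}. \<bar>h t\<bar> \<le> M" by (auto simp: bounded_iff)
 then have "h t \<le> max M (l + 1)" if "0 \<le> t" for t using T[of t] that by (cases "t \<le> T") (force simp: le_max_iff_disj)+
 then show ?thesis by blast
qed

text \<open>On a catenoid the potential decays exponentially, but the weight of the norm only like 1
  / t^2. Membership in the weighted space therefore makes the curvature term integrable.\<close>

lemma wV_bound:
 assumes c: "0 < c" shows "\<exists>K. \<forall>t\<ge>0. wV i t \<le> K * wstar c i t"
proof (cases "i = 2")
 case True
 then show ?thesis by (intro exI[of _ 0]) (simp add: wV_def)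
next
 case False
 have "((\<lambda>t. 2 / (cosh (t - waist))^2 / (c^2 * (cosh (t - waist))^2 /
  ((1 + (c * sqrt ((cosh (t - waist))^2 + t^2))^2) * (ln (2 + c * sqrt ((cosh (t - waist))^2 + t^2)))^2))) \<longlongrightarrow> 0) at_top"
  using c by real_asymp
 then have lim: "((\<lambda>t. wV i t / wstar c i t) \<longlongrightarrow> 0) at_top"
  using False by (simp add: wV_def wstar_def warea_def wnorm_def)
 have "continuous_on {0..} (\<lambda>t. wV i t / wstar c i t)"
  by (intro continuous_intros wstar_cont[OF c] continuous_on_subset[OF W.V_cont]) (use wstar_pos[OF c, of _ i] in force)+
 from bounded_of_limit[OF this lim] obtain K where "\<forall>t\<ge>0. wV i t / wstar c i t \<le> K" by blast
 then show ?thesis using wstar_pos[OF c, of _ i] by (intro exI[of _ K]) (simp add: pos_divide_le_eq)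
qed

lemma set_integrable_bound_continuous:
 fixes f g :: "real \<Rightarrow> real"
 assumes "L1_on {0..} f" "continuous_on {0..} g" "\<And>t. 0 \<le> t \<Longrightarrow> \<bar>g t\<bar> \<le> f t"
 shows "L1_on {0..} g"
proof (rule set_integrable_bound[OF assms(1)])
 show "set_borel_measurable lborel {0..} g"
  unfolding set_borel_measurable_def using borel_measurable_continuous_on_indicator[OF _ assms(2)] by simp
 show "AE x\<in>{0..} in lborel. norm (g x) \<le> norm (f x)" using assms(3) by (intro AE_I2) fastforce
qed

lemma inverse_square_integrable: "L1_on {0..} (\<lambda>t::real. 1 / (1 + t)^2)"
proof (rule pos_integrable_FTC)
 show "((\<lambda>t. - 1 / (1 + t)) has_real_derivative 1 / (1 + t)^2) (at t)" if "0 \<le> t" for t :: real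
  using that by (auto intro!: derivative_eq_intros simp: power2_eq_square)
 show "continuous_on {0..} (\<lambda>t::real. 1 / (1 + t)^2)" by (intro continuous_intros) auto
 show "((\<lambda>t::real. - 1 / (1 + t)) \<longlongrightarrow> 0) at_top" by real_asymp
qed auto

text \<open>The squared logarithm is decisive on the plane, where the weight compares with the
  derivative of - 2 / ln (2 + c r). On a catenoid the logarithm of the distance grows like t, which
  gives 1 / (1 + t)^2. Bounded functions thus belong to the weighted space.\<close>

lemma wstar_integrable:
 assumes c: "0 < c" shows "L1_on {0..} (wstar c i)"
proof (cases "i = 2")
 case True
 define r where "r t = t + 2 / sqrt 3" for t :: real
 have r: "0 < r t" if "0 \<le> t" for t using that by (simp add: r_def add_nonneg_pos)
 define f where "f t = 2 * (c / ((2 + c * r t) * (ln (2 + c * r t))^2))" for t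
 have pos: "1 < 2 + c * r t" if "0 \<le> t" for t
  using mult_pos_pos[OF c r[OF that]] by linarith
 have f: "L1_on {0..} f"
 proof (rule pos_integrable_FTC[where \<Phi> = "\<lambda>t. - 2 / ln (2 + c * r t)" and l = 0])
  fix t :: real assume t: "0 \<le> t"
  have l: "0 < ln (2 + c * r t)" using pos[OF t] by simp
  show "0 \<le> f t" using pos[OF t] c by (simp add: f_def)
  have "((\<lambda>t. 2 + c * r t) has_real_derivative c) (at t)"
   unfolding r_def by (auto intro!: derivative_eq_intros)
  from DERIV_ln_divide[THEN DERIV_chain2, OF _ this] pos[OF t]
  have "((\<lambda>t. ln (2 + c * r t)) has_real_derivative 1 / (2 + c * r t) * c) (at t)" by simp
  from DERIV_inverse_fun[OF this] l
  have "((\<lambda>t. inverse (ln (2 + c * r t))) has_real_derivative - (inverse (ln (2 + c * r t)) * (1 / (2 + c * r t) * c) * inverse (ln (2 + c * r t)))) (at t)"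
   by (simp add: mult_ac)
  from DERIV_cmult[OF this, of "- 2"]
  show "((\<lambda>t. - 2 / ln (2 + c * r t)) has_real_derivative f t) (at t)"
   unfolding divide_inverse f_def by (simp add: power2_eq_square inverse_eq_divide mult_ac)
 next
  have r: "continuous_on {0..} r" unfolding r_def by (intro continuous_intros)
  have nz: "2 + c * r t \<noteq> 0" if "t \<in> {0..}" for t using pos[of t] that by auto
  have "continuous_on {0..} (\<lambda>t. ln (2 + c * r t))"
   by (intro continuous_intros r) (use nz in blast)
  moreover have "(2 + c * r t) \<noteq> 0 \<and> ln (2 + c * r t) \<noteq> 0" if "t \<in> {0..}" for t
   using pos[of t] that by auto
  ultimately show "continuous_on {0..} f"
   unfolding f_def[abs_def] by (intro continuous_intros r) auto
 next
  show "((\<lambda>t. - 2 / ln (2 + c * r t)) \<longlongrightarrow> 0) at_top" unfolding r_def using c by real_asymp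
 qed
 show ?thesis
 proof (rule set_integrable_bound_continuous[OF f wstar_cont[OF c]])
  fix t :: real assume t: "0 \<le> t"
  define x where "x = c * r t"
  define L where "L = (ln (2 + x))^2"
  have x: "0 < x" using c r[OF t] by (simp add: x_def)
  have L: "0 < L" using x by (simp add: L_def)
  have "0 \<le> (1 - x)^2" by simp
  then have "x * (2 + x) \<le> 2 * (1 + x^2)" by (simp add: power2_eq_square algebra_simps)
  then have "x / (1 + x^2) \<le> 2 / (2 + x)" using x by (simp add: field_simps add_pos_nonneg)
  then have "c / L * (x / (1 + x^2)) \<le> c / L * (2 / (2 + x))" using c L by (intro mult_left_mono) auto
  moreover have "wstar c i t = c / L * (x / (1 + x^2))"
   using True by (simp add: wstar_def warea_def wnorm_def x_def L_def r_def power2_eq_square mult_ac)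
  moreover have "f t = c / L * (2 / (2 + x))" by (simp add: f_def x_def L_def mult_ac)
  ultimately show "\<bar>wstar c i t\<bar> \<le> f t" using abs_of_pos[OF wstar_pos[OF c t, of i]] by linarith
 qed
next
 case False
 have "((\<lambda>t. c^2 * (cosh (t - waist))^2 / ((1 + (c * sqrt ((cosh (t - waist))^2 + t^2))^2) *
  (ln (2 + c * sqrt ((cosh (t - waist))^2 + t^2)))^2) * (1 + t)^2) \<longlongrightarrow> 1) at_top"
  using c by (real_asymp, simp add: power2_eq_square field_simps)
 then have lim: "((\<lambda>t. wstar c i t * (1 + t)^2) \<longlongrightarrow> 1) at_top"
  using False by (simp add: wstar_def warea_def wnorm_def)
 have "continuous_on {0..} (\<lambda>t. wstar c i t * (1 + t)^2)" by (intro continuous_intros wstar_cont[OF c])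
 from bounded_of_limit[OF this lim] obtain K where K: "\<And>t. 0 \<le> t \<Longrightarrow> wstar c i t * (1 + t)^2 \<le> K" by blast
 show ?thesis
 proof (rule set_integrable_bound_continuous[OF _ wstar_cont[OF c]])
  show "L1_on {0..} (\<lambda>t. K * (1 / (1 + t)^2))"
   by (intro set_integrable_mult_right inverse_square_integrable)
  show "\<bar>wstar c i t\<bar> \<le> K * (1 / (1 + t)^2)" if "0 \<le> t" for t
   using K[OF that] wstar_pos[OF c that, of i] that by (simp add: pos_le_divide_eq)
 qed
qed

section \<open>Bilinear densities and linear combinations\<close>

lemma set_integrable_weighted_mult:
 fixes f g w :: "'a::euclidean_space \<Rightarrow> real"
 assumes "L1_on A (\<lambda>x. w x * (f x)^2)" "L1_on A (\<lambda>x. w x * (g x)^2)"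
  and [measurable]: "w \<in> borel_fun" "f \<in> borel_fun" "g \<in> borel_fun" "A \<in> sets borel"
 shows "L1_on A (\<lambda>x. w x * (f x * g x))"
proof (rule set_integrable_bound_borel)
 show "L1_on A (\<lambda>x. \<bar>w x * (f x)^2\<bar> + \<bar>w x * (g x)^2\<bar>)"
  using assms(1,2) by (auto simp: set_integrable_abs)
 fix x
 have "0 \<le> (\<bar>f x\<bar> - \<bar>g x\<bar>)^2" by simp
 then have "2 * (\<bar>f x\<bar> * \<bar>g x\<bar>) \<le> (f x)^2 + (g x)^2" by (simp add: power2_diff)
 moreover have "0 \<le> \<bar>f x\<bar> * \<bar>g x\<bar>" by simp
 ultimately have "\<bar>f x\<bar> * \<bar>g x\<bar> \<le> (f x)^2 + (g x)^2" by linarith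
 then have "\<bar>w x\<bar> * (\<bar>f x\<bar> * \<bar>g x\<bar>) \<le> \<bar>w x\<bar> * ((f x)^2 + (g x)^2)" by (intro mult_left_mono) auto
 then show "\<bar>w x * (f x * g x)\<bar> \<le> \<bar>w x * (f x)^2\<bar> + \<bar>w x * (g x)^2\<bar>"
  by (simp add: abs_mult distrib_left)
qed simp_all

lemma set_integrable_square_combination:
 fixes f g w :: "'a::euclidean_space \<Rightarrow> real"
 assumes "L1_on A (\<lambda>x. w x * (f x)^2)" "L1_on A (\<lambda>x. w x * (g x)^2)"
  and "w \<in> borel_fun" "f \<in> borel_fun" "g \<in> borel_fun" "A \<in> sets borel"
 shows "L1_on A (\<lambda>x. w x * (a * f x + g x)^2)"
proof -
 have "L1_on A (\<lambda>x. a^2 * (w x * (f x)^2) + 2 * a * (w x * (f x * g x)) + w x * (g x)^2)"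
  by (intro set_integral_add(1) set_integrable_mult_right set_integrable_weighted_mult assms)
 moreover have "a^2 * (w x * (f x)^2) + 2 * a * (w x * (f x * g x)) + w x * (g x)^2 = w x * (a * f x + g x)^2" for x
  by (simp add: power2_eq_square algebra_simps)
 ultimately show ?thesis by simp
qed

lemma set_integral_linear_sum:
 fixes f :: "'b \<Rightarrow> 'a::euclidean_space \<Rightarrow> real"
 assumes "\<And>b. b \<in> B \<Longrightarrow> L1_on A (f b)"
 shows "(LBINT x:A. (\<Sum>b\<in>B. a b * f b x)) = (\<Sum>b\<in>B. a b * (LBINT x:A. f b x))"
proof -
 have "(LBINT x:A. (\<Sum>b\<in>B. a b * f b x)) = (LBINT x. (\<Sum>b\<in>B. a b * (indicator A x *\<^sub>R f b x)))"
  unfolding set_lebesgue_integral_def by (simp add: sum_distrib_left mult_ac)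
 also have "\<dots> = (\<Sum>b\<in>B. LBINT x. a b * (indicator A x *\<^sub>R f b x))"
  using assms by (intro Bochner_Integration.integral_sum integrable_mult_right) (simp add: set_integrable_def)
 finally show ?thesis by (simp add: set_lebesgue_integral_def)
qed

context face_weights
begin

definition pair_density where
 "pair_density v G H v' G' H' p = \<rho> (fst p) * (G p * G' p) + H p * H' p / \<rho> (fst p) - V (fst p) * (v p * v' p)"

lemma face_functionI: "strip_data v G H \<tau> \<Longrightarrow> face_function \<rho> V \<kappa> y v G H \<tau>"
 by unfold_locales

lemma weights_meas:
 "(\<lambda>p::real \<times> real. \<rho> (fst p)) \<in> borel_fun" "(\<lambda>p::real \<times> real. V (fst p)) \<in> borel_fun"
 using rho_cont V_cont by (auto intro!: borel_measurable_continuous_onI continuous_on_compose2[of UNIV _ UNIV fst] continuous_intros)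

lemma pair_density_integrable:
 assumes D: "strip_data v G H \<tau>" and D': "strip_data v' G' H' \<tau>'"
 shows "L1_on strip (pair_density v G H v' G' H')"
  and "L1_on circ (\<lambda>s. \<tau> s * \<tau>' s)"
proof -
 interpret D: face_function \<rho> V \<kappa> y v G H \<tau> by (rule face_functionI[OF D])
 interpret D': face_function \<rho> V \<kappa> y v' G' H' \<tau>' by (rule face_functionI[OF D'])
 note m[measurable] = weights_meas D.meas D'.meas
 have 1: "L1_on strip (\<lambda>p. \<rho> (fst p) * (G p * G' p))"
  by (rule set_integrable_weighted_mult[OF D.rG2 D'.rG2]) auto
 have "L1_on strip (\<lambda>p. 1 / \<rho> (fst p) * (H p * H' p))"
  by (rule set_integrable_weighted_mult) (use D.rH2 D'.rH2 in auto)
 then have 2: "L1_on strip (\<lambda>p. H p * H' p / \<rho> (fst p))" by simp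
 have 3: "L1_on strip (\<lambda>p. V (fst p) * (v p * v' p))"
  by (rule set_integrable_weighted_mult[OF D.Vv2 D'.Vv2]) auto
 show "L1_on strip (pair_density v G H v' G' H')"
  unfolding pair_density_def[abs_def] using 1 2 3 by (intro set_integral_diff set_integral_add)
 show "L1_on circ (\<lambda>s. \<tau> s * \<tau>' s)"
  by (rule set_integrable_mult_L2[OF D.tau2 D'.tau2]) auto
qed

lemma strip_data_zero: "strip_data (\<lambda>p. 0) (\<lambda>p. 0) (\<lambda>p. 0) (\<lambda>s. 0)"
 unfolding strip_data_def
 by (auto simp: set_integrable_def intro!: primitive_on_const AE_I2 exI[of _ "\<lambda>_. 0"])

lemma strip_data_combination:
 assumes D: "strip_data v G H \<tau>" and D': "strip_data v' G' H' \<tau>'"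
 shows "strip_data (\<lambda>p. a * v p + v' p) (\<lambda>p. a * G p + G' p) (\<lambda>p. a * H p + H' p) (\<lambda>s. a * \<tau> s + \<tau>' s)"
proof -
 interpret D: face_function \<rho> V \<kappa> y v G H \<tau> by (rule face_functionI[OF D])
 interpret D': face_function \<rho> V \<kappa> y v' G' H' \<tau>' by (rule face_functionI[OF D'])
 note m[measurable] = weights_meas D.meas D'.meas
 have m1: "(\<lambda>p. a * v p + v' p) \<in> borel_fun" "(\<lambda>p. a * G p + G' p) \<in> borel_fun"
  "(\<lambda>p. a * H p + H' p) \<in> borel_fun" "(\<lambda>s. a * \<tau> s + \<tau>' s) \<in> borel_fun" by measurable
 have 1: "L1_on strip (\<lambda>p. \<rho> (fst p) * (a * G p + G' p)^2)"
  by (rule set_integrable_square_combination[OF D.rG2 D'.rG2]) auto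
 have "L1_on strip (\<lambda>p. 1 / \<rho> (fst p) * (a * H p + H' p)^2)"
  by (rule set_integrable_square_combination) (use D.rH2 D'.rH2 in auto)
 then have 2: "L1_on strip (\<lambda>p. (a * H p + H' p)^2 / \<rho> (fst p))" by simp
 have 3: "L1_on strip (\<lambda>p. V (fst p) * (a * v p + v' p)^2)"
  by (rule set_integrable_square_combination[OF D.Vv2 D'.Vv2]) auto
 have 4: "L1_on (cyl T) (\<lambda>p. (a * v p + v' p)^2)" for T
  using set_integrable_square_combination[of _ "\<lambda>_. 1" v v' a] D.v2[of T] D'.v2[of T] by simp
 have 5: "L1_on circ (\<lambda>s. (a * \<tau> s + \<tau>' s)^2)"
  using set_integrable_square_combination[of _ "\<lambda>_. 1" \<tau> \<tau>' a] D.tau2 D'.tau2 by simp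
 have 6: "AE s\<in>circ in lborel. a * v (0, s) + v' (0, s) = a * \<tau> s + \<tau>' s \<and>
   (\<forall>T\<ge>0. primitive_on 0 T (\<lambda>t. a * v (t, s) + v' (t, s)) (\<lambda>t. a * G (t, s) + G' (t, s)))"
  using D.v_primitive D'.v_primitive
 proof (eventually_elim, intro impI)
  fix s :: real
  assume "s \<in> circ \<longrightarrow> v (0, s) = \<tau> s \<and> (\<forall>T\<ge>0. primitive_on 0 T (\<lambda>t. v (t, s)) (\<lambda>t. G (t, s)))"
   "s \<in> circ \<longrightarrow> v' (0, s) = \<tau>' s \<and> (\<forall>T\<ge>0. primitive_on 0 T (\<lambda>t. v' (t, s)) (\<lambda>t. G' (t, s)))" "s \<in> circ"
  then show "a * v (0, s) + v' (0, s) = a * \<tau> s + \<tau>' s \<and>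
   (\<forall>T\<ge>0. primitive_on 0 T (\<lambda>t. a * v (t, s) + v' (t, s)) (\<lambda>t. a * G (t, s) + G' (t, s)))"
   using primitive_on_add[OF primitive_on_cmult[of 0 _ "\<lambda>t. v (t, s)" "\<lambda>t. G (t, s)" a], of _ "\<lambda>t. v' (t, s)" "\<lambda>t. G' (t, s)"] by simp
 qed
 have 7: "AE t in lborel. 0 \<le> t \<longrightarrow> (\<exists>b. primitive_on 0 (2 * pi) b (\<lambda>s. a * H (t, s) + H' (t, s)) \<and> b (2 * pi) = b 0 \<and>
   (AE s\<in>circ in lborel. a * v (t, s) + v' (t, s) = b s))"
  using D.v_angular D'.v_angular
 proof (eventually_elim, intro impI)
  fix t :: real
  assume "0 \<le> t \<longrightarrow> (\<exists>b. primitive_on 0 (2 * pi) b (\<lambda>s. H (t, s)) \<and> b (2 * pi) = b 0 \<and>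
   (AE s\<in>circ in lborel. v (t, s) = b s))"
   "0 \<le> t \<longrightarrow> (\<exists>b. primitive_on 0 (2 * pi) b (\<lambda>s. H' (t, s)) \<and> b (2 * pi) = b 0 \<and>
   (AE s\<in>circ in lborel. v' (t, s) = b s))" "0 \<le> t"
  then obtain b b' where b: "primitive_on 0 (2 * pi) b (\<lambda>s. H (t, s))" "b (2 * pi) = b 0"
    "AE s\<in>circ in lborel. v (t, s) = b s"
   and b': "primitive_on 0 (2 * pi) b' (\<lambda>s. H' (t, s))" "b' (2 * pi) = b' 0"
    "AE s\<in>circ in lborel. v' (t, s) = b' s" by blast
  show "\<exists>b. primitive_on 0 (2 * pi) b (\<lambda>s. a * H (t, s) + H' (t, s)) \<and> b (2 * pi) = b 0 \<and>
   (AE s\<in>circ in lborel. a * v (t, s) + v' (t, s) = b s)"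
  proof (intro exI[of _ "\<lambda>s. a * b s + b' s"] conjI)
   show "AE s\<in>circ in lborel. a * v (t, s) + v' (t, s) = a * b s + b' s"
    using b(3) b'(3) by eventually_elim auto
  qed (use b b' in \<open>auto intro: primitive_on_add primitive_on_cmult\<close>)
 qed
 show ?thesis unfolding strip_data_def using m1 1 2 3 4 5 6 7 by blast
qed

lemma strip_data_sum:
 assumes "finite B" "\<And>b. b \<in> B \<Longrightarrow> strip_data (v b) (G b) (H b) (\<tau> b)"
 shows "strip_data (\<lambda>p. \<Sum>b\<in>B. a b * v b p) (\<lambda>p. \<Sum>b\<in>B. a b * G b p) (\<lambda>p. \<Sum>b\<in>B. a b * H b p)
  (\<lambda>s. \<Sum>b\<in>B. a b * \<tau> b s :: real)"
 using assms
proof (induction B rule: finite_induct)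
 case empty then show ?case by (simp add: strip_data_zero)
next
 case (insert x B)
 then show ?case using strip_data_combination[of "v x" "G x" "H x" "\<tau> x" _ _ _ _ "a x"] by simp
qed

text \<open>The contribution of one face to the index form, for arbitrary representatives: linear
  combinations of the data of several triples occur that are not taken as the data of a single
  triple.\<close>

definition pairing where
 "pairing q v G H \<tau> v' G' H' \<tau>' = (LBINT p:strip. pair_density v G H v' G' H' p) + q * (LBINT s:circ. \<tau> s * \<tau>' s)"

lemma pairing_commute: "pairing q v G H \<tau> v' G' H' \<tau>' = pairing q v' G' H' \<tau>' v G H \<tau>"
 by (simp add: pairing_def pair_density_def mult_ac)

lemma pairing_sum:
 assumes "finite B" "\<And>b. b \<in> B \<Longrightarrow> strip_data (v b) (G b) (H b) (\<tau> b)" and D': "strip_data v' G' H' \<tau>'"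
 shows "pairing q (\<lambda>p. \<Sum>b\<in>B. a b * v b p) (\<lambda>p. \<Sum>b\<in>B. a b * G b p) (\<lambda>p. \<Sum>b\<in>B. a b * H b p)
  (\<lambda>s. \<Sum>b\<in>B. a b * \<tau> b s) v' G' H' \<tau>' = (\<Sum>b\<in>B. a b * pairing q (v b) (G b) (H b) (\<tau> b) v' G' H' \<tau>')"
proof -
 note i = pair_density_integrable[OF assms(2) D']
 have e: "pair_density (\<lambda>p. \<Sum>b\<in>B. a b * v b p) (\<lambda>p. \<Sum>b\<in>B. a b * G b p) (\<lambda>p. \<Sum>b\<in>B. a b * H b p) v' G' H' p
  = (\<Sum>b\<in>B. a b * pair_density (v b) (G b) (H b) v' G' H' p)" for p
  unfolding pair_density_def
  by (simp add: sum_distrib_left sum_distrib_right sum_divide_distrib sum.distrib sum_subtractf distrib_left right_diff_distrib mult_ac)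
 have 1: "(LBINT p:strip. (\<Sum>b\<in>B. a b * pair_density (v b) (G b) (H b) v' G' H' p))
  = (\<Sum>b\<in>B. a b * (LBINT p:strip. pair_density (v b) (G b) (H b) v' G' H' p))"
  by (rule set_integral_linear_sum[OF i(1)])
 have 2: "(LBINT s:circ. (\<Sum>b\<in>B. a b * \<tau> b s) * \<tau>' s)
  = (\<Sum>b\<in>B. a b * (LBINT s:circ. \<tau> b s * \<tau>' s))"
  unfolding sum_distrib_right mult.assoc by (rule set_integral_linear_sum[OF i(2)])
 show ?thesis unfolding pairing_def e 1 2
  by (simp add: sum_distrib_left sum.distrib distrib_left mult_ac)
qed

end

section \<open>The index form in coordinates\<close>

text \<open>The indicator confines everything to the open half-cylinder, the place where weak
  gradients are determined and measurability is known.\<close>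

definition "comp_U c \<phi> i p = (indicator open_half p * \<phi> i (Ycat c i p) :: real)"
definition "comp_G c \<phi> i p = (indicator open_half p * weak_grad (\<phi> i \<circ> Ycat c i) p $ 1 :: real)"
definition "comp_H c \<phi> i p = (indicator open_half p * weak_grad (\<phi> i \<circ> Ycat c i) p $ 2 :: real)"
definition "comp_T c \<phi> i = bd_trace (\<phi> i \<circ> Ycat c i)"
text \<open>The representative of \<open>trace_representation\<close>: absolutely continuous along
  almost every ray, with the chosen trace as its value at t = 0 there.\<close>

definition "comp_V c \<phi> i p = comp_T c \<phi> i (snd p) + (LBINT s:{0..fst p}. comp_G c \<phi> i (s, snd p))"

abbreviation "comp_data c \<phi> i \<equiv> W.strip_data i (comp_V c \<phi> i) (comp_G c \<phi> i) (comp_H c \<phi> i) (comp_T c \<phi> i)"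

lemma admissible_weak_grad:
 assumes "admissible X \<phi>"
 shows "weakly_differentiable (\<phi> i \<circ> X i)" and "is_weak_grad (\<phi> i \<circ> X i) (weak_grad (\<phi> i \<circ> X i))"
  and "has_trace (\<phi> i \<circ> X i) (bd_trace (\<phi> i \<circ> X i))"
proof -
 show wd: "weakly_differentiable (\<phi> i \<circ> X i)" using assms by (simp add: admissible_def)
 then show "is_weak_grad (\<phi> i \<circ> X i) (weak_grad (\<phi> i \<circ> X i))"
  unfolding weakly_differentiable_def weak_grad_def by (rule someI_ex)
 have "\<exists>\<tau>. has_trace (\<phi> i \<circ> X i) \<tau>" using assms unfolding admissible_def by blast
 then show "has_trace (\<phi> i \<circ> X i) (bd_trace (\<phi> i \<circ> X i))" unfolding bd_trace_def by (rule someI_ex)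
qed

lemma comp_measurable:
 assumes "admissible (Ycat c) \<phi>"
 shows "comp_U c \<phi> i \<in> borel_fun" "comp_G c \<phi> i \<in> borel_fun" "comp_H c \<phi> i \<in> borel_fun"
proof -
 have l: "locally_integrable (\<phi> i \<circ> Ycat c i)" "\<And>j. locally_integrable (\<lambda>p. weak_grad (\<phi> i \<circ> Ycat c i) p $ j)"
  using admissible_weak_grad(2)[OF assms, of i] unfolding is_weak_grad_def by blast+
 show "comp_U c \<phi> i \<in> borel_fun"
  using locally_integrable_measurable[OF l(1)] by (simp add: comp_U_def[abs_def] o_def)
 show "comp_G c \<phi> i \<in> borel_fun" "comp_H c \<phi> i \<in> borel_fun"
  using locally_integrable_measurable[OF l(2)] by (simp_all add: comp_G_def[abs_def] comp_H_def[abs_def])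
qed

text \<open>The formula for the weight is controlled for t >= 0, where the logarithm is positive;
  \<open>max 0\<close> extends it continuously to negative t.\<close>

lemma wstar_meas: "0 < c \<Longrightarrow> (\<lambda>p::real \<times> real. wstar c i (max 0 (fst p))) \<in> borel_fun"
 by (intro borel_measurable_continuous_onI continuous_on_compose2[OF wstar_cont, of c _ "\<lambda>p. max 0 (fst p)"] continuous_intros) auto

lemma warea_meas: "(\<lambda>p::real \<times> real. warea c i (max 0 (fst p))) \<in> borel_fun"
 unfolding warea_def by (cases "i = 2") (auto intro!: borel_measurable_continuous_onI continuous_intros)

lemma L2_star_conv:
 assumes c: "0 < c" and \<phi>: "admissible (Ycat c) \<phi>"
 shows "L2_star (Ycat c i) (\<phi> i) \<longleftrightarrow> L1_on strip (\<lambda>p. wstar c i (max 0 (fst p)) * (comp_U c \<phi> i p)^2)"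
 unfolding L2_star_def face_integrable_def
proof (rule period_strip_convert(1))
 note [measurable] = comp_measurable[OF \<phi>] wstar_meas[OF c]
 show "(\<lambda>p. wstar c i (max 0 (fst p)) * (comp_U c \<phi> i p)^2) \<in> borel_fun" by measurable
 fix p assume "p \<in> period_strip"
 then obtain t s where p: "p = (t, s)" "0 < t" by (auto simp: period_strip_def)
 then show "(\<phi> i (Ycat c i p))^2 / ((1 + (norm (Ycat c i p))^2) * (ln (2 + norm (Ycat c i p)))^2) * area_density (Ycat c i) p
   = wstar c i (max 0 (fst p)) * (comp_U c \<phi> i p)^2"
  by (simp add: Ycat_norm_area[OF c] comp_U_def wstar_def)
qed

lemma square_integrable_conv:
 assumes c: "0 < c" and \<phi>: "admissible (Ycat c) \<phi>"
 shows "face_integrable (Ycat c i) (\<lambda>p. (\<phi> i (Ycat c i p))^2) \<longleftrightarrow> L1_on strip (\<lambda>p. warea c i (max 0 (fst p)) * (comp_U c \<phi> i p)^2)"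
 unfolding face_integrable_def
proof (rule period_strip_convert(1))
 note [measurable] = comp_measurable[OF \<phi>] warea_meas
 show "(\<lambda>p. warea c i (max 0 (fst p)) * (comp_U c \<phi> i p)^2) \<in> borel_fun" by measurable
 fix p assume "p \<in> period_strip"
 then obtain t s where p: "p = (t, s)" "0 < t" by (auto simp: period_strip_def)
 then show "(\<phi> i (Ycat c i p))^2 * area_density (Ycat c i) p = warea c i (max 0 (fst p)) * (comp_U c \<phi> i p)^2"
  by (simp add: Ycat_norm_area[OF c] comp_U_def)
qed

lemma grad_L2_conv:
 assumes c: "0 < c" and \<phi>: "admissible (Ycat c) \<phi>"
 shows "grad_L2 (Ycat c i) (\<phi> i) \<longleftrightarrow>
  L1_on strip (\<lambda>p. wrho i (fst p) * (comp_G c \<phi> i p)^2 + (comp_H c \<phi> i p)^2 / wrho i (fst p))"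
 unfolding grad_L2_def face_integrable_def
proof (rule period_strip_convert(1))
 note [measurable] = comp_measurable[OF \<phi>] W.weights_meas
 show "(\<lambda>p. wrho i (fst p) * (comp_G c \<phi> i p)^2 + (comp_H c \<phi> i p)^2 / wrho i (fst p)) \<in> borel_fun" by measurable
 fix p assume "p \<in> period_strip"
 then obtain t s where p: "p = (t, s)" "0 < t" by (auto simp: period_strip_def)
 then show "grad_inner (Ycat c i) p (weak_grad (\<phi> i \<circ> Ycat c i) p) (weak_grad (\<phi> i \<circ> Ycat c i) p) * area_density (Ycat c i) p
   = wrho i (fst p) * (comp_G c \<phi> i p)^2 + (comp_H c \<phi> i p)^2 / wrho i (fst p)"
  by (simp add: Ycat_density(2)[OF c] comp_G_def comp_H_def power2_eq_square)
qed

lemma compact_subset_energy: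
 assumes c: "0 < c" shows "compact_W12_triples (Ycat c) \<subseteq> energy_triples (Ycat c)"
proof
 fix \<phi> assume "\<phi> \<in> compact_W12_triples (Ycat c)"
 then have \<phi>: "admissible (Ycat c) \<phi>" and f: "\<And>i. face_integrable (Ycat c i) (\<lambda>p. (\<phi> i (Ycat c i p))^2)"
  and g: "\<And>i. grad_L2 (Ycat c i) (\<phi> i)"
  by (auto simp: compact_W12_triples_def)
 note [measurable] = comp_measurable[OF \<phi>] wstar_meas[OF c]
 have "L2_star (Ycat c i) (\<phi> i)" for i
  unfolding L2_star_conv[OF c \<phi>]
 proof (rule set_integrable_bound_borel)
  show "L1_on strip (\<lambda>p. 4 * (warea c i (max 0 (fst p)) * (comp_U c \<phi> i p)^2))"
   using f[of i] unfolding square_integrable_conv[OF c \<phi>] by simp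
  fix p :: "real \<times> real" assume "p \<in> strip"
  then have t: "0 \<le> fst p" by (auto simp: mem_Times_iff)
  define N where "N = wnorm c i (fst p)"
  \<comment> \<open>This lower bound for the logarithm keeps the weight below 4 times the area
    density, which is the factor chosen above.\<close>
  have l: "1 / 2 \<le> ln (2 + N)" using ln_wnorm_pos[OF c t, of i] ln2_half by (simp add: N_def)
  then have "(1 / 2)^2 \<le> (ln (2 + N))^2" by (intro power_mono) auto
  then have "1 * (1 / 2)^2 \<le> (1 + N^2) * (ln (2 + N))^2" by (intro mult_mono) auto
  then have "warea c i (fst p) * 1 \<le> warea c i (fst p) * (4 * ((1 + N^2) * (ln (2 + N))^2))"
   using warea_pos[OF c t, of i] by (intro mult_left_mono) (auto simp: power2_eq_square)
  moreover have "0 < (1 + N^2) * (ln (2 + N))^2" using l by (intro mult_pos_pos add_pos_nonneg zero_less_power) auto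
  ultimately have "wstar c i (fst p) \<le> 4 * warea c i (fst p)"
   unfolding wstar_def N_def[symmetric] by (simp add: pos_divide_le_eq mult_ac)
  then have "wstar c i (fst p) * (comp_U c \<phi> i p)^2 \<le> 4 * warea c i (fst p) * (comp_U c \<phi> i p)^2"
   by (intro mult_right_mono) auto
  then show "\<bar>wstar c i (max 0 (fst p)) * (comp_U c \<phi> i p)^2\<bar> \<le> 4 * (warea c i (max 0 (fst p)) * (comp_U c \<phi> i p)^2)"
   using t wstar_pos[OF c t, of i] by (simp add: abs_mult max_absorb2)
 qed auto
 then show "\<phi> \<in> energy_triples (Ycat c)" using \<phi> g by (simp add: energy_triples_def)
qed

text \<open>The weighted norm gives square integrability on compact parts through
  \<open>wstar_lower\<close>, and integrability of the potential term through
  \<open>wV_bound\<close>; the rest is \<open>strip_data_of_weak\<close>.\<close>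

lemma energy_component:
 assumes c: "0 < c" and \<phi>: "\<phi> \<in> energy_triples (Ycat c)"
 shows "comp_data c \<phi> i" and "AE p\<in>strip in lborel. comp_V c \<phi> i p = comp_U c \<phi> i p"
proof -
 have ad: "admissible (Ycat c) \<phi>" and L: "L2_star (Ycat c i) (\<phi> i)" and gr: "grad_L2 (Ycat c i) (\<phi> i)"
  using \<phi> by (auto simp: energy_triples_def)
 note m[measurable] = comp_measurable[OF ad, of i] W.weights_meas[of i] wstar_meas[OF c, of i]
 note iG = gr[unfolded grad_L2_conv[OF c ad]]
 note iU = L[unfolded L2_star_conv[OF c ad]]
 have pos: "0 < wrho i (fst p)" if "p \<in> strip" for p :: "real \<times> real" using W.rho_pos that by (auto simp: mem_Times_iff)
 have 1: "L1_on strip (\<lambda>p. wrho i (fst p) * (comp_G c \<phi> i p)^2)"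
  by (rule set_integrable_bound_borel[OF iG]) (use pos in \<open>auto simp: abs_mult less_imp_le\<close>)
 have 2: "L1_on strip (\<lambda>p. (comp_H c \<phi> i p)^2 / wrho i (fst p))"
  by (rule set_integrable_bound_borel[OF iG]) (use pos in \<open>auto simp: abs_mult less_imp_le\<close>)
 obtain K where K: "\<And>t. 0 \<le> t \<Longrightarrow> wV i t \<le> K * wstar c i t" using wV_bound[OF c] by blast
 have 3: "L1_on strip (\<lambda>p. wV i (fst p) * (comp_U c \<phi> i p)^2)"
 proof (rule set_integrable_bound_borel)
  show "L1_on strip (\<lambda>p. K * (wstar c i (max 0 (fst p)) * (comp_U c \<phi> i p)^2))"
   using iU by simp
  fix p :: "real \<times> real" assume "p \<in> strip"
  then have t: "0 \<le> fst p" by (auto simp: mem_Times_iff)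
  have "0 \<le> wV i (fst p)" by (simp add: wV_def)
  then show "\<bar>wV i (fst p) * (comp_U c \<phi> i p)^2\<bar> \<le> K * (wstar c i (max 0 (fst p)) * (comp_U c \<phi> i p)^2)"
   using mult_right_mono[OF K[OF t], of "(comp_U c \<phi> i p)^2"] t by (simp add: abs_mult max_absorb2 mult.assoc)
 qed auto
 have 4: "L1_on (cyl T) (\<lambda>p. (comp_U c \<phi> i p)^2)" for T
 proof (cases "0 \<le> T")
  case True
  then obtain \<delta> where \<delta>: "0 < \<delta>" "\<And>t. t \<in> {0..T} \<Longrightarrow> \<delta> \<le> wstar c i t" using wstar_lower[OF c True] by blast
  show ?thesis
  proof (rule set_integrable_bound_borel)
   show "L1_on (cyl T) (\<lambda>p. 1 / \<delta> * (wstar c i (max 0 (fst p)) * (comp_U c \<phi> i p)^2))"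
    by (intro set_integrable_mult_right set_integrable_subset[OF iU]) auto
   fix p :: "real \<times> real" assume p: "p \<in> cyl T"
   then have "\<delta> * (comp_U c \<phi> i p)^2 \<le> wstar c i (fst p) * (comp_U c \<phi> i p)^2"
    by (intro mult_right_mono \<delta>(2)) (auto simp: mem_Times_iff)
   then show "\<bar>(comp_U c \<phi> i p)^2\<bar> \<le> 1 / \<delta> * (wstar c i (max 0 (fst p)) * (comp_U c \<phi> i p)^2)"
    using \<delta>(1) p by (simp add: field_simps max_absorb2 mem_Times_iff)
  qed auto
 qed (simp add: set_integrable_def)
 have per: "(\<phi> i \<circ> Ycat c i) (t, s + 2 * pi) = (\<phi> i \<circ> Ycat c i) (t, s)" for t s by (simp add: Ycat_periodic)
 note S = face_weights.strip_data_of_weak[OF weights[of i] admissible_weak_grad(1,3)[OF ad, of i] per, of "comp_U c \<phi> i" "comp_G c \<phi> i" "comp_H c \<phi> i" "comp_V c \<phi> i"]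
 show "comp_data c \<phi> i" unfolding comp_T_def
  by (rule S(1)[OF _ _ _ 1 2 3 4]) (simp_all add: comp_U_def comp_G_def comp_H_def comp_V_def comp_T_def o_def)
 show "AE p\<in>strip in lborel. comp_V c \<phi> i p = comp_U c \<phi> i p"
  by (rule S(2)[OF _ _ _ 1 2 3 4]) (simp_all add: comp_U_def comp_G_def comp_H_def comp_V_def comp_T_def o_def)
qed

text \<open>\<open>admissible\<close> asserts the balance for some traces only; uniqueness transfers
  it to those chosen by \<open>bd_trace\<close>.\<close>

lemma traces_sum_zero:
 assumes "admissible (Ycat c) \<phi>"
 shows "AE s in lborel. (\<Sum>i\<in>UNIV. comp_T c \<phi> i s) = 0"
proof -
 obtain \<tau> where \<tau>: "\<And>i. has_trace (\<phi> i \<circ> Ycat c i) (\<tau> i)" "AE s in lborel. (\<Sum>i\<in>UNIV. \<tau> i s) = 0"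
  using assms unfolding admissible_def by blast
 have "AE s in lborel. comp_T c \<phi> i s = \<tau> i s" for i
  unfolding comp_T_def by (rule trace_unique[OF admissible_weak_grad(3)[OF assms] \<tau>(1)])
 then have "AE s in lborel. \<forall>i\<in>UNIV. comp_T c \<phi> i s = \<tau> i s" by (subst AE_finite_all) simp_all
 with \<tau>(2) show ?thesis by eventually_elim simp
qed

abbreviation "pair_with c \<psi> i v G H \<tau> \<equiv> W.pairing i (wq i) v G H \<tau> (comp_V c \<psi> i) (comp_G c \<psi> i) (comp_H c \<psi> i) (comp_T c \<psi> i)"
abbreviation "bform c i \<phi> \<psi> \<equiv> W.pairing i (wq i) (comp_V c \<phi> i) (comp_G c \<phi> i) (comp_H c \<phi> i) (comp_T c \<phi> i)
 (comp_V c \<psi> i) (comp_G c \<psi> i) (comp_H c \<psi> i) (comp_T c \<psi> i)"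

lemma set_integral_half_open:
 fixes f :: "real \<Rightarrow> real"
 assumes "L1_on {a..b} f"
 shows "(LBINT s:{a..<b}. f s) = (LBINT s:{a..b}. f s)"
proof -
 have i: "L1_on {a..<b} f" by (rule set_integrable_subset[OF assms]) auto
 have "AE s in lborel. indicator {a..<b} s *\<^sub>R f s = indicator {a..b} s *\<^sub>R f s"
  using AE_lborel_singleton[of b] by eventually_elim (auto simp: indicator_def)
 then show ?thesis unfolding set_lebesgue_integral_def
  by (intro integral_cong_AE) (use assms i in \<open>auto simp: set_integrable_def\<close>)
qed

lemma index_form_conv:
 assumes c: "0 < c" and \<phi>: "\<phi> \<in> energy_triples (Ycat c)" and \<psi>: "\<psi> \<in> energy_triples (Ycat c)"
 shows "index_form (Ycat c) \<phi> \<psi> = (\<Sum>i\<in>UNIV. bform c i \<phi> \<psi>)"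
 unfolding index_form_def
proof (rule sum.cong[OF refl])
 fix i :: 3
 have ad: "admissible (Ycat c) \<phi>" "admissible (Ycat c) \<psi>" using \<phi> \<psi> by (auto simp: energy_triples_def)
 note m[measurable] = comp_measurable[OF ad(1), of i] comp_measurable[OF ad(2), of i] W.weights_meas[of i]
 have mp[measurable]: "W.pair_density i (comp_U c \<phi> i) (comp_G c \<phi> i) (comp_H c \<phi> i) (comp_U c \<psi> i) (comp_G c \<psi> i) (comp_H c \<psi> i) \<in> borel_fun"
  unfolding W.pair_density_def[abs_def] by measurable
 note D = energy_component[OF c \<phi>, of i] and D' = energy_component[OF c \<psi>, of i]
 have "face_integral (Ycat c i) (\<lambda>p. grad_inner (Ycat c i) p (weak_grad (\<phi> i \<circ> Ycat c i) p) (weak_grad (\<psi> i \<circ> Ycat c i) p)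
    - second_form_norm_sq (Ycat c i) p * \<phi> i (Ycat c i p) * \<psi> i (Ycat c i p))
  = (LBINT p:strip. W.pair_density i (comp_U c \<phi> i) (comp_G c \<phi> i) (comp_H c \<phi> i) (comp_U c \<psi> i) (comp_G c \<psi> i) (comp_H c \<psi> i) p)"
  unfolding face_integral_def
 proof (rule period_strip_convert(2)[OF mp])
  fix p assume "p \<in> period_strip"
  then obtain t s where p: "p = (t, s)" "0 < t" by (auto simp: period_strip_def)
  then show "(grad_inner (Ycat c i) p (weak_grad (\<phi> i \<circ> Ycat c i) p) (weak_grad (\<psi> i \<circ> Ycat c i) p)
    - second_form_norm_sq (Ycat c i) p * \<phi> i (Ycat c i p) * \<psi> i (Ycat c i p)) * area_density (Ycat c i) p
   = W.pair_density i (comp_U c \<phi> i) (comp_G c \<phi> i) (comp_H c \<phi> i) (comp_U c \<psi> i) (comp_G c \<psi> i) (comp_H c \<psi> i) p"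
   by (simp add: Ycat_density(1)[OF c] comp_U_def comp_G_def comp_H_def W.pair_density_def)
 qed
 also have "\<dots> = (LBINT p:strip. W.pair_density i (comp_V c \<phi> i) (comp_G c \<phi> i) (comp_H c \<phi> i) (comp_V c \<psi> i) (comp_G c \<psi> i) (comp_H c \<psi> i) p)"
 proof (rule set_integral_eq_AE(2)[OF W.pair_density_integrable(1)[OF D(1) D'(1)] mp])
  show "AE p\<in>strip in lborel. W.pair_density i (comp_U c \<phi> i) (comp_G c \<phi> i) (comp_H c \<phi> i) (comp_U c \<psi> i) (comp_G c \<psi> i) (comp_H c \<psi> i) p =
   W.pair_density i (comp_V c \<phi> i) (comp_G c \<phi> i) (comp_H c \<phi> i) (comp_V c \<psi> i) (comp_G c \<psi> i) (comp_H c \<psi> i) p"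
   using D(2) D'(2) by eventually_elim (simp add: W.pair_density_def)
 qed auto
 finally show "face_integral (Ycat c i) (\<lambda>p. grad_inner (Ycat c i) p (weak_grad (\<phi> i \<circ> Ycat c i) p) (weak_grad (\<psi> i \<circ> Ycat c i) p)
    - second_form_norm_sq (Ycat c i) p * \<phi> i (Ycat c i p) * \<psi> i (Ycat c i p))
   - boundary_integral (Ycat c i) (\<lambda>\<theta>. (boundary_curvature (Ycat c i) \<theta> \<bullet> conormal (Ycat c i) \<theta>)
     * bd_trace (\<phi> i \<circ> Ycat c i) \<theta> * bd_trace (\<psi> i \<circ> Ycat c i) \<theta>) = bform c i \<phi> \<psi>"
  unfolding Ycat_boundary[OF c] W.pairing_def
  using set_integral_half_open[OF W.pair_density_integrable(2)[OF D(1) D'(1)]] by (simp add: comp_T_def)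
qed

text \<open>Points with parameter t have norm at least c t, so a compact set meets only a bounded
  range of t.\<close>

lemma compact_support_component:
 assumes c: "0 < c" and \<phi>: "\<phi> \<in> compact_W12_triples (Ycat c)"
 shows "\<exists>T0\<ge>0. AE p in lborel. T0 < fst p \<longrightarrow> comp_U c \<phi> i p = 0"
proof -
 obtain K where K: "compact K" "AE p\<in>open_half in lborel. Ycat c i p \<notin> K \<longrightarrow> \<phi> i (Ycat c i p) = 0"
  using \<phi> unfolding compact_W12_triples_def compactly_supported_def by blast
 obtain R where R: "\<And>x. x \<in> K \<Longrightarrow> norm x \<le> R" using compact_imp_bounded[OF K(1)] unfolding bounded_iff by blast
 have far: "Ycat c i p \<notin> K" if "\<bar>R\<bar> / c < fst p" for p
 proof
  assume "Ycat c i p \<in> K"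
  then have "norm (Ycat c i p) \<le> R" by (rule R)
  moreover obtain t s where p: "p = (t, s)" by force
  have t: "0 \<le> t" "\<bar>R\<bar> / c < t" using that c divide_nonneg_pos[of "\<bar>R\<bar>" c] unfolding p fst_conv by linarith+
  have "c * t \<le> wnorm c i t"
  proof -
   have "t \<le> sqrt ((cosh (t - waist))^2 + t^2)" by (rule real_le_rsqrt) simp
   then show ?thesis using c by (auto simp: wnorm_def)
  qed
  moreover have "\<bar>R\<bar> < c * t" using t(2) c by (simp add: field_simps)
  ultimately show False using Ycat_norm_area(1)[OF c t(1), of i s] p by simp
 qed
 show ?thesis
 proof (intro exI[of _ "\<bar>R\<bar> / c"] conjI)
  show "0 \<le> \<bar>R\<bar> / c" using c by simp
  show "AE p in lborel. \<bar>R\<bar> / c < fst p \<longrightarrow> comp_U c \<phi> i p = 0"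
   using K(2)
  proof eventually_elim
   fix p :: "real \<times> real" assume "p \<in> open_half \<longrightarrow> Ycat c i p \<notin> K \<longrightarrow> \<phi> i (Ycat c i p) = 0"
   then show "\<bar>R\<bar> / c < fst p \<longrightarrow> comp_U c \<phi> i p = 0"
    using far[of p] by (cases "p \<in> open_half") (simp_all add: comp_U_def)
  qed
 qed
qed

section \<open>Triples with separated variables\<close>

definition mode :: "nat \<Rightarrow> real \<Rightarrow> real" where "mode k s = (if k = 0 then 1 else if k = 1 then cos s else sin s)"
definition mode' :: "nat \<Rightarrow> real \<Rightarrow> real" where "mode' k s = (if k = 0 then 0 else if k = 1 then - sin s else cos s)"
definition mode_eigenvalue :: "nat \<Rightarrow> real" where "mode_eigenvalue k = (if k = 0 then 0 else 1)"

lemma mode_deriv: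
 "(mode k has_real_derivative mode' k s) (at s)"
 "(mode' k has_real_derivative - mode_eigenvalue k * mode k s) (at s)"
 "mode' k (2 * pi) = mode' k 0"
 unfolding mode_def[abs_def] mode'_def[abs_def] mode_eigenvalue_def
 by (cases "k = 0"; cases "k = 1"; auto intro!: derivative_eq_intros)+

lemma mode_cont: "continuous_on UNIV (mode k)" "continuous_on UNIV (mode' k)"
 unfolding mode_def[abs_def] mode'_def[abs_def]
 by (cases "k = 0"; cases "k = 1"; auto intro!: continuous_intros)+

lemma mode_sq_le: "(mode k s)^2 \<le> 1" "(mode' k s)^2 \<le> 1"
 by (auto simp: mode_def mode'_def abs_square_le_1)

text \<open>The ambient functions that read off the parameter \<open>t\<close> and the Fourier modes of \<open>\<theta>\<close> on the faces.\<close>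

definition "face_time c i x = (if i = (1::3) then x $ 3 / c else if i = 2 then sqrt ((x $ 1)^2 + (x $ 2)^2) / c - 2 / sqrt 3
 else - x $ 3 / c)" for x :: "real^3"
definition "face_mode k x = (if k = (0::nat) then 1 else if k = 1 then x $ 1 / sqrt ((x $ 1)^2 + (x $ 2)^2)
 else x $ 2 / sqrt ((x $ 1)^2 + (x $ 2)^2))" for x :: "real^3"
definition lift :: "real \<Rightarrow> nat \<Rightarrow> (3 \<Rightarrow> real \<Rightarrow> real) \<Rightarrow> triple" where
 "lift c k F i x = F i (face_time c i x) * face_mode k x"

lemma lift_Ycat:
 assumes c: "0 < c" and t: "0 \<le> t"
 shows "lift c k F i (Ycat c i (t, s)) = F i t * mode k s"
proof -
 have cyl: "sqrt ((r * cos s)^2 + (r * sin s)^2) = r" if "0 < r" for r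
 proof -
  have "(r * cos s)^2 + (r * sin s)^2 = r^2 * ((sin s)^2 + (cos s)^2)"
   by (simp only: power_mult_distrib) algebra
  then show ?thesis using that by simp
 qed
 define r where "r = c * (if i = 2 then t + 2 / sqrt 3 else cosh (t - waist))"
 have r: "0 < r" using c t by (auto simp: r_def intro!: mult_pos_pos add_nonneg_pos)
 have x12: "Ycat c i (t, s) $ 1 = r * cos s" "Ycat c i (t, s) $ 2 = r * sin s"
  using three_cases[of i] by (auto simp: pseudo_Y_catenoid_def catenoid_face_def planar_face_def r_def waist_def)
 have "face_time c i (Ycat c i (t, s)) = t"
 proof (cases "i = 2")
  case True
  have "face_time c i (Ycat c i (t, s)) = r / c - 2 / sqrt 3"
   using True x12 cyl[OF r] by (simp add: face_time_def)
  then show ?thesis using True c by (simp add: r_def)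
 next
  case False
  then show ?thesis using c by (simp add: face_time_def pseudo_Y_catenoid_def catenoid_face_def)
 qed
 moreover have "face_mode k (Ycat c i (t, s)) = mode k s"
  unfolding face_mode_def mode_def x12 cyl[OF r] using r by simp
 ultimately show ?thesis by (simp add: lift_def)
qed

text \<open>One-dimensional conditions under which a profile times a Fourier mode lies in the energy
  space. Boundedness yields the weighted norm by \<open>wstar_integrable\<close>; the angular energy
  is asked only for \<open>k \<noteq> 0\<close>, as the constant mode has zero angular
  derivative.\<close>

locale radial_mode =
 fixes c :: real and k :: nat and F F' :: "3 \<Rightarrow> real \<Rightarrow> real"
 assumes c: "0 < c"
  and prim: "\<And>i T. 0 \<le> T \<Longrightarrow> primitive_on 0 T (F i) (F' i)"
  and Fm: "\<And>i. F i \<in> borel_fun" and F'm: "\<And>i. F' i \<in> borel_fun"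
  and bounded: "\<And>i. \<exists>M. \<forall>t\<ge>0. \<bar>F i t\<bar> \<le> M"
  and radial_energy: "\<And>i. L1_on {0..} (\<lambda>t. wrho i t * (F' i t)^2)"
  and angular_energy: "\<And>i. k \<noteq> 0 \<Longrightarrow> L1_on {0..} (\<lambda>t. (F i t)^2 / wrho i t)"
  and balance: "F 1 0 + F 2 0 + F 3 0 = 0"
begin

abbreviation "\<Phi> \<equiv> lift c k F"

lemma lift_function:
 "is_weak_grad (\<Phi> i \<circ> Ycat c i) (\<lambda>p. vector [F' i (fst p) * mode k (snd p), F i (fst p) * mode' k (snd p)])"
 "has_trace (\<Phi> i \<circ> Ycat c i) (\<lambda>s. F i 0 * mode k s)"
 by (rule explicit_function[OF prim Fm F'm mode_deriv(1) mode_cont(2)]; simp add: lift_Ycat[OF c])+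

lemma admissible: "admissible (Ycat c) \<Phi>"
 unfolding admissible_def
proof (intro conjI exI[of _ "\<lambda>i s. F i 0 * mode k s"] allI)
 show "weakly_differentiable (\<Phi> i \<circ> Ycat c i)" for i
  unfolding weakly_differentiable_def using lift_function(1) by blast
 have "(\<Sum>i\<in>UNIV. F i 0 * mode k s) = (F 1 0 + F 2 0 + F 3 0) * mode k s" for s
  by (simp add: sum_3 distrib_right)
 then show "AE s in lborel. (\<Sum>i\<in>UNIV. F i 0 * mode k s) = 0" using balance by simp
qed (rule lift_function)

lemma mode_meas[measurable]: "(\<lambda>p::real \<times> real. mode k (snd p)) \<in> borel_fun" "(\<lambda>p::real \<times> real. mode' k (snd p)) \<in> borel_fun"
 "(\<lambda>p::real \<times> real. F i (fst p)) \<in> borel_fun" "(\<lambda>p::real \<times> real. F' i (fst p)) \<in> borel_fun"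
 by (rule compose_fst_snd_meas, (rule Fm F'm | (rule borel_measurable_continuous_onI, rule mode_cont)))+

lemma comp_lift:
 "AE p\<in>strip in lborel. comp_U c \<Phi> i p = F i (fst p) * mode k (snd p)"
 "AE p\<in>strip in lborel. comp_G c \<Phi> i p = F' i (fst p) * mode k (snd p)"
 "AE p\<in>strip in lborel. comp_H c \<Phi> i p = F i (fst p) * mode' k (snd p)"
 "AE s in lborel. comp_T c \<Phi> i s = F i 0 * mode k s"
proof -
 note pos = AE_coordinate(2)[OF AE_lborel_singleton[of 0]]
 show "AE p\<in>strip in lborel. comp_U c \<Phi> i p = F i (fst p) * mode k (snd p)"
  using pos
 proof eventually_elim
  fix p :: "real \<times> real" assume p: "fst p \<noteq> 0"
  obtain t s where ts: "p = (t, s)" by force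
  show "p \<in> strip \<longrightarrow> comp_U c \<Phi> i p = F i (fst p) * mode k (snd p)"
   using p by (auto simp: comp_U_def lift_Ycat[OF c] ts)
 qed
 have g: "AE p\<in>open_half in lborel. weak_grad (\<Phi> i \<circ> Ycat c i) p = vector [F' i (fst p) * mode k (snd p), F i (fst p) * mode' k (snd p)]"
  by (rule weak_grad_unique[OF admissible_weak_grad(2)[OF admissible] lift_function(1)])
 show "AE p\<in>strip in lborel. comp_G c \<Phi> i p = F' i (fst p) * mode k (snd p)"
  using g pos by eventually_elim (auto simp: comp_G_def mem_Times_iff)
 show "AE p\<in>strip in lborel. comp_H c \<Phi> i p = F i (fst p) * mode' k (snd p)"
  using g pos by eventually_elim (auto simp: comp_H_def mem_Times_iff)
 show "AE s in lborel. comp_T c \<Phi> i s = F i 0 * mode k s"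
  unfolding comp_T_def by (rule trace_unique[OF admissible_weak_grad(3)[OF admissible] lift_function(2)])
qed

lemma circle_square_integrable: "L1_on circ (\<lambda>s. (mode k s)^2)" "L1_on circ (\<lambda>s. (mode' k s)^2)"
 by (intro continuous_set_integrable continuous_intros continuous_on_subset[OF mode_cont(1)] continuous_on_subset[OF mode_cont(2)] subset_UNIV)+

lemma energy: "\<Phi> \<in> energy_triples (Ycat c)"
proof -
 note m[measurable] = comp_measurable[OF admissible] W.weights_meas wstar_meas[OF c]
 have "grad_L2 (Ycat c i) (\<Phi> i)" for i
  unfolding grad_L2_conv[OF c admissible]
 proof (rule set_integral_eq_AE(1))
  have "L1_on strip (\<lambda>p. (wrho i (fst p) * (F' i (fst p))^2) * (mode k (snd p))^2)"
   by (rule set_integrable_prod[OF radial_energy circle_square_integrable(1)])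
  moreover have "L1_on strip (\<lambda>p. (F i (fst p))^2 / wrho i (fst p) * (mode' k (snd p))^2)"
  proof (cases "k = 0")
   case False
   show ?thesis by (rule set_integrable_prod[OF angular_energy[OF False] circle_square_integrable(2)])
  qed (simp add: mode'_def set_integrable_def)
  ultimately show "L1_on strip (\<lambda>p. wrho i (fst p) * (F' i (fst p))^2 * (mode k (snd p))^2
   + (F i (fst p))^2 / wrho i (fst p) * (mode' k (snd p))^2)" by (rule set_integral_add)
  show "AE p\<in>strip in lborel. wrho i (fst p) * (comp_G c \<Phi> i p)^2 + (comp_H c \<Phi> i p)^2 / wrho i (fst p)
   = wrho i (fst p) * (F' i (fst p))^2 * (mode k (snd p))^2 + (F i (fst p))^2 / wrho i (fst p) * (mode' k (snd p))^2"
   using comp_lift(2,3)[of i] by eventually_elim (simp add: power_mult_distrib)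
 qed measurable
 moreover have "L2_star (Ycat c i) (\<Phi> i)" for i
  unfolding L2_star_conv[OF c admissible]
 proof -
  obtain M where M: "\<And>t. 0 \<le> t \<Longrightarrow> \<bar>F i t\<bar> \<le> M" using bounded by blast
  have "L1_on strip (\<lambda>p. wstar c i (max 0 (fst p)) * (F i (fst p) * mode k (snd p))^2)"
  proof (rule set_integrable_bound_borel)
   have "L1_on {0..} (\<lambda>t. wstar c i (max 0 t))"
    using wstar_integrable[OF c, of i] by (rule set_integrable_cong[THEN iffD1, rotated 3]) auto
   from set_integrable_prod[OF this, of "circ" "\<lambda>_. M^2"]
   show "L1_on strip (\<lambda>p. wstar c i (max 0 (fst p)) * M^2)"
    by (simp add: continuous_set_integrable)
   fix p :: "real \<times> real" assume "p \<in> strip"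
   then have t: "0 \<le> fst p" by (auto simp: mem_Times_iff)
   have "(F i (fst p))^2 \<le> M^2" using M[OF t] by (metis abs_ge_zero power2_abs power_mono)
   then have "(F i (fst p))^2 * (mode k (snd p))^2 \<le> M^2 * 1" using mode_sq_le by (intro mult_mono) auto
   then show "\<bar>wstar c i (max 0 (fst p)) * (F i (fst p) * mode k (snd p))^2\<bar> \<le> wstar c i (max 0 (fst p)) * M^2"
    using wstar_pos[OF c t, of i] t by (simp add: power_mult_distrib abs_mult max_absorb2)
  qed auto
  then show "L1_on strip (\<lambda>p. wstar c i (max 0 (fst p)) * (comp_U c \<Phi> i p)^2)"
  proof (rule set_integral_eq_AE(1))
   show "AE p\<in>strip in lborel. wstar c i (max 0 (fst p)) * (comp_U c \<Phi> i p)^2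
    = wstar c i (max 0 (fst p)) * (F i (fst p) * mode k (snd p))^2"
    using comp_lift(1)[of i] by eventually_elim simp
  qed measurable
 qed
 ultimately show ?thesis using admissible by (simp add: energy_triples_def)
qed

lemma comp_lift_V: "AE p\<in>strip in lborel. comp_V c \<Phi> i p = F i (fst p) * mode k (snd p)"
 using comp_lift(1)[of i] energy_component(2)[OF c energy, of i] by eventually_elim simp

abbreviation "lift_form i v G H \<tau> \<equiv> pair_with c \<Phi> i v G H \<tau>"

text \<open>The chosen gradient and trace of the lifted triple agree almost everywhere with the
  explicit ones, after which \<open>mode_form\<close> reduces the pairing to a radial
  integral.\<close>

lemma pairing_lift:
 assumes D: "W.strip_data i v G H \<tau>"
 shows "L1_on {0..} (\<lambda>t. wrho i t * F' i t * cmean G (mode k) t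
   + (mode_eigenvalue k / wrho i t - wV i t) * F i t * cmean v (mode k) t)" (is ?A)
  and "lift_form i v G H \<tau> = (LBINT t:{0..}. wrho i t * F' i t * cmean G (mode k) t
   + (mode_eigenvalue k / wrho i t - wV i t) * F i t * cmean v (mode k) t) + wq i * (F i 0 * cmean v (mode k) 0)" (is ?B)
proof -
 interpret D: face_function "wrho i" "wV i" "wkap i" "wy i" v G H \<tau> by (rule W.face_functionI[OF D])
 note E = energy_component(1)[OF c energy, of i]
 note int = W.pair_density_integrable[OF D E]
 let ?f = "\<lambda>p. wrho i (fst p) * G p * (F' i (fst p) * mode k (snd p))
   + H p * (F i (fst p) * mode' k (snd p)) / wrho i (fst p) - wV i (fst p) * v p * (F i (fst p) * mode k (snd p))"
 note [measurable] = D.meas W.weights_meas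
 have f: "?f \<in> borel_fun" by measurable
 have ae: "AE p\<in>strip in lborel. ?f p = W.pair_density i v G H (comp_V c \<Phi> i) (comp_G c \<Phi> i) (comp_H c \<Phi> i) p"
  using comp_lift_V[of i] comp_lift(2,3)[of i] by eventually_elim (simp add: W.pair_density_def mult.assoc)
 note S = set_integral_eq_AE[OF int(1) f sets_cyl(2) ae]
 note M = D.mode_form[OF mode_deriv Fm F'm S(1)]
 show ?A by (rule M(1))
 have "(LBINT s:circ. \<tau> s * comp_T c \<Phi> i s) = (LBINT s:circ. F i 0 * (\<tau> s * mode k s))"
 proof (rule set_integral_eq_AE(2)[symmetric, OF int(2)])
  show "AE s\<in>circ in lborel. F i 0 * (\<tau> s * mode k s) = \<tau> s * comp_T c \<Phi> i s"
   using comp_lift(4)[of i] by eventually_elim (simp add: mult_ac)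
  have [measurable]: "mode k \<in> borel_fun" using mode_cont(1) by (rule borel_measurable_continuous_onI)
  show "(\<lambda>s. F i 0 * (\<tau> s * mode k s)) \<in> borel_fun" by measurable
 qed auto
 also have "\<dots> = F i 0 * cmean v (mode k) 0"
  using D.cmean_primitive(3)[OF mode_cont(1), of 0] by simp
 finally show ?B unfolding W.pairing_def M(2)[symmetric] S(2)[symmetric] by simp
qed

end

section \<open>The upper bound for the Morse index\<close>

lemma AE_exists_greater:
 assumes "AE t in lborel. P (t::real)"
 shows "\<exists>t>M. P t"
proof (rule ccontr)
 assume "\<not> ?thesis"
 then have sub: "{M<..<M + 1} \<subseteq> {t. \<not> P t}" by auto
 obtain N where N: "N \<in> null_sets lborel" "{t. \<not> P t} \<subseteq> N"
  using assms by (auto simp: eventually_ae_filter)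
 have "emeasure lborel {M<..<M + 1} \<le> emeasure lborel N"
  using sub N by (intro emeasure_mono) auto
 then show False using N(1) by (simp add: null_sets_def)
qed

text \<open>The natural boundary condition of the index form, \<open>\<rho> y' = q y\<close> at t =
  0, for the positive field \<open>wy\<close>. Through it the curvature term is absorbed when the
  square is completed.\<close>

lemma wq_kap: "wq i = - wkap i 0"
 using waist_values(1) by (simp add: wq_def wkap_def)

lemma (in face_weights) pairing_self:
 "pairing q v G H \<tau> v G H \<tau> = (LBINT p:strip. energy_density v G H p) + q * (LBINT s:circ. (\<tau> s)^2)"
 by (simp add: pairing_def pair_density_def energy_density_def power2_eq_square)

lemma boundary_modes_balance:
 assumes c: "0 < c" and \<phi>: "\<phi> \<in> energy_triples (Ycat c)" and e: "continuous_on UNIV e"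
 shows "cmean (comp_V c \<phi> 1) e 0 + cmean (comp_V c \<phi> 2) e 0 + cmean (comp_V c \<phi> 3) e 0 = 0"
proof -
 have cm: "cmean (comp_V c \<phi> i) e 0 = (LBINT s:circ. comp_T c \<phi> i s * e s)"
  and m: "comp_T c \<phi> i \<in> borel_fun"
  and int: "L1_on circ (\<lambda>s. comp_T c \<phi> i s * e s)" for i
 proof -
  interpret D: face_function "wrho i" "wV i" "wkap i" "wy i" "comp_V c \<phi> i" "comp_G c \<phi> i" "comp_H c \<phi> i" "comp_T c \<phi> i"
   by (rule W.face_functionI[OF energy_component(1)[OF c \<phi>]])
  show "cmean (comp_V c \<phi> i) e 0 = (LBINT s:circ. comp_T c \<phi> i s * e s)"
   by (rule D.cmean_primitive(3)[OF e order_refl])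
  show "comp_T c \<phi> i \<in> borel_fun" by (rule D.meas)
  obtain K where K: "\<And>s. s \<in> circ \<Longrightarrow> \<bar>e s\<bar> \<le> K" using D.continuous_circle_bounded[OF e] by blast
  show "L1_on circ (\<lambda>s. comp_T c \<phi> i s * e s)"
   by (rule set_integrable_bounded_mult[OF D.tau_L1 K]) (use D.meas e in \<open>auto intro: borel_measurable_continuous_onI\<close>)
 qed
 have "(LBINT s:circ. comp_T c \<phi> 1 s * e s + comp_T c \<phi> 2 s * e s + comp_T c \<phi> 3 s * e s) = (LBINT s:circ. 0)"
 proof (rule set_integral_eq_AE(2))
  have [measurable]: "e \<in> borel_fun" using e by (rule borel_measurable_continuous_onI)
  note [measurable] = m
  show "(\<lambda>s. comp_T c \<phi> 1 s * e s + comp_T c \<phi> 2 s * e s + comp_T c \<phi> 3 s * e s) \<in> borel_fun" by measurable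
  have "AE s in lborel. (\<Sum>i\<in>UNIV. comp_T c \<phi> i s) = 0"
   using \<phi> by (intro traces_sum_zero) (simp add: energy_triples_def)
  then show "AE s\<in>circ in lborel. comp_T c \<phi> 1 s * e s + comp_T c \<phi> 2 s * e s + comp_T c \<phi> 3 s * e s = 0"
   by eventually_elim (simp add: sum_3 flip: distrib_right)
 qed (simp_all add: set_integrable_def)
 then show ?thesis unfolding cm
  by (subst (asm) set_integral_add(2), simp add: int, simp add: int, subst (asm) set_integral_add(2)) (simp_all add: int)
qed

lemma comp_V_sum:
 assumes c: "0 < c" and fin: "finite B" and B: "B \<subseteq> energy_triples (Ycat c)"
  and \<Phi>: "\<And>i x. \<Phi> i x = (\<Sum>b\<in>B. a b * b i x)"
 shows "AE p\<in>strip in lborel. (\<Sum>b\<in>B. a b * comp_V c b i p) = comp_U c \<Phi> i p"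
proof -
 have "AE p in lborel. \<forall>b\<in>B. p \<in> strip \<longrightarrow> comp_V c b i p = comp_U c b i p"
  using energy_component(2)[OF c] B fin by (subst AE_finite_all) auto
 then show ?thesis
  by eventually_elim (simp add: comp_U_def \<Phi> sum_distrib_left mult_ac)
qed

lemma cmean_sum:
 assumes c: "0 < c" and fin: "finite B" and B: "B \<subseteq> energy_triples (Ycat c)" and e: "continuous_on UNIV e" and t: "0 \<le> t"
 shows "cmean (\<lambda>p. \<Sum>b\<in>B. a b * comp_V c b i p) e t = (\<Sum>b\<in>B. a b * cmean (comp_V c b i) e t)"
proof -
 have int: "L1_on circ (\<lambda>s. comp_V c b i (t, s) * e s)" if "b \<in> B" for b
 proof -
  interpret D: face_function "wrho i" "wV i" "wkap i" "wy i" "comp_V c b i" "comp_G c b i" "comp_H c b i" "comp_T c b i"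
   using B that by (intro W.face_functionI energy_component(1)[OF c]) auto
  show ?thesis by (rule D.cmean_primitive(2)[OF e t])
 qed
 show ?thesis unfolding cmean_def sum_distrib_right mult.assoc
  by (rule set_integral_linear_sum[OF int])
qed

text \<open>\<open>comp_V\<close> depends on chosen gradients and traces, so linearity is available
  only almost everywhere. The two sides agree for almost every radius, and continuity in t settles
  the given one.\<close>

lemma cmean_combination:
 assumes c: "0 < c" and fin: "finite B" and B: "B \<subseteq> energy_triples (Ycat c)" and \<Phi>E: "\<Phi> \<in> energy_triples (Ycat c)"
  and \<Phi>: "\<And>i x. \<Phi> i x = (\<Sum>b\<in>B. a b * b i x)"
  and e: "continuous_on UNIV e" and t: "0 \<le> t"
 shows "cmean (comp_V c \<Phi> i) e t = (\<Sum>b\<in>B. a b * cmean (comp_V c b i) e t)"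
proof -
 define v where "v p = (\<Sum>b\<in>B. a b * comp_V c b i p)" for p
 have Dv: "W.strip_data i v (\<lambda>p. \<Sum>b\<in>B. a b * comp_G c b i p) (\<lambda>p. \<Sum>b\<in>B. a b * comp_H c b i p) (\<lambda>s. \<Sum>b\<in>B. a b * comp_T c b i s)"
  unfolding v_def[abs_def] using B by (intro W.strip_data_sum[OF fin] energy_component(1)[OF c]) auto
 interpret D: face_function "wrho i" "wV i" "wkap i" "wy i" v "\<lambda>p. \<Sum>b\<in>B. a b * comp_G c b i p" "\<lambda>p. \<Sum>b\<in>B. a b * comp_H c b i p" "\<lambda>s. \<Sum>b\<in>B. a b * comp_T c b i s"
  by (rule W.face_functionI[OF Dv])
 interpret D': face_function "wrho i" "wV i" "wkap i" "wy i" "comp_V c \<Phi> i" "comp_G c \<Phi> i" "comp_H c \<Phi> i" "comp_T c \<Phi> i"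
  by (rule W.face_functionI[OF energy_component(1)[OF c \<Phi>E]])
 have "AE p\<in>strip in lborel. v p = comp_V c \<Phi> i p"
  using comp_V_sum[OF c fin B \<Phi>, of i] energy_component(2)[OF c \<Phi>E, of i] by eventually_elim (simp add: v_def)
 from AE_slices[OF this] have ae: "AE r\<in>{0..t + 1} in lborel. cmean v e r - cmean (comp_V c \<Phi> i) e r = 0"
 proof eventually_elim
  fix r :: real assume "AE s in lborel. (r, s) \<in> strip \<longrightarrow> v (r, s) = comp_V c \<Phi> i (r, s)"
  then have "cmean v e r = cmean (comp_V c \<Phi> i) e r" if "0 \<le> r"
   unfolding cmean_def
  proof (intro set_integral_eq_AE(2))
   show "L1_on circ (\<lambda>s. comp_V c \<Phi> i (r, s) * e s)" by (rule D'.cmean_primitive(2)[OF e that])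
   have [measurable]: "e \<in> borel_fun" using e by (rule borel_measurable_continuous_onI)
   note [measurable] = borel_slice(1)[OF D.meas(1)]
   show "(\<lambda>s. v (r, s) * e s) \<in> borel_fun" by measurable
   assume "AE s in lborel. (r, s) \<in> strip \<longrightarrow> v (r, s) = comp_V c \<Phi> i (r, s)"
   then show "AE s\<in>circ in lborel. v (r, s) * e s = comp_V c \<Phi> i (r, s) * e s"
    by eventually_elim (use that in auto)
  qed auto
  then show "r \<in> {0..t + 1} \<longrightarrow> cmean v e r - cmean (comp_V c \<Phi> i) e r = 0" by auto
 qed
 have "continuous_on {0..t + 1} (\<lambda>r. cmean v e r - cmean (comp_V c \<Phi> i) e r)"
  using t by (intro continuous_intros primitive_on_continuous[OF D.cmean_primitive(1)[OF e]]
    primitive_on_continuous[OF D'.cmean_primitive(1)[OF e]]) auto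
 then have "cmean v e t - cmean (comp_V c \<Phi> i) e t = 0"
  using AE_zero_imp_zero_interval[OF _ _ ae] t by force
 then show ?thesis using cmean_sum[OF c fin B e t, of a i] by (simp add: v_def[abs_def])
qed

text \<open>On a catenoid the radial energy gives 3 / 2 and the curvature term
  \<open>- wkap i 0\<close> another 1 / 2; on the plane the energy is only nonnegative and the
  curvature term is - 1. All other angular modes are discarded by
  \<open>energy_ge_radial\<close>.\<close>

lemma compact_face_bound:
 assumes c: "0 < c" and \<phi>: "\<phi> \<in> compact_W12_triples (Ycat c)"
  and zero: "i \<noteq> 2 \<Longrightarrow> mean (comp_V c \<phi> i) waist = 0"
 shows "(if i = 2 then - 1 else 2) * (mean (comp_V c \<phi> i) 0)^2 / (2 * pi) \<le> bform c i \<phi> \<phi>"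
proof -
 have \<phi>E: "\<phi> \<in> energy_triples (Ycat c)" using \<phi> compact_subset_energy[OF c] by blast
 note E = energy_component[OF c \<phi>E, of i]
 interpret D: face_function "wrho i" "wV i" "wkap i" "wy i" "comp_V c \<phi> i" "comp_G c \<phi> i" "comp_H c \<phi> i" "comp_T c \<phi> i"
  by (rule W.face_functionI[OF E(1)])
 let ?f = "mean (comp_V c \<phi> i)" and ?g = "mean (comp_G c \<phi> i)"
 let ?e = "W.energy_density i (comp_V c \<phi> i) (comp_G c \<phi> i) (comp_H c \<phi> i)"
 obtain T0 where T0: "0 \<le> T0" "AE p in lborel. T0 < fst p \<longrightarrow> comp_U c \<phi> i p = 0"
  using compact_support_component[OF c \<phi>] by blast
 have far: "AE p\<in>strip in lborel. T0 < fst p \<longrightarrow> comp_V c \<phi> i p = 0"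
  using T0(2) E(2) by eventually_elim auto
 \<comment> \<open>Beyond the support almost every circle carries the zero function; one such circle
   removes the outer boundary terms.\<close>
 obtain T where T: "max T0 1 < T" and sl: "AE s in lborel. (T, s) \<in> strip \<longrightarrow> T0 < fst (T, s) \<longrightarrow> comp_V c \<phi> i (T, s) = 0"
  using AE_exists_greater[OF AE_slices[OF far]] by blast
 have T': "0 \<le> T" "1 \<le> T" "T0 < T" using T by auto
 have sl': "AE s\<in>circ in lborel. comp_V c \<phi> i (T, s) = 0"
  using sl by eventually_elim (use T' in auto)
 have m: "(\<lambda>s. comp_V c \<phi> i (T, s)) \<in> borel_fun" by (rule borel_slice(1)[OF D.meas(1)])
 have "D.sq_mean T = (LBINT s:circ. 0)" unfolding D.sq_mean_def
  by (rule set_integral_eq_AE(2)) (use m sl' in \<open>auto simp: set_integrable_def elim: eventually_mono\<close>)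
 then have s0: "D.sq_mean T = 0" by simp
 have "?f T = (LBINT s:circ. 0)" unfolding cmean_def
  by (rule set_integral_eq_AE(2)) (use m sl' in \<open>auto simp: set_integrable_def elim: eventually_mono\<close>)
 then have f0: "?f T = 0" by simp
 \<comment> \<open>Where \<open>comp_V\<close> vanishes the potential drops out, so the discarded
   part of the energy is nonnegative.\<close>
 have tail: "(LBINT p:cyl T. ?e p) \<le> (LBINT p:strip. ?e p)"
  unfolding set_lebesgue_integral_def
 proof (rule integral_mono_AE)
  show "AE p in lborel. indicator (cyl T) p *\<^sub>R ?e p \<le> indicator strip p *\<^sub>R ?e p"
   using far
  proof eventually_elim
   fix p :: "real \<times> real" assume p: "p \<in> strip \<longrightarrow> T0 < fst p \<longrightarrow> comp_V c \<phi> i p = 0"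
   show "indicator (cyl T) p *\<^sub>R ?e p \<le> indicator strip p *\<^sub>R ?e p"
   proof (cases "p \<in> strip \<and> T < fst p")
    case True
    then have "comp_V c \<phi> i p = 0" "0 < wrho i (fst p)" using p T' W.rho_pos by auto
    then have "0 \<le> ?e p" by (simp add: W.energy_density_def)
    then show ?thesis using True by (auto simp: indicator_def)
   qed (auto simp: indicator_def)
  qed
 qed (use D.energy_density_integrable in \<open>simp_all add: set_integrable_def\<close>)
 have bf: "bform c i \<phi> \<phi> = (LBINT p:strip. ?e p) - wkap i 0 * D.sq_mean 0"
  unfolding W.pairing_self wq_kap D.sq_mean_primitive(3)[OF order_refl] by simp
 have low: "((LBINT t:{0..T}. wrho i t * (?g t)^2 - wV i t * (?f t)^2) - wkap i 0 * (?f 0)^2) / (2 * pi) \<le> bform c i \<phi> \<phi>"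
  using D.energy_ge_radial[OF T'(1)] tail s0 f0 unfolding bf by simp
 have "(if i = 2 then - 1 else 2) * (?f 0)^2 \<le> (LBINT t:{0..T}. wrho i t * (?g t)^2 - wV i t * (?f t)^2) - wkap i 0 * (?f 0)^2"
 proof (cases "i = 2")
  case True
  have "0 \<le> (LBINT t:{0..T}. wrho i t * (?g t)^2 - wV i t * (?f t)^2)"
   by (rule set_integral_nonneg_real) (use True W.rho_pos[of _ i] in \<open>auto simp: wV_def less_imp_le\<close>)
  then show ?thesis using True by (simp add: wkap_def)
 next
  case False
  have g2: "L1_on {0..T} (\<lambda>t. (?g t)^2)"
  proof (rule set_integrable_subset)
   show "L1_on {0..} (\<lambda>t. (?g t)^2)"
    using D.rho_mean_sq_integrable[of "\<lambda>_. 1"] False by (simp add: wrho_def)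
  qed auto
  have "primitive_on 0 T ?f ?g" by (rule D.cmean_primitive(1)[OF continuous_on_const T'(1)])
  from catenoid_radial_bound[OF this T'(2) g2 zero[OF False] f0]
  have "3 / 2 * (?f 0)^2 \<le> (LBINT t:{0..T}. wrho i t * (?g t)^2 - wV i t * (?f t)^2)"
   using False by (simp add: wrho_def wV_def)
  moreover have "wkap i 0 = - 1 / 2" using False waist_values(1) by (simp add: wkap_def)
  ultimately show ?thesis using False by simp
 qed
 then have "(if i = 2 then - 1 else 2) * (?f 0)^2 / (2 * pi) \<le>
   ((LBINT t:{0..T}. wrho i t * (?g t)^2 - wV i t * (?f t)^2) - wkap i 0 * (?f 0)^2) / (2 * pi)"
  by (intro divide_right_mono) auto
 with low show ?thesis by linarith
qed

text \<open>With f2 = - (f1 + f3) at the junction, the face bounds add up to 2 f1^2 + 2 f3^2 - (f1 +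
  f3)^2, which is the square of f1 - f3.\<close>

lemma index_form_nonneg:
 assumes c: "0 < c" and \<phi>: "\<phi> \<in> compact_W12_triples (Ycat c)"
  and z: "mean (comp_V c \<phi> 1) waist = 0" "mean (comp_V c \<phi> 3) waist = 0"
 shows "0 \<le> index_form (Ycat c) \<phi> \<phi>"
proof -
 have \<phi>E: "\<phi> \<in> energy_triples (Ycat c)" using \<phi> compact_subset_energy[OF c] by blast
 define f where "f i = mean (comp_V c \<phi> i) 0" for i
 have b: "f 2 = - (f 1 + f 3)"
  using boundary_modes_balance[OF c \<phi>E continuous_on_const, of 1] by (simp add: f_def)
 have "0 \<le> (2 * (f 1)^2 - (f 2)^2 + 2 * (f 3)^2) / (2 * pi)"
 proof -
  have "2 * (f 1)^2 - (f 2)^2 + 2 * (f 3)^2 = (f 1 - f 3)^2" unfolding b by (simp add: power2_eq_square algebra_simps)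
  then show ?thesis by simp
 qed
 also have "\<dots> = 2 * (f 1)^2 / (2 * pi) + - 1 * (f 2)^2 / (2 * pi) + 2 * (f 3)^2 / (2 * pi)"
  by (simp add: add_divide_distrib diff_divide_distrib)
 also have "\<dots> \<le> bform c 1 \<phi> \<phi> + bform c 2 \<phi> \<phi> + bform c 3 \<phi> \<phi>"
  using compact_face_bound[OF c \<phi>, of 1] compact_face_bound[OF c \<phi>, of 2] compact_face_bound[OF c \<phi>, of 3] z
  unfolding f_def by (intro add_mono) simp_all
 also have "\<dots> = index_form (Ycat c) \<phi> \<phi>"
  unfolding index_form_conv[OF c \<phi>E \<phi>E] sum_3 ..
 finally show ?thesis .
qed

lemma triple_subspace_sum:
 assumes V: "triple_subspace V" and "finite B" "B \<subseteq> V"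
 shows "(\<lambda>i x. \<Sum>b\<in>B. a b * b i x) \<in> V"
 using assms(2,3)
proof (induction B rule: finite_induct)
 case empty then show ?case using V by (simp add: triple_subspace_def)
next
 case (insert x B)
 have 1: "(\<lambda>i y. a x * x i y) \<in> V" using V insert.prems unfolding triple_subspace_def by blast
 have 2: "(\<lambda>i y. \<Sum>b\<in>B. a b * b i y) \<in> V" using insert by simp
 have add: "(\<lambda>i x. \<phi> i x + \<psi> i x) \<in> V" if "\<phi> \<in> V" "\<psi> \<in> V" for \<phi> \<psi>
  using V that unfolding triple_subspace_def by blast
 have "(\<lambda>i y. a x * x i y + (\<Sum>b\<in>B. a b * b i y)) \<in> V" by (rule add[OF 1 2])
 then show ?case using insert by simp
qed

text \<open>Vanishing of the rotational mean at the waists of both catenoids is two linear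
  conditions; three independent triples would leave a nonzero combination satisfying both, on which
  the form is nonnegative.\<close>

lemma morse_index_le:
 assumes c: "0 < c" shows "morse_index (Ycat c) \<le> 2"
 unfolding morse_index_def quotient_dim_def
proof (intro SUP_least)
 fix V B assume "V \<in> {V. V \<subseteq> compact_W12_triples (Ycat c) \<and> triple_subspace V \<and> negative_definite_on (Ycat c) V}"
  and "B \<in> {B. B \<subseteq> V \<and> independent_modulo (ae_zero (Ycat c)) B}"
 then have V: "V \<subseteq> compact_W12_triples (Ycat c)" "triple_subspace V" "negative_definite_on (Ycat c) V"
  and B: "B \<subseteq> V" "independent_modulo (ae_zero (Ycat c)) B" by auto
 have fin: "finite B" using B(2) by (simp add: independent_modulo_def)
 have BE: "B \<subseteq> energy_triples (Ycat c)" using B V compact_subset_energy[OF c] by blast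
 have "card B \<le> 2"
 proof (rule ccontr)
  assume "\<not> card B \<le> 2"
  then have "2 < card B" by simp
  from exists_nontrivial_combination[OF fin this, of "\<lambda>j b. cmean (comp_V c b (if j = 0 then 1 else 3)) (\<lambda>_. 1) waist"]
  obtain a where a: "\<exists>b\<in>B. a b \<noteq> 0" and
   z: "\<And>j. j < 2 \<Longrightarrow> (\<Sum>b\<in>B. a b * cmean (comp_V c b (if j = (0::nat) then 1 else 3)) (\<lambda>_. 1) waist) = 0"
   by blast
  define \<Phi> :: triple where "\<Phi> = (\<lambda>i x. \<Sum>b\<in>B. a b * b i x)"
  have \<Phi>V: "\<Phi> \<in> V" unfolding \<Phi>_def by (rule triple_subspace_sum[OF V(2) fin B(1)])
  then have \<Phi>: "\<Phi> \<in> compact_W12_triples (Ycat c)" using V by blast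
  then have \<Phi>E: "\<Phi> \<in> energy_triples (Ycat c)" using compact_subset_energy[OF c] by blast
  have "\<Phi> \<notin> ae_zero (Ycat c)" using B(2) a unfolding independent_modulo_def \<Phi>_def by blast
  then have "index_form (Ycat c) \<Phi> \<Phi> < 0" using V(3) \<Phi>V unfolding negative_definite_on_def by blast
  moreover have "mean (comp_V c \<Phi> i) waist = (\<Sum>b\<in>B. a b * mean (comp_V c b i) waist)" for i
   by (rule cmean_combination[OF c fin BE \<Phi>E]) (use waist_bounds in \<open>auto simp: \<Phi>_def\<close>)
  then have "0 \<le> index_form (Ycat c) \<Phi> \<Phi>"
   using z[of 0] z[of 1] by (intro index_form_nonneg[OF c \<Phi>]) simp_all
  ultimately show False by simp
 qed
 then show "enat (card B) \<le> 2" by (simp add: numeral_eq_enat)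
qed

section \<open>The lower bound for the Morse index\<close>

text \<open>Separate continuity suffices: slicing gives zero on whole circles for almost every t,
  then continuity along the ray gives it for every t.\<close>

lemma ae_zero_pointwise:
 assumes z: "\<phi> \<in> ae_zero X" and cs: "\<And>t. 0 < t \<Longrightarrow> continuous_on UNIV (\<lambda>s. \<phi> i (X i (t, s)))"
  and ct: "\<And>s. continuous_on {0<..} (\<lambda>t. \<phi> i (X i (t, s)))" and t: "0 < t"
 shows "\<phi> i (X i (t, s)) = 0"
proof -
 have "AE p\<in>open_half in lborel. \<phi> i (X i p) = 0" using z by (simp add: ae_zero_def)
 from AE_slices[OF this] have ae: "AE t in lborel. 0 < t \<longrightarrow> \<phi> i (X i (t, s)) = 0"
 proof eventually_elim
  fix t :: real assume a: "AE s in lborel. (t, s) \<in> open_half \<longrightarrow> \<phi> i (X i (t, s)) = 0"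
  have "\<phi> i (X i (t, s)) = 0" if t: "0 < t"
  proof (rule AE_zero_imp_zero_interval[where h = "\<lambda>s. \<phi> i (X i (t, s))" and x = s and p = "s - 1" and q = "s + 1"])
   show "continuous_on {s - 1..s + 1} (\<lambda>s. \<phi> i (X i (t, s)))" using cs[OF t] by (rule continuous_on_subset) auto
   show "AE x\<in>{s - 1..s + 1} in lborel. \<phi> i (X i (t, x)) = 0"
    using a by eventually_elim (use t in auto)
  qed auto
  then show "0 < t \<longrightarrow> \<phi> i (X i (t, s)) = 0" by blast
 qed
 show ?thesis
 proof (rule AE_zero_imp_zero_interval[where h = "\<lambda>t. \<phi> i (X i (t, s))" and x = t and p = "t / 2" and q = "t + 1"])
  show "continuous_on {t / 2..t + 1} (\<lambda>t. \<phi> i (X i (t, s)))" using ct by (rule continuous_on_subset) (use t in auto)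
  show "AE x\<in>{t / 2..t + 1} in lborel. \<phi> i (X i (x, s)) = 0"
   using ae by eventually_elim (use t in auto)
 qed (use t in auto)
qed

text \<open>Phrasing independence by indices spares a separate proof that the members are distinct:
  two equal ones would satisfy the relation with coefficients 1 and - 1.\<close>

lemma quotient_dim_ge_indexed:
 assumes N: "(\<lambda>i x. 0) \<in> N" and V: "\<And>k. k < n \<Longrightarrow> g k \<in> V"
  and ind: "\<And>\<alpha> k. (\<lambda>i x. \<Sum>k<n. \<alpha> k * g k i x) \<in> N \<Longrightarrow> k < n \<Longrightarrow> \<alpha> k = 0"
 shows "enat n \<le> quotient_dim N V"
proof -
 have inj: "inj_on g {..<n}"
 proof (rule inj_onI, rule ccontr)
  fix j k assume jk: "j \<in> {..<n}" "k \<in> {..<n}" "g j = g k" "j \<noteq> k"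
  define \<alpha> where "\<alpha> m = (if m = j then 1 else if m = k then - 1 else 0 :: real)" for m
  have "(\<Sum>m<n. \<alpha> m * g m i x) = 0" for i x
  proof -
   have "(\<Sum>m<n. \<alpha> m * g m i x) = (\<Sum>m\<in>{j, k}. \<alpha> m * g m i x)"
    by (rule sum.mono_neutral_right) (use jk in \<open>auto simp: \<alpha>_def\<close>)
   then show ?thesis using jk by (simp add: \<alpha>_def)
  qed
  then have "(\<lambda>i x. \<Sum>m<n. \<alpha> m * g m i x) \<in> N" using N by simp
  from ind[OF this, of j] jk show False by (simp add: \<alpha>_def)
 qed
 have "independent_modulo N (g ` {..<n})"
  unfolding independent_modulo_def
 proof (intro conjI allI impI ballI)
  fix a b assume a: "(\<lambda>i x. \<Sum>b\<in>g ` {..<n}. a b * b i x) \<in> N" and "b \<in> g ` {..<n}"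
  then obtain k where k: "k < n" "b = g k" by auto
  have "(\<Sum>b\<in>g ` {..<n}. a b * b i x) = (\<Sum>k<n. a (g k) * g k i x)" for i x
   using inj by (simp add: sum.reindex)
  with a have "(\<lambda>i x. \<Sum>k<n. a (g k) * g k i x) \<in> N" by simp
  from ind[OF this k(1)] show "a b = 0" by (simp add: k)
 qed simp
 moreover have "g ` {..<n} \<subseteq> V" using V by auto
 ultimately have "enat (card (g ` {..<n})) \<le> quotient_dim N V"
  unfolding quotient_dim_def by (intro SUP_upper) auto
 then show ?thesis using inj by (simp add: card_image)
qed

text \<open>
 A trapezoidal cut-off vanishing on the junction; supported on a single catenoid, it makes the index form
 negative. Its slopes are chosen so that crude numerical bounds suffice.
\<close>

definition trapezoid :: "real \<Rightarrow> real" where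
 "trapezoid t = (if t \<le> 1 then t else if t \<le> 4 then 1 else if t \<le> 8 then 2 - t / 4 else 0)"
definition trapezoid' :: "real \<Rightarrow> real" where
 "trapezoid' t = (if t \<le> 1 then 1 else if t \<le> 4 then 0 else if t \<le> 8 then - 1 / 4 else 0)"

lemma trapezoid_meas: "trapezoid \<in> borel_fun" "trapezoid' \<in> borel_fun"
 unfolding trapezoid_def[abs_def] trapezoid'_def[abs_def] by measurable

lemma trapezoid_primitive: "0 \<le> T \<Longrightarrow> primitive_on 0 T trapezoid trapezoid'"
proof -
 assume T: "0 \<le> T"
 define M where "M = max T 8"
 have 1: "primitive_on 0 1 trapezoid trapezoid'"
  by (rule primitive_on_cong[OF primitive_on_at_deriv[of 0 1 "\<lambda>t. t" "\<lambda>_. 1"]])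
   (auto simp: trapezoid_def trapezoid'_def intro!: derivative_eq_intros)
 have 2: "primitive_on 1 4 trapezoid trapezoid'"
  by (rule primitive_on_cong[OF primitive_on_const[of _ _ 1]]) (auto simp: trapezoid_def trapezoid'_def)
 have 3: "primitive_on 4 8 trapezoid trapezoid'"
  by (rule primitive_on_cong[OF primitive_on_at_deriv[of 4 8 "\<lambda>t. 2 - t / 4" "\<lambda>_. - 1 / 4"]])
   (auto simp: trapezoid_def trapezoid'_def intro!: derivative_eq_intros)
 have 4: "primitive_on 8 M trapezoid trapezoid'"
  by (rule primitive_on_cong[OF primitive_on_const[of _ _ 0]]) (auto simp: trapezoid_def trapezoid'_def)
 have "primitive_on 0 M trapezoid trapezoid'"
  by (rule primitive_on_concat[OF primitive_on_concat[OF primitive_on_concat[OF 1 2] 3] 4]) (auto simp: M_def)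
 then show ?thesis by (rule primitive_on_subinterval) (use T in \<open>auto simp: M_def\<close>)
qed

lemma trapezoid_bounds: "0 \<le> t \<Longrightarrow> \<bar>trapezoid t\<bar> \<le> 1" "8 \<le> t \<Longrightarrow> trapezoid t = 0" "8 < t \<Longrightarrow> trapezoid' t = 0" "trapezoid 0 = 0"
 "\<bar>trapezoid' t\<bar> \<le> 1"
 by (auto simp: trapezoid_def trapezoid'_def abs_le_iff)

text \<open>As exp (2 waist) = 3, tanh (x - waist) is a rational function of exp (- 2 x), and e
  between 2 and 3 suffices. The bound 3 / 8 is what balances the contributions 1 / 2 and 1 / 4 of
  the two slopes in \<open>trapezoid_energy_negative\<close>.\<close>

lemma tanh_numeric: "3 / 8 < tanh (4 - waist) - tanh (1 - waist)"
proof -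
 have e: "exp (- 2 * (x - waist)) = 3 * exp (- 2 * x)" for x
 proof -
  have "exp (2 * waist) = 3" by (simp add: waist_def exp_double)
  moreover have "exp (- 2 * (x - waist)) = exp (2 * waist) * exp (- 2 * x)" by (simp add: mult_exp_exp algebra_simps)
  ultimately show ?thesis by simp
 qed
 have t: "tanh (x - waist) = (1 - 3 * exp (- 2 * x)) / (1 + 3 * exp (- 2 * x))" for x
  unfolding tanh_real_altdef e ..
 define q where "q = exp (1::real)"
 have q: "2 \<le> q" "q \<le> 3" using exp_le exp_ge_add_one_self[of 1] by (auto simp: q_def)
 have q2: "exp (- 2 * 1) = 1 / q^2" and q8: "exp (- 2 * 4) = 1 / q ^ 8"
  by (simp_all add: q_def exp_minus inverse_eq_divide flip: exp_of_nat_mult)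
 have "q^2 \<le> 3^2" using q by (intro power_mono) auto
 then have "1 / 9 \<le> 1 / q^2" using q by (intro divide_left_mono) auto
 moreover have "(1 - 3 * x) / (1 + 3 * x) \<le> 1 / 2" if "1 / 9 \<le> x" for x :: real using that by (simp add: pos_divide_le_eq)
 ultimately have 1: "tanh (1 - waist) \<le> 1 / 2" unfolding t q2 by blast
 have "2 ^ 8 \<le> q ^ 8" using q by (intro power_mono) auto
 then have "1 / q ^ 8 \<le> 1 / 2 ^ 8" using q by (intro divide_left_mono) auto
 moreover have "0 \<le> 1 / q ^ 8" using q by simp
 moreover have "7 / 8 < (1 - 3 * x) / (1 + 3 * x)" if "x \<le> 1 / 2 ^ 8" "0 \<le> x" for x :: real
  using that by (simp add: pos_less_divide_eq)
 ultimately have 2: "7 / 8 < tanh (4 - waist)" unfolding t q8 by blast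
 show ?thesis using 1 2 by simp
qed

text \<open>The bound 3 / 4 is the value at the junction, a point of [0, 1] farthest from the neck
  because \<open>1 \<le> 2 * waist\<close>.\<close>

lemma cosh_bound_near_waist: "0 \<le> t \<Longrightarrow> t \<le> 1 \<Longrightarrow> 3 / 4 \<le> 1 / (cosh (t - waist))^2"
proof -
 assume t: "0 \<le> t" "t \<le> 1"
 have "cosh \<bar>t - waist\<bar> \<le> cosh \<bar>waist\<bar>"
  using t waist_bounds by (subst cosh_real_nonneg_le_iff) auto
 then have "(cosh (t - waist))^2 \<le> (cosh waist)^2" by (intro power_mono) simp_all
 then have "1 / (cosh waist)^2 \<le> 1 / (cosh (t - waist))^2"
  by (intro divide_left_mono) auto
 then show ?thesis unfolding waist_values(3) .
qed

definition "trapezoid_density t = (trapezoid' t)^2 - 2 / (cosh (t - waist))^2 * (trapezoid t)^2"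

lemma trapezoid_integrable: "L1_on {0..8} (\<lambda>t. (trapezoid' t)^2)" "L1_on {0..8} trapezoid_density"
 "L1_on {0..} (\<lambda>t. (trapezoid' t)^2)"
proof -
 note [measurable] = trapezoid_meas
 show 1: "L1_on {0..8} (\<lambda>t. (trapezoid' t)^2)"
  by (rule set_integrable_bound_borel[where f = "\<lambda>_. 1"])
   (use trapezoid_bounds(5) in \<open>auto intro!: continuous_set_integrable continuous_intros simp: abs_square_le_1\<close>)
 have "cosh x \<noteq> 0" for x :: real using cosh_real_pos[of x] by simp
 then show "L1_on {0..8} trapezoid_density"
  unfolding trapezoid_density_def[abs_def]
  by (intro set_integral_diff 1 continuous_set_integrable continuous_intros primitive_on_continuous[OF trapezoid_primitive]) auto
 show "L1_on {0..} (\<lambda>t. (trapezoid' t)^2)"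
  by (subst set_integrable_restrict[where A = "{0..8}"]) (auto simp: trapezoid_bounds 1)
qed

text \<open>The rising slope costs at most 1 / 2 after a lower bound for the potential, the falling
  slope at most 4 / 16; on the flat part the potential integrates exactly to a difference of
  tanh.\<close>

lemma trapezoid_energy_negative: "(LBINT t:{0..8}. trapezoid_density t) < 0"
proof -
 have cosh0: "cosh x \<noteq> 0" for x :: real using cosh_real_pos[of x] by simp
 have split: "(LBINT t:{0..8}. trapezoid_density t) = (LBINT t:{0..1}. trapezoid_density t)
  + (LBINT t:{1..4}. trapezoid_density t) + (LBINT t:{4..8}. trapezoid_density t)"
  using set_integral_split_Icc[OF trapezoid_integrable(2), of 1]
   set_integral_split_Icc[OF set_integrable_subset[OF trapezoid_integrable(2)], of 1 8 4] by simp
 have bound: "(LBINT t:{p..q}. trapezoid_density t) \<le> \<Psi> q - \<Psi> p"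
  if pq: "0 \<le> p" "p \<le> q" "q \<le> 8" and d: "\<And>t. p \<le> t \<Longrightarrow> t \<le> q \<Longrightarrow> (\<Psi> has_real_derivative \<psi> t) (at t)"
   "continuous_on {p..q} \<psi>" and le: "\<And>t. p < t \<Longrightarrow> t < q \<Longrightarrow> trapezoid_density t \<le> \<psi> t" for p q \<Psi> \<psi>
 proof -
  have P: "primitive_on p q \<Psi> \<psi>" by (rule primitive_on_at_deriv[OF d])
  have "(LBINT t:{p..q}. trapezoid_density t) \<le> (LBINT t:{p..q}. \<psi> t)"
  proof (rule set_integral_mono_AE)
   show "L1_on {p..q} trapezoid_density" by (rule set_integrable_subset[OF trapezoid_integrable(2)]) (use pq in auto)
   show "L1_on {p..q} \<psi>" by (rule primitive_on_integrable[OF P])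
   show "AE t\<in>{p..q} in lborel. trapezoid_density t \<le> \<psi> t"
    using AE_lborel_singleton[of p] AE_lborel_singleton[of q] by eventually_elim (auto intro: le)
  qed
  also have "\<dots> = \<Psi> q - \<Psi> p" using primitive_on_eq[OF P, of q] pq by simp
  finally show ?thesis .
 qed
 have 1: "(LBINT t:{0..1}. trapezoid_density t) \<le> 1 / 2"
 proof -
  have "trapezoid_density t \<le> 1 - 3 / 2 * t^2" if "0 < t" "t < 1" for t
  proof -
   have "2 * (3 / 4) * t^2 \<le> 2 * (1 / (cosh (t - waist))^2) * t^2"
    using cosh_bound_near_waist[of t] that by (intro mult_right_mono mult_left_mono) auto
   then show ?thesis using that by (simp add: trapezoid_density_def trapezoid_def trapezoid'_def)
  qed
  then have "(LBINT t:{0..1}. trapezoid_density t) \<le> (1 - 1 ^ 3 / 2) - (0 - 0 ^ 3 / 2)"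
   by (intro bound[where \<Psi> = "\<lambda>t. t - t ^ 3 / 2" and \<psi> = "\<lambda>t. 1 - 3 / 2 * t^2"])
    (auto intro!: derivative_eq_intros continuous_intros simp: power2_eq_square)
  then show ?thesis by simp
 qed
 have 2: "(LBINT t:{1..4}. trapezoid_density t) \<le> - 2 * tanh (4 - waist) - - 2 * tanh (1 - waist)"
  by (rule bound[where \<Psi> = "\<lambda>t. - 2 * tanh (t - waist)", OF _ _ _ DERIV_cmult[OF tanh_deriv]])
   (auto intro!: continuous_intros simp: trapezoid_density_def trapezoid_def trapezoid'_def cosh0)
 have 3: "(LBINT t:{4..8}. trapezoid_density t) \<le> 8 / 16 - 4 / 16"
  by (rule bound[where \<psi> = "\<lambda>t. 1 / 16"])
   (auto intro!: derivative_eq_intros simp: trapezoid_density_def trapezoid'_def power2_eq_square)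
 show ?thesis using 1 2 3 tanh_numeric unfolding split by linarith
qed

lemma (in radial_mode) cmean_lift:
 "AE t in lborel. 0 \<le> t \<longrightarrow> cmean (comp_V c \<Phi> i) (mode k) t = F i t * (LBINT s:circ. (mode k s)^2)"
 "AE t in lborel. 0 \<le> t \<longrightarrow> cmean (comp_G c \<Phi> i) (mode k) t = F' i t * (LBINT s:circ. (mode k s)^2)"
proof -
 have *: "AE t in lborel. 0 \<le> t \<longrightarrow> cmean w (mode k) t = h t * (LBINT s:circ. (mode k s)^2)"
  if ae: "AE p\<in>strip in lborel. w p = h (fst p) * mode k (snd p)" and w: "w \<in> borel_fun"
  for w and h :: "real \<Rightarrow> real"
  using AE_slices[OF ae]
 proof eventually_elim
  fix t :: real assume a: "AE s in lborel. (t, s) \<in> strip \<longrightarrow> w (t, s) = h (fst (t, s)) * mode k (snd (t, s))"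
  have "cmean w (mode k) t = (LBINT s:circ. h t * (mode k s)^2)" if "0 \<le> t"
   unfolding cmean_def
  proof (rule set_integral_eq_AE(2))
   show "L1_on circ (\<lambda>s. h t * (mode k s)^2)"
    by (intro set_integrable_mult_right circle_square_integrable)
   have [measurable]: "mode k \<in> borel_fun" using mode_cont(1) by (rule borel_measurable_continuous_onI)
   note [measurable] = borel_slice(1)[OF w]
   show "(\<lambda>s. w (t, s) * mode k s) \<in> borel_fun" by measurable
   show "AE s\<in>circ in lborel. w (t, s) * mode k s = h t * (mode k s)^2"
    using a by eventually_elim (use that in \<open>auto simp: power2_eq_square\<close>)
  qed auto
  then show "0 \<le> t \<longrightarrow> cmean w (mode k) t = h t * (LBINT s:circ. (mode k s)^2)" by simp
 qed
 interpret D: face_function "wrho i" "wV i" "wkap i" "wy i" "comp_V c \<Phi> i" "comp_G c \<Phi> i" "comp_H c \<Phi> i" "comp_T c \<Phi> i"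
  by (rule W.face_functionI[OF energy_component(1)[OF c energy]])
 show "AE t in lborel. 0 \<le> t \<longrightarrow> cmean (comp_V c \<Phi> i) (mode k) t = F i t * (LBINT s:circ. (mode k s)^2)"
  by (rule *[OF comp_lift_V D.meas(1)])
 show "AE t in lborel. 0 \<le> t \<longrightarrow> cmean (comp_G c \<Phi> i) (mode k) t = F' i t * (LBINT s:circ. (mode k s)^2)"
  by (rule *[OF comp_lift(2) D.meas(2)])
qed

lemma Ycat_circle:
 obtains s' where "0 \<le> s'" "s' \<le> 2 * pi" "\<And>t. Ycat c i (t, s) = Ycat c i (t, s')"
proof -
 obtain s' where "0 \<le> s'" "s' < 2 * pi" "cos s = cos s'" "sin s = sin s'"
  using sincos_total_2pi[of "cos s" "sin s"] by (metis sin_cos_squared_add2)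
 then show ?thesis by (intro that[of s']) (auto simp: pseudo_Y_catenoid_def catenoid_face_def planar_face_def)
qed

lemma Ycat_cont: "continuous_on UNIV (Ycat c i)"
proof -
 have eq: "(vector [a, b, d] :: real^3) = a *\<^sub>R axis 1 1 + b *\<^sub>R axis 2 1 + d *\<^sub>R axis 3 1" for a b d :: real
  by (simp add: vec_eq_iff forall_3 axis_def)
 show ?thesis
  unfolding pseudo_Y_catenoid_def catenoid_face_def planar_face_def eq case_prod_beta
  by (cases "i = 1"; cases "i = 2"; simp; intro continuous_intros)
qed

lemma (in radial_mode) compact_lift:
 assumes R: "0 \<le> R" and far: "\<And>i t. R < t \<Longrightarrow> F i t = 0"
 shows "\<Phi> \<in> compact_W12_triples (Ycat c)"
proof -
 have "face_integrable (Ycat c i) (\<lambda>p. (\<Phi> i (Ycat c i p))^2)" for i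
  unfolding square_integrable_conv[OF c admissible]
 proof (rule set_integral_eq_AE(1))
  have "L1_on {0..} (\<lambda>t. warea c i (max 0 t) * (F i t)^2)"
  proof (subst set_integrable_restrict[where A = "{0..R}"])
   have "continuous_on {0..R} (\<lambda>t. warea c i (max 0 t))"
    unfolding warea_def by (cases "i = 2") (auto intro!: continuous_intros)
   then show "L1_on {0..R} (\<lambda>t. warea c i (max 0 t) * (F i t)^2)"
    by (intro continuous_set_integrable continuous_intros primitive_on_continuous[OF prim[OF R]])
  qed (auto simp: far)
  from set_integrable_prod[OF this circle_square_integrable(1)]
  show "L1_on strip (\<lambda>p. warea c i (max 0 (fst p)) * (F i (fst p))^2 * (mode k (snd p))^2)" .
  note [measurable] = comp_measurable[OF admissible] warea_meas
  show "(\<lambda>p. warea c i (max 0 (fst p)) * (comp_U c \<Phi> i p)^2) \<in> borel_fun" by measurable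
  show "AE p\<in>strip in lborel. warea c i (max 0 (fst p)) * (comp_U c \<Phi> i p)^2
   = warea c i (max 0 (fst p)) * (F i (fst p))^2 * (mode k (snd p))^2"
   using comp_lift(1)[of i] by eventually_elim (simp add: power_mult_distrib)
 qed auto
 moreover have "compactly_supported (Ycat c i) (\<Phi> i)" for i
  unfolding compactly_supported_def
 proof (intro exI[of _ "Ycat c i ` (cyl R)"] conjI AE_I2 impI)
  show "compact (Ycat c i ` (cyl R))"
   by (intro compact_continuous_image continuous_on_subset[OF Ycat_cont] compact_Times) auto
  show "Ycat c i ` (cyl R) \<subseteq> surface (Ycat c i)"
   unfolding surface_def by (intro image_mono) auto
  fix p :: "real \<times> real" assume p: "p \<in> open_half" "Ycat c i p \<notin> Ycat c i ` (cyl R)"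
  obtain t s where ts: "p = (t, s)" "0 < t" using p(1) by auto
  obtain s' where s': "0 \<le> s'" "s' \<le> 2 * pi" "\<And>t. Ycat c i (t, s) = Ycat c i (t, s')" using Ycat_circle[of c i s] by blast
  have "\<not> t \<le> R"
  proof
   assume "t \<le> R"
   then have "(t, s') \<in> cyl R" using s' ts by auto
   then have "Ycat c i (t, s') \<in> Ycat c i ` (cyl R)" by (rule imageI)
   then show False using p(2) s'(3)[of t] ts by simp
  qed
  then show "\<Phi> i (Ycat c i p) = 0" using far ts by (simp add: lift_Ycat[OF c])
 qed
 moreover have "grad_L2 (Ycat c i) (\<Phi> i)" for i using energy by (simp add: energy_triples_def)
 ultimately show ?thesis using admissible by (simp add: compact_W12_triples_def)
qed

text \<open>Both profiles vanish at the junction, so the weights a and b on the catenoids are free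
  and the balance of traces is automatic.\<close>

definition "two_trapezoids c a b = lift c 0 (\<lambda>i t. (if i = 1 then a else if i = 2 then 0 else b) * trapezoid t)"

lemma two_trapezoids_mode:
 assumes c: "0 < c"
 shows "radial_mode c 0 (\<lambda>i t. (if i = 1 then a else if i = 2 then 0 else b) * trapezoid t)
  (\<lambda>i t. (if i = 1 then a else if i = 2 then 0 else b) * trapezoid' t)"
proof (unfold_locales)
 note [measurable] = trapezoid_meas
 fix i :: 3
 let ?A = "if i = 1 then a else if i = 2 then 0 else b"
 show "primitive_on 0 T (\<lambda>t. ?A * trapezoid t) (\<lambda>t. ?A * trapezoid' t)" if "0 \<le> T" for T
  by (rule primitive_on_cmult[OF trapezoid_primitive[OF that]])
 show "(\<lambda>t. ?A * trapezoid t) \<in> borel_fun" "(\<lambda>t. ?A * trapezoid' t) \<in> borel_fun" by measurable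
 show "\<exists>M. \<forall>t\<ge>0. \<bar>?A * trapezoid t\<bar> \<le> M"
  by (rule exI[of _ "\<bar>?A\<bar>"]) (auto simp: abs_mult intro!: mult_left_le trapezoid_bounds(1))
 show "L1_on {0..} (\<lambda>t. wrho i t * (?A * trapezoid' t)^2)"
 proof (cases "i = 2")
  case False
  have "L1_on {0..} (\<lambda>t. ?A^2 * (trapezoid' t)^2)"
   by (intro set_integrable_mult_right trapezoid_integrable(3))
  then show ?thesis using False by (simp add: wrho_def power_mult_distrib)
 qed (simp add: set_integrable_def)
qed (use c in \<open>auto simp: trapezoid_bounds\<close>)

text \<open>The two profiles live on different faces, so there is no cross term, and the boundary
  terms vanish with the traces.\<close>

lemma two_trapezoids_form:
 assumes c: "0 < c"
 shows "two_trapezoids c a b \<in> compact_W12_triples (Ycat c)"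
  and "index_form (Ycat c) (two_trapezoids c a b) (two_trapezoids c a b) = 2 * pi * (a^2 + b^2) * (LBINT t:{0..8}. trapezoid_density t)"
proof -
 define A where "A i = (if i = 1 then a else if i = (2::3) then 0 else b)" for i
 interpret L: radial_mode c 0 "\<lambda>i t. A i * trapezoid t" "\<lambda>i t. A i * trapezoid' t"
  using two_trapezoids_mode[OF c, of a b] by (simp add: A_def)
 have \<Phi>: "two_trapezoids c a b = L.\<Phi>" by (simp add: two_trapezoids_def A_def)
 show "two_trapezoids c a b \<in> compact_W12_triples (Ycat c)"
  unfolding \<Phi> by (rule L.compact_lift[of 8]) (auto simp: trapezoid_bounds)
 have "bform c i L.\<Phi> L.\<Phi> = 2 * pi * (A i)^2 * (LBINT t:{0..8}. trapezoid_density t)" for i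
 proof -
  note P = L.pairing_lift[OF energy_component(1)[OF c L.energy, of i]]
  let ?f = "\<lambda>t. wrho i t * (A i * trapezoid' t) * cmean (comp_G c L.\<Phi> i) (mode 0) t
   + (mode_eigenvalue 0 / wrho i t - wV i t) * (A i * trapezoid t) * cmean (comp_V c L.\<Phi> i) (mode 0) t"
  have m0: "(LBINT s:circ. (mode 0 s)^2) = 2 * pi" by (simp add: mode_def set_integral_const)
  have "(LBINT t:{0..}. ?f t) = (LBINT t:{0..}. 2 * pi * (A i)^2 * trapezoid_density t)"
  proof (rule set_integral_eq_AE(2)[symmetric, OF P(1)])
   have [measurable]: "(\<lambda>t. cosh (t - waist)) \<in> borel_fun" by (intro borel_measurable_continuous_onI continuous_intros)
   note [measurable] = trapezoid_meas
   show "(\<lambda>t. 2 * pi * (A i)^2 * trapezoid_density t) \<in> borel_fun"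
    unfolding trapezoid_density_def[abs_def] by measurable
   show "AE t\<in>{0..} in lborel. 2 * pi * (A i)^2 * trapezoid_density t = ?f t"
    using L.cmean_lift(1)[of i, unfolded m0] L.cmean_lift(2)[of i, unfolded m0]
   proof (eventually_elim, intro impI)
    fix t :: real
    assume "0 \<le> t \<longrightarrow> cmean (comp_V c L.\<Phi> i) (mode 0) t = A i * trapezoid t * (2 * pi)"
     "0 \<le> t \<longrightarrow> cmean (comp_G c L.\<Phi> i) (mode 0) t = A i * trapezoid' t * (2 * pi)" "t \<in> {0..}"
    then have h: "cmean (comp_V c L.\<Phi> i) (mode 0) t = A i * trapezoid t * (2 * pi)"
     "cmean (comp_G c L.\<Phi> i) (mode 0) t = A i * trapezoid' t * (2 * pi)" by auto
    show "2 * pi * (A i)^2 * trapezoid_density t = ?f t"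
    proof (cases "i = 2")
     case True
     then have "A i = 0" by (simp add: A_def)
     then show ?thesis by simp
    next
     case False
     then have "wrho i t = 1" "wV i t = 2 / (cosh (t - waist))^2" by (simp_all add: wrho_def wV_def)
     then show ?thesis unfolding h
      by (simp add: mode_eigenvalue_def trapezoid_density_def power2_eq_square right_diff_distrib mult_ac)
    qed
   qed
  qed auto
  also have "\<dots> = 2 * pi * (A i)^2 * (LBINT t:{0..}. trapezoid_density t)" by simp
  also have "(LBINT t:{0..}. trapezoid_density t) = (LBINT t:{0..8}. trapezoid_density t)"
   by (rule set_integral_restrict) (auto simp: trapezoid_density_def trapezoid_bounds)
  finally show ?thesis unfolding P(2) by (simp add: trapezoid_bounds)
 qed
 then show "index_form (Ycat c) (two_trapezoids c a b) (two_trapezoids c a b) = 2 * pi * (a^2 + b^2) * (LBINT t:{0..8}. trapezoid_density t)"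
  unfolding \<Phi> index_form_conv[OF c L.energy L.energy] sum_3 by (simp add: A_def algebra_simps)
qed

lemma two_trapezoids_linear:
 "two_trapezoids c a b i x + two_trapezoids c a' b' i x = two_trapezoids c (a + a') (b + b') i x"
 "r * two_trapezoids c a b i x = two_trapezoids c (r * a) (r * b) i x"
 "two_trapezoids c 0 0 i x = 0"
 by (simp_all add: two_trapezoids_def lift_def distrib_right)

lemma zero_ae_zero: "(\<lambda>i x. 0) \<in> ae_zero X"
 by (simp add: ae_zero_def)

lemma morse_index_ge:
 assumes c: "0 < c" shows "2 \<le> morse_index (Ycat c)"
proof -
 define V where "V = {\<phi>. \<exists>a b. \<phi> = two_trapezoids c a b}"
 define g where "g k = (if k = (0::nat) then two_trapezoids c 1 0 else two_trapezoids c 0 1)" for k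
 have "enat 2 \<le> quotient_dim (ae_zero (Ycat c)) V"
 proof (rule quotient_dim_ge_indexed[OF zero_ae_zero, of _ g])
  show "g k \<in> V" for k by (auto simp: g_def V_def)
  fix \<alpha> :: "nat \<Rightarrow> real" and k :: nat assume a: "(\<lambda>i x. \<Sum>k<2. \<alpha> k * g k i x) \<in> ae_zero (Ycat c)" and k: "k < 2"
  have e: "(\<lambda>i x. \<Sum>k<2. \<alpha> k * g k i x) = two_trapezoids c (\<alpha> 0) (\<alpha> 1)"
   by (intro ext) (simp add: g_def numeral_2_eq_2 two_trapezoids_linear)
  have v: "two_trapezoids c (\<alpha> 0) (\<alpha> 1) i (Ycat c i (t, s)) = (if i = 1 then \<alpha> 0 else if i = 2 then 0 else \<alpha> 1) * trapezoid t"
   if "0 \<le> t" for i t s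
   using lift_Ycat[OF c that] by (simp add: two_trapezoids_def mode_def)
  \<comment> \<open>At t = 2 the trapezoid equals 1, so the values there read off the
    coefficients.\<close>
  have z: "two_trapezoids c (\<alpha> 0) (\<alpha> 1) i (Ycat c i (2, 0)) = 0" for i
  proof (rule ae_zero_pointwise[OF a[unfolded e]])
   show "continuous_on UNIV (\<lambda>s. two_trapezoids c (\<alpha> 0) (\<alpha> 1) i (Ycat c i (t, s)))" if "0 < t" for t
    using that by (simp add: v del: One_nat_def)
   have ct: "continuous_on {0<..} trapezoid"
   proof (rule continuous_on_open_UN[of UNIV "\<lambda>n::nat. {0<..<real n}", simplified, THEN continuous_on_subset])
    fix n :: nat
    show "continuous_on {0<..<real n} trapezoid"
     by (rule continuous_on_subset[OF primitive_on_continuous[OF trapezoid_primitive[of "real n"]]]) auto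
   qed (auto intro: reals_Archimedean2)
   show "continuous_on {0<..} (\<lambda>t. two_trapezoids c (\<alpha> 0) (\<alpha> 1) i (Ycat c i (t, s)))" for s
    by (rule continuous_on_eq[OF continuous_on_mult_left[OF ct, of "if i = 1 then \<alpha> 0 else if i = 2 then 0 else \<alpha> 1"]]) (simp add: v del: One_nat_def)
  qed simp
  have "\<alpha> 0 = 0" using z[of 1] by (simp add: v trapezoid_def del: One_nat_def)
  moreover have "\<alpha> 1 = 0" using z[of 3] by (simp add: v trapezoid_def del: One_nat_def)
  ultimately show "\<alpha> k = 0" using k by (metis less_2_cases_iff One_nat_def)
 qed
 also have "quotient_dim (ae_zero (Ycat c)) V \<le> morse_index (Ycat c)"
  unfolding morse_index_def
 proof (rule SUP_upper, intro CollectI conjI)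
  show "V \<subseteq> compact_W12_triples (Ycat c)" using two_trapezoids_form(1)[OF c] by (auto simp: V_def)
  have "(\<lambda>i x. 0) \<in> V" unfolding V_def by (intro CollectI exI[of _ 0]) (simp add: fun_eq_iff two_trapezoids_linear)
  moreover have "(\<lambda>i x. \<phi> i x + \<psi> i x) \<in> V" if "\<phi> \<in> V" "\<psi> \<in> V" for \<phi> \<psi>
  proof -
   obtain a b a' b' where "\<phi> = two_trapezoids c a b" "\<psi> = two_trapezoids c a' b'" using \<open>\<phi> \<in> V\<close> \<open>\<psi> \<in> V\<close> unfolding V_def by blast
   then have "(\<lambda>i x. \<phi> i x + \<psi> i x) = two_trapezoids c (a + a') (b + b')" by (simp add: fun_eq_iff two_trapezoids_linear)
   then show ?thesis unfolding V_def by blast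
  qed
  moreover have "(\<lambda>i x. r * \<phi> i x) \<in> V" if "\<phi> \<in> V" for \<phi> r
  proof -
   obtain a b where "\<phi> = two_trapezoids c a b" using \<open>\<phi> \<in> V\<close> unfolding V_def by blast
   then have "(\<lambda>i x. r * \<phi> i x) = two_trapezoids c (r * a) (r * b)" by (simp add: fun_eq_iff two_trapezoids_linear)
   then show ?thesis unfolding V_def by blast
  qed
  ultimately show "triple_subspace V" unfolding triple_subspace_def by blast
  show "negative_definite_on (Ycat c) V"
   unfolding negative_definite_on_def
  proof (intro ballI impI)
   fix \<phi> assume "\<phi> \<in> V" and nz: "\<phi> \<notin> ae_zero (Ycat c)"
   then obtain a b where \<phi>: "\<phi> = two_trapezoids c a b" by (auto simp: V_def)
   have "a \<noteq> 0 \<or> b \<noteq> 0"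
   proof (rule ccontr)
    assume "\<not> (a \<noteq> 0 \<or> b \<noteq> 0)"
    then have "\<phi> = (\<lambda>i x. 0)" by (simp add: \<phi> fun_eq_iff two_trapezoids_linear)
    with nz zero_ae_zero show False by blast
   qed
   then have "0 < a^2 + b^2" by (simp add: sum_power2_gt_zero_iff)
   then show "index_form (Ycat c) \<phi> \<phi> < 0"
    unfolding \<phi> two_trapezoids_form(2)[OF c] using trapezoid_energy_negative by (intro mult_pos_neg) auto
  qed
 qed
 finally show ?thesis by (simp add: numeral_eq_enat)
qed

section \<open>The nullity\<close>

definition "radial_null i t = (if i = (2::3) then 1 else tanh (t - waist) :: real)"
definition "radial_null' i t = (if i = (2::3) then 0 else 1 / (cosh (t - waist))^2 :: real)"
definition "angular_null' i t = (if i = (2::3) then - 1 / (t + 2 / sqrt 3)^2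
 else - (1 / cosh (t - waist) * tanh (t - waist)) :: real)"

lemma cosh_ne0: "cosh (x::real) \<noteq> 0"
 using cosh_real_pos[of x] by simp

lemma plane_radius_pos: "0 \<le> t \<Longrightarrow> 0 < t + 2 / sqrt 3"
 by (simp add: add_nonneg_pos)

lemma wy_deriv: "0 \<le> t \<Longrightarrow> (wy i has_real_derivative angular_null' i t) (at t)"
 using W.y_deriv[of t i] plane_radius_pos[of t]
 by (cases "i = 2") (simp_all add: wkap_def wrho_def wy_def[abs_def] angular_null'_def power2_eq_square mult_ac)

lemma null_ode:
 assumes t: "0 \<le> t"
 shows "(radial_null i has_real_derivative radial_null' i t) (at t)"
  and "((\<lambda>t. wrho i t * radial_null' i t) has_real_derivative (0 / wrho i t - wV i t) * radial_null i t) (at t)"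
  and "((\<lambda>t. wrho i t * angular_null' i t) has_real_derivative (1 / wrho i t - wV i t) * wy i t) (at t)"
proof -
 define th where "th t = tanh (t - waist)" for t
 have dth: "(th has_real_derivative 1 - (th t)^2) (at t)" for t
  unfolding th_def using tanh_deriv[of t] unfolding cosh_sq_identity .
 have sq: "1 / (cosh (t - waist))^2 = 1 - (th t)^2" for t unfolding th_def by (rule cosh_sq_identity)
 define sh where "sh t = 1 / cosh (t - waist)" for t
 have shsq: "sh t * sh t = 1 - th t * th t" for t using sq[of t] by (simp add: sh_def power2_eq_square)
 have dsh: "(sh has_real_derivative - (sh t * th t)) (at t)" for t
  unfolding sh_def[abs_def] th_def using cosh_ne0[of "t - waist"]
  by (auto intro!: derivative_eq_intros simp: tanh_def power2_eq_square field_simps)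
 show "(radial_null i has_real_derivative radial_null' i t) (at t)"
  unfolding radial_null_def[abs_def] radial_null'_def by (cases "i = 2") (auto intro: tanh_deriv)
 show "((\<lambda>t. wrho i t * radial_null' i t) has_real_derivative (0 / wrho i t - wV i t) * radial_null i t) (at t)"
 proof (cases "i = 2")
  case False
  have "wV i t = 2 * (1 - (th t)^2)" using False sq[of t] by (simp add: wV_def)
  moreover have "((\<lambda>t. 1 - (th t)^2) has_real_derivative - (2 * (1 - (th t)^2)) * th t) (at t)"
   by (auto intro!: derivative_eq_intros dth simp: algebra_simps)
  ultimately show ?thesis using False by (simp add: wrho_def radial_null'_def radial_null_def sq flip: th_def)
 qed (simp add: wrho_def wV_def radial_null'_def)
 show "((\<lambda>t. wrho i t * angular_null' i t) has_real_derivative (1 / wrho i t - wV i t) * wy i t) (at t)"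
 proof (cases "i = 2")
  case True
  note p = plane_radius_pos[OF t]
  have "((\<lambda>t. - (1 / (t + 2 / sqrt 3))) has_real_derivative 1 / (t + 2 / sqrt 3) * (1 / (t + 2 / sqrt 3))) (at t)"
   using p by (auto intro!: derivative_eq_intros simp: divide_simps)
  moreover have "\<forall>\<^sub>F s in nhds t. - (1 / (s + 2 / sqrt 3)) = (s + 2 / sqrt 3) * (- 1 / (s + 2 / sqrt 3)^2)"
  proof (rule eventually_mono)
   show "\<forall>\<^sub>F s in nhds t. - (2 / sqrt 3) < s" by (rule eventually_nhds_in_open[of "{- (2 / sqrt 3)<..}", simplified]) (use p in linarith)
  qed (simp add: power2_eq_square)
  ultimately show ?thesis using True
   by (simp add: wrho_def wV_def wy_def angular_null'_def DERIV_cong_ev[OF refl])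
 next
  case False
  have "((\<lambda>t. - (sh t * th t)) has_real_derivative (1 - 2 * (1 - (th t)^2)) * sh t) (at t)"
   by (auto intro!: derivative_eq_intros dth dsh simp: power2_eq_square algebra_simps)
  moreover have "wV i t = 2 * (1 - (th t)^2)" using False sq[of t] by (simp add: wV_def)
  ultimately show ?thesis using False by (simp add: wrho_def wy_def angular_null'_def flip: th_def sh_def)
 qed
qed

lemma null_cont: "continuous_on UNIV (radial_null i)"
 unfolding radial_null_def[abs_def] by (cases "i = 2") (auto intro!: continuous_intros simp: cosh_ne0)

lemma null_cont': "continuous_on {0..} (radial_null' i)" "continuous_on {0..} (angular_null' i)" "continuous_on {0..} (wy i)"
 using plane_radius_pos unfolding radial_null'_def[abs_def] angular_null'_def[abs_def] wy_def[abs_def]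
 by (cases "i = 2"; force intro!: continuous_intros simp: cosh_ne0)+

lemma null_borel: "radial_null i \<in> borel_fun" "radial_null' i \<in> borel_fun"
 "wy i \<in> borel_fun" "angular_null' i \<in> borel_fun"
proof -
 have [measurable]: "(\<lambda>t. cosh (t - waist)) \<in> borel_fun" "(\<lambda>t. tanh (t - waist)) \<in> borel_fun"
  by (auto intro!: borel_measurable_continuous_onI continuous_intros simp: cosh_ne0)
 show "radial_null i \<in> borel_fun" "radial_null' i \<in> borel_fun"
  "wy i \<in> borel_fun" "angular_null' i \<in> borel_fun"
  unfolding radial_null_def[abs_def] radial_null'_def[abs_def] angular_null'_def[abs_def] wy_def[abs_def] by measurable
qed

lemma null_bounded: "\<bar>radial_null i t\<bar> \<le> 1" "0 \<le> t \<Longrightarrow> \<bar>wy i t\<bar> \<le> 2"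
proof -
 have "\<bar>tanh (t - waist)\<bar> \<le> 1" using tanh_real_bounds[of "t - waist"] by auto
 then show "\<bar>radial_null i t\<bar> \<le> 1" by (simp add: radial_null_def)
 show "\<bar>wy i t\<bar> \<le> 2" if "0 \<le> t"
 proof (cases "i = 2")
  case True
  have "1 \<le> wrho i t" by (rule W.rho_ge1[OF that])
  then show ?thesis using True plane_radius_pos[OF that] by (simp add: wrho_def wy_def divide_le_eq)
 next
  case False
  have "1 \<le> cosh (t - waist)" by (rule cosh_real_ge_1)
  then show ?thesis using False by (simp add: wy_def divide_le_eq)
 qed
qed

lemma sech_square_integrable: "L1_on {0..} (\<lambda>t. 1 / (cosh (t - waist))^2)"
proof (rule pos_integrable_FTC[where \<Phi> = "\<lambda>t. tanh (t - waist)" and l = 1])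
 show "((\<lambda>t. tanh (t - waist)) has_real_derivative 1 / (cosh (t - waist))^2) (at t)" for t by (rule tanh_deriv)
 show "((\<lambda>t. tanh (t - waist)) \<longlongrightarrow> 1) at_top" by real_asymp
qed (auto intro!: continuous_intros simp: cosh_ne0)

lemma inverse_cube_integrable: "L1_on {0..} (\<lambda>t. 1 / (t + 2 / sqrt 3) ^ 3)"
proof (rule pos_integrable_FTC[where \<Phi> = "\<lambda>t. - 1 / (2 * (t + 2 / sqrt 3)^2)" and l = 0])
 fix t :: real assume "0 \<le> t"
 then have p: "0 < t + 2 / sqrt 3" by (rule plane_radius_pos)
 have aux: "((\<lambda>t. - 1 / (2 * (t + a)^2)) has_real_derivative 1 / (t + a) ^ 3) (at t)" if "t + a = r" "0 < r" for a r :: real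
  using that(2) by (auto intro!: derivative_eq_intros simp: that(1) power2_eq_square power3_eq_cube divide_simps)
 show "((\<lambda>t. - 1 / (2 * (t + 2 / sqrt 3)^2)) has_real_derivative 1 / (t + 2 / sqrt 3) ^ 3) (at t)"
  by (rule aux[OF refl p])
 show "0 \<le> 1 / (t + 2 / sqrt 3) ^ 3" using p by simp
next
 show "((\<lambda>t. - 1 / (2 * (t + 2 / sqrt 3)^2)) \<longlongrightarrow> 0) at_top" by real_asymp
 show "continuous_on {0..} (\<lambda>t. 1 / (t + 2 / sqrt 3) ^ 3)"
  using plane_radius_pos by (force intro!: continuous_intros)
qed

lemma null_energy:
 "L1_on {0..} (\<lambda>t. wrho i t * (radial_null' i t)^2)"
 "L1_on {0..} (\<lambda>t. wrho i t * (angular_null' i t)^2)"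
 "L1_on {0..} (\<lambda>t. (wy i t)^2 / wrho i t)"
proof -
 have s1: "1 / (cosh (t - waist))^2 \<le> 1" "0 \<le> 1 / (cosh (t - waist))^2" for t
  using one_le_power[OF cosh_real_ge_1, of "t - waist" 2] by (simp_all add: divide_le_eq)
 have th1: "(tanh (t - waist))^2 \<le> 1" for t using cosh_sq_identity[of "t - waist"] s1[of t] by linarith
 have cat: "L1_on {0..} (\<lambda>t. (h t)^2)" if "h \<in> borel_fun" "\<And>t. (h t)^2 \<le> 1 / (cosh (t - waist))^2" for h
  by (rule set_integrable_bound_borel[OF sech_square_integrable]) (use that in auto)
 show "L1_on {0..} (\<lambda>t. wrho i t * (radial_null' i t)^2)"
 proof (cases "i = 2")
  case False
  have "(radial_null' i t)^2 \<le> 1 / (cosh (t - waist))^2" for t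
   using False mult_left_mono[OF s1(1) s1(2), of t t] by (simp add: radial_null'_def power2_eq_square)
  from cat[OF null_borel(2) this] show ?thesis using False by (simp add: wrho_def)
 qed (simp add: radial_null'_def set_integrable_def)
 show "L1_on {0..} (\<lambda>t. wrho i t * (angular_null' i t)^2)"
 proof (cases "i = 2")
  case True
  show ?thesis
   by (rule set_integrable_cong[THEN iffD1, OF refl refl _ inverse_cube_integrable])
    (use True plane_radius_pos in \<open>force simp: wrho_def angular_null'_def power2_eq_square power3_eq_cube\<close>)
 next
  case False
  have "(angular_null' i t)^2 \<le> 1 / (cosh (t - waist))^2" for t
   using False mult_left_mono[OF th1[of t] s1(2)[of t]] by (simp add: angular_null'_def power_mult_distrib power_divide)
  from cat[OF null_borel(4) this] show ?thesis using False by (simp add: wrho_def)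
 qed
 show "L1_on {0..} (\<lambda>t. (wy i t)^2 / wrho i t)"
 proof (cases "i = 2")
  case True
  show ?thesis
   by (rule set_integrable_cong[THEN iffD1, OF refl refl _ inverse_cube_integrable])
    (use True plane_radius_pos in \<open>force simp: wrho_def wy_def power2_eq_square power3_eq_cube\<close>)
 next
  case False
  have "(wy i t)^2 \<le> 1 / (cosh (t - waist))^2" for t
   using False by (simp add: wy_def power_divide)
  from cat[OF null_borel(3) this] show ?thesis using False by (simp add: wrho_def)
 qed
qed

text \<open>Exponential decay of the derivatives on the catenoids beats the linear growth of
  coefficients there; on the plane 1 / r beats the logarithm, and the constant field has derivative
  zero.\<close>

lemma null_decay:
 "((\<lambda>T. wrho i T * radial_null' i T * (1 + (LBINT t:{0..T}. 1 / wrho i t))) \<longlongrightarrow> 0) at_top"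
 "((\<lambda>T. wrho i T * angular_null' i T * (1 + (LBINT t:{0..T}. 1 / wrho i t))) \<longlongrightarrow> 0) at_top"
proof -
 have ev: "\<forall>\<^sub>F T in at_top. (0::real) \<le> T" by (rule eventually_ge_at_top)
 show "((\<lambda>T. wrho i T * radial_null' i T * (1 + (LBINT t:{0..T}. 1 / wrho i t))) \<longlongrightarrow> 0) at_top"
 proof (cases "i = 2")
  case False
  have "((\<lambda>T::real. 1 / (cosh (T - waist))^2 * (1 + T)) \<longlongrightarrow> 0) at_top" by real_asymp
  then show ?thesis
   by (rule Lim_transform_eventually) (use ev in \<open>eventually_elim, simp only: wrho_integral False if_False, simp add: False wrho_def radial_null'_def\<close>)
 qed (simp add: radial_null'_def)
 show "((\<lambda>T. wrho i T * angular_null' i T * (1 + (LBINT t:{0..T}. 1 / wrho i t))) \<longlongrightarrow> 0) at_top"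
 proof (cases "i = 2")
  case True
  have "((\<lambda>T::real. (T + 2 / sqrt 3) * (- 1 / (T + 2 / sqrt 3)^2) * (1 + ln ((T + 2 / sqrt 3) / (2 / sqrt 3)))) \<longlongrightarrow> 0) at_top" by real_asymp
  then show ?thesis
   by (rule Lim_transform_eventually) (use ev in \<open>eventually_elim, simp only: wrho_integral, simp only: True wrho_def angular_null'_def if_True simp_thms\<close>)
 next
  case False
  have "((\<lambda>T::real. - (1 / cosh (T - waist) * tanh (T - waist)) * (1 + T)) \<longlongrightarrow> 0) at_top" by real_asymp
  then show ?thesis
   by (rule Lim_transform_eventually) (use ev in \<open>eventually_elim, simp only: wrho_integral False if_False, simp add: False wrho_def angular_null'_def\<close>)
 qed
qed

text \<open>
 The rotationally symmetric field is induced on the catenoids by the vertical translation and is constant on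
 the plane. The others combine horizontal translations of the catenoids with the harmonic functions
 \<open>cos \<theta> / r\<close> and \<open>sin \<theta> / r\<close> on the plane.
\<close>

definition "radial_jacobi c \<sigma> = lift c 0 (\<lambda>i t. \<sigma> i * radial_null i t)" for \<sigma> :: "3 \<Rightarrow> real"
definition "angular_jacobi c k \<beta> = lift c k (\<lambda>i t. \<beta> i * wy i t)" for \<beta> :: "3 \<Rightarrow> real"

lemma wy_0: "wy i 0 = sqrt 3 / 2"
 by (simp add: wy_def waist_values(2))

lemma null_primitive: "0 \<le> T \<Longrightarrow> primitive_on 0 T (radial_null i) (radial_null' i)" "0 \<le> T \<Longrightarrow> primitive_on 0 T (wy i) (angular_null' i)"
 by (rule primitive_on_at_deriv; auto intro: null_ode(1) wy_deriv continuous_on_subset[OF null_cont'(1)] continuous_on_subset[OF null_cont'(2)])+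

text \<open>The radial field has boundary value - 1 / 2 on the catenoids and 1 on the plane; the
  condition on \<open>\<sigma>\<close> is the balance of these traces.\<close>

lemma radial_jacobi_mode: "0 < c \<Longrightarrow> \<sigma> 1 + \<sigma> 3 = 2 * \<sigma> 2 \<Longrightarrow> radial_mode c 0 (\<lambda>i t. \<sigma> i * radial_null i t) (\<lambda>i t. \<sigma> i * radial_null' i t)"
proof (unfold_locales)
 note [measurable] = null_borel
 fix i :: 3
 show "primitive_on 0 T (\<lambda>t. \<sigma> i * radial_null i t) (\<lambda>t. \<sigma> i * radial_null' i t)" if "0 \<le> T" for T
  by (rule primitive_on_cmult[OF null_primitive(1)[OF that]])
 show "(\<lambda>t. \<sigma> i * radial_null i t) \<in> borel_fun" "(\<lambda>t. \<sigma> i * radial_null' i t) \<in> borel_fun" by measurable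
 show "\<exists>M. \<forall>t\<ge>0. \<bar>\<sigma> i * radial_null i t\<bar> \<le> M"
  by (rule exI[of _ "\<bar>\<sigma> i\<bar>"]) (auto simp: abs_mult intro!: mult_left_le null_bounded(1))
 show "L1_on {0..} (\<lambda>t. wrho i t * (\<sigma> i * radial_null' i t)^2)"
  using set_integrable_mult_right[OF null_energy(1)[of i], of "(\<sigma> i)^2"] by (simp add: power_mult_distrib mult_ac)
next
 assume "\<sigma> 1 + \<sigma> 3 = 2 * \<sigma> 2"
 then show "\<sigma> 1 * radial_null 1 0 + \<sigma> 2 * radial_null 2 0 + \<sigma> 3 * radial_null 3 0 = 0"
  by (simp add: radial_null_def waist_values)
qed auto

text \<open>All three profiles \<open>wy i\<close> have the same boundary value, so the balance
  concerns the coefficients alone. It leaves two of them free, for cos and for sin: four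
  dimensions.\<close>

lemma angular_jacobi_mode: "0 < c \<Longrightarrow> \<beta> 1 + \<beta> 2 + \<beta> 3 = 0 \<Longrightarrow> radial_mode c k (\<lambda>i t. \<beta> i * wy i t) (\<lambda>i t. \<beta> i * angular_null' i t)"
proof (unfold_locales)
 note [measurable] = null_borel
 fix i :: 3
 show "primitive_on 0 T (\<lambda>t. \<beta> i * wy i t) (\<lambda>t. \<beta> i * angular_null' i t)" if "0 \<le> T" for T
  by (rule primitive_on_cmult[OF null_primitive(2)[OF that]])
 show "(\<lambda>t. \<beta> i * wy i t) \<in> borel_fun" "(\<lambda>t. \<beta> i * angular_null' i t) \<in> borel_fun" by measurable
 show "\<exists>M. \<forall>t\<ge>0. \<bar>\<beta> i * wy i t\<bar> \<le> M"
  by (rule exI[of _ "\<bar>\<beta> i\<bar> * 2"]) (auto simp: abs_mult intro!: mult_left_mono null_bounded(2))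
 show "L1_on {0..} (\<lambda>t. wrho i t * (\<beta> i * angular_null' i t)^2)"
  using set_integrable_mult_right[OF null_energy(2)[of i], of "(\<beta> i)^2"] by (simp add: power_mult_distrib mult_ac)
 show "L1_on {0..} (\<lambda>t. (\<beta> i * wy i t)^2 / wrho i t)"
  using set_integrable_mult_right[OF null_energy(3)[of i], of "(\<beta> i)^2"] by (simp add: power_mult_distrib mult_ac)
next
 assume "\<beta> 1 + \<beta> 2 + \<beta> 3 = 0"
 then have "(\<beta> 1 + \<beta> 2 + \<beta> 3) * (sqrt 3 / 2) = 0" by simp
 then show "\<beta> 1 * wy 1 0 + \<beta> 2 * wy 2 0 + \<beta> 3 * wy 3 0 = 0" unfolding wy_0 distrib_right .
qed auto

text \<open>Only the defect in the natural boundary condition survives, multiplied by the boundary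
  coefficient of the other function.\<close>

lemma (in radial_mode) null_pairing:
 assumes D: "W.strip_data i v G H \<tau>"
  and ode: "\<And>t. 0 \<le> t \<Longrightarrow> ((\<lambda>t. wrho i t * F' i t) has_real_derivative (mode_eigenvalue k / wrho i t - wV i t) * F i t) (at t)"
  and cont: "continuous_on {0..} (F i)"
  and decay: "((\<lambda>T. wrho i T * F' i T * (1 + (LBINT t:{0..T}. 1 / wrho i t))) \<longlongrightarrow> 0) at_top"
 shows "lift_form i v G H \<tau> = (wq i * F i 0 - wrho i 0 * F' i 0) * cmean v (mode k) 0"
proof -
 interpret D: face_function "wrho i" "wV i" "wkap i" "wy i" v G H \<tau> by (rule W.face_functionI[OF D])
 have "(LBINT t:{0..}. wrho i t * F' i t * cmean G (mode k) t
   + (mode_eigenvalue k / wrho i t - wV i t) * F i t * cmean v (mode k) t) = - (wrho i 0 * F' i 0 * cmean v (mode k) 0)"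
  by (rule D.null_mode_form[OF mode_cont(1) pairing_lift(1)[OF D] ode cont decay])
 then show ?thesis
  unfolding pairing_lift(2)[OF D] by (simp only: left_diff_distrib mult.assoc)
qed

text \<open>The field violates the natural boundary condition by the same amount - 1 on every face:
  - 1 / 4 - 3 / 4 on the catenoids and - 1 - 0 on the plane. With equal coefficients the balance of
  traces cancels the sum, so that triple is null.\<close>

lemma radial_pairing:
 assumes c: "0 < c" and \<sigma>: "\<sigma> 1 + \<sigma> 3 = 2 * \<sigma> 2" and D: "W.strip_data i v G H \<tau>"
 shows "pair_with c (radial_jacobi c \<sigma>) i v G H \<tau> = - \<sigma> i * mean v 0"
proof -
 interpret L: radial_mode c 0 "\<lambda>i t. \<sigma> i * radial_null i t" "\<lambda>i t. \<sigma> i * radial_null' i t" by (rule radial_jacobi_mode[OF c \<sigma>])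
 have m0: "mode 0 = (\<lambda>_. 1)" by (simp add: mode_def fun_eq_iff)
 have "wq i * radial_null i 0 - wrho i 0 * radial_null' i 0 = - 1"
  using waist_values by (simp add: wq_def wrho_def radial_null_def radial_null'_def)
 then have "wq i * (\<sigma> i * radial_null i 0) - wrho i 0 * (\<sigma> i * radial_null' i 0) = - \<sigma> i" by algebra
 moreover have "L.lift_form i v G H \<tau> = (wq i * (\<sigma> i * radial_null i 0) - wrho i 0 * (\<sigma> i * radial_null' i 0)) * cmean v (mode 0) 0"
 proof (rule L.null_pairing[OF D])
  show "((\<lambda>t. wrho i t * (\<sigma> i * radial_null' i t)) has_real_derivative (mode_eigenvalue 0 / wrho i t - wV i t) * (\<sigma> i * radial_null i t)) (at t)"
   if "0 \<le> t" for t
   using DERIV_cmult[OF null_ode(2)[OF that, of i], of "\<sigma> i"] by (simp add: mode_eigenvalue_def mult_ac)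
  show "continuous_on {0..} (\<lambda>t. \<sigma> i * radial_null i t)" by (intro continuous_intros continuous_on_subset[OF null_cont]) auto
  show "((\<lambda>T. wrho i T * (\<sigma> i * radial_null' i T) * (1 + (LBINT t:{0..T}. 1 / wrho i t))) \<longlongrightarrow> 0) at_top"
   using tendsto_mult_left[OF null_decay(1)[of i], of "\<sigma> i"] by (simp add: mult_ac)
 qed
 ultimately show ?thesis by (simp add: radial_jacobi_def m0)
qed

text \<open>Here the natural boundary condition holds face by face, so every face contributes zero
  and the coefficients stay free up to balance.\<close>

lemma angular_pairing:
 assumes c: "0 < c" and \<beta>: "\<beta> 1 + \<beta> 2 + \<beta> 3 = 0" and k: "k \<noteq> 0" and D: "W.strip_data i v G H \<tau>"
 shows "pair_with c (angular_jacobi c k \<beta>) i v G H \<tau> = 0"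
proof -
 interpret L: radial_mode c k "\<lambda>i t. \<beta> i * wy i t" "\<lambda>i t. \<beta> i * angular_null' i t" by (rule angular_jacobi_mode[OF c \<beta>])
 have "wrho i 0 * angular_null' i 0 = wq i * wy i 0"
  using waist_values unfolding wy_0 by (simp add: wq_def wrho_def angular_null'_def power2_eq_square real_div_sqrt)
 then have "wq i * (\<beta> i * wy i 0) - wrho i 0 * (\<beta> i * angular_null' i 0) = 0" by (simp add: mult_ac)
 moreover have "L.lift_form i v G H \<tau> = (wq i * (\<beta> i * wy i 0) - wrho i 0 * (\<beta> i * angular_null' i 0)) * cmean v (mode k) 0"
 proof (rule L.null_pairing[OF D])
  show "((\<lambda>t. wrho i t * (\<beta> i * angular_null' i t)) has_real_derivative (mode_eigenvalue k / wrho i t - wV i t) * (\<beta> i * wy i t)) (at t)"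
   if "0 \<le> t" for t
   using DERIV_cmult[OF null_ode(3)[OF that, of i], of "\<beta> i"] k by (simp add: mode_eigenvalue_def mult_ac)
  show "continuous_on {0..} (\<lambda>t. \<beta> i * wy i t)" by (intro continuous_intros null_cont')
  show "((\<lambda>T. wrho i T * (\<beta> i * angular_null' i T) * (1 + (LBINT t:{0..T}. 1 / wrho i t))) \<longlongrightarrow> 0) at_top"
   using tendsto_mult_left[OF null_decay(2)[of i], of "\<beta> i"] by (simp add: mult_ac)
 qed
 ultimately show ?thesis by (simp add: angular_jacobi_def)
qed

lemma jacobi_null:
 assumes c: "0 < c"
 shows "radial_jacobi c (\<lambda>_. 1) \<in> null_space (Ycat c)"
  and "\<beta> 1 + \<beta> 2 + \<beta> 3 = 0 \<Longrightarrow> k \<noteq> 0 \<Longrightarrow> angular_jacobi c k \<beta> \<in> null_space (Ycat c)"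
proof -
 let ?R = "radial_jacobi c (\<lambda>_. 1)"
 have E: "?R \<in> energy_triples (Ycat c)"
  unfolding radial_jacobi_def by (rule radial_mode.energy[OF radial_jacobi_mode[OF c]]) simp
 have "index_form (Ycat c) ?R \<psi> = 0" if \<psi>: "\<psi> \<in> energy_triples (Ycat c)" for \<psi>
 proof -
  have "bform c i ?R \<psi> = - mean (comp_V c \<psi> i) 0" for i
   by (subst W.pairing_commute) (simp add: radial_pairing[OF c _ energy_component(1)[OF c \<psi>]])
  then show ?thesis
   unfolding index_form_conv[OF c E \<psi>] sum_3 using boundary_modes_balance[OF c \<psi> continuous_on_const, of 1] by simp
 qed
 with E show "?R \<in> null_space (Ycat c)" by (simp add: null_space_def)
 assume \<beta>: "\<beta> 1 + \<beta> 2 + \<beta> 3 = 0" and k: "k \<noteq> 0"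
 have E: "angular_jacobi c k \<beta> \<in> energy_triples (Ycat c)"
  unfolding angular_jacobi_def by (rule radial_mode.energy[OF angular_jacobi_mode[OF c \<beta>]])
 have "index_form (Ycat c) (angular_jacobi c k \<beta>) \<psi> = 0" if \<psi>: "\<psi> \<in> energy_triples (Ycat c)" for \<psi>
 proof -
  have "bform c i (angular_jacobi c k \<beta>) \<psi> = 0" for i
   by (subst W.pairing_commute) (rule angular_pairing[OF c \<beta> k energy_component(1)[OF c \<psi>]])
  then show ?thesis unfolding index_form_conv[OF c E \<psi>] by simp
 qed
 with E show "angular_jacobi c k \<beta> \<in> null_space (Ycat c)" by (simp add: null_space_def)
qed

lemma nullity_ge:
 assumes c: "0 < c" shows "5 \<le> nullity (Ycat c)"
proof -
 define \<beta> \<gamma> :: "3 \<Rightarrow> real" where "\<beta> i = (if i = 1 then 1 else if i = 2 then - 1 else 0)"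
  and "\<gamma> i = (if i = 1 then 0 else if i = 2 then - 1 else 1)" for i
 have \<beta>: "\<beta> 1 + \<beta> 2 + \<beta> 3 = 0" and \<gamma>: "\<gamma> 1 + \<gamma> 2 + \<gamma> 3 = 0" by (simp_all add: \<beta>_def \<gamma>_def)
 define g where "g k = (if k = (0::nat) then radial_jacobi c (\<lambda>_. 1) else if k = 1 then angular_jacobi c 1 \<beta> else if k = 2 then angular_jacobi c 2 \<beta>
  else if k = 3 then angular_jacobi c 1 \<gamma> else angular_jacobi c 2 \<gamma>)" for k
 have "enat 5 \<le> quotient_dim (ae_zero (Ycat c)) (null_space (Ycat c))"
 proof (rule quotient_dim_ge_indexed[OF zero_ae_zero, of _ g])
  show "g k \<in> null_space (Ycat c)" for k
   using jacobi_null[OF c] \<beta> \<gamma> by (simp add: g_def)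
  fix \<alpha> :: "nat \<Rightarrow> real" and k :: nat assume a: "(\<lambda>i x. \<Sum>k<5. \<alpha> k * g k i x) \<in> ae_zero (Ycat c)" and k: "k < 5"
  have five: "{..<5} = {0, 1, 2, 3, 4::nat}" by auto
  define h where "h i t s = \<alpha> 0 * radial_null i t + (\<alpha> 1 * \<beta> i + \<alpha> 3 * \<gamma> i) * wy i t * cos s + (\<alpha> 2 * \<beta> i + \<alpha> 4 * \<gamma> i) * wy i t * sin s" for i t s
  have v: "(\<Sum>k<5. \<alpha> k * g k i (Ycat c i (t, s))) = h i t s" if "0 \<le> t" for i t s
   unfolding five using lift_Ycat[OF c that]
   by (simp add: g_def radial_jacobi_def angular_jacobi_def mode_def h_def algebra_simps)
  have z: "h i t s = 0" if t: "0 < t" for i t s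
  proof -
   have "(\<Sum>k<5. \<alpha> k * g k i (Ycat c i (t, s))) = 0"
   proof (rule ae_zero_pointwise[OF a _ _ t])
    show "continuous_on UNIV (\<lambda>s. \<Sum>k<5. \<alpha> k * g k i (Ycat c i (t, s)))" if "0 < t" for t
     using that by (simp add: v) (auto simp: h_def intro!: continuous_intros)
    have "continuous_on {0<..} (\<lambda>t. h i t s)" for s
     unfolding h_def using null_cont[of i] null_cont'(3)[of i]
     by (intro continuous_intros) (auto intro: continuous_on_subset)
    then show "continuous_on {0<..} (\<lambda>t. \<Sum>k<5. \<alpha> k * g k i (Ycat c i (t, s)))" for s
     by (rule continuous_on_eq) (simp add: v)
   qed
   then show ?thesis using v[of t i s] t by simp
  qed
  \<comment> \<open>On the catenoids the radial field vanishes at the neck and \<open>wy\<close>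
    equals 1, so the angles 0 and pi / 2 isolate the four angular coefficients; a point off the neck
    then yields the radial one.\<close>
  have w: "wy i waist = 1" "radial_null i waist = 0" if "i \<noteq> 2" for i using that by (simp_all add: wy_def radial_null_def)
  note b = waist_bounds(1)
  have 1: "\<alpha> 1 = 0" using z[OF b, of 1 0] by (simp add: h_def w \<beta>_def \<gamma>_def)
  have 2: "\<alpha> 2 = 0" using z[OF b, of 1 "pi / 2"] by (simp add: h_def w \<beta>_def \<gamma>_def)
  have 3: "\<alpha> 3 = 0" using z[OF b, of 3 0] by (simp add: h_def w \<beta>_def \<gamma>_def)
  have 4: "\<alpha> 4 = 0" using z[OF b, of 3 "pi / 2"] by (simp add: h_def w \<beta>_def \<gamma>_def)
  have "\<alpha> 0 * tanh waist = 0" using z[of "2 * waist" 1 0] b by (simp add: h_def 1 3 \<beta>_def \<gamma>_def radial_null_def del: One_nat_def)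
  then have 0: "\<alpha> 0 = 0" by (simp add: waist_values)
  have "k \<in> {..<5}" using k by simp
  then show "\<alpha> k = 0" unfolding five using 0 1 2 3 4 by (elim insertE) simp_all
 qed
 then show ?thesis by (simp add: nullity_def numeral_eq_enat)
qed

section \<open>The second radial solution, Green functions, and the upper bound for the
  nullity\<close>

definition "second_sol i t = (if i = (2::3) then ln ((t + 2 / sqrt 3) / (2 / sqrt 3))
 else (1 - waist / 2) * tanh (t - waist) + (1 - (t - waist) * tanh (t - waist)) / 2 :: real)"
definition "second_sol' i t = (if i = (2::3) then 1 / (t + 2 / sqrt 3)
 else (1 - waist / 2) * (1 / (cosh (t - waist))^2) - (tanh (t - waist) + (t - waist) * (1 / (cosh (t - waist))^2)) / 2 :: real)"

text \<open>The weights 1 - waist / 2 and 1 / 2 of the translation and homothety fields are chosen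
  for this: at the junction these fields take the values - 1 / 2 and 1 - waist / 2.\<close>

lemma second_sol_0: "second_sol i 0 = 0"
 using waist_values(1) by (simp add: second_sol_def field_simps)

lemma second_sol_deriv:
 assumes t: "0 \<le> t"
 shows "(second_sol i has_real_derivative second_sol' i t) (at t)"
  and "((\<lambda>t. wrho i t * second_sol' i t) has_real_derivative (0 / wrho i t - wV i t) * second_sol i t) (at t)"
proof -
 define th where "th t = tanh (t - waist)" for t
 have dth: "(th has_real_derivative 1 - (th t)^2) (at t)" for t
  unfolding th_def using tanh_deriv[of t] unfolding cosh_sq_identity .
 have sq: "1 / (cosh (t - waist))^2 = 1 - (th t)^2" for t unfolding th_def by (rule cosh_sq_identity)
 show "(second_sol i has_real_derivative second_sol' i t) (at t)"
 proof (cases "i = 2")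
  case True
  have "((\<lambda>t. ln ((t + b) / b)) has_real_derivative 1 / (t + b)) (at t)" if "0 < b" "0 < t + b" for b
   using that by (auto intro!: derivative_eq_intros)
  from this[OF _ plane_radius_pos[OF t]] True show ?thesis by (simp add: second_sol_def[abs_def] second_sol'_def)
 next
  case False
  have "((\<lambda>t. (1 - waist / 2) * th t + (1 - (t - waist) * th t) / 2) has_real_derivative
   (1 - waist / 2) * (1 - (th t)^2) - (th t + (t - waist) * (1 - (th t)^2)) / 2) (at t)"
   by (auto intro!: derivative_eq_intros dth simp: field_simps)
  then show ?thesis using False by (simp add: second_sol_def[abs_def] second_sol'_def sq flip: th_def)
 qed
 show "((\<lambda>t. wrho i t * second_sol' i t) has_real_derivative (0 / wrho i t - wV i t) * second_sol i t) (at t)"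
 proof (cases "i = 2")
  case True
  have "\<forall>\<^sub>F s in nhds t. (s + 2 / sqrt 3) * (1 / (s + 2 / sqrt 3)) = 1"
  proof (rule eventually_mono)
   show "\<forall>\<^sub>F s in nhds t. - (2 / sqrt 3) < s"
    by (rule eventually_nhds_in_open[of "{- (2 / sqrt 3)<..}", simplified]) (use plane_radius_pos[OF t] in linarith)
  qed simp
  then show ?thesis using True by (simp add: wrho_def wV_def second_sol'_def DERIV_cong_ev[OF refl])
 next
  case False
  have "((\<lambda>t. (1 - waist / 2) * (1 - (th t)^2) - (th t + (t - waist) * (1 - (th t)^2)) / 2) has_real_derivative
   - (2 * (1 - (th t)^2)) * ((1 - waist / 2) * th t + (1 - (t - waist) * th t) / 2)) (at t)"
   by (auto intro!: derivative_eq_intros dth simp: power2_eq_square field_simps)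
  moreover have "wV i t = 2 * (1 - (th t)^2)" using False sq[of t] by (simp add: wV_def)
  ultimately show ?thesis using False by (simp add: wrho_def second_sol_def second_sol'_def sq flip: th_def)
 qed
qed

text \<open>For two solutions of the same radial equation \<open>\<rho>\<close> times the Wronskian
  is constant; on a catenoid it is half of that of the translation and homothety fields, which is -
  1.\<close>

lemma second_sol_wronskian:
 assumes t: "0 \<le> t"
 shows "wrho i t * (radial_null i t * second_sol' i t - second_sol i t * radial_null' i t) = (if i = 2 then 1 else - 1 / 2)"
proof (cases "i = 2")
 case True
 then show ?thesis using plane_radius_pos[OF t] by (simp add: wrho_def radial_null_def second_sol'_def radial_null'_def)
next
 case False
 define th where "th = tanh (t - waist)"
 have sq: "1 / (cosh (t - waist))^2 = 1 - th^2" unfolding th_def by (rule cosh_sq_identity)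
 show ?thesis using False
  by (simp add: wrho_def radial_null_def second_sol'_def radial_null'_def second_sol_def sq flip: th_def)
   (simp add: field_simps power2_eq_square)
qed

text \<open>Countably many translates of the strip by multiples of 2 pi cover the
  half-plane.\<close>

lemma AE_periodic:
 fixes P :: "real \<times> real \<Rightarrow> bool"
 assumes ae: "AE p\<in>strip in lborel. P p" and per: "\<And>t s. P (t, s + 2 * pi) = P (t, s)"
 shows "AE p\<in>open_half in lborel. P p"
proof -
 have pern: "P (t, s + 2 * pi * real n) = P (t, s)" for t s n
 proof (induction n)
  case (Suc n)
  have eq: "s + 2 * pi * real (Suc n) = (s + 2 * pi * real n) + 2 * pi" by (simp add: algebra_simps)
  show ?case unfolding eq using Suc per[of t "s + 2 * pi * real n"] by blast
 qed simp
 have peri: "P (t, s + 2 * pi * of_int k) = P (t, s)" for t s and k :: int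
 proof (cases "0 \<le> k")
  case True then show ?thesis using pern[of t s "nat k"] by simp
 next
  case False then show ?thesis using pern[of t "s + 2 * pi * of_int k" "nat (- k)"] by simp
 qed
 have "AE p in lborel. p + (0, 2 * pi * of_int k) \<in> strip \<longrightarrow> P (p + (0, 2 * pi * of_int k))" for k :: int
  by (rule AE_translate[OF ae])
 then have "AE p in lborel. \<forall>k::int. p + (0, 2 * pi * of_int k) \<in> strip \<longrightarrow> P (p + (0, 2 * pi * of_int k))"
  by (simp add: AE_all_countable)
 then show ?thesis
 proof eventually_elim
  fix p :: "real \<times> real" assume a: "\<forall>k::int. p + (0, 2 * pi * of_int k) \<in> strip \<longrightarrow> P (p + (0, 2 * pi * of_int k))"
  obtain t s where p: "p = (t, s)" by force
  define k where "k = - \<lfloor>s / (2 * pi)\<rfloor>"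
  have "of_int \<lfloor>s / (2 * pi)\<rfloor> \<le> s / (2 * pi)" "s / (2 * pi) \<le> of_int \<lfloor>s / (2 * pi)\<rfloor> + 1" by linarith+
  then have "of_int \<lfloor>s / (2 * pi)\<rfloor> * (2 * pi) \<le> s" "s \<le> (of_int \<lfloor>s / (2 * pi)\<rfloor> + 1) * (2 * pi)"
   by (simp_all only: pos_le_divide_eq pos_divide_le_eq pi_gt_zero zero_less_mult_iff zero_less_numeral simp_thms)
  then have "0 \<le> s + 2 * pi * of_int k" "s + 2 * pi * of_int k \<le> 2 * pi"
   by (simp_all add: k_def algebra_simps)
  then have "P (t, s + 2 * pi * of_int k)" if "0 < t" using a[rule_format, of k] that by (simp add: p)
  then show "p \<in> open_half \<longrightarrow> P p" by (auto simp: p peri)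
 qed
qed

lemma second_sol_cont: "continuous_on {0..} (second_sol i)" "continuous_on {0..} (second_sol' i)"
 "continuous_on {0..} (wrho i)"
proof -
 show "continuous_on {0..} (second_sol i)"
  using second_sol_deriv(1) by (intro continuous_at_imp_continuous_on ballI DERIV_isCont) auto
 show "continuous_on {0..} (second_sol' i)"
  using plane_radius_pos unfolding second_sol'_def[abs_def]
  by (cases "i = 2"; force intro!: continuous_intros simp: cosh_ne0)
 show "continuous_on {0..} (wrho i)" by (rule continuous_on_subset[OF W.rho_cont]) auto
qed

lemma second_sol_borel: "second_sol i \<in> borel_fun" "second_sol' i \<in> borel_fun"
proof -
 have [measurable]: "(\<lambda>t. cosh (t - waist)) \<in> borel_fun" "(\<lambda>t. tanh (t - waist)) \<in> borel_fun"
  by (auto intro!: borel_measurable_continuous_onI continuous_intros simp: cosh_ne0)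
 show "second_sol i \<in> borel_fun" "second_sol' i \<in> borel_fun"
  unfolding second_sol_def[abs_def] second_sol'_def[abs_def] by measurable
qed

text \<open>The Green function of the radial Jacobi operator on a single face, with pole at \<open>s\<close>.\<close>

definition "green i s t = (if t \<le> s then radial_null i s * second_sol i t else second_sol i s * radial_null i t)"
definition "green' i s t = (if t \<le> s then radial_null i s * second_sol' i t else second_sol i s * radial_null' i t)"

text \<open>The Green function vanishes at the junction, so its extension by zero to the other two
  faces is balanced. Beyond the pole it is a multiple of the bounded field
  \<open>radial_null\<close>, which gives boundedness and finite energy.\<close>

lemma green_mode:
 assumes c: "0 < c" and s: "0 \<le> s"
 shows "radial_mode c 0 (\<lambda>j t. if j = i then green i s t else 0) (\<lambda>j t. if j = i then green' i s t else 0)"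
proof -
 note [measurable] = null_borel second_sol_borel
 have g0: "green i s 0 = 0" using s by (simp add: green_def second_sol_0)
 have P: "primitive_on 0 T (green i s) (green' i s)" if T: "0 \<le> T" for T
 proof -
  define M where "M = max T s"
  have 1: "primitive_on 0 s (second_sol i) (second_sol' i)"
   by (rule primitive_on_at_deriv) (auto intro: second_sol_deriv(1) continuous_on_subset[OF second_sol_cont(2)])
  have "primitive_on 0 s (green i s) (green' i s)"
   by (rule primitive_on_cong[OF primitive_on_cmult[OF 1, of "radial_null i s"]]) (auto simp: green_def green'_def)
  moreover have "primitive_on 0 M (radial_null i) (radial_null' i)" using s by (intro null_primitive(1)) (simp add: M_def)
  then have 2: "primitive_on s M (radial_null i) (radial_null' i)"
   by (rule primitive_on_subinterval) (use s in \<open>auto simp: M_def\<close>)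
  have "primitive_on s M (green i s) (green' i s)"
   by (rule primitive_on_cong[OF primitive_on_cmult[OF 2, of "second_sol i s"]]) (auto simp: green_def green'_def)
  ultimately have "primitive_on 0 M (green i s) (green' i s)"
   by (rule primitive_on_concat) (use s in \<open>auto simp: M_def\<close>)
  then show ?thesis by (rule primitive_on_subinterval) (use T in \<open>auto simp: M_def\<close>)
 qed
 have B: "\<exists>M. \<forall>t\<ge>0. \<bar>green i s t\<bar> \<le> M"
 proof -
  have "bounded (second_sol i ` {0..s})"
   by (intro compact_imp_bounded compact_continuous_image continuous_on_subset[OF second_sol_cont(1)]) auto
  then obtain K where "\<forall>t\<in>{0..s}. \<bar>second_sol i t\<bar> \<le> K" by (auto simp: bounded_iff)
  then have K: "\<bar>second_sol i t\<bar> \<le> K" if "t \<in> {0..s}" for t using that by blast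
  have "\<bar>green i s t\<bar> \<le> \<bar>K\<bar> + \<bar>second_sol i s\<bar>" if t: "0 \<le> t" for t
  proof (cases "t \<le> s")
   case True
   have "\<bar>radial_null i s\<bar> * \<bar>second_sol i t\<bar> \<le> 1 * \<bar>K\<bar>"
    using K[of t] t True by (intro mult_mono null_bounded(1)) auto
   then show ?thesis using True by (simp add: green_def abs_mult)
  next
   case False
   have "\<bar>second_sol i s\<bar> * \<bar>radial_null i t\<bar> \<le> \<bar>second_sol i s\<bar> * 1"
    by (intro mult_left_mono null_bounded(1)) auto
   then show ?thesis using False by (simp add: green_def abs_mult)
  qed
  then show ?thesis by blast
 qed
 have E: "L1_on {0..} (\<lambda>t. wrho i t * (green' i s t)^2)"
 proof -
  have "L1_on {0..s} (\<lambda>t. wrho i t * (radial_null i s * second_sol' i t)^2)"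
   by (intro continuous_set_integrable continuous_intros continuous_on_subset[OF second_sol_cont(3)] continuous_on_subset[OF second_sol_cont(2)]) auto
  then have 1: "L1_on {0..s} (\<lambda>t. wrho i t * (green' i s t)^2)"
   by (rule set_integrable_cong[THEN iffD1, OF refl refl, rotated]) (auto simp: green'_def)
  have "L1_on {0..} (\<lambda>t. (second_sol i s)^2 * (wrho i t * (radial_null' i t)^2))"
   by (intro set_integrable_mult_right null_energy(1))
  then have "L1_on {s<..} (\<lambda>t. (second_sol i s)^2 * (wrho i t * (radial_null' i t)^2))"
   by (rule set_integrable_subset) (use s in auto)
  then have 2: "L1_on {s<..} (\<lambda>t. wrho i t * (green' i s t)^2)"
   by (rule set_integrable_cong[THEN iffD1, OF refl refl, rotated]) (auto simp: green'_def power_mult_distrib)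
  have "{0..} = {0..s} \<union> {s<..}" using s by auto
  then show ?thesis using set_integrable_Un[OF 1 2] by simp
 qed
 have m: "green i s \<in> borel_fun" "green' i s \<in> borel_fun"
  unfolding green_def[abs_def] green'_def[abs_def] by measurable
 show ?thesis
 proof (unfold_locales)
  fix j :: 3
  show "primitive_on 0 T (\<lambda>t. if j = i then green i s t else 0) (\<lambda>t. if j = i then green' i s t else 0)" if "0 \<le> T" for T
   using P[OF that] primitive_on_const[of 0 T 0] by (cases "j = i") simp_all
  show "L1_on {0..} (\<lambda>t. wrho j t * (if j = i then green' i s t else 0)^2)"
   using E by (cases "j = i") (simp_all add: set_integrable_def)
  show "\<exists>M. \<forall>t\<ge>0. \<bar>if j = i then green i s t else 0\<bar> \<le> M" using B by (cases "j = i") auto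
  show "(\<lambda>t. if j = i then green i s t else 0) \<in> borel_fun" "(\<lambda>t. if j = i then green' i s t else 0) \<in> borel_fun"
   using m by (cases "j = i"; simp)+
 qed (use c g0 in auto)
qed

text \<open>
 The Green functions determine the radial part of a null triple on each face by its boundary value, and the
 Jacobi field \<open>(y\<^sub>0, 0, - y\<^sub>0)\<close> shows that the boundary values on the two catenoids agree.
\<close>

lemma radial_part_vanishes:
 assumes c: "0 < c" and D: "\<And>i. W.strip_data i (v i) (G i) (H i) (\<tau> i)"
  and null: "\<And>\<psi>. \<psi> \<in> energy_triples (Ycat c) \<Longrightarrow>
   (\<Sum>i\<in>UNIV. pair_with c \<psi> i (v i) (G i) (H i) (\<tau> i)) = 0"
  and bal: "mean (v 1) 0 + mean (v 2) 0 + mean (v 3) 0 = 0"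
  and z1: "mean (v 1) 0 = 0" and s: "0 \<le> s"
 shows "mean (v i) s = 0"
proof -
 have m0: "mode 0 = (\<lambda>_. 1)" by (simp add: mode_def fun_eq_iff)
 have e0: "mode_eigenvalue 0 = 0" by (simp add: mode_eigenvalue_def)
 define \<sigma> :: "3 \<Rightarrow> real" where "\<sigma> i = (if i = 1 then 1 else if i = 2 then 0 else - 1)" for i
 have \<sigma>: "\<sigma> 1 + \<sigma> 3 = 2 * \<sigma> 2" by (simp add: \<sigma>_def)
 have "radial_jacobi c \<sigma> \<in> energy_triples (Ycat c)"
  unfolding radial_jacobi_def by (rule radial_mode.energy[OF radial_jacobi_mode[OF c \<sigma>]])
 from null[OF this] have "(\<Sum>i\<in>UNIV. - \<sigma> i * mean (v i) 0) = 0"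
  unfolding radial_pairing[OF c \<sigma> D] .
 then have "mean (v 3) 0 = 0" using z1 by (simp add: sum_3 \<sigma>_def)
 with z1 bal have zero: "mean (v i) 0 = 0" using three_cases[of i] by auto
 interpret Di: face_function "wrho i" "wV i" "wkap i" "wy i" "v i" "G i" "H i" "\<tau> i" by (rule W.face_functionI[OF D])
 interpret R: radial_mode c 0 "\<lambda>i t. 1 * radial_null i t" "\<lambda>i t. 1 * radial_null' i t"
  by (rule radial_jacobi_mode[OF c, of "\<lambda>_. 1"]) simp
 interpret L: radial_mode c 0 "\<lambda>j t. if j = i then green i s t else 0" "\<lambda>j t. if j = i then green' i s t else 0"
  by (rule green_mode[OF c s])
 \<comment> \<open>The test triple lives on face i alone, so the vanishing sum isolates the pairing
   on this face.\<close>
 have "L.lift_form j (v j) (G j) (H j) (\<tau> j) = 0" if "j \<noteq> i" for j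
  unfolding L.pairing_lift(2)[OF D] using that by simp
 then have "(\<Sum>j\<in>UNIV - {i}. L.lift_form j (v j) (G j) (H j) (\<tau> j)) = 0" by (intro sum.neutral) auto
 then have "L.lift_form i (v i) (G i) (H i) (\<tau> i) = 0"
  using null[OF L.energy] by (simp add: sum.remove[of UNIV i])
 then have int: "(LBINT t:{0..}. wrho i t * green' i s t * mean (G i) t
   + (0 / wrho i t - wV i t) * green i s t * mean (v i) t) = 0"
  unfolding L.pairing_lift(2)[OF D] m0 e0 using zero by simp
 \<comment> \<open>The rotational mean on the face is a multiple of \<open>radial_null\<close>,
   fixed by its boundary value.\<close>
 have "mean (v i) s * radial_null i 0 = mean (v i) 0 * radial_null i s"
 proof (rule Di.green_value[OF s null_ode(2) second_sol_deriv(2) _ second_sol_cont(1) second_sol_0 second_sol_wronskian _ null_decay(1)])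
  show "continuous_on {0..} (radial_null i)" by (rule continuous_on_subset[OF null_cont]) auto
  show "(if i = 2 then 1 else - 1 / 2 :: real) \<noteq> 0" by simp
  show "L1_on {0..} (\<lambda>t. wrho i t * radial_null' i t * mean (G i) t + (0 / wrho i t - wV i t) * radial_null i t * mean (v i) t)"
   using R.pairing_lift(1)[OF D, of i] unfolding m0 e0 by simp
  show "green i s t = (if t \<le> s then radial_null i s * second_sol i t else second_sol i s * radial_null i t)"
   "green' i s t = (if t \<le> s then radial_null i s * second_sol' i t else second_sol i s * radial_null' i t)" for t
   by (simp_all add: green_def green'_def)
  show "L1_on {0..} (\<lambda>t. wrho i t * green' i s t * mean (G i) t + (0 / wrho i t - wV i t) * green i s t * mean (v i) t)"
   using L.pairing_lift(1)[OF D, of i] unfolding m0 e0 by simp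
 qed (use int in auto)
 moreover have "radial_null i 0 \<noteq> 0" using waist_bounds(1) by (simp add: radial_null_def)
 ultimately show ?thesis using zero by simp
qed

text \<open>Six independent null triples would have a nonzero combination annihilated by five
  functionals. On it the null equations first remove the rotational part; testing it against itself
  then makes the completed squares zero on each face, and \<open>vanishing\<close> applies because
  the first modes of the traces are gone too.\<close>

lemma nullity_le:
 assumes c: "0 < c" shows "nullity (Ycat c) \<le> 5"
 unfolding nullity_def quotient_dim_def
proof (intro SUP_least)
 fix B assume "B \<in> {B. B \<subseteq> null_space (Ycat c) \<and> independent_modulo (ae_zero (Ycat c)) B}"
 then have B: "B \<subseteq> null_space (Ycat c)" "independent_modulo (ae_zero (Ycat c)) B" by auto
 have fin: "finite B" using B(2) by (simp add: independent_modulo_def)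
 have BE: "B \<subseteq> energy_triples (Ycat c)" using B by (auto simp: null_space_def)
 have "card B \<le> 5"
 proof (rule ccontr)
  assume "\<not> card B \<le> 5"
  then have "5 < card B" by simp
  \<comment> \<open>The functionals are boundary coefficients: the constant, cos and sin modes on
    face 1 for j = 0, 1, 2, and the cos and sin modes on face 3 for j = 3, 4. The angular modes on
    the plane follow from the balance.\<close>
  from exists_nontrivial_combination[OF fin this, of "\<lambda>j b. cmean (comp_V c b (if j < 3 then 1 else 3))
   (if j = 0 then (\<lambda>_. 1) else if j = 1 \<or> j = 3 then cos else sin) 0"]
  obtain a where a: "\<exists>b\<in>B. a b \<noteq> 0" and
   z: "\<And>j. j < 5 \<Longrightarrow> (\<Sum>b\<in>B. a b * cmean (comp_V c b (if j < (3::nat) then 1 else 3))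
    (if j = 0 then (\<lambda>_. 1) else if j = 1 \<or> j = 3 then cos else sin) 0) = 0"
   by blast
  define v where "v i p = (\<Sum>b\<in>B. a b * comp_V c b i p)" for i p
  define G where "G i p = (\<Sum>b\<in>B. a b * comp_G c b i p)" for i p
  define H where "H i p = (\<Sum>b\<in>B. a b * comp_H c b i p)" for i p
  define \<tau> where "\<tau> i s = (\<Sum>b\<in>B. a b * comp_T c b i s)" for i s
  have EB: "comp_data c b i" if "b \<in> B" for b i using BE that by (intro energy_component(1)[OF c]) auto
  have D: "W.strip_data i (v i) (G i) (H i) (\<tau> i)" for i
   unfolding v_def[abs_def] G_def[abs_def] H_def[abs_def] \<tau>_def[abs_def] by (rule W.strip_data_sum[OF fin EB])
  have lin: "W.pairing i (wq i) (v i) (G i) (H i) (\<tau> i) v' G' H' \<tau>' =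
   (\<Sum>b\<in>B. a b * W.pairing i (wq i) (comp_V c b i) (comp_G c b i) (comp_H c b i) (comp_T c b i) v' G' H' \<tau>')"
   if "W.strip_data i v' G' H' \<tau>'" for i v' G' H' \<tau>'
   unfolding v_def[abs_def] G_def[abs_def] H_def[abs_def] \<tau>_def[abs_def] by (rule W.pairing_sum[OF fin EB that])
  have null: "(\<Sum>i\<in>UNIV. pair_with c \<psi> i (v i) (G i) (H i) (\<tau> i)) = 0"
   if \<psi>: "\<psi> \<in> energy_triples (Ycat c)" for \<psi>
  proof -
   have "(\<Sum>i\<in>UNIV. pair_with c \<psi> i (v i) (G i) (H i) (\<tau> i))
    = (\<Sum>b\<in>B. a b * (\<Sum>i\<in>UNIV. bform c i b \<psi>))"
    unfolding lin[OF energy_component(1)[OF c \<psi>]] sum_distrib_left by (rule sum.swap)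
   also have "\<dots> = (\<Sum>b\<in>B. a b * index_form (Ycat c) b \<psi>)"
    using BE by (intro sum.cong refl) (auto simp: index_form_conv[OF c _ \<psi>])
   also have "\<dots> = 0" using B(1) \<psi> by (intro sum.neutral) (auto simp: null_space_def)
   finally show ?thesis .
  qed
  have cm: "cmean (v i) e 0 = (\<Sum>b\<in>B. a b * cmean (comp_V c b i) e 0)" if "continuous_on UNIV e" for i e
   unfolding v_def[abs_def] by (rule cmean_sum[OF c fin BE that order_refl])
  have bal: "cmean (v 1) e 0 + cmean (v 2) e 0 + cmean (v 3) e 0 = 0" if e: "continuous_on UNIV e" for e
  proof -
   have "cmean (v 1) e 0 + cmean (v 2) e 0 + cmean (v 3) e 0 =
    (\<Sum>b\<in>B. a b * (cmean (comp_V c b 1) e 0 + cmean (comp_V c b 2) e 0 + cmean (comp_V c b 3) e 0))"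
    unfolding cm[OF e] by (simp add: sum.distrib distrib_left)
   then show ?thesis using boundary_modes_balance[OF c _ e] BE by (simp add: subset_iff)
  qed
  have cc: "continuous_on UNIV (cos :: real \<Rightarrow> real)" "continuous_on UNIV (sin :: real \<Rightarrow> real)" by (intro continuous_intros)+
  have z1: "mean (v 1) 0 = 0" using z[of 0] by (simp add: cm)
  have cs: "cmean (v i) cos 0 = 0" "cmean (v i) sin 0 = 0" for i
  proof -
   have "cmean (v 1) cos 0 = 0" "cmean (v 1) sin 0 = 0" "cmean (v 3) cos 0 = 0" "cmean (v 3) sin 0 = 0"
    using z[of 1] z[of 2] z[of 3] z[of 4] by (simp_all add: cm cc)
   then show "cmean (v i) cos 0 = 0" "cmean (v i) sin 0 = 0"
    using bal[OF cc(1)] bal[OF cc(2)] three_cases[of i] by auto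
  qed
  have f1: "mean (v i) s = 0" if "0 \<le> s" for i s
   by (rule radial_part_vanishes[OF c D null bal[OF continuous_on_const] z1 that])
  \<comment> \<open>The energy of each face, curvature term included, bounds its nonnegative
    squares, so a zero total forces every one of them to be zero.\<close>
  define E where "E i = W.pairing i (wq i) (v i) (G i) (H i) (\<tau> i) (v i) (G i) (H i) (\<tau> i)" for i
  have sq: "(LBINT p:cyl T. W.square_density i (v i) (G i) (H i) p) \<le> E i"
   "0 \<le> (LBINT p:cyl T. W.square_density i (v i) (G i) (H i) p)" if T: "0 \<le> T" for i T
  proof -
   interpret Di: face_function "wrho i" "wV i" "wkap i" "wy i" "v i" "G i" "H i" "\<tau> i" by (rule W.face_functionI[OF D])
   show "(LBINT p:cyl T. W.square_density i (v i) (G i) (H i) p) \<le> E i"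
    using Di.square_le_energy[OF f1 T] unfolding E_def W.pairing_self wq_kap Di.sq_mean_primitive(3)[OF order_refl] by simp
   show "0 \<le> (LBINT p:cyl T. W.square_density i (v i) (G i) (H i) p)"
    by (rule Di.square_mono(2)[OF f1 T order_refl])
  qed
  \<comment> \<open>Linearity in one argument exposes pairings with the members of \<open>B\<close>,
    which are energy triples and hence paired to zero by \<open>null\<close>.\<close>
  have "(\<Sum>i\<in>UNIV. E i) = (\<Sum>b\<in>B. a b * (\<Sum>i\<in>UNIV. pair_with c b i (v i) (G i) (H i) (\<tau> i)))"
   unfolding E_def lin[OF D] sum_distrib_left by (subst sum.swap) (intro sum.cong refl, simp add: W.pairing_commute)
  also have "\<dots> = 0" using BE by (intro sum.neutral) (auto simp: null)
  finally have "(\<Sum>i\<in>UNIV. E i) = 0" .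
  moreover have E0: "0 \<le> E i" for i using sq[of 0 i] by simp
  ultimately have "E i = 0" for i by (simp add: sum_nonneg_eq_0_iff)
  then have sq0: "(LBINT p:cyl T. W.square_density i (v i) (G i) (H i) p) = 0" if "0 \<le> T" for i T
   using sq[OF that, of i] by simp
  have v0: "AE p\<in>strip in lborel. v i p = 0" for i
  proof -
   interpret Di: face_function "wrho i" "wV i" "wkap i" "wy i" "v i" "G i" "H i" "\<tau> i" by (rule W.face_functionI[OF D])
   show ?thesis by (rule Di.vanishing[OF f1 sq0 cs])
  qed
  define \<Phi> :: triple where "\<Phi> = (\<lambda>i x. \<Sum>b\<in>B. a b * b i x)"
  have "\<Phi> \<in> ae_zero (Ycat c)"
   unfolding ae_zero_def
  proof (intro CollectI allI)
   fix i
   have "AE p\<in>strip in lborel. v i p = comp_U c \<Phi> i p"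
    unfolding v_def by (rule comp_V_sum[OF c fin BE]) (simp add: \<Phi>_def)
   with v0[of i] AE_coordinate(2)[OF AE_lborel_singleton[of 0]] have "AE p\<in>strip in lborel. \<Phi> i (Ycat c i p) = 0"
   proof eventually_elim
    fix p :: "real \<times> real" assume h: "p \<in> strip \<longrightarrow> v i p = 0" "fst p \<noteq> 0" "p \<in> strip \<longrightarrow> v i p = comp_U c \<Phi> i p"
    then show "p \<in> strip \<longrightarrow> \<Phi> i (Ycat c i p) = 0"
     by (cases p) (auto simp: comp_U_def)
   qed
   then show "AE p\<in>open_half in lborel. \<Phi> i (Ycat c i p) = 0"
    by (rule AE_periodic) (simp add: Ycat_periodic)
  qed
  then show False using B(2) a unfolding independent_modulo_def \<Phi>_def by blast
 qed
 then show "enat (card B) \<le> 5" by (simp add: numeral_eq_enat)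
qed

theorem theorem4p4:
 fixes c :: real
 assumes "0 < c"
 shows "morse_index (pseudo_Y_catenoid c) = 2 \<and> nullity (pseudo_Y_catenoid c) = 5"
 using morse_index_le[OF assms] morse_index_ge[OF assms] nullity_le[OF assms] nullity_ge[OF assms] by (simp add: order_antisym)

end
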